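(* Let $H$ be a quasi-Hopf algebra, $A$ a left $H$-module algebra, $B$ a right $H$-module algebra, $\mathfrak A$ a right $H$-comodule algebra and $\mathfrak B$ a left $H$-comodule algebra. Then there are algebra isomorphisms $$A\blacktriangleright\!\!<(\mathfrak A\otimes\mathfrak B)>\!\!\blacktriangleleft B\;\simeq\;(A\otimes B)\bowtie(\mathfrak A\otimes\mathfrak B)\;\simeq\;\mathfrak A>\!\!\triangleleft\,(A\otimes B)\,\triangleright\!\!<\mathfrak B.$$
   Context: All algebras and spaces are over a field $k$, $\otimes=\otimes_k$; summation is understood. A quasi-bialgebra $(H,\Delta,\varepsilon,\Phi)$: a unital associative algebra $H$, algebra maps $\Delta:H\to H\otimes H$ ($\Delta(h)=h_1\otimes h_2$), $\varepsilon:H\to k$, and an invertible $\Phi=X^1\otimes X^2\otimes X^3\in H^{\otimes3}$, $\Phi^{-1}=x^1\otimes x^2\otimes x^3$, with $(id\otimes\Delta)(\Delta(h))=\Phi(\Delta\otimes id)(\Delta(h))\Phi^{-1}$, $(id\otimes\varepsilon)\Delta=id=(\varepsilon\otimes id)\Delta$, $(1\otimes\Phi)(id\otimes\Delta\otimes id)(\Phi)(\Phi\otimes1)=(id\otimes id\otimes\Delta)(\Phi)(\Delta\otimes id\otimes id)(\Phi)$, $(id\otimes\varepsilon\otimes id)(\Phi)=1\otimes1$. A quasi-Hopf algebra is a quasi-bialgebra with an algebra anti-automorphism $S$ (so $S$ is bijective) and $\alpha,\beta\in H$ such that $S(h_1)\alpha h_2=\varepsilon(h)\alpha$, $h_1\beta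 S(h_2)=\varepsilon(h)\beta$, $X^1\beta S(X^2)\alpha X^3=1$, $S(x^1)\alpha x^2\beta S(x^3)=1$; by rescaling one assumes $\varepsilon(\alpha)=\varepsilon(\beta)=1$ and $\varepsilon\circ S=\varepsilon$. Drinfeld twist: $f=f^1\otimes f^2=(S\otimes S)(\Delta^{cop}(x^1))\,\gamma\,\Delta(x^2\beta S(x^3))\in H\otimes H$, where $\Delta^{cop}(h)=h_2\otimes h_1$, $\gamma=S(A^2)\alpha A^3\otimes S(A^1)\alpha A^4$, $A^1\otimes A^2\otimes A^3\otimes A^4=(\Phi\otimes1)(\Delta\otimes id\otimes id)(\Phi^{-1})$; it is invertible. A left $H$-module algebra: a left $H$-module $A$ with bilinear multiplication and two-sided unit $1_A$ with $(aa')a''=(X^1\cdot a)[(X^2\cdot a')(X^3\cdot a'')]$, $h\cdot(aa')=(h_1\cdot a)(h_2\cdot a')$, $h\cdot1_A=\varepsilon(h)1_A$. A right $H$-module algebra: a right $H$-module $B$ with bilinear multiplication and two-sided unit $1_B$ with $(bb')b''=(b\cdot x^1)[(b'\cdot x^2)(b''\cdot x^3)]$, $(bb')\cdot h=(b\cdot h_1)(b'\cdot h_2)$, $1_B\cdot h=\varepsilon(h)1_B$. An $H$-bimodule algebra: an $H$-bimodule $\mathcal A$ with a bilinear multiplication and a two-sided unit $1_{\mathcal A}$ such that $(\varphi\varphi')\varphi''=(X^1\cdot\varphi\cdot x^1)[(X^2\cdot\varphi'\cdot x^2)(X^3\cdot\varphi''\cdot x^3)]$, $h\cdot(\varphi\varphi')=(h_1\cdot\varphi)(h_2\cdot\varphi')$,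 $(\varphi\varphi')\cdot h=(\varphi\cdot h_1)(\varphi'\cdot h_2)$, $h\cdot1_{\mathcal A}=\varepsilon(h)1_{\mathcal A}=1_{\mathcal A}\cdot h$. $A\otimes B$ is an $H$-bimodule algebra with componentwise multiplication and $h\cdot(a\otimes b)\cdot h'=h\cdot a\otimes b\cdot h'$. A right $H$-comodule algebra: a unital associative algebra $\mathfrak A$, an algebra map $\rho:\mathfrak A\to\mathfrak A\otimes H$, $\rho(a)=a_{\langle0\rangle}\otimes a_{\langle1\rangle}$, and an invertible $\Phi_\rho=\tilde X^1_\rho\otimes\tilde X^2_\rho\otimes\tilde X^3_\rho\in\mathfrak A\otimes H\otimes H$, $\Phi_\rho^{-1}=\tilde x^1_\rho\otimes\tilde x^2_\rho\otimes\tilde x^3_\rho$, with $\Phi_\rho(\rho\otimes id)(\rho(a))=(id\otimes\Delta)(\rho(a))\Phi_\rho$, $(1\otimes\Phi)(id\otimes\Delta\otimes id)(\Phi_\rho)(\Phi_\rho\otimes1)=(id\otimes id\otimes\Delta)(\Phi_\rho)(\rho\otimes id\otimes id)(\Phi_\rho)$, $(id\otimes\varepsilon)\rho=id$, $(id\otimes\varepsilon\otimes id)(\Phi_\rho)=(id\otimes id\otimes\varepsilon)(\Phi_\rho)=1\otimes1$. A left $H$-comodule algebra: a unital associative algebra $\mathfrak B$, an algebra map $\lambda:\mathfrak B\to H\otimes\mathfrak B$, $\lambda(b)=b_{[-1]}\otimes b_{[0]}$, and an invertible $\Phi_\lambda=\tilde X^1_\lambda\otimes\tilde X^2_\lambda\otimes\tilde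 X^3_\lambda\in H\otimes H\otimes\mathfrak B$, $\Phi_\lambda^{-1}=\tilde x^1_\lambda\otimes\tilde x^2_\lambda\otimes\tilde x^3_\lambda$, with $(id\otimes\lambda)(\lambda(b))\Phi_\lambda=\Phi_\lambda(\Delta\otimes id)(\lambda(b))$, $(1\otimes\Phi_\lambda)(id\otimes\Delta\otimes id)(\Phi_\lambda)(\Phi\otimes1)=(id\otimes id\otimes\lambda)(\Phi_\lambda)(\Delta\otimes id\otimes id)(\Phi_\lambda)$, $(\varepsilon\otimes id)\lambda=id$, $(id\otimes\varepsilon\otimes id)(\Phi_\lambda)=(\varepsilon\otimes id\otimes id)(\Phi_\lambda)=1\otimes1$. An $H$-bicomodule algebra $(\mathbb A,\lambda,\rho,\Phi_\lambda,\Phi_\rho,\Phi_{\lambda,\rho})$: $(\mathbb A,\lambda,\Phi_\lambda)$ is a left and $(\mathbb A,\rho,\Phi_\rho)$ a right $H$-comodule algebra, and $\Phi_{\lambda,\rho}\in H\otimes\mathbb A\otimes H$ is invertible, $\Phi_{\lambda,\rho}^{-1}=\theta^1\otimes\theta^2\otimes\theta^3$, with $\Phi_{\lambda,\rho}(\lambda\otimes id)(\rho(u))=(id\otimes\rho)(\lambda(u))\Phi_{\lambda,\rho}$, $(1\otimes\Phi_{\lambda,\rho})(id\otimes\lambda\otimes id)(\Phi_{\lambda,\rho})(\Phi_\lambda\otimes1)=(id\otimes id\otimes\rho)(\Phi_\lambda)(\Delta\otimes id\otimes id)(\Phi_{\lambda,\rho})$, $(1\otimes\Phi_\rho)(id\otimes\rho\otimes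 id)(\Phi_{\lambda,\rho})(\Phi_{\lambda,\rho}\otimes1)=(id\otimes id\otimes\Delta)(\Phi_{\lambda,\rho})(\lambda\otimes id\otimes id)(\Phi_\rho)$. Iterated indices mean successive application of $\lambda,\rho,\Delta$. $\mathfrak A\otimes\mathfrak B$ is an $H$-bicomodule algebra with $\rho(a\otimes b)=(a_{\langle0\rangle}\otimes b)\otimes a_{\langle1\rangle}$, $\lambda(a\otimes b)=b_{[-1]}\otimes(a\otimes b_{[0]})$, $\Phi_\rho=(\tilde X^1_\rho\otimes1_{\mathfrak B})\otimes\tilde X^2_\rho\otimes\tilde X^3_\rho$, $\Phi_\lambda=\tilde X^1_\lambda\otimes\tilde X^2_\lambda\otimes(1_{\mathfrak A}\otimes\tilde X^3_\lambda)$, $\Phi_{\lambda,\rho}=1_H\otimes(1_{\mathfrak A}\otimes1_{\mathfrak B})\otimes1_H$. The algebras (all associative and unital), for $\mathbb A$ an $H$-bicomodule algebra and $\mathcal A$ an $H$-bimodule algebra: (1) generalized diagonal crossed product $\mathcal A\bowtie\mathbb A$: $\mathcal A\otimes\mathbb A$ with $(\varphi\bowtie u)(\varphi'\bowtie u')=(\Omega^1\cdot\varphi\cdot\Omega^5)(\Omega^2u_{\langle0\rangle_{[-1]}}\cdot\varphi'\cdot S^{-1}(u_{\langle1\rangle})\Omega^4)\bowtie\Omega^3u_{\langle0\rangle_{[0]}}u'$, where $\Omega=\Omega^1\otimes\cdots\otimes\Omega^5=(\tilde X^1_\rho)_{[-1]_1}\tilde x^1_\lambda\theta^1\otimes(\tilde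 X^1_\rho)_{[-1]_2}\tilde x^2_\lambda\theta^2_{[-1]}\otimes(\tilde X^1_\rho)_{[0]}\tilde x^3_\lambda\theta^2_{[0]}\otimes S^{-1}(f^1\tilde X^2_\rho\theta^3)\otimes S^{-1}(f^2\tilde X^3_\rho)$; (2) two-sided generalized smash product $A\blacktriangleright\!\!<\mathbb A>\!\!\blacktriangleleft B$: $A\otimes\mathbb A\otimes B$ with $(a\blacktriangleright\!\!<u>\!\!\blacktriangleleft b)(a'\blacktriangleright\!\!<u'>\!\!\blacktriangleleft b')=(\tilde x^1_\lambda\cdot a)(\tilde x^2_\lambda u_{[-1]}\theta^1\cdot a')\blacktriangleright\!\!<\tilde x^3_\lambda u_{[0]}\theta^2u'_{\langle0\rangle}\tilde x^1_\rho>\!\!\blacktriangleleft(b\cdot\theta^3u'_{\langle1\rangle}\tilde x^2_\rho)(b'\cdot\tilde x^3_\rho)$; (3) generalized two-sided crossed product $\mathfrak A>\!\!\triangleleft\,\mathcal A\,\triangleright\!\!<\mathfrak B$: $\mathfrak A\otimes\mathcal A\otimes\mathfrak B$ with $(a>\!\!\triangleleft\varphi\triangleright\!\!<b)(a'>\!\!\triangleleft\varphi'\triangleright\!\!<b')=aa'_{\langle0\rangle}\tilde x^1_\rho>\!\!\triangleleft(\tilde x^1_\lambda\cdot\varphi\cdot a'_{\langle1\rangle}\tilde x^2_\rho)(\tilde x^2_\lambda b_{[-1]}\cdot\varphi'\cdot\tilde x^3_\rho)\triangleright\!\!<\tilde x^3_\lambda b_{[0]}b'$. *)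

theory Defs
  imports "HOL-Algebra.Module" "HOL-Algebra.QuotRing"
begin

text \<open>
  Vector spaces and (not necessarily associative) algebras over a field \<open>K\<close> are records of type
  \<^type>\<open>module\<close>, whose fields \<open>mult\<close> and \<open>one\<close> carry the product and the unit. For a mere vector
  space these two fields are meaningless.
\<close>

text \<open>An element of \<open>V \<otimes> W\<close> is a coset of formal \<open>K\<close>-linear combinations of pairs.\<close>

type_synonym ('k, 'v, 'w) ten = "('v \<times> 'w \<Rightarrow> 'k) set"
type_synonym ('k, 'u, 'v, 'w) ten3 = "('k, 'u, ('k, 'v, 'w) ten) ten"

record ('k, 'h) quasi_hopf = "('k, 'h) module" +
  comult :: "'h \<Rightarrow> ('k, 'h, 'h) ten" (\<open>\<Delta>\<index>\<close>)
  counit :: "'h \<Rightarrow> 'k" (\<open>\<epsilon>\<index>\<close>)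
  reassoc :: "('k, 'h, 'h, 'h) ten3" (\<open>\<Phi>\<index>\<close>)
  antipode :: "'h \<Rightarrow> 'h" (\<open>S\<index>\<close>)
  alpha_elem :: 'h (\<open>\<alpha>\<index>\<close>)
  beta_elem :: 'h (\<open>\<beta>\<index>\<close>)

record ('k, 'h, 'a) left_mod = "('k, 'a) module" +
  lact :: "'h \<Rightarrow> 'a \<Rightarrow> 'a"

record ('k, 'h, 'b) right_mod = "('k, 'b) module" +
  ract :: "'b \<Rightarrow> 'h \<Rightarrow> 'b"

record ('k, 'h, 'm) bimod = "('k, 'm) module" +
  bi_lact :: "'h \<Rightarrow> 'm \<Rightarrow> 'm"
  bi_ract :: "'m \<Rightarrow> 'h \<Rightarrow> 'm"

record ('k, 'h, 'a) right_comod = "('k, 'a) module" +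
  rcoact :: "'a \<Rightarrow> ('k, 'a, 'h) ten"
  rcoact_reassoc :: "('k, 'a, 'h, 'h) ten3"

record ('k, 'h, 'b) left_comod = "('k, 'b) module" +
  lcoact :: "'b \<Rightarrow> ('k, 'h, 'b) ten"
  lcoact_reassoc :: "('k, 'h, 'h, 'b) ten3"

record ('k, 'h, 'u) bicomod = "('k, 'u) module" +
  bi_lcoact :: "'u \<Rightarrow> ('k, 'h, 'u) ten"
  bi_lreassoc :: "('k, 'h, 'h, 'u) ten3"
  bi_rcoact :: "'u \<Rightarrow> ('k, 'u, 'h) ten"
  bi_rreassoc :: "('k, 'u, 'h, 'h) ten3"
  bi_lrreassoc :: "('k, 'h, 'u, 'h) ten3"

context
  fixes K :: "'k ring"
begin

section \<open>Tensor products\<close>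

definition free_space :: "'x set \<Rightarrow> ('k, 'x \<Rightarrow> 'k) module" where
  "free_space X =
    \<lparr>carrier = {r. (\<forall>p. r p \<in> carrier K) \<and> finite {p. r p \<noteq> \<zero>\<^bsub>K\<^esub>} \<and> {p. r p \<noteq> \<zero>\<^bsub>K\<^esub>} \<subseteq> X},
     mult = undefined, one = undefined,
     zero = (\<lambda>p. \<zero>\<^bsub>K\<^esub>), add = (\<lambda>r s p. r p \<oplus>\<^bsub>K\<^esub> s p), smult = (\<lambda>c r p. c \<otimes>\<^bsub>K\<^esub> r p)\<rparr>"

definition single :: "'x \<Rightarrow> 'x \<Rightarrow> 'k" where
  "single p = (\<lambda>q. if q = p then \<one>\<^bsub>K\<^esub> else \<zero>\<^bsub>K\<^esub>)"

definition bilinear_rels ::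
    "('k, 'v, 'c) module_scheme \<Rightarrow> ('k, 'w, 'd) module_scheme \<Rightarrow> ('v \<times> 'w \<Rightarrow> 'k) set" where
  "bilinear_rels V W = (let F = free_space (carrier V \<times> carrier W) in
     {single (v \<oplus>\<^bsub>V\<^esub> v', w) \<ominus>\<^bsub>F\<^esub> (single (v, w) \<oplus>\<^bsub>F\<^esub> single (v', w)) | v v' w.
        v \<in> carrier V \<and> v' \<in> carrier V \<and> w \<in> carrier W} \<union>
     {single (v, w \<oplus>\<^bsub>W\<^esub> w') \<ominus>\<^bsub>F\<^esub> (single (v, w) \<oplus>\<^bsub>F\<^esub> single (v, w')) | v w w'.
        v \<in> carrier V \<and> w \<in> carrier W \<and> w' \<in> carrier W} \<union>
     {single (c \<odot>\<^bsub>V\<^esub> v, w) \<ominus>\<^bsub>F\<^esub> c \<odot>\<^bsub>F\<^esub> single (v, w) | c v w.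
        c \<in> carrier K \<and> v \<in> carrier V \<and> w \<in> carrier W} \<union>
     {single (v, c \<odot>\<^bsub>W\<^esub> w) \<ominus>\<^bsub>F\<^esub> c \<odot>\<^bsub>F\<^esub> single (v, w) | c v w.
        c \<in> carrier K \<and> v \<in> carrier V \<and> w \<in> carrier W})"

definition tensor_kernel ::
    "('k, 'v, 'c) module_scheme \<Rightarrow> ('k, 'w, 'd) module_scheme \<Rightarrow> ('v \<times> 'w \<Rightarrow> 'k) set" where
  "tensor_kernel V W =
     \<Inter>{N. submodule N K (free_space (carrier V \<times> carrier W)) \<and> bilinear_rels V W \<subseteq> N}"

definition pure ::
    "('k, 'v, 'c) module_scheme \<Rightarrow> ('k, 'w, 'd) module_scheme \<Rightarrow> 'v \<Rightarrow> 'w \<Rightarrow> ('k, 'v, 'w) ten" where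
  "pure V W v w = tensor_kernel V W +>\<^bsub>free_space (carrier V \<times> carrier W)\<^esub> single (v, w)"

text \<open>
  \<open>tsum Z f t\<close> is the value at \<open>t \<in> V \<otimes> W\<close> of the linear map into \<open>Z\<close> induced by a bilinear \<open>f\<close>.
  It renders Sweedler-style notation: \<open>tsum Z (\<lambda>x y. f x y) t\<close> is \<open>f t\<^sup>1 t\<^sup>2\<close>, summation
  understood. For bilinear \<open>f\<close> the chosen representative is irrelevant.
\<close>

definition tsum :: "('k, 'z, 'e) module_scheme \<Rightarrow> ('v \<Rightarrow> 'w \<Rightarrow> 'z) \<Rightarrow> ('k, 'v, 'w) ten \<Rightarrow> 'z" where
  "tsum Z f t = (let r = SOME r. r \<in> t in
     \<Oplus>\<^bsub>Z\<^esub>p\<in>{p. r p \<noteq> \<zero>\<^bsub>K\<^esub>}. r p \<odot>\<^bsub>Z\<^esub> f (fst p) (snd p))"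

definition tensor_space ::
    "('k, 'v, 'c) module_scheme \<Rightarrow> ('k, 'w, 'd) module_scheme \<Rightarrow> ('k, ('k, 'v, 'w) ten) module" where
  "tensor_space V W = (let F = free_space (carrier V \<times> carrier W); N = tensor_kernel V W in
     \<lparr>carrier = a_rcosets\<^bsub>F\<^esub> N, mult = undefined, one = undefined,
      zero = N, add = set_add F, smult = (\<lambda>c t. \<Union>r\<in>t. N +>\<^bsub>F\<^esub> (c \<odot>\<^bsub>F\<^esub> r))\<rparr>)"

definition tensor ::
    "('k, 'v, 'c) module_scheme \<Rightarrow> ('k, 'w, 'd) module_scheme \<Rightarrow> ('k, ('k, 'v, 'w) ten) module"
    (infixr \<open>\<boxtimes>\<close> 75) where
  "V \<boxtimes> W = (tensor_space V W)
     \<lparr>mult := (\<lambda>s t. tsum (tensor_space V W) (\<lambda>v w. tsum (tensor_space V W) (\<lambda>v' w'.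
                 pure V W (v \<otimes>\<^bsub>V\<^esub> v') (w \<otimes>\<^bsub>W\<^esub> w')) t) s),
      one := pure V W \<one>\<^bsub>V\<^esub> \<one>\<^bsub>W\<^esub>\<rparr>"

text \<open>Longer tensor products are nested to the right.\<close>

definition pure3 where
  "pure3 U V W u v w = pure U (V \<boxtimes> W) u (pure V W v w)"

definition pure4 where
  "pure4 U V W X u v w x = pure U (V \<boxtimes> W \<boxtimes> X) u (pure3 V W X v w x)"

definition pure5 where
  "pure5 U V W X Y u v w x y = pure U (V \<boxtimes> W \<boxtimes> X \<boxtimes> Y) u (pure4 V W X Y v w x y)"

definition tsum3 where
  "tsum3 Z f t = tsum Z (\<lambda>x. tsum Z (f x)) t"

definition tsum4 where
  "tsum4 Z f t = tsum Z (\<lambda>x. tsum3 Z (f x)) t"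

definition tsum5 where
  "tsum5 Z f t = tsum Z (\<lambda>x. tsum4 Z (f x)) t"

text \<open>
  \<open>split_i\<close> applies a linear map \<open>f\<close> with values in \<open>X \<otimes> Y\<close> (such as \<open>\<Delta>\<close>, \<open>\<rho>\<close>, \<open>\<lambda>\<close>) to the
  \<open>i\<close>-th factor of a threefold tensor, e.g. \<open>split1\<close> is \<open>f \<otimes> id \<otimes> id\<close>.
\<close>

definition split1 where
  "split1 X Y V W f t = tsum3 (X \<boxtimes> Y \<boxtimes> V \<boxtimes> W)
     (\<lambda>u v w. tsum (X \<boxtimes> Y \<boxtimes> V \<boxtimes> W) (\<lambda>x y. pure4 X Y V W x y v w) (f u)) t"

definition split2 where
  "split2 U X Y W f t = tsum3 (U \<boxtimes> X \<boxtimes> Y \<boxtimes> W)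
     (\<lambda>u v w. tsum (U \<boxtimes> X \<boxtimes> Y \<boxtimes> W) (\<lambda>x y. pure4 U X Y W u x y w) (f v)) t"

definition split3 where
  "split3 U V X Y f t = tsum3 (U \<boxtimes> V \<boxtimes> X \<boxtimes> Y)
     (\<lambda>u v w. tsum (U \<boxtimes> V \<boxtimes> X \<boxtimes> Y) (\<lambda>x y. pure4 U V X Y u v x y) (f w)) t"

text \<open>\<open>t \<otimes> 1\<close> for a threefold tensor \<open>t\<close>.\<close>

definition append_one where
  "append_one U V W X t = tsum3 (U \<boxtimes> V \<boxtimes> W \<boxtimes> X) (\<lambda>u v w. pure4 U V W X u v w \<one>\<^bsub>X\<^esub>) t"

text \<open>\<open>f \<otimes> id\<close> and \<open>id \<otimes> f\<close> on a twofold tensor, for \<open>f\<close> with values in \<open>X \<otimes> Y\<close>.\<close>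

definition split_left where
  "split_left X Y W f t = tsum (X \<boxtimes> Y \<boxtimes> W)
     (\<lambda>u w. tsum (X \<boxtimes> Y \<boxtimes> W) (\<lambda>x y. pure3 X Y W x y w) (f u)) t"

definition split_right where
  "split_right U X Y f t = tsum (U \<boxtimes> X \<boxtimes> Y)
     (\<lambda>u w. tsum (U \<boxtimes> X \<boxtimes> Y) (\<lambda>x y. pure3 U X Y u x y) (f w)) t"

section \<open>Algebras and their homomorphisms\<close>

definition bilinear_map ::
    "('k, 'u, 'c) module_scheme \<Rightarrow> ('k, 'v, 'd) module_scheme \<Rightarrow> ('k, 'w, 'e) module_scheme
      \<Rightarrow> ('u \<Rightarrow> 'v \<Rightarrow> 'w) \<Rightarrow> bool" where
  "bilinear_map U V W f \<longleftrightarrow>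
    (\<forall>u\<in>carrier U. \<forall>v\<in>carrier V. f u v \<in> carrier W) \<and>
    (\<forall>u\<in>carrier U. \<forall>u'\<in>carrier U. \<forall>v\<in>carrier V. f (u \<oplus>\<^bsub>U\<^esub> u') v = f u v \<oplus>\<^bsub>W\<^esub> f u' v) \<and>
    (\<forall>u\<in>carrier U. \<forall>v\<in>carrier V. \<forall>v'\<in>carrier V. f u (v \<oplus>\<^bsub>V\<^esub> v') = f u v \<oplus>\<^bsub>W\<^esub> f u v') \<and>
    (\<forall>c\<in>carrier K. \<forall>u\<in>carrier U. \<forall>v\<in>carrier V.
       f (c \<odot>\<^bsub>U\<^esub> u) v = c \<odot>\<^bsub>W\<^esub> f u v \<and> f u (c \<odot>\<^bsub>V\<^esub> v) = c \<odot>\<^bsub>W\<^esub> f u v)"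

definition nonassoc_algebra :: "('k, 'a, 'c) module_scheme \<Rightarrow> bool" where
  "nonassoc_algebra A \<longleftrightarrow> module K A \<and> bilinear_map A A A (mult A) \<and> \<one>\<^bsub>A\<^esub> \<in> carrier A \<and>
    (\<forall>a\<in>carrier A. \<one>\<^bsub>A\<^esub> \<otimes>\<^bsub>A\<^esub> a = a \<and> a \<otimes>\<^bsub>A\<^esub> \<one>\<^bsub>A\<^esub> = a)"

definition assoc_algebra :: "('k, 'a, 'c) module_scheme \<Rightarrow> bool" where
  "assoc_algebra A \<longleftrightarrow> module K A \<and> ring A \<and> bilinear_map A A A (mult A)"

definition algebra_hom ::
    "('k, 'a, 'c) module_scheme \<Rightarrow> ('k, 'b, 'd) module_scheme \<Rightarrow> ('a \<Rightarrow> 'b) set" where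
  "algebra_hom A B =
    {f \<in> ring_hom A B. \<forall>c\<in>carrier K. \<forall>a\<in>carrier A. f (c \<odot>\<^bsub>A\<^esub> a) = c \<odot>\<^bsub>B\<^esub> f a}"

definition algebra_iso ::
    "('k, 'a, 'c) module_scheme \<Rightarrow> ('k, 'b, 'd) module_scheme \<Rightarrow> ('a \<Rightarrow> 'b) set" where
  "algebra_iso A B = algebra_hom A B \<inter> ring_iso A B"

section \<open>Quasi-Hopf algebras and their (co)module algebras\<close>

context
  fixes H :: "('k, 'h) quasi_hopf" (structure)
begin

definition quasi_bialgebra :: bool where
  "quasi_bialgebra \<longleftrightarrow>
    assoc_algebra H \<and>
    \<Delta> \<in> algebra_hom H (H \<boxtimes> H) \<and>
    \<epsilon> \<in> ring_hom H K \<and> (\<forall>c\<in>carrier K. \<forall>h\<in>carrier H. \<epsilon> (c \<odot> h) = c \<otimes>\<^bsub>K\<^esub> \<epsilon> h) \<and>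
    \<Phi> \<in> Units (H \<boxtimes> H \<boxtimes> H) \<and>
    (\<forall>h\<in>carrier H. split_right H H H \<Delta> (\<Delta> h) =
       \<Phi> \<otimes>\<^bsub>H \<boxtimes> H \<boxtimes> H\<^esub> split_left H H H \<Delta> (\<Delta> h) \<otimes>\<^bsub>H \<boxtimes> H \<boxtimes> H\<^esub> inv\<^bsub>H \<boxtimes> H \<boxtimes> H\<^esub> \<Phi>) \<and>
    (\<forall>h\<in>carrier H. tsum H (\<lambda>h1 h2. \<epsilon> h2 \<odot> h1) (\<Delta> h) = h) \<and>
    (\<forall>h\<in>carrier H. tsum H (\<lambda>h1 h2. \<epsilon> h1 \<odot> h2) (\<Delta> h) = h) \<and>
    pure H (H \<boxtimes> H \<boxtimes> H) \<one> \<Phi> \<otimes>\<^bsub>H \<boxtimes> H \<boxtimes> H \<boxtimes> H\<^esub> split2 H H H H \<Delta> \<Phi>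
        \<otimes>\<^bsub>H \<boxtimes> H \<boxtimes> H \<boxtimes> H\<^esub> append_one H H H H \<Phi>
      = split3 H H H H \<Delta> \<Phi> \<otimes>\<^bsub>H \<boxtimes> H \<boxtimes> H \<boxtimes> H\<^esub> split1 H H H H \<Delta> \<Phi> \<and>
    tsum3 (H \<boxtimes> H) (\<lambda>X1 X2 X3. \<epsilon> X2 \<odot>\<^bsub>H \<boxtimes> H\<^esub> pure H H X1 X3) \<Phi> = \<one>\<^bsub>H \<boxtimes> H\<^esub>"

text \<open>
  The last line of the definition is the normalisation of \<open>\<alpha>\<close> and \<open>\<beta>\<close>, which can always be achieved
  by rescaling, together with \<open>\<epsilon> \<circ> S = \<epsilon>\<close>.
\<close>

definition quasi_hopf_algebra :: bool where
  "quasi_hopf_algebra \<longleftrightarrow>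
    quasi_bialgebra \<and>
    bij_betw S (carrier H) (carrier H) \<and>
    (\<forall>g\<in>carrier H. \<forall>h\<in>carrier H. S (g \<oplus> h) = S g \<oplus> S h \<and> S (g \<otimes> h) = S h \<otimes> S g) \<and>
    (\<forall>c\<in>carrier K. \<forall>h\<in>carrier H. S (c \<odot> h) = c \<odot> S h) \<and>
    S \<one> = \<one> \<and>
    \<alpha> \<in> carrier H \<and> \<beta> \<in> carrier H \<and>
    (\<forall>h\<in>carrier H. tsum H (\<lambda>h1 h2. S h1 \<otimes> \<alpha> \<otimes> h2) (\<Delta> h) = \<epsilon> h \<odot> \<alpha>) \<and>
    (\<forall>h\<in>carrier H. tsum H (\<lambda>h1 h2. h1 \<otimes> \<beta> \<otimes> S h2) (\<Delta> h) = \<epsilon> h \<odot> \<beta>) \<and>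
    tsum3 H (\<lambda>X1 X2 X3. X1 \<otimes> \<beta> \<otimes> S X2 \<otimes> \<alpha> \<otimes> X3) \<Phi> = \<one> \<and>
    tsum3 H (\<lambda>x1 x2 x3. S x1 \<otimes> \<alpha> \<otimes> x2 \<otimes> \<beta> \<otimes> S x3) (inv\<^bsub>H \<boxtimes> H \<boxtimes> H\<^esub> \<Phi>) = \<one> \<and>
    \<epsilon> \<alpha> = \<one>\<^bsub>K\<^esub> \<and> \<epsilon> \<beta> = \<one>\<^bsub>K\<^esub> \<and> (\<forall>h\<in>carrier H. \<epsilon> (S h) = \<epsilon> h)"

definition antipode_inv :: "'h \<Rightarrow> 'h" where
  "antipode_inv = inv_into (carrier H) S"

definition drinfeld_gamma :: "('k, 'h, 'h) ten" where
  "drinfeld_gamma =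
    tsum4 (H \<boxtimes> H) (\<lambda>A1 A2 A3 A4. pure H H (S A2 \<otimes> \<alpha> \<otimes> A3) (S A1 \<otimes> \<alpha> \<otimes> A4))
      (append_one H H H H \<Phi> \<otimes>\<^bsub>H \<boxtimes> H \<boxtimes> H \<boxtimes> H\<^esub>
       split1 H H H H \<Delta> (inv\<^bsub>H \<boxtimes> H \<boxtimes> H\<^esub> \<Phi>))"

definition drinfeld_twist :: "('k, 'h, 'h) ten" where
  "drinfeld_twist =
    tsum3 (H \<boxtimes> H) (\<lambda>x1 x2 x3.
      tsum (H \<boxtimes> H) (\<lambda>h1 h2. pure H H (S h2) (S h1)) (\<Delta> x1)
        \<otimes>\<^bsub>H \<boxtimes> H\<^esub> drinfeld_gamma \<otimes>\<^bsub>H \<boxtimes> H\<^esub> \<Delta> (x2 \<otimes> \<beta> \<otimes> S x3))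
      (inv\<^bsub>H \<boxtimes> H \<boxtimes> H\<^esub> \<Phi>)"

definition left_module_algebra :: "('k, 'h, 'a) left_mod \<Rightarrow> bool" where
  "left_module_algebra A \<longleftrightarrow>
    nonassoc_algebra A \<and>
    bilinear_map H A A (lact A) \<and>
    (\<forall>g\<in>carrier H. \<forall>h\<in>carrier H. \<forall>a\<in>carrier A. lact A (g \<otimes> h) a = lact A g (lact A h a)) \<and>
    (\<forall>a\<in>carrier A. lact A \<one> a = a) \<and>
    (\<forall>a\<in>carrier A. \<forall>a'\<in>carrier A. \<forall>a''\<in>carrier A.
       (a \<otimes>\<^bsub>A\<^esub> a') \<otimes>\<^bsub>A\<^esub> a'' =
       tsum3 A (\<lambda>X1 X2 X3. lact A X1 a \<otimes>\<^bsub>A\<^esub> (lact A X2 a' \<otimes>\<^bsub>A\<^esub> lact A X3 a'')) \<Phi>) \<and>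
    (\<forall>h\<in>carrier H. \<forall>a\<in>carrier A. \<forall>a'\<in>carrier A.
       lact A h (a \<otimes>\<^bsub>A\<^esub> a') = tsum A (\<lambda>h1 h2. lact A h1 a \<otimes>\<^bsub>A\<^esub> lact A h2 a') (\<Delta> h)) \<and>
    (\<forall>h\<in>carrier H. lact A h \<one>\<^bsub>A\<^esub> = \<epsilon> h \<odot>\<^bsub>A\<^esub> \<one>\<^bsub>A\<^esub>)"

definition right_module_algebra :: "('k, 'h, 'b) right_mod \<Rightarrow> bool" where
  "right_module_algebra B \<longleftrightarrow>
    nonassoc_algebra B \<and>
    bilinear_map B H B (ract B) \<and>
    (\<forall>g\<in>carrier H. \<forall>h\<in>carrier H. \<forall>b\<in>carrier B. ract B b (g \<otimes> h) = ract B (ract B b g) h) \<and>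
    (\<forall>b\<in>carrier B. ract B b \<one> = b) \<and>
    (\<forall>b\<in>carrier B. \<forall>b'\<in>carrier B. \<forall>b''\<in>carrier B.
       (b \<otimes>\<^bsub>B\<^esub> b') \<otimes>\<^bsub>B\<^esub> b'' =
       tsum3 B (\<lambda>x1 x2 x3. ract B b x1 \<otimes>\<^bsub>B\<^esub> (ract B b' x2 \<otimes>\<^bsub>B\<^esub> ract B b'' x3))
         (inv\<^bsub>H \<boxtimes> H \<boxtimes> H\<^esub> \<Phi>)) \<and>
    (\<forall>h\<in>carrier H. \<forall>b\<in>carrier B. \<forall>b'\<in>carrier B.
       ract B (b \<otimes>\<^bsub>B\<^esub> b') h = tsum B (\<lambda>h1 h2. ract B b h1 \<otimes>\<^bsub>B\<^esub> ract B b' h2) (\<Delta> h)) \<and>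
    (\<forall>h\<in>carrier H. ract B \<one>\<^bsub>B\<^esub> h = \<epsilon> h \<odot>\<^bsub>B\<^esub> \<one>\<^bsub>B\<^esub>)"

definition right_comodule_algebra :: "('k, 'h, 'a) right_comod \<Rightarrow> bool" where
  "right_comodule_algebra A \<longleftrightarrow> (let \<rho> = rcoact A; \<Phi>\<rho> = rcoact_reassoc A in
    assoc_algebra A \<and>
    \<rho> \<in> algebra_hom A (A \<boxtimes> H) \<and>
    \<Phi>\<rho> \<in> Units (A \<boxtimes> H \<boxtimes> H) \<and>
    (\<forall>a\<in>carrier A. \<Phi>\<rho> \<otimes>\<^bsub>A \<boxtimes> H \<boxtimes> H\<^esub> split_left A H H \<rho> (\<rho> a)
                 = split_right A H H \<Delta> (\<rho> a) \<otimes>\<^bsub>A \<boxtimes> H \<boxtimes> H\<^esub> \<Phi>\<rho>) \<and>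
    pure A (H \<boxtimes> H \<boxtimes> H) \<one>\<^bsub>A\<^esub> \<Phi> \<otimes>\<^bsub>A \<boxtimes> H \<boxtimes> H \<boxtimes> H\<^esub> split2 A H H H \<Delta> \<Phi>\<rho>
        \<otimes>\<^bsub>A \<boxtimes> H \<boxtimes> H \<boxtimes> H\<^esub> append_one A H H H \<Phi>\<rho>
      = split3 A H H H \<Delta> \<Phi>\<rho> \<otimes>\<^bsub>A \<boxtimes> H \<boxtimes> H \<boxtimes> H\<^esub> split1 A H H H \<rho> \<Phi>\<rho> \<and>
    (\<forall>a\<in>carrier A. tsum A (\<lambda>a0 a1. \<epsilon> a1 \<odot>\<^bsub>A\<^esub> a0) (\<rho> a) = a) \<and>
    tsum3 (A \<boxtimes> H) (\<lambda>X1 X2 X3. \<epsilon> X2 \<odot>\<^bsub>A \<boxtimes> H\<^esub> pure A H X1 X3) \<Phi>\<rho> = \<one>\<^bsub>A \<boxtimes> H\<^esub> \<and>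
    tsum3 (A \<boxtimes> H) (\<lambda>X1 X2 X3. \<epsilon> X3 \<odot>\<^bsub>A \<boxtimes> H\<^esub> pure A H X1 X2) \<Phi>\<rho> = \<one>\<^bsub>A \<boxtimes> H\<^esub>)"

definition left_comodule_algebra :: "('k, 'h, 'b) left_comod \<Rightarrow> bool" where
  "left_comodule_algebra B \<longleftrightarrow> (let lam = lcoact B; \<Phi>lam = lcoact_reassoc B in
    assoc_algebra B \<and>
    lam \<in> algebra_hom B (H \<boxtimes> B) \<and>
    \<Phi>lam \<in> Units (H \<boxtimes> H \<boxtimes> B) \<and>
    (\<forall>b\<in>carrier B. split_right H H B lam (lam b) \<otimes>\<^bsub>H \<boxtimes> H \<boxtimes> B\<^esub> \<Phi>lam
                 = \<Phi>lam \<otimes>\<^bsub>H \<boxtimes> H \<boxtimes> B\<^esub> split_left H H B \<Delta> (lam b)) \<and>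
    pure H (H \<boxtimes> H \<boxtimes> B) \<one> \<Phi>lam \<otimes>\<^bsub>H \<boxtimes> H \<boxtimes> H \<boxtimes> B\<^esub> split2 H H H B \<Delta> \<Phi>lam
        \<otimes>\<^bsub>H \<boxtimes> H \<boxtimes> H \<boxtimes> B\<^esub> append_one H H H B \<Phi>
      = split3 H H H B lam \<Phi>lam \<otimes>\<^bsub>H \<boxtimes> H \<boxtimes> H \<boxtimes> B\<^esub> split1 H H H B \<Delta> \<Phi>lam \<and>
    (\<forall>b\<in>carrier B. tsum B (\<lambda>b1 b0. \<epsilon> b1 \<odot>\<^bsub>B\<^esub> b0) (lam b) = b) \<and>
    tsum3 (H \<boxtimes> B) (\<lambda>X1 X2 X3. \<epsilon> X2 \<odot>\<^bsub>H \<boxtimes> B\<^esub> pure H B X1 X3) \<Phi>lam = \<one>\<^bsub>H \<boxtimes> B\<^esub> \<and>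
    tsum3 (H \<boxtimes> B) (\<lambda>X1 X2 X3. \<epsilon> X1 \<odot>\<^bsub>H \<boxtimes> B\<^esub> pure H B X2 X3) \<Phi>lam = \<one>\<^bsub>H \<boxtimes> B\<^esub>)"

definition tensor_bimod ::
    "('k, 'h, 'a) left_mod \<Rightarrow> ('k, 'h, 'b) right_mod \<Rightarrow> ('k, 'h, ('k, 'a, 'b) ten) bimod" where
  "tensor_bimod A B = (let T = A \<boxtimes> B in
    \<lparr>carrier = carrier T, mult = mult T, one = one T, zero = zero T, add = add T, smult = smult T,
     bi_lact = (\<lambda>h. tsum T (\<lambda>a b. pure A B (lact A h a) b)),
     bi_ract = (\<lambda>t h. tsum T (\<lambda>a b. pure A B a (ract B b h)) t)\<rparr>)"

definition tensor_bicomod ::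
    "('k, 'h, 'a) right_comod \<Rightarrow> ('k, 'h, 'b) left_comod \<Rightarrow> ('k, 'h, ('k, 'a, 'b) ten) bicomod" where
  "tensor_bicomod A B = (let T = A \<boxtimes> B in
    \<lparr>carrier = carrier T, mult = mult T, one = one T, zero = zero T, add = add T, smult = smult T,
     bi_lcoact = tsum (H \<boxtimes> T)
       (\<lambda>a b. tsum (H \<boxtimes> T) (\<lambda>b1 b0. pure H T b1 (pure A B a b0)) (lcoact B b)),
     bi_lreassoc = tsum3 (H \<boxtimes> H \<boxtimes> T)
       (\<lambda>X1 X2 X3. pure3 H H T X1 X2 (pure A B \<one>\<^bsub>A\<^esub> X3)) (lcoact_reassoc B),
     bi_rcoact = tsum (T \<boxtimes> H)
       (\<lambda>a b. tsum (T \<boxtimes> H) (\<lambda>a0 a1. pure T H (pure A B a0 b) a1) (rcoact A a)),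
     bi_rreassoc = tsum3 (T \<boxtimes> H \<boxtimes> H)
       (\<lambda>X1 X2 X3. pure3 T H H (pure A B X1 \<one>\<^bsub>B\<^esub>) X2 X3) (rcoact_reassoc A),
     bi_lrreassoc = pure3 H T H \<one> (pure A B \<one>\<^bsub>A\<^esub> \<one>\<^bsub>B\<^esub>) \<one>\<rparr>)"

section \<open>The three products\<close>

text \<open>
  The products are written down for arbitrary data of the right type, since their formulas do not
  depend on the axioms of (bi)module and (bi)comodule algebras; they are associative and unital when
  these axioms hold. Throughout, the numbered variables \<open>l\<close>, \<open>r\<close> and \<open>\<theta>\<close> are the legs of the
  inverses of the left, right and two-sided reassociators.
\<close>

definition Omega ::
    "('k, 'h, 'u) bicomod \<Rightarrow> ('k, 'h, ('k, 'h, ('k, 'u, ('k, 'h, 'h) ten) ten) ten) ten" where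
  "Omega U = (let T = H \<boxtimes> H \<boxtimes> U \<boxtimes> H \<boxtimes> H in
    tsum3 T (\<lambda>X1 X2 X3.
    tsum3 T (\<lambda>l1 l2 l3.
    tsum3 T (\<lambda>\<theta>1 \<theta>2 \<theta>3.
    tsum T (\<lambda>f1 f2.
    tsum T (\<lambda>X1m X1z.      \<comment> \<open>\<open>\<lambda>(X\<^sup>1)\<close>\<close>
    tsum T (\<lambda>X1m1 X1m2.
    tsum T (\<lambda>\<theta>2m \<theta>2z.      \<comment> \<open>\<open>\<lambda>(\<theta>\<^sup>2)\<close>\<close>
      pure5 H H U H H
        (X1m1 \<otimes> l1 \<otimes> \<theta>1)
        (X1m2 \<otimes> l2 \<otimes> \<theta>2m)
        (X1z \<otimes>\<^bsub>U\<^esub> l3 \<otimes>\<^bsub>U\<^esub> \<theta>2z)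
        (antipode_inv (f1 \<otimes> X2 \<otimes> \<theta>3))
        (antipode_inv (f2 \<otimes> X3)))
      (bi_lcoact U \<theta>2)) (\<Delta> X1m)) (bi_lcoact U X1))
      drinfeld_twist)
      (inv\<^bsub>H \<boxtimes> U \<boxtimes> H\<^esub> (bi_lrreassoc U)))
      (inv\<^bsub>H \<boxtimes> H \<boxtimes> U\<^esub> (bi_lreassoc U)))
      (bi_rreassoc U))"

definition diagonal_crossed_product ::
    "('k, 'h, 'm) bimod \<Rightarrow> ('k, 'h, 'u) bicomod \<Rightarrow> ('k, ('k, 'm, 'u) ten) module" where
  "diagonal_crossed_product M U = (let T = M \<boxtimes> U in T
    \<lparr>mult := (\<lambda>s t.
       tsum T (\<lambda>\<phi> u. tsum T (\<lambda>\<phi>' u'.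
       tsum5 T (\<lambda>O1 O2 O3 O4 O5.
       tsum T (\<lambda>u0 u1. tsum T (\<lambda>u0m u0z.
         pure M U
           (bi_ract M (bi_lact M O1 \<phi>) O5 \<otimes>\<^bsub>M\<^esub>
            bi_ract M (bi_lact M (O2 \<otimes> u0m) \<phi>') (antipode_inv u1 \<otimes> O4))
           (O3 \<otimes>\<^bsub>U\<^esub> u0z \<otimes>\<^bsub>U\<^esub> u'))
         (bi_lcoact U u0)) (bi_rcoact U u)) (Omega U)) t) s),
      one := pure M U \<one>\<^bsub>M\<^esub> \<one>\<^bsub>U\<^esub>\<rparr>)"

definition two_sided_smash_product ::
    "('k, 'h, 'a) left_mod \<Rightarrow> ('k, 'h, 'u) bicomod \<Rightarrow> ('k, 'h, 'b) right_mod
      \<Rightarrow> ('k, ('k, 'a, 'u, 'b) ten3) module" where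
  "two_sided_smash_product A U B = (let T = A \<boxtimes> U \<boxtimes> B in T
    \<lparr>mult := (\<lambda>s t.
       tsum3 T (\<lambda>a u b. tsum3 T (\<lambda>a' u' b'.
       tsum3 T (\<lambda>l1 l2 l3. tsum3 T (\<lambda>\<theta>1 \<theta>2 \<theta>3. tsum3 T (\<lambda>r1 r2 r3.
       tsum T (\<lambda>um uz. tsum T (\<lambda>u'0 u'1.
         pure3 A U B
           (lact A l1 a \<otimes>\<^bsub>A\<^esub> lact A (l2 \<otimes> um \<otimes> \<theta>1) a')
           (l3 \<otimes>\<^bsub>U\<^esub> uz \<otimes>\<^bsub>U\<^esub> \<theta>2 \<otimes>\<^bsub>U\<^esub> u'0 \<otimes>\<^bsub>U\<^esub> r1)
           (ract B b (\<theta>3 \<otimes> u'1 \<otimes> r2) \<otimes>\<^bsub>B\<^esub> ract B b' r3))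
         (bi_rcoact U u')) (bi_lcoact U u))
         (inv\<^bsub>U \<boxtimes> H \<boxtimes> H\<^esub> (bi_rreassoc U)))
         (inv\<^bsub>H \<boxtimes> U \<boxtimes> H\<^esub> (bi_lrreassoc U)))
         (inv\<^bsub>H \<boxtimes> H \<boxtimes> U\<^esub> (bi_lreassoc U))) t) s),
      one := pure3 A U B \<one>\<^bsub>A\<^esub> \<one>\<^bsub>U\<^esub> \<one>\<^bsub>B\<^esub>\<rparr>)"

definition two_sided_crossed_product ::
    "('k, 'h, 'a) right_comod \<Rightarrow> ('k, 'h, 'm) bimod \<Rightarrow> ('k, 'h, 'b) left_comod
      \<Rightarrow> ('k, ('k, 'a, 'm, 'b) ten3) module" where
  "two_sided_crossed_product A M B = (let T = A \<boxtimes> M \<boxtimes> B in T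
    \<lparr>mult := (\<lambda>s t.
       tsum3 T (\<lambda>a \<phi> b. tsum3 T (\<lambda>a' \<phi>' b'.
       tsum3 T (\<lambda>r1 r2 r3. tsum3 T (\<lambda>l1 l2 l3.
       tsum T (\<lambda>a'0 a'1. tsum T (\<lambda>bm bz.
         pure3 A M B
           (a \<otimes>\<^bsub>A\<^esub> a'0 \<otimes>\<^bsub>A\<^esub> r1)
           (bi_ract M (bi_lact M l1 \<phi>) (a'1 \<otimes> r2) \<otimes>\<^bsub>M\<^esub>
            bi_ract M (bi_lact M (l2 \<otimes> bm) \<phi>') r3)
           (l3 \<otimes>\<^bsub>B\<^esub> bz \<otimes>\<^bsub>B\<^esub> b'))
         (lcoact B b)) (rcoact A a'))
         (inv\<^bsub>H \<boxtimes> H \<boxtimes> B\<^esub> (lcoact_reassoc B)))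
         (inv\<^bsub>A \<boxtimes> H \<boxtimes> H\<^esub> (rcoact_reassoc A))) t) s),
      one := pure3 A M B \<one>\<^bsub>A\<^esub> \<one>\<^bsub>M\<^esub> \<one>\<^bsub>B\<^esub>\<rparr>)"

end

end

end

theory Submission
  imports Defs
begin

text \<open>
  Since \<open>\<Phi>\<^bsub>\<lambda>,\<rho>\<^esub>\<close> of the bicomodule algebra \<open>U \<otimes> Y\<close> is trivial (\<open>U\<close> the right and \<open>Y\<close> the left comodule
  algebra), each of the three products splits, after a permutation of the tensor factors, as an ordinary
  tensor product of an algebra on \<open>A \<otimes> Y\<close>, the same for all three, and an algebra on \<open>B \<otimes> U\<close>. The latter
  is the same algebra \<open>D\<close> for the smash product and the two-sided crossed product, and another one \<open>D'\<close> for
  the diagonal crossed product. The map \<open>b \<otimes> x \<mapsto> b \<cdot> q\<^sup>2 x\<^sub>1 \<otimes> q\<^sup>1 x\<^sub>0\<close> with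
  \<open>q = X\<^sup>1 \<otimes> S\<^sup>-\<^sup>1(\<alpha> X\<^sup>3) X\<^sup>2\<close> is an isomorphism from \<open>D'\<close> to \<open>D\<close>: its inverse comes from
  \<open>p = x\<^sup>1 \<otimes> x\<^sup>2 \<beta> S(x\<^sup>3)\<close>, and its multiplicativity is a formula for the comultiplication of \<open>q\<close>, which
  follows from the pentagon identity of the comodule algebra and from the properties
  \<open>f \<Delta>(S(h)) = (S \<otimes> S)(\<Delta>\<^sup>c\<^sup>o\<^sup>p(h)) f\<close> and \<open>f \<Delta>(\<alpha>) = \<gamma>\<close> of the Drinfeld twist. Associativity of the
  three products plays no role.
\<close>

text \<open>The reassociators, q, p and f are unspecified sums of pure tensors, so an identity
  between them cannot be checked leg by leg. Most steps are therefore stated first for an arbitrary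
  tensor in place of such an element, where both sides are linear and pure tensors decide, and then
  specialised; this is why many formulas reappear with their structural elements turned into
  arguments. Relations between the actual elements enter mostly through one mechanism: a contraction
  such as S(c) \<alpha> d or c \<beta> S(d) turns a factor \<Delta>(h) on its proper side into
  \<epsilon>(h). A pentagon is rearranged until each comultiplied reassociator faces such a
  contraction and collapses to 1. The shape of q is dictated by the two products. In
  \<open>Dalg\<close> a coaction leg of the right factor x' acts on b; in \<open>Dalg'\<close> a
  coaction leg of the left factor x acts on b' through S^-1. The identity (1 \<otimes> S^-1(x1)) q
  \<rho>(x0) = (x \<otimes> 1) q converts one kind of action into the other.\<close>

locale base =
  fixes K :: "'k ring"
  assumes K: "cring K"
begin

section \<open>Linear and bilinear maps between modules\<close>

definition lin :: "('k, 'v, 'c) module_scheme \<Rightarrow> ('k, 'w, 'd) module_scheme \<Rightarrow> ('v \<Rightarrow> 'w) \<Rightarrow> bool" where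
  "lin V W f \<longleftrightarrow> (\<forall>x\<in>carrier V. f x \<in> carrier W) \<and>
    (\<forall>x\<in>carrier V. \<forall>y\<in>carrier V. f (x \<oplus>\<^bsub>V\<^esub> y) = f x \<oplus>\<^bsub>W\<^esub> f y) \<and>
    (\<forall>c\<in>carrier K. \<forall>x\<in>carrier V. f (c \<odot>\<^bsub>V\<^esub> x) = c \<odot>\<^bsub>W\<^esub> f x)"

lemma linI:
  assumes "\<And>x. x \<in> carrier V \<Longrightarrow> f x \<in> carrier W"
    and "\<And>x y. x \<in> carrier V \<Longrightarrow> y \<in> carrier V \<Longrightarrow> f (x \<oplus>\<^bsub>V\<^esub> y) = f x \<oplus>\<^bsub>W\<^esub> f y"
    and "\<And>c x. c \<in> carrier K \<Longrightarrow> x \<in> carrier V \<Longrightarrow> f (c \<odot>\<^bsub>V\<^esub> x) = c \<odot>\<^bsub>W\<^esub> f x"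
  shows "lin V W f"
  using assms by (simp add: lin_def)

lemma lin_closed: "lin V W f \<Longrightarrow> x \<in> carrier V \<Longrightarrow> f x \<in> carrier W"
  and lin_add: "lin V W f \<Longrightarrow> x \<in> carrier V \<Longrightarrow> y \<in> carrier V \<Longrightarrow> f (x \<oplus>\<^bsub>V\<^esub> y) = f x \<oplus>\<^bsub>W\<^esub> f y"
  and lin_smult: "lin V W f \<Longrightarrow> c \<in> carrier K \<Longrightarrow> x \<in> carrier V \<Longrightarrow> f (c \<odot>\<^bsub>V\<^esub> x) = c \<odot>\<^bsub>W\<^esub> f x"
  by (simp_all add: lin_def)

abbreviation bil where "bil \<equiv> bilinear_map K"

text \<open>Bilinearity is reduced to two families of linear maps, so that the rules for
  \<open>lin\<close> also settle goals about \<open>bil\<close>.\<close>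

lemma bilI:
  assumes "\<And>u. u \<in> carrier U \<Longrightarrow> lin V W (f u)"
    and "\<And>v. v \<in> carrier V \<Longrightarrow> lin U W (\<lambda>u. f u v)"
  shows "bil U V W f"
  using assms by (simp add: bilinear_map_def lin_def)

lemma bil_lin1: "bil U V W f \<Longrightarrow> v \<in> carrier V \<Longrightarrow> lin U W (\<lambda>u. f u v)"
  and bil_lin2: "bil U V W f \<Longrightarrow> u \<in> carrier U \<Longrightarrow> lin V W (f u)"
  and bil_closed: "bil U V W f \<Longrightarrow> u \<in> carrier U \<Longrightarrow> v \<in> carrier V \<Longrightarrow> f u v \<in> carrier W"
  by (simp_all add: bilinear_map_def lin_def)

abbreviation vs :: "('k, 'v, 'c) module_scheme \<Rightarrow> bool" where "vs \<equiv> module K"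

lemma vs_ag: "vs V \<Longrightarrow> abelian_group V"
  by (rule module.axioms(2))

lemma lin_zero:
  assumes "vs V" "vs W" "lin V W f"
  shows "f \<zero>\<^bsub>V\<^esub> = \<zero>\<^bsub>W\<^esub>"
proof -
  interpret V: module K V by fact
  interpret W: module K W by fact
  have "f (\<zero>\<^bsub>K\<^esub> \<odot>\<^bsub>V\<^esub> \<zero>\<^bsub>V\<^esub>) = \<zero>\<^bsub>K\<^esub> \<odot>\<^bsub>W\<^esub> f \<zero>\<^bsub>V\<^esub>"
    using assms(3) by (intro lin_smult) auto
  then show ?thesis
    using lin_closed[OF assms(3) V.M.zero_closed] by simp
qed

lemma lin_minus:
  assumes "vs V" "vs W" "lin V W f" "x \<in> carrier V"
  shows "f (\<ominus>\<^bsub>V\<^esub> x) = \<ominus>\<^bsub>W\<^esub> f x"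
proof -
  interpret V: module K V by fact
  interpret W: module K W by fact
  have "f (\<ominus>\<^bsub>V\<^esub> x \<oplus>\<^bsub>V\<^esub> x) = f (\<ominus>\<^bsub>V\<^esub> x) \<oplus>\<^bsub>W\<^esub> f x"
    using assms by (intro lin_add) auto
  then have "f (\<ominus>\<^bsub>V\<^esub> x) \<oplus>\<^bsub>W\<^esub> f x = \<zero>\<^bsub>W\<^esub>"
    using assms(4) lin_zero[OF assms(1,2,3)] by (simp add: V.M.l_neg)
  then show ?thesis
    using W.M.minus_equality[of "f (\<ominus>\<^bsub>V\<^esub> x)" "f x"] assms(4) lin_closed[OF assms(3)] by simp
qed

lemma lin_finsum:
  assumes "vs V" "vs W" "lin V W f" "g \<in> I \<rightarrow> carrier V"
  shows "f (finsum V g I) = finsum W (\<lambda>i. f (g i)) I"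
proof -
  interpret V: module K V by fact
  interpret W: module K W by fact
  show ?thesis
    using assms(4)
  proof (induction I rule: infinite_finite_induct)
    case (insert x F)
    then have "(\<lambda>i. f (g i)) \<in> F \<rightarrow> carrier W" "f (g x) \<in> carrier W"
      using assms(3) by (auto simp: lin_def)
    with insert show ?case
      using assms(3) by (simp add: Pi_iff lin_add)
  \<comment> \<open>For an infinite index set both sums have the default value zero, which f
    preserves.\<close>
  qed (auto simp: lin_zero[OF assms(1,2,3)] V.M.finsum_infinite W.M.finsum_infinite)
qed

section \<open>Free modules and the evaluation of formal combinations\<close>

lemma free_module: "vs (free_space K X)"
proof -
  interpret K: cring K by (rule K)
  have fin: "finite {p. r p \<oplus>\<^bsub>K\<^esub> s p \<noteq> \<zero>\<^bsub>K\<^esub>}"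
    if "finite {p. r p \<noteq> \<zero>\<^bsub>K\<^esub>}" "finite {p. s p \<noteq> \<zero>\<^bsub>K\<^esub>}" for r s :: "'a \<Rightarrow> 'k"
    by (rule finite_subset[of _ "{p. r p \<noteq> \<zero>\<^bsub>K\<^esub>} \<union> {p. s p \<noteq> \<zero>\<^bsub>K\<^esub>}"]) (use that in auto)
  have fins: "finite {p. c \<otimes>\<^bsub>K\<^esub> r p \<noteq> \<zero>\<^bsub>K\<^esub>}"
    if "finite {p. r p \<noteq> \<zero>\<^bsub>K\<^esub>}" "c \<in> carrier K" for c and r :: "'a \<Rightarrow> 'k"
    by (rule finite_subset[of _ "{p. r p \<noteq> \<zero>\<^bsub>K\<^esub>}"]) (use that in auto)
  have grp: "abelian_group (free_space K X)"
  proof (rule abelian_groupI)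
    fix x assume x: "x \<in> carrier (free_space K X)"
    let ?y = "\<lambda>p. \<ominus>\<^bsub>K\<^esub> x p"
    have *: "{p. ?y p \<noteq> \<zero>\<^bsub>K\<^esub>} \<subseteq> {p. x p \<noteq> \<zero>\<^bsub>K\<^esub>}" by auto
    have "?y \<in> carrier (free_space K X)"
      using x finite_subset[OF *] * by (simp add: free_space_def)
    moreover have "?y \<oplus>\<^bsub>free_space K X\<^esub> x = \<zero>\<^bsub>free_space K X\<^esub>"
      using x by (simp add: free_space_def K.l_neg)
    ultimately show "\<exists>y\<in>carrier (free_space K X). y \<oplus>\<^bsub>free_space K X\<^esub> x = \<zero>\<^bsub>free_space K X\<^esub>"
      by blast
  next
    fix x y assume "x \<in> carrier (free_space K X)" "y \<in> carrier (free_space K X)"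
    then show "x \<oplus>\<^bsub>free_space K X\<^esub> y \<in> carrier (free_space K X)"
      using fin[of x y] by (auto simp: free_space_def subset_iff) (metis K.l_zero K.zero_closed)
  qed (auto simp: free_space_def K.a_ac)
  show ?thesis
  proof (rule moduleI)
    fix a x assume "a \<in> carrier K" "x \<in> carrier (free_space K X)"
    then show "a \<odot>\<^bsub>free_space K X\<^esub> x \<in> carrier (free_space K X)"
      using fins[of x a] by (auto simp: free_space_def subset_iff) (metis K.r_null)
  qed (use grp K in \<open>auto simp: free_space_def K.l_distr K.r_distr K.m_assoc\<close>)
qed

lemma single_closed: "p \<in> X \<Longrightarrow> single K p \<in> carrier (free_space K X)"
proof -
  interpret K: cring K by (rule K)
  have "{q. single K p q \<noteq> \<zero>\<^bsub>K\<^esub>} \<subseteq> {p}" by (auto simp: single_def)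
  then have "finite {q. single K p q \<noteq> \<zero>\<^bsub>K\<^esub>}" by (rule finite_subset) simp
  then show "p \<in> X \<Longrightarrow> single K p \<in> carrier (free_space K X)"
    by (auto simp: free_space_def single_def)
qed

lemma free_spaceD:
  assumes "r \<in> carrier (free_space K X)"
  shows "r p \<in> carrier K" "finite {p. r p \<noteq> \<zero>\<^bsub>K\<^esub>}" "r p \<noteq> \<zero>\<^bsub>K\<^esub> \<Longrightarrow> p \<in> X"
  using assms by (auto simp add: free_space_def)

text \<open>Induction on a finite set containing the support: resetting r to zero at one point p
  splits off the generator at p with its coefficient.\<close>

lemma free_induct [consumes 1, case_names zero step]:
  assumes "r \<in> carrier (free_space K X)"
    and zero: "P \<zero>\<^bsub>free_space K X\<^esub>"
    and step: "\<And>c p s. c \<in> carrier K \<Longrightarrow> p \<in> X \<Longrightarrow> s \<in> carrier (free_space K X) \<Longrightarrow> P s \<Longrightarrow>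
      P ((c \<odot>\<^bsub>free_space K X\<^esub> single K p) \<oplus>\<^bsub>free_space K X\<^esub> s)"
  shows "P r"
proof -
  interpret K: cring K by (rule K)
  have "finite A \<Longrightarrow> r \<in> carrier (free_space K X) \<Longrightarrow> {p. r p \<noteq> \<zero>\<^bsub>K\<^esub>} \<subseteq> A \<Longrightarrow> P r" for A r
  proof (induction A arbitrary: r rule: finite_induct)
    case empty
    then have "r = \<zero>\<^bsub>free_space K X\<^esub>" by (auto simp: free_space_def)
    then show ?case using zero by simp
  next
    case (insert p A)
    show ?case
    proof (cases "r p = \<zero>\<^bsub>K\<^esub>")
      case True
      with insert show ?thesis by (metis (mono_tags, lifting) mem_Collect_eq subset_insert)
    next
      case False
      then have p: "p \<in> X" using insert by (auto simp: free_space_def)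
      have rK: "r q \<in> carrier K" for q using insert by (auto simp: free_space_def)
      define s where "s = r(p := \<zero>\<^bsub>K\<^esub>)"
      have ss: "{p. s p \<noteq> \<zero>\<^bsub>K\<^esub>} \<subseteq> {p. r p \<noteq> \<zero>\<^bsub>K\<^esub>}" by (auto simp: s_def)
      have fs: "finite {p. s p \<noteq> \<zero>\<^bsub>K\<^esub>}"
        by (rule finite_subset[OF ss]) (use insert in \<open>simp add: free_space_def\<close>)
      have s: "s \<in> carrier (free_space K X)"
        using insert.prems ss fs by (auto simp: free_space_def s_def)
      have r: "r = (r p \<odot>\<^bsub>free_space K X\<^esub> single K p) \<oplus>\<^bsub>free_space K X\<^esub> s"
        using rK by (auto simp: free_space_def s_def single_def)
      have "P s"
        by (rule insert.IH[OF s]) (use insert.prems in \<open>auto simp: s_def split: if_splits\<close>)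
      then show ?thesis
        by (subst r) (rule step[OF rK p s])
    qed
  qed
  then show ?thesis
    using assms(1) by (auto simp: free_space_def)
qed

text \<open>The linear extension of f from generators to formal combinations, written with the same
  sum as in \<open>tsum\<close>.\<close>

definition ev :: "('k, 'z, 'e) module_scheme \<Rightarrow> ('x \<Rightarrow> 'z) \<Rightarrow> ('x \<Rightarrow> 'k) \<Rightarrow> 'z" where
  "ev Z f r = (\<Oplus>\<^bsub>Z\<^esub>p\<in>{p. r p \<noteq> \<zero>\<^bsub>K\<^esub>}. r p \<odot>\<^bsub>Z\<^esub> f p)"

text \<open>Terms with coefficient zero contribute nothing. This lets combinations with different
  supports be summed over one common finite set.\<close>

lemma ev_superset:
  assumes "vs Z" "f \<in> X \<rightarrow> carrier Z" "r \<in> carrier (free_space K X)"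
    and "finite A" "{p. r p \<noteq> \<zero>\<^bsub>K\<^esub>} \<subseteq> A" "A \<subseteq> X"
  shows "ev Z f r = (\<Oplus>\<^bsub>Z\<^esub>p\<in>A. r p \<odot>\<^bsub>Z\<^esub> f p)"
proof -
  interpret Z: module K Z by fact
  have rK: "r q \<in> carrier K" for q using assms(3) by (auto simp: free_space_def)
  show ?thesis
    unfolding ev_def
    by (rule Z.M.add.finprod_mono_neutral_cong_left) (use assms rK in \<open>auto simp: Pi_iff\<close>)
qed

lemma ev_lin:
  assumes "vs Z" "f \<in> X \<rightarrow> carrier Z"
  shows "lin (free_space K X) Z (ev Z f)"
proof (rule linI)
  interpret Z: module K Z by fact
  interpret F: module K "free_space K X" by (rule free_module)
  let ?F = "free_space K X"
  have supp: "finite {p. r p \<noteq> \<zero>\<^bsub>K\<^esub>}" "{p. r p \<noteq> \<zero>\<^bsub>K\<^esub>} \<subseteq> X" "\<And>q. r q \<in> carrier K"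
    if "r \<in> carrier ?F" for r
    using that by (auto simp: free_space_def)
  fix r assume r: "r \<in> carrier ?F"
  have f: "f p \<in> carrier Z" if "p \<in> X" for p using that assms by auto
  show "ev Z f r \<in> carrier Z"
    unfolding ev_def using supp[OF r] assms(2) by (intro Z.M.finsum_closed) (auto simp: Pi_iff)
  {
    fix s assume s: "s \<in> carrier ?F"
    let ?A = "{p. r p \<noteq> \<zero>\<^bsub>K\<^esub>} \<union> {p. s p \<noteq> \<zero>\<^bsub>K\<^esub>}"
    have A: "finite ?A" "?A \<subseteq> X" using supp[OF r] supp[OF s] by auto
    have rs: "r \<oplus>\<^bsub>?F\<^esub> s \<in> carrier ?F" using r s by simp
    have "ev Z f (r \<oplus>\<^bsub>?F\<^esub> s) = (\<Oplus>\<^bsub>Z\<^esub>p\<in>?A. (r \<oplus>\<^bsub>?F\<^esub> s) p \<odot>\<^bsub>Z\<^esub> f p)"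
      using A supp(3)[OF r] supp(3)[OF s]
      by (intro ev_superset[OF assms rs]) (auto simp: free_space_def)
    also have "\<dots> = (\<Oplus>\<^bsub>Z\<^esub>p\<in>?A. r p \<odot>\<^bsub>Z\<^esub> f p \<oplus>\<^bsub>Z\<^esub> s p \<odot>\<^bsub>Z\<^esub> f p)"
    proof (rule Z.M.finsum_cong')
      fix i assume "i \<in> ?A"
      then have "f i \<in> carrier Z" using A f by blast
      then show "(r \<oplus>\<^bsub>?F\<^esub> s) i \<odot>\<^bsub>Z\<^esub> f i = r i \<odot>\<^bsub>Z\<^esub> f i \<oplus>\<^bsub>Z\<^esub> s i \<odot>\<^bsub>Z\<^esub> f i"
        using supp(3)[OF r] supp(3)[OF s] by (simp add: free_space_def Z.smult_l_distr)
    qed (use A f supp(3)[OF r] supp(3)[OF s] in \<open>auto simp: subset_iff\<close>)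
    also have "\<dots> = (\<Oplus>\<^bsub>Z\<^esub>p\<in>?A. r p \<odot>\<^bsub>Z\<^esub> f p) \<oplus>\<^bsub>Z\<^esub> (\<Oplus>\<^bsub>Z\<^esub>p\<in>?A. s p \<odot>\<^bsub>Z\<^esub> f p)"
      by (rule Z.M.finsum_addf) (use A f supp(3)[OF r] supp(3)[OF s] in \<open>auto simp: subset_iff\<close>)
    also have "\<dots> = ev Z f r \<oplus>\<^bsub>Z\<^esub> ev Z f s"
      using A by (simp add: ev_superset[OF assms r A(1) _ A(2)] ev_superset[OF assms s A(1) _ A(2)])
    finally show "ev Z f (r \<oplus>\<^bsub>?F\<^esub> s) = ev Z f r \<oplus>\<^bsub>Z\<^esub> ev Z f s" .
  }
  {
    fix c assume c: "c \<in> carrier K"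
    let ?A = "{p. r p \<noteq> \<zero>\<^bsub>K\<^esub>}"
    have cr: "c \<odot>\<^bsub>?F\<^esub> r \<in> carrier ?F" using r c by simp
    have "ev Z f (c \<odot>\<^bsub>?F\<^esub> r) = (\<Oplus>\<^bsub>Z\<^esub>p\<in>?A. (c \<odot>\<^bsub>?F\<^esub> r) p \<odot>\<^bsub>Z\<^esub> f p)"
      using supp[OF r] c by (intro ev_superset[OF assms cr]) (auto simp: free_space_def)
    also have "\<dots> = (\<Oplus>\<^bsub>Z\<^esub>p\<in>?A. c \<odot>\<^bsub>Z\<^esub> (r p \<odot>\<^bsub>Z\<^esub> f p))"
    proof (rule Z.M.finsum_cong')
      fix i assume "i \<in> ?A"
      then have "f i \<in> carrier Z" using supp[OF r] f by blast
      then show "(c \<odot>\<^bsub>?F\<^esub> r) i \<odot>\<^bsub>Z\<^esub> f i = c \<odot>\<^bsub>Z\<^esub> (r i \<odot>\<^bsub>Z\<^esub> f i)"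
        using supp(3)[OF r] c by (simp add: free_space_def Z.smult_assoc1)
    qed (use f supp[OF r] c in \<open>auto simp: subset_iff\<close>)
    also have "\<dots> = c \<odot>\<^bsub>Z\<^esub> ev Z f r"
      unfolding ev_def
      by (rule Z.finsum_smult_ldistr[symmetric]) (use supp[OF r] f c in \<open>auto simp: subset_iff\<close>)
    finally show "ev Z f (c \<odot>\<^bsub>?F\<^esub> r) = c \<odot>\<^bsub>Z\<^esub> ev Z f r" .
  }
qed

lemma ev_single:
  assumes "vs Z" "f \<in> X \<rightarrow> carrier Z" "p \<in> X"
  shows "ev Z f (single K p) = f p"
proof -
  interpret Z: module K Z by fact
  have fp: "f p \<in> carrier Z" using assms by auto
  have "ev Z f (single K p) = (\<Oplus>\<^bsub>Z\<^esub>q\<in>{p}. single K p q \<odot>\<^bsub>Z\<^esub> f q)"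
    by (intro ev_superset[OF assms(1,2) single_closed[OF assms(3)]])
      (use assms in \<open>auto simp: single_def\<close>)
  then show ?thesis using fp by (simp add: single_def)
qed

section \<open>Tensor products\<close>

abbreviation tens (infixr \<open>\<boxtimes>\<close> 75) where "V \<boxtimes> W \<equiv> tensor K V W"
abbreviation FS where "FS V W \<equiv> free_space K (carrier V \<times> carrier W)"
abbreviation TK where "TK V W \<equiv> tensor_kernel K V W"

lemma rels_sub:
  assumes "vs V" "vs W"
  shows "bilinear_rels K V W \<subseteq> carrier (FS V W)"
proof -
  interpret V: module K V by fact
  interpret W: module K W by fact
  interpret F: module K "FS V W" by (rule free_module)
  show ?thesis
    unfolding bilinear_rels_def Let_def
    by (auto intro!: F.M.minus_closed F.M.add.m_closed F.smult_closed single_closed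
        simp: V.smult_closed W.smult_closed)
qed

lemma TK_sub:
  assumes "vs V" "vs W"
  shows "submodule (TK V W) K (FS V W)" "bilinear_rels K V W \<subseteq> TK V W"
proof -
  interpret F: module K "FS V W" by (rule free_module)
  let ?S = "{N. submodule N K (FS V W) \<and> bilinear_rels K V W \<subseteq> N}"
  \<comment> \<open>The whole free module is a member of the family, so the intersection defining
    the kernel is not over the empty family.\<close>
  have c: "carrier (FS V W) \<in> ?S"
    using F.carrier_is_submodule rels_sub[OF assms] by auto
  show "submodule (TK V W) K (FS V W)"
  proof (rule F.submoduleI)
    show "TK V W \<subseteq> carrier (FS V W)" using c unfolding tensor_kernel_def by blast
    show "\<zero>\<^bsub>FS V W\<^esub> \<in> TK V W"
      unfolding tensor_kernel_def
      using subgroup.one_closed[OF submodule.axioms(1)] by fastforce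
  qed (auto simp: tensor_kernel_def dest: F.submoduleE intro: submodule.smult_closed)
  show "bilinear_rels K V W \<subseteq> TK V W"
    unfolding tensor_kernel_def by auto
qed

definition cls where
  "cls V W r = TK V W +>\<^bsub>FS V W\<^esub> r"

context
  fixes V :: "('k, 'v, 'c) module_scheme" and W :: "('k, 'w, 'd) module_scheme"
  assumes V: "vs V" and W: "vs W"
begin

interpretation V: module K V by (rule V)
interpretation W: module K W by (rule W)
interpretation F: module K "FS V W" by (rule free_module)

lemma abelian_subgroup_TK: "abelian_subgroup (TK V W) (FS V W)"
  using submodule.axioms(1)[OF TK_sub(1)[OF V W]] F.M.abelian_group_axioms
  by (intro abelian_subgroupI3 additive_subgroupI) auto

interpretation N: abelian_subgroup "TK V W" "FS V W" by (rule abelian_subgroup_TK)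

lemma cls_eq:
  assumes "r \<in> carrier (FS V W)" "s \<in> carrier (FS V W)"
  shows "cls V W r = cls V W s \<longleftrightarrow> r \<ominus>\<^bsub>FS V W\<^esub> s \<in> TK V W"
proof
  assume "cls V W r = cls V W s"
  then have "r \<in> cls V W s" using N.a_rcos_self[OF assms(1)] by (simp add: cls_def)
  then show "r \<ominus>\<^bsub>FS V W\<^esub> s \<in> TK V W"
    using N.a_rcos_module_imp[OF assms(2)] by (simp add: cls_def a_minus_def)
next
  assume "r \<ominus>\<^bsub>FS V W\<^esub> s \<in> TK V W"
  then have "r \<in> cls V W s"
    using N.a_rcos_module_rev[OF assms(2,1)] by (simp add: cls_def a_minus_def)
  then show "cls V W r = cls V W s"
    using N.a_repr_independence'[OF _ assms(2)] by (simp add: cls_def)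
qed

lemma cls_closed: "r \<in> carrier (FS V W) \<Longrightarrow> cls V W r \<in> carrier (V \<boxtimes> W)"
  using F.M.a_rcosetsI[OF N.a_subset] by (simp add: cls_def tensor_def tensor_space_def Let_def)

lemma clsE:
  assumes "t \<in> carrier (V \<boxtimes> W)"
  obtains r where "r \<in> carrier (FS V W)" "t = cls V W r"
  using assms by (auto simp: cls_def tensor_def tensor_space_def Let_def A_RCOSETS_def')

lemma cls_add:
  assumes "r \<in> carrier (FS V W)" "s \<in> carrier (FS V W)"
  shows "cls V W r \<oplus>\<^bsub>V \<boxtimes> W\<^esub> cls V W s = cls V W (r \<oplus>\<^bsub>FS V W\<^esub> s)"
  using N.a_rcos_sum[OF assms] by (simp add: cls_def tensor_def tensor_space_def Let_def)

lemma cls_zero: "\<zero>\<^bsub>V \<boxtimes> W\<^esub> = cls V W \<zero>\<^bsub>FS V W\<^esub>"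
  using N.a_subset by (simp add: cls_def tensor_def tensor_space_def Let_def)

text \<open>Scalar multiplication on cosets is defined as a union over all members. Members of one
  coset differ by kernel elements, and so do their multiples, so all members contribute the same
  coset and the union collapses.\<close>

lemma cls_smult:
  assumes c: "c \<in> carrier K" and r: "r \<in> carrier (FS V W)"
  shows "c \<odot>\<^bsub>V \<boxtimes> W\<^esub> cls V W r = cls V W (c \<odot>\<^bsub>FS V W\<^esub> r)"
proof -
  have *: "cls V W (c \<odot>\<^bsub>FS V W\<^esub> s) = cls V W (c \<odot>\<^bsub>FS V W\<^esub> r)" if s: "s \<in> cls V W r" for s
  proof -
    have s': "s \<in> TK V W +>\<^bsub>FS V W\<^esub> r" using s by (simp only: cls_def)
    have sF: "s \<in> carrier (FS V W)"
      by (rule N.a_elemrcos_carrier[OF r s'])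
    have "c \<odot>\<^bsub>FS V W\<^esub> (s \<oplus>\<^bsub>FS V W\<^esub> \<ominus>\<^bsub>FS V W\<^esub> r) \<in> TK V W"
      by (rule F.submoduleE(4)[OF TK_sub(1)[OF V W] c N.a_rcos_module_imp[OF r s']])
    also have "c \<odot>\<^bsub>FS V W\<^esub> (s \<oplus>\<^bsub>FS V W\<^esub> \<ominus>\<^bsub>FS V W\<^esub> r) = c \<odot>\<^bsub>FS V W\<^esub> s \<ominus>\<^bsub>FS V W\<^esub> c \<odot>\<^bsub>FS V W\<^esub> r"
      using c r sF by (simp only: a_minus_def F.smult_r_distr F.smult_r_minus F.M.a_inv_closed)
    finally show ?thesis
      using cls_eq[OF F.smult_closed[OF c sF] F.smult_closed[OF c r]] by blast
  qed
  have "(\<Union>s\<in>cls V W r. cls V W (c \<odot>\<^bsub>FS V W\<^esub> s)) = cls V W (c \<odot>\<^bsub>FS V W\<^esub> r)"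
    using N.a_rcos_self[OF r, folded cls_def] * by (intro UN_constant_eq[of r] ballI) assumption+
  then show ?thesis
    by (simp only: cls_def tensor_def tensor_space_def Let_def module.simps ring.simps monoid.simps)
qed

lemma tens_vs: "vs (V \<boxtimes> W)"
proof (rule moduleI)
  show "abelian_group (V \<boxtimes> W)"
  proof (rule abelian_groupI)
    fix x y z assume "x \<in> carrier (V \<boxtimes> W)" "y \<in> carrier (V \<boxtimes> W)" "z \<in> carrier (V \<boxtimes> W)"
    then show "x \<oplus>\<^bsub>V \<boxtimes> W\<^esub> y \<oplus>\<^bsub>V \<boxtimes> W\<^esub> z = x \<oplus>\<^bsub>V \<boxtimes> W\<^esub> (y \<oplus>\<^bsub>V \<boxtimes> W\<^esub> z)"
      by (elim clsE) (simp add: cls_add F.M.a_assoc)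
  next
    fix x y assume "x \<in> carrier (V \<boxtimes> W)" "y \<in> carrier (V \<boxtimes> W)"
    then show "x \<oplus>\<^bsub>V \<boxtimes> W\<^esub> y \<in> carrier (V \<boxtimes> W)" "x \<oplus>\<^bsub>V \<boxtimes> W\<^esub> y = y \<oplus>\<^bsub>V \<boxtimes> W\<^esub> x"
      by (elim clsE; simp add: cls_add cls_closed F.M.a_comm)+
  next
    fix x assume x: "x \<in> carrier (V \<boxtimes> W)"
    then show "\<zero>\<^bsub>V \<boxtimes> W\<^esub> \<oplus>\<^bsub>V \<boxtimes> W\<^esub> x = x"
      by (elim clsE) (simp add: cls_add cls_zero)
    from x obtain r where r: "r \<in> carrier (FS V W)" "x = cls V W r" by (rule clsE)
    then show "\<exists>y\<in>carrier (V \<boxtimes> W). y \<oplus>\<^bsub>V \<boxtimes> W\<^esub> x = \<zero>\<^bsub>V \<boxtimes> W\<^esub>"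
      by (intro bexI[of _ "cls V W (\<ominus>\<^bsub>FS V W\<^esub> r)"]) (simp_all add: cls_add cls_zero cls_closed F.M.l_neg)
  qed (simp add: cls_zero cls_closed)
next
  fix a b x y assume *: "a \<in> carrier K" "b \<in> carrier K" "x \<in> carrier (V \<boxtimes> W)" "y \<in> carrier (V \<boxtimes> W)"
  then show "a \<odot>\<^bsub>V \<boxtimes> W\<^esub> (x \<oplus>\<^bsub>V \<boxtimes> W\<^esub> y) = a \<odot>\<^bsub>V \<boxtimes> W\<^esub> x \<oplus>\<^bsub>V \<boxtimes> W\<^esub> a \<odot>\<^bsub>V \<boxtimes> W\<^esub> y"
    by (elim clsE) (simp add: cls_add cls_smult F.smult_r_distr)
qed (use K in \<open>auto elim!: clsE simp: cls_add cls_smult cls_closed F.smult_l_distr F.smult_assoc1\<close>)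

lemma pure_cls: "pure K V W v w = cls V W (single K (v, w))"
  by (simp add: pure_def cls_def)

lemma pure_closed: "v \<in> carrier V \<Longrightarrow> w \<in> carrier W \<Longrightarrow> pure K V W v w \<in> carrier (V \<boxtimes> W)"
  unfolding pure_cls by (rule cls_closed) (simp add: single_closed)

lemma pure_bil: "bil V W (V \<boxtimes> W) (pure K V W)"
proof -
  have s: "v \<in> carrier V \<Longrightarrow> w \<in> carrier W \<Longrightarrow> single K (v, w) \<in> carrier (FS V W)" for v w
    by (simp add: single_closed)
  note R = TK_sub(2)[OF V W, THEN subsetD]
  show ?thesis
    unfolding bilinear_map_def
  proof (intro conjI ballI)
    fix u u' v assume "u \<in> carrier V" "u' \<in> carrier V" "v \<in> carrier W"
    then show "pure K V W (u \<oplus>\<^bsub>V\<^esub> u') v = pure K V W u v \<oplus>\<^bsub>V \<boxtimes> W\<^esub> pure K V W u' v"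
      by (simp add: pure_cls cls_add s cls_eq) (rule R, unfold bilinear_rels_def Let_def, blast)
  next
    fix u v v' assume "u \<in> carrier V" "v \<in> carrier W" "v' \<in> carrier W"
    then show "pure K V W u (v \<oplus>\<^bsub>W\<^esub> v') = pure K V W u v \<oplus>\<^bsub>V \<boxtimes> W\<^esub> pure K V W u v'"
      by (simp add: pure_cls cls_add s cls_eq) (rule R, unfold bilinear_rels_def Let_def, blast)
  next
    fix c u v assume "c \<in> carrier K" "u \<in> carrier V" "v \<in> carrier W"
    then show "pure K V W (c \<odot>\<^bsub>V\<^esub> u) v = c \<odot>\<^bsub>V \<boxtimes> W\<^esub> pure K V W u v"
      by (simp add: pure_cls cls_smult s cls_eq) (rule R, unfold bilinear_rels_def Let_def, blast)
  next
    fix c u v assume "c \<in> carrier K" "u \<in> carrier V" "v \<in> carrier W"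
    then show "pure K V W u (c \<odot>\<^bsub>W\<^esub> v) = c \<odot>\<^bsub>V \<boxtimes> W\<^esub> pure K V W u v"
      by (simp add: pure_cls cls_smult s cls_eq) (rule R, unfold bilinear_rels_def Let_def, blast)
  qed (rule pure_closed)
qed

text \<open>Coefficients are absorbed into the first factor, c(v \<otimes> w) = cv \<otimes> w, and
  zero is 0 \<otimes> 0; hence pure tensors and sums are the only cases.\<close>

lemma tens_induct [consumes 1, case_names pure add]:
  assumes t: "t \<in> carrier (V \<boxtimes> W)"
    and pure: "\<And>v w. v \<in> carrier V \<Longrightarrow> w \<in> carrier W \<Longrightarrow> P (pure K V W v w)"
    and add: "\<And>s t. s \<in> carrier (V \<boxtimes> W) \<Longrightarrow> t \<in> carrier (V \<boxtimes> W) \<Longrightarrow> P s \<Longrightarrow> P t \<Longrightarrow> P (s \<oplus>\<^bsub>V \<boxtimes> W\<^esub> t)"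
  shows "P t"
proof -
  interpret T: module K "V \<boxtimes> W" by (rule tens_vs)
  obtain r where r: "r \<in> carrier (FS V W)" "t = cls V W r" using t by (rule clsE)
  have "pure K V W \<zero>\<^bsub>V\<^esub> \<zero>\<^bsub>W\<^esub> = \<zero>\<^bsub>V \<boxtimes> W\<^esub>"
    by (rule lin_zero[OF V tens_vs bil_lin1[OF pure_bil]]) simp
  then have zero: "P \<zero>\<^bsub>V \<boxtimes> W\<^esub>" using pure[of "\<zero>\<^bsub>V\<^esub>" "\<zero>\<^bsub>W\<^esub>"] by simp
  from r(1) have "P (cls V W r)"
  proof (induction r rule: free_induct)
    case zero
    then show ?case using \<open>P \<zero>\<^bsub>V \<boxtimes> W\<^esub>\<close> by (simp add: cls_zero)
  next
    case (step c p s)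
    obtain v w where p: "p = (v, w)" by (cases p)
    with step have vw: "v \<in> carrier V" "w \<in> carrier W" by auto
    have "cls V W ((c \<odot>\<^bsub>FS V W\<^esub> single K p) \<oplus>\<^bsub>FS V W\<^esub> s) = pure K V W (c \<odot>\<^bsub>V\<^esub> v) w \<oplus>\<^bsub>V \<boxtimes> W\<^esub> cls V W s"
      using step vw p
      by (simp add: lin_smult[OF bil_lin1[OF pure_bil vw(2)]])
        (simp add: pure_cls cls_smult cls_add single_closed)
    then show ?case
      using step vw by (simp add: add pure cls_closed pure_closed)
  qed
  then show ?thesis using r by simp
qed

text \<open>The combinations that f evaluates to zero form a submodule containing the bilinearity
  relations, hence containing \<open>TK V W\<close>. So the member of the coset picked by
  \<open>SOME\<close> evaluates to the same vector as r.\<close>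

lemma tsum_cls:
  assumes Z: "vs Z" and f: "bil V W Z f" and r: "r \<in> carrier (FS V W)"
  shows "tsum K Z f (cls V W r) = ev Z (\<lambda>p. f (fst p) (snd p)) r"
proof -
  interpret Z: module K Z by (rule Z)
  let ?g = "\<lambda>p. f (fst p) (snd p)"
  have g: "?g \<in> carrier V \<times> carrier W \<rightarrow> carrier Z" using f by (auto simp: bil_closed)
  note evl = ev_lin[OF Z g]
  note evs = ev_single[OF Z g]
  let ?N = "{r \<in> carrier (FS V W). ev Z ?g r = \<zero>\<^bsub>Z\<^esub>}"
  have sub: "submodule ?N K (FS V W)"
    by (rule F.submoduleI)
      (auto simp: lin_zero[OF free_module Z evl] lin_minus[OF free_module Z evl] lin_add[OF evl] lin_smult[OF evl])
  have evm: "ev Z ?g (r \<ominus>\<^bsub>FS V W\<^esub> s) = ev Z ?g r \<ominus>\<^bsub>Z\<^esub> ev Z ?g s"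
    if "r \<in> carrier (FS V W)" "s \<in> carrier (FS V W)" for r s
    using that by (simp add: a_minus_def lin_minus[OF free_module Z evl] lin_add[OF evl])
  have ev0: "ev Z ?g (r \<ominus>\<^bsub>FS V W\<^esub> s) = \<zero>\<^bsub>Z\<^esub>"
    if "r \<in> carrier (FS V W)" "s \<in> carrier (FS V W)" "ev Z ?g r = ev Z ?g s" for r s
    using that evm[of r s] lin_closed[OF evl, of s] by (simp add: Z.M.r_neg a_minus_def)
  have "bilinear_rels K V W \<subseteq> ?N"
    unfolding bilinear_rels_def Let_def using f
    by (auto intro!: ev0 F.M.minus_closed single_closed simp: single_closed lin_add[OF evl] lin_smult[OF evl] evs bilinear_map_def)
  then have "TK V W \<subseteq> ?N" unfolding tensor_kernel_def using sub by blast
  define s where "s = (SOME s. s \<in> cls V W r)"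
  have "s \<in> cls V W r"
    unfolding s_def by (rule someI[of _ r]) (use N.a_rcos_self[OF r] in \<open>simp add: cls_def\<close>)
  then have s: "s \<in> carrier (FS V W)" "s \<ominus>\<^bsub>FS V W\<^esub> r \<in> TK V W"
    using r N.a_elemrcos_carrier[OF r] N.a_rcos_module_imp[OF r] by (auto simp: cls_def a_minus_def)
  then have "ev Z ?g s \<ominus>\<^bsub>Z\<^esub> ev Z ?g r = \<zero>\<^bsub>Z\<^esub>"
    using \<open>TK V W \<subseteq> ?N\<close> evm[OF s(1) r] by auto
  then have "ev Z ?g s = ev Z ?g r"
    using Z.M.minus_equality[of "ev Z ?g s" "\<ominus>\<^bsub>Z\<^esub> ev Z ?g r"] lin_closed[OF evl s(1)] lin_closed[OF evl r]
    by (simp add: a_minus_def)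
  then show ?thesis
    by (simp add: tsum_def s_def[symmetric] Let_def ev_def)
qed

lemma tsum_lin:
  assumes Z: "vs Z" and f: "bil V W Z f"
  shows "lin (V \<boxtimes> W) Z (tsum K Z f)"
proof -
  have g: "(\<lambda>p. f (fst p) (snd p)) \<in> carrier V \<times> carrier W \<rightarrow> carrier Z" using f by (auto simp: bil_closed)
  note evl = ev_lin[OF Z g]
  show ?thesis
    by (rule linI; (elim clsE)?)
      (auto simp: tsum_cls[OF Z f] cls_add cls_smult lin_add[OF evl] lin_smult[OF evl] lin_closed[OF evl] elim!: clsE)
qed

lemma tsum_pure:
  assumes Z: "vs Z" and f: "bil V W Z f" and vw: "v \<in> carrier V" "w \<in> carrier W"
  shows "tsum K Z f (pure K V W v w) = f v w"
proof -
  have g: "(\<lambda>p. f (fst p) (snd p)) \<in> carrier V \<times> carrier W \<rightarrow> carrier Z" using f by (auto simp: bil_closed)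
  show ?thesis
    using vw ev_single[OF Z g, of "(v, w)"] by (simp add: pure_cls tsum_cls[OF Z f] single_closed)
qed

text \<open>The value of \<open>tsum\<close> is a finite sum over a representative that does not depend on \<open>f\<close>.\<close>

definition rep where "rep t = (SOME s. s \<in> t)"

lemma tsum_rep: "tsum K Z f t = ev Z (\<lambda>p. f (fst p) (snd p)) (rep t)"
  by (simp add: tsum_def rep_def ev_def Let_def)

lemma rep_closed:
  assumes t: "t \<in> carrier (V \<boxtimes> W)"
  shows "rep t \<in> carrier (FS V W)"
proof -
  obtain r where r: "r \<in> carrier (FS V W)" "t = cls V W r" using t by (rule clsE)
  have "rep t \<in> t"
    unfolding rep_def by (rule someI[of _ r]) (use N.a_rcos_self[OF r(1)] r(2) in \<open>simp add: cls_def\<close>)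
  then show ?thesis
    using r N.a_elemrcos_carrier[OF r(1)] by (auto simp: cls_def)
qed

lemma tsum_closed:
  assumes Z: "vs Z" and t: "t \<in> carrier (V \<boxtimes> W)"
    and f: "\<And>v w. v \<in> carrier V \<Longrightarrow> w \<in> carrier W \<Longrightarrow> f v w \<in> carrier Z"
  shows "tsum K Z f t \<in> carrier Z"
proof -
  define r where "r = rep t"
  have r: "r \<in> carrier (FS V W)" by (simp add: r_def rep_closed[OF t])
  have tr: "tsum K Z f t = ev Z (\<lambda>p. f (fst p) (snd p)) r" for f
    by (simp add: tsum_rep r_def)
  have g: "(\<lambda>p. f (fst p) (snd p)) \<in> carrier V \<times> carrier W \<rightarrow> carrier Z" using f by auto
  show ?thesis unfolding tr by (rule lin_closed[OF ev_lin[OF Z g] r])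
qed

lemma tsum_cong:
  assumes Z: "vs Z" and t: "t \<in> carrier (V \<boxtimes> W)"
    and f: "\<And>v w. v \<in> carrier V \<Longrightarrow> w \<in> carrier W \<Longrightarrow> f v w = g v w"
    and g: "\<And>v w. v \<in> carrier V \<Longrightarrow> w \<in> carrier W \<Longrightarrow> g v w \<in> carrier Z"
  shows "tsum K Z f t = tsum K Z g t"
proof -
  interpret Z: module K Z by (rule Z)
  define r where "r = rep t"
  have r: "r \<in> carrier (FS V W)" by (simp add: r_def rep_closed[OF t])
  have tr: "tsum K Z f t = ev Z (\<lambda>p. f (fst p) (snd p)) r" for f
    by (simp add: tsum_rep r_def)
  show ?thesis
    unfolding tr ev_def
    by (rule Z.M.finsum_cong') (use free_spaceD[OF r] f g in \<open>auto\<close>)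
qed

text \<open>Once a representative of t is fixed, the sum is an ordinary finite linear combination,
  and a linear map passes through it term by term.\<close>

lemma lin_tsum:
  assumes Y: "vs Y" and Z: "vs Z" and t: "t \<in> carrier (V \<boxtimes> W)" and h: "lin Y Z h"
    and f: "\<And>v w. v \<in> carrier V \<Longrightarrow> w \<in> carrier W \<Longrightarrow> f v w \<in> carrier Y"
  shows "h (tsum K Y f t) = tsum K Z (\<lambda>v w. h (f v w)) t"
proof -
  interpret Y: module K Y by (rule Y)
  interpret Z: module K Z by (rule Z)
  define r where "r = rep t"
  have r: "r \<in> carrier (FS V W)" by (simp add: r_def rep_closed[OF t])
  have tr: "tsum K Z f t = ev Z (\<lambda>p. f (fst p) (snd p)) r" for f
    by (simp add: tsum_rep r_def)
  have "h (ev Y (\<lambda>p. f (fst p) (snd p)) r)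
      = (\<Oplus>\<^bsub>Z\<^esub>p\<in>{p. r p \<noteq> \<zero>\<^bsub>K\<^esub>}. h (r p \<odot>\<^bsub>Y\<^esub> f (fst p) (snd p)))"
    unfolding ev_def by (rule lin_finsum[OF Y Z h]) (use free_spaceD[OF r] f in auto)
  also have "\<dots> = (\<Oplus>\<^bsub>Z\<^esub>p\<in>{p. r p \<noteq> \<zero>\<^bsub>K\<^esub>}. r p \<odot>\<^bsub>Z\<^esub> h (f (fst p) (snd p)))"
    by (rule Z.M.finsum_cong')
      (use free_spaceD[OF r] f h in \<open>auto simp: lin_closed lin_smult\<close>)
  finally show ?thesis by (simp add: tsum_rep r_def ev_def)
qed

text \<open>The representative of t is the same for every x, so linearity in x holds termwise;
  commutativity of \<open>K\<close> moves the scalar past the coefficients.\<close>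

lemma tsum_param_lin:
  assumes Y: "vs Y" and Z: "vs Z" and t: "t \<in> carrier (V \<boxtimes> W)"
    and f: "\<And>v w. v \<in> carrier V \<Longrightarrow> w \<in> carrier W \<Longrightarrow> lin Y Z (\<lambda>x. f x v w)"
  shows "lin Y Z (\<lambda>x. tsum K Z (f x) t)"
proof -
  interpret Y: module K Y by (rule Y)
  interpret Z: module K Z by (rule Z)
  define r where "r = rep t"
  have r: "r \<in> carrier (FS V W)" by (simp add: r_def rep_closed[OF t])
  have tr: "tsum K Z f t = ev Z (\<lambda>p. f (fst p) (snd p)) r" for f
    by (simp add: tsum_rep r_def)
  have rp: "r p \<in> carrier K" "r p \<noteq> \<zero>\<^bsub>K\<^esub> \<Longrightarrow> fst p \<in> carrier V \<and> snd p \<in> carrier W"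
    "finite {p. r p \<noteq> \<zero>\<^bsub>K\<^esub>}" for p
    using free_spaceD(1,3)[OF r, of p] free_spaceD(2)[OF r] by (auto simp: mem_Times_iff)
  have fc: "x \<in> carrier Y \<Longrightarrow> r p \<noteq> \<zero>\<^bsub>K\<^esub> \<Longrightarrow> f x (fst p) (snd p) \<in> carrier Z" for x p
    using rp(2) lin_closed[OF f] by blast
  show ?thesis
  proof (rule linI)
    fix x assume x: "x \<in> carrier Y"
    show "tsum K Z (f x) t \<in> carrier Z"
      by (rule tsum_closed[OF Z t]) (rule lin_closed[OF f _ ], use x in auto)
    fix y assume y: "y \<in> carrier Y"
    show "tsum K Z (f (x \<oplus>\<^bsub>Y\<^esub> y)) t = tsum K Z (f x) t \<oplus>\<^bsub>Z\<^esub> tsum K Z (f y) t"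
    proof -
      have "tsum K Z (f (x \<oplus>\<^bsub>Y\<^esub> y)) t = (\<Oplus>\<^bsub>Z\<^esub>p\<in>{p. r p \<noteq> \<zero>\<^bsub>K\<^esub>}. r p \<odot>\<^bsub>Z\<^esub> f x (fst p) (snd p) \<oplus>\<^bsub>Z\<^esub> r p \<odot>\<^bsub>Z\<^esub> f y (fst p) (snd p))"
        unfolding tr ev_def
        by (rule Z.M.finsum_cong') (use x y rp fc lin_add[OF f] in \<open>auto simp: Z.smult_r_distr\<close>)
      also have "\<dots> = tsum K Z (f x) t \<oplus>\<^bsub>Z\<^esub> tsum K Z (f y) t"
        unfolding tr ev_def
        by (rule Z.M.finsum_addf) (use x y rp fc in auto)
      finally show ?thesis .
    qed
  next
    fix c x assume x: "c \<in> carrier K" "x \<in> carrier Y"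
    have "tsum K Z (f (c \<odot>\<^bsub>Y\<^esub> x)) t = (\<Oplus>\<^bsub>Z\<^esub>p\<in>{p. r p \<noteq> \<zero>\<^bsub>K\<^esub>}. c \<odot>\<^bsub>Z\<^esub> (r p \<odot>\<^bsub>Z\<^esub> f x (fst p) (snd p)))"
      unfolding tr ev_def
    proof (rule Z.M.finsum_cong')
      fix i assume "i \<in> {p. r p \<noteq> \<zero>\<^bsub>K\<^esub>}"
      then have i: "r i \<noteq> \<zero>\<^bsub>K\<^esub>" by simp
      have "r i \<odot>\<^bsub>Z\<^esub> f (c \<odot>\<^bsub>Y\<^esub> x) (fst i) (snd i) = (r i \<otimes>\<^bsub>K\<^esub> c) \<odot>\<^bsub>Z\<^esub> f x (fst i) (snd i)"
        using x rp(1)[of i] rp(2)[OF i] fc[OF x(2) i] lin_smult[OF f] by (simp add: Z.smult_assoc1)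
      also have "\<dots> = c \<odot>\<^bsub>Z\<^esub> (r i \<odot>\<^bsub>Z\<^esub> f x (fst i) (snd i))"
        using x rp(1)[of i] fc[OF x(2) i] by (simp add: Z.smult_assoc1[symmetric] comm_monoid.m_comm[OF cring.axioms(2)[OF K]])
      finally show "r i \<odot>\<^bsub>Z\<^esub> f (c \<odot>\<^bsub>Y\<^esub> x) (fst i) (snd i) = c \<odot>\<^bsub>Z\<^esub> (r i \<odot>\<^bsub>Z\<^esub> f x (fst i) (snd i))" .
    qed (use x rp fc in auto)
    also have "\<dots> = c \<odot>\<^bsub>Z\<^esub> tsum K Z (f x) t"
      unfolding tr ev_def
      by (rule Z.finsum_smult_ldistr[symmetric]) (use x rp fc in auto)
    finally show "tsum K Z (f (c \<odot>\<^bsub>Y\<^esub> x)) t = c \<odot>\<^bsub>Z\<^esub> tsum K Z (f x) t" .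
  qed
qed

lemma tens_ext:
  assumes "lin (V \<boxtimes> W) Z f" "lin (V \<boxtimes> W) Z g" "t \<in> carrier (V \<boxtimes> W)"
    and "\<And>v w. v \<in> carrier V \<Longrightarrow> w \<in> carrier W \<Longrightarrow> f (pure K V W v w) = g (pure K V W v w)"
  shows "f t = g t"
  using assms(3)
  by (induction t rule: tens_induct) (simp_all add: assms(4) lin_add[OF assms(1)] lin_add[OF assms(2)])

end

end

text \<open>These rules follow the syntax of a term in one variable. Repeating
  \<open>(assumption | rule lins | simp)+\<close> thus proves linearity of a map written with nested
  tensor sums, which is the side condition of every reduction to pure tensors.\<close>

named_theorems lins "linearity and closure rules for maps built from tensor sums"

context base
begin

section \<open>Algebras as modules with a bilinear product\<close>

definition nalg :: "('k, 'a, 'c) module_scheme \<Rightarrow> bool" where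
  "nalg A \<longleftrightarrow> vs A \<and> bil A A A (mult A) \<and> \<one>\<^bsub>A\<^esub> \<in> carrier A"

abbreviation aalg :: "('k, 'a, 'c) module_scheme \<Rightarrow> bool" where "aalg \<equiv> assoc_algebra K"

lemma nalg_vs [simp]: "nalg A \<Longrightarrow> vs A"
  and nalg_one [simp]: "nalg A \<Longrightarrow> \<one>\<^bsub>A\<^esub> \<in> carrier A"
  and nalg_bil: "nalg A \<Longrightarrow> bil A A A (mult A)"
  by (simp_all only: nalg_def)

lemma aalg_ring: "aalg A \<Longrightarrow> ring A"
  by (simp only: assoc_algebra_def)

lemma aalg_monoid: "aalg A \<Longrightarrow> monoid A"
  by (rule ring.is_monoid[OF aalg_ring])

lemma aalg_nalg [simp]: "aalg A \<Longrightarrow> nalg A"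
proof -
  assume A: "aalg A"
  show "nalg A"
    using A monoid.one_closed[OF aalg_monoid[OF A]] unfolding assoc_algebra_def nalg_def by blast
qed

lemma mult_closed [simp]: "nalg A \<Longrightarrow> x \<in> carrier A \<Longrightarrow> y \<in> carrier A \<Longrightarrow> x \<otimes>\<^bsub>A\<^esub> y \<in> carrier A"
  by (rule bil_closed[OF nalg_bil])

lemma mult_assoc: "aalg A \<Longrightarrow> x \<in> carrier A \<Longrightarrow> y \<in> carrier A \<Longrightarrow> z \<in> carrier A \<Longrightarrow>
    x \<otimes>\<^bsub>A\<^esub> y \<otimes>\<^bsub>A\<^esub> z = x \<otimes>\<^bsub>A\<^esub> (y \<otimes>\<^bsub>A\<^esub> z)"
  and mult_one [simp]: "aalg A \<Longrightarrow> x \<in> carrier A \<Longrightarrow> x \<otimes>\<^bsub>A\<^esub> \<one>\<^bsub>A\<^esub> = x"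
  and one_mult [simp]: "aalg A \<Longrightarrow> x \<in> carrier A \<Longrightarrow> \<one>\<^bsub>A\<^esub> \<otimes>\<^bsub>A\<^esub> x = x"
  by (simp_all add: monoid.m_assoc[OF aalg_monoid] monoid.r_one[OF aalg_monoid] monoid.l_one[OF aalg_monoid])

lemma smult_closed' [simp]: "vs V \<Longrightarrow> c \<in> carrier K \<Longrightarrow> x \<in> carrier V \<Longrightarrow> c \<odot>\<^bsub>V\<^esub> x \<in> carrier V"
  by (rule module.smult_closed)

lemma add_closed' [simp]: "vs V \<Longrightarrow> x \<in> carrier V \<Longrightarrow> y \<in> carrier V \<Longrightarrow> x \<oplus>\<^bsub>V\<^esub> y \<in> carrier V"
  by (rule abelian_monoid.a_closed[OF abelian_group.axioms(1)[OF vs_ag]])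

declare tens_vs [simp] pure_closed [simp, lins] mult_closed [lins]

lemma lin_id [lins]: "lin V V (\<lambda>x. x)"
  by (rule linI) simp_all

lemma lin_comp: "lin V W g \<Longrightarrow> lin U V f \<Longrightarrow> lin U W (\<lambda>x. g (f x))"
  by (simp add: lin_def)

lemma lin_pure1 [lins]: "vs V \<Longrightarrow> vs W \<Longrightarrow> w \<in> carrier W \<Longrightarrow> lin Y V f \<Longrightarrow> lin Y (V \<boxtimes> W) (\<lambda>x. pure K V W (f x) w)"
  by (rule lin_comp[OF bil_lin1[OF pure_bil]])

lemma lin_pure2 [lins]: "vs V \<Longrightarrow> vs W \<Longrightarrow> v \<in> carrier V \<Longrightarrow> lin Y W f \<Longrightarrow> lin Y (V \<boxtimes> W) (\<lambda>x. pure K V W v (f x))"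
  by (rule lin_comp[OF bil_lin2[OF pure_bil]])

lemma lin_mult1 [lins]: "nalg A \<Longrightarrow> c \<in> carrier A \<Longrightarrow> lin Y A f \<Longrightarrow> lin Y A (\<lambda>x. f x \<otimes>\<^bsub>A\<^esub> c)"
  by (rule lin_comp[OF bil_lin1[OF nalg_bil]])

lemma lin_mult2 [lins]: "nalg A \<Longrightarrow> c \<in> carrier A \<Longrightarrow> lin Y A f \<Longrightarrow> lin Y A (\<lambda>x. c \<otimes>\<^bsub>A\<^esub> f x)"
  by (rule lin_comp[OF bil_lin2[OF nalg_bil]])

lemma lin_smult_intro [lins]: "vs Z \<Longrightarrow> c \<in> carrier K \<Longrightarrow> lin Y Z f \<Longrightarrow> lin Y Z (\<lambda>x. c \<odot>\<^bsub>Z\<^esub> f x)"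
proof (rule linI)
  assume Z: "vs Z" and c: "c \<in> carrier K" and f: "lin Y Z f"
  interpret Z: module K Z by (rule Z)
  note fc = lin_closed[OF f]
  show "x \<in> carrier Y \<Longrightarrow> c \<odot>\<^bsub>Z\<^esub> f x \<in> carrier Z" for x using c fc by simp
  show "x \<in> carrier Y \<Longrightarrow> y \<in> carrier Y \<Longrightarrow> c \<odot>\<^bsub>Z\<^esub> f (x \<oplus>\<^bsub>Y\<^esub> y) = c \<odot>\<^bsub>Z\<^esub> f x \<oplus>\<^bsub>Z\<^esub> c \<odot>\<^bsub>Z\<^esub> f y" for x y
    using c fc by (simp add: lin_add[OF f] Z.smult_r_distr)
  show "a \<in> carrier K \<Longrightarrow> x \<in> carrier Y \<Longrightarrow> c \<odot>\<^bsub>Z\<^esub> f (a \<odot>\<^bsub>Y\<^esub> x) = a \<odot>\<^bsub>Z\<^esub> (c \<odot>\<^bsub>Z\<^esub> f x)" for a x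
    using c fc by (simp add: lin_smult[OF f] Z.smult_assoc1[symmetric] comm_monoid.m_comm[OF cring.axioms(2)[OF K]])
qed

lemma lin_tsum1 [lins]: "lin Y (V \<boxtimes> W) g \<Longrightarrow> vs V \<Longrightarrow> vs W \<Longrightarrow> vs Z \<Longrightarrow> bil V W Z f \<Longrightarrow> lin Y Z (\<lambda>x. tsum K Z f (g x))"
  by (rule lin_comp[OF tsum_lin])

lemma lin_tsum2 [lins]:
  assumes "t \<in> carrier (V \<boxtimes> W)" "vs V" "vs W" "vs Y" "vs Z"
    "\<And>v w. v \<in> carrier V \<Longrightarrow> w \<in> carrier W \<Longrightarrow> lin Y Z (\<lambda>x. f x v w)"
  shows "lin Y Z (\<lambda>x. tsum K Z (f x) t)"
  by (rule tsum_param_lin) (use assms in auto)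

lemma bilI' [lins]:
  assumes "\<And>v. v \<in> carrier V \<Longrightarrow> lin Y Z (\<lambda>y. f v y)"
    "\<And>y. y \<in> carrier Y \<Longrightarrow> lin V Z (\<lambda>v. f v y)"
  shows "bil V Y Z f"
  using assms by (intro bilI)

section \<open>The algebra structure on tensor products\<close>

text \<open>The product of \<open>V \<boxtimes> W\<close> is defined by sums in
  \<open>tensor_space\<close>, before the product field is set. A sum reads only the additive
  structure and the scalars, which agree in both records.\<close>

lemma tsum_space: "tsum K (tensor_space K V W) f t = tsum K (V \<boxtimes> W) f t"
  by (simp add: tsum_def tensor_def finsum_def tensor_space_def Let_def)

lemma tens_mult:
  "s \<otimes>\<^bsub>V \<boxtimes> W\<^esub> t = tsum K (V \<boxtimes> W) (\<lambda>v w. tsum K (V \<boxtimes> W) (\<lambda>v' w'.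
      pure K V W (v \<otimes>\<^bsub>V\<^esub> v') (w \<otimes>\<^bsub>W\<^esub> w')) t) s"
  unfolding tsum_space[symmetric] by (simp add: tensor_def)

lemma tens_one: "\<one>\<^bsub>V \<boxtimes> W\<^esub> = pure K V W \<one>\<^bsub>V\<^esub> \<one>\<^bsub>W\<^esub>"
  by (simp add: tensor_def)

context
  fixes V :: "('k, 'v, 'c) module_scheme" and W :: "('k, 'w, 'd) module_scheme"
  assumes V [simp]: "nalg V" and W [simp]: "nalg W"
begin

lemma tens_mult_bil: "bil (V \<boxtimes> W) (V \<boxtimes> W) (V \<boxtimes> W) (mult (V \<boxtimes> W))"
  unfolding tens_mult[abs_def]
  by (assumption | rule lins | simp)+

lemma tens_mult_pure [simp]:
  "a \<in> carrier V \<Longrightarrow> b \<in> carrier W \<Longrightarrow> c \<in> carrier V \<Longrightarrow> d \<in> carrier W \<Longrightarrow>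
    pure K V W a b \<otimes>\<^bsub>V \<boxtimes> W\<^esub> pure K V W c d = pure K V W (a \<otimes>\<^bsub>V\<^esub> c) (b \<otimes>\<^bsub>W\<^esub> d)"
proof -
  assume a [simp]: "a \<in> carrier V" "b \<in> carrier W" "c \<in> carrier V" "d \<in> carrier W"
  have "pure K V W a b \<otimes>\<^bsub>V \<boxtimes> W\<^esub> pure K V W c d =
    tsum K (V \<boxtimes> W) (\<lambda>v' w'. pure K V W (a \<otimes>\<^bsub>V\<^esub> v') (b \<otimes>\<^bsub>W\<^esub> w')) (pure K V W c d)"
    unfolding tens_mult
    by (rule tsum_pure[where V = V and W = W]) (assumption | rule lins | simp)+
  also have "\<dots> = pure K V W (a \<otimes>\<^bsub>V\<^esub> c) (b \<otimes>\<^bsub>W\<^esub> d)"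
    by (rule tsum_pure[where V = V and W = W]) (assumption | rule lins | simp)+
  finally show ?thesis .
qed

lemma tens_nalg [simp]: "nalg (V \<boxtimes> W)"
  unfolding nalg_def using tens_mult_bil by (simp add: tens_one)

end

text \<open>Both sides of associativity are linear in each of three arguments, so the arguments are
  reduced to pure tensors one after another, where the law holds factor by factor.\<close>

lemma tens_aalg [simp]:
  assumes V [simp]: "aalg V" and W [simp]: "aalg W"
  shows "aalg (V \<boxtimes> W)"
proof -
  have [simp]: "nalg V" "nalg W" "vs V" "vs W" using V W by auto
  let ?T = "V \<boxtimes> W"
  have [simp]: "\<one>\<^bsub>?T\<^esub> \<in> carrier ?T" by (simp add: tens_one)
  note b = tens_mult_bil[of V W, simplified]
  have assoc: "x \<otimes>\<^bsub>?T\<^esub> y \<otimes>\<^bsub>?T\<^esub> z = x \<otimes>\<^bsub>?T\<^esub> (y \<otimes>\<^bsub>?T\<^esub> z)"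
    if x [simp]: "x \<in> carrier ?T" and y [simp]: "y \<in> carrier ?T" and z [simp]: "z \<in> carrier ?T" for x y z
  proof (rule tens_ext[where t = x and V = V and W = W and Z = ?T])
    fix a b assume a [simp]: "a \<in> carrier V" "b \<in> carrier W"
    show "pure K V W a b \<otimes>\<^bsub>?T\<^esub> y \<otimes>\<^bsub>?T\<^esub> z = pure K V W a b \<otimes>\<^bsub>?T\<^esub> (y \<otimes>\<^bsub>?T\<^esub> z)"
    proof (rule tens_ext[where t = y and V = V and W = W and Z = ?T])
      fix c d assume c [simp]: "c \<in> carrier V" "d \<in> carrier W"
      show "pure K V W a b \<otimes>\<^bsub>?T\<^esub> pure K V W c d \<otimes>\<^bsub>?T\<^esub> z = pure K V W a b \<otimes>\<^bsub>?T\<^esub> (pure K V W c d \<otimes>\<^bsub>?T\<^esub> z)"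
        by (rule tens_ext[where t = z and V = V and W = W and Z = ?T])
          (assumption | rule lins | simp add: mult_assoc)+
    qed (assumption | rule lins | simp)+
  qed (assumption | rule lins | simp)+
  have one: "\<one>\<^bsub>?T\<^esub> \<otimes>\<^bsub>?T\<^esub> x = x" "x \<otimes>\<^bsub>?T\<^esub> \<one>\<^bsub>?T\<^esub> = x" if x [simp]: "x \<in> carrier ?T" for x
    by (rule tens_ext[where t = x and V = V and W = W and Z = ?T];
        (assumption | rule lins | simp add: tens_one)+)+
  have "ring ?T"
  proof (rule ringI)
    show "abelian_group ?T" by (rule vs_ag) simp
    show "monoid ?T" by (rule monoidI) (simp_all add: assoc one)
  qed (use b in \<open>auto simp: bilinear_map_def\<close>)
  then show ?thesis unfolding assoc_algebra_def using b by simp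
qed

section \<open>Linear maps on tensor products\<close>

text \<open>This is f \<otimes> g.\<close>

definition tmap where
  "tmap V' W' f g = tsum K (V' \<boxtimes> W') (\<lambda>v w. pure K V' W' (f v) (g w))"

context
  fixes V :: "('k, 'v, 'c) module_scheme" and W :: "('k, 'w, 'd) module_scheme"
    and V' :: "('k, 'v1, 'c1) module_scheme" and W' :: "('k, 'w1, 'd1) module_scheme" and f g
  assumes vs [simp]: "vs V" "vs W" "vs V'" "vs W'" and f: "lin V V' f" and g: "lin W W' g"
begin

lemma lin_tmap: "lin (V \<boxtimes> W) (V' \<boxtimes> W') (tmap V' W' f g)"
  unfolding tmap_def
  by (assumption | rule lins lin_comp[OF f] lin_comp[OF g] lin_closed[OF f] lin_closed[OF g] | simp)+

lemma tmap_pure: "a \<in> carrier V \<Longrightarrow> b \<in> carrier W \<Longrightarrow> tmap V' W' f g (pure K V W a b) = pure K V' W' (f a) (g b)"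
  unfolding tmap_def
  by (subst tsum_pure[where V = V and W = W]) (assumption | rule lins lin_comp[OF f] lin_comp[OF g] lin_closed[OF f] lin_closed[OF g] | simp)+

end

section \<open>Algebra homomorphisms and units\<close>

definition ahom :: "('k, 'v, 'c) module_scheme \<Rightarrow> ('k, 'w, 'd) module_scheme \<Rightarrow> ('v \<Rightarrow> 'w) \<Rightarrow> bool" where
  "ahom A B f \<longleftrightarrow> lin A B f \<and> (\<forall>x\<in>carrier A. \<forall>y\<in>carrier A. f (x \<otimes>\<^bsub>A\<^esub> y) = f x \<otimes>\<^bsub>B\<^esub> f y) \<and> f \<one>\<^bsub>A\<^esub> = \<one>\<^bsub>B\<^esub>"

lemma ahom_lin: "ahom A B f \<Longrightarrow> lin A B f"
  and ahom_mult: "ahom A B f \<Longrightarrow> x \<in> carrier A \<Longrightarrow> y \<in> carrier A \<Longrightarrow> f (x \<otimes>\<^bsub>A\<^esub> y) = f x \<otimes>\<^bsub>B\<^esub> f y"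
  and ahom_one: "ahom A B f \<Longrightarrow> f \<one>\<^bsub>A\<^esub> = \<one>\<^bsub>B\<^esub>"
  and ahom_closed: "ahom A B f \<Longrightarrow> x \<in> carrier A \<Longrightarrow> f x \<in> carrier B"
  by (simp_all add: ahom_def lin_def)

lemma ahom_id: "ahom A A (\<lambda>x. x)"
  by (simp add: ahom_def lin_id)

lemma ahom_comp: "ahom B C g \<Longrightarrow> ahom A B f \<Longrightarrow> ahom A C (\<lambda>x. g (f x))"
  by (auto simp: ahom_def lin_def)

lemma ahom_iff: "f \<in> algebra_hom K A B \<longleftrightarrow> ahom A B f"
  by (auto simp: algebra_hom_def ring_hom_def ahom_def lin_def)

text \<open>F(xy) and F(x)F(y) are linear in x and in y, so multiplicativity on pure tensors
  decides.\<close>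

lemma ahom_tensI:
  assumes V: "nalg V" and W: "nalg W" and Z: "nalg Z" and F: "lin (V \<boxtimes> W) Z F"
    and m: "\<And>a b c d. a \<in> carrier V \<Longrightarrow> b \<in> carrier W \<Longrightarrow> c \<in> carrier V \<Longrightarrow> d \<in> carrier W \<Longrightarrow>
      F (pure K V W (a \<otimes>\<^bsub>V\<^esub> c) (b \<otimes>\<^bsub>W\<^esub> d)) = F (pure K V W a b) \<otimes>\<^bsub>Z\<^esub> F (pure K V W c d)"
    and one: "F (pure K V W \<one>\<^bsub>V\<^esub> \<one>\<^bsub>W\<^esub>) = \<one>\<^bsub>Z\<^esub>"
  shows "ahom (V \<boxtimes> W) Z F"
proof -
  note [simp] = V W Z lin_closed[OF F]
  note [lins] = lin_comp[OF F] F
  have "F (x \<otimes>\<^bsub>V \<boxtimes> W\<^esub> y) = F x \<otimes>\<^bsub>Z\<^esub> F y" if x [simp]: "x \<in> carrier (V \<boxtimes> W)" and y [simp]: "y \<in> carrier (V \<boxtimes> W)" for x y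
  proof (rule tens_ext[where t = x and V = V and W = W and Z = Z])
    fix a b assume a [simp]: "a \<in> carrier V" "b \<in> carrier W"
    show "F (pure K V W a b \<otimes>\<^bsub>V \<boxtimes> W\<^esub> y) = F (pure K V W a b) \<otimes>\<^bsub>Z\<^esub> F y"
      by (rule tens_ext[where t = y and V = V and W = W and Z = Z])
        (assumption | rule lins | simp add: m)+
  qed (assumption | rule lins | simp)+
  then show ?thesis
    by (simp add: ahom_def F one tens_one)
qed

lemma ahom_tmap:
  assumes [simp]: "nalg V" "nalg W" "nalg V'" "nalg W'" and f: "ahom V V' f" and g: "ahom W W' g"
  shows "ahom (V \<boxtimes> W) (V' \<boxtimes> W') (tmap V' W' f g)"
  by (rule ahom_tensI)
    (simp_all add: lin_tmap tmap_pure[where V = V and W = W] ahom_lin[OF f] ahom_lin[OF g]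
      ahom_closed[OF f] ahom_closed[OF g] ahom_mult[OF f] ahom_mult[OF g] ahom_one[OF f] ahom_one[OF g] tens_one)

text \<open>An algebra map sends mutually inverse elements to mutually inverse elements. This
  transports facts about a reassociator to its inverse.\<close>

lemma ahom_Units:
  assumes A: "aalg A" and B: "aalg B" and f: "ahom A B f" and u: "u \<in> Units A"
  shows "f u \<in> Units B" "f (inv\<^bsub>A\<^esub> u) = inv\<^bsub>B\<^esub> (f u)"
proof -
  interpret A: monoid A by (rule aalg_monoid[OF A])
  interpret B: monoid B by (rule aalg_monoid[OF B])
  note c = A.Units_closed[OF u] A.Units_inv_closed[OF u]
  have e: "f u \<otimes>\<^bsub>B\<^esub> f (inv\<^bsub>A\<^esub> u) = \<one>\<^bsub>B\<^esub>" "f (inv\<^bsub>A\<^esub> u) \<otimes>\<^bsub>B\<^esub> f u = \<one>\<^bsub>B\<^esub>"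
    using ahom_mult[OF f c] ahom_mult[OF f c(2,1)] ahom_one[OF f] A.Units_r_inv[OF u] A.Units_l_inv[OF u]
    by metis+
  have d: "f u \<in> carrier B" "f (inv\<^bsub>A\<^esub> u) \<in> carrier B"
    by (rule ahom_closed[OF f c(1)], rule ahom_closed[OF f c(2)])
  show "f u \<in> Units B" using e d unfolding Units_def by blast
  show "f (inv\<^bsub>A\<^esub> u) = inv\<^bsub>B\<^esub> (f u)" by (rule B.inv_unique'[OF d e])
qed

lemma Units_closed' [simp]: "aalg A \<Longrightarrow> u \<in> Units A \<Longrightarrow> u \<in> carrier A"
  by (rule monoid.Units_closed[OF aalg_monoid])

lemma Units_inv_closed' [simp]: "aalg A \<Longrightarrow> u \<in> Units A \<Longrightarrow> inv\<^bsub>A\<^esub> u \<in> carrier A"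
  by (rule monoid.Units_inv_closed[OF aalg_monoid])

lemma Units_r_inv' [simp]: "aalg A \<Longrightarrow> u \<in> Units A \<Longrightarrow> u \<otimes>\<^bsub>A\<^esub> inv\<^bsub>A\<^esub> u = \<one>\<^bsub>A\<^esub>"
  by (rule monoid.Units_r_inv[OF aalg_monoid])

lemma Units_l_inv' [simp]: "aalg A \<Longrightarrow> u \<in> Units A \<Longrightarrow> inv\<^bsub>A\<^esub> u \<otimes>\<^bsub>A\<^esub> u = \<one>\<^bsub>A\<^esub>"
  by (rule monoid.Units_l_inv[OF aalg_monoid])

lemma Units_cancel:
  assumes A: "aalg A" and u: "u \<in> Units A" and x: "x \<in> carrier A"
  shows "u \<otimes>\<^bsub>A\<^esub> (inv\<^bsub>A\<^esub> u \<otimes>\<^bsub>A\<^esub> x) = x" "inv\<^bsub>A\<^esub> u \<otimes>\<^bsub>A\<^esub> (u \<otimes>\<^bsub>A\<^esub> x) = x"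
    "x \<otimes>\<^bsub>A\<^esub> u \<otimes>\<^bsub>A\<^esub> inv\<^bsub>A\<^esub> u = x" "x \<otimes>\<^bsub>A\<^esub> inv\<^bsub>A\<^esub> u \<otimes>\<^bsub>A\<^esub> u = x"
proof -
  note [simp] = A u x
  have "u \<otimes>\<^bsub>A\<^esub> (inv\<^bsub>A\<^esub> u \<otimes>\<^bsub>A\<^esub> x) = (u \<otimes>\<^bsub>A\<^esub> inv\<^bsub>A\<^esub> u) \<otimes>\<^bsub>A\<^esub> x"
    by (rule mult_assoc[symmetric]) simp_all
  then show "u \<otimes>\<^bsub>A\<^esub> (inv\<^bsub>A\<^esub> u \<otimes>\<^bsub>A\<^esub> x) = x" by simp
  have "inv\<^bsub>A\<^esub> u \<otimes>\<^bsub>A\<^esub> (u \<otimes>\<^bsub>A\<^esub> x) = (inv\<^bsub>A\<^esub> u \<otimes>\<^bsub>A\<^esub> u) \<otimes>\<^bsub>A\<^esub> x"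
    by (rule mult_assoc[symmetric]) simp_all
  then show "inv\<^bsub>A\<^esub> u \<otimes>\<^bsub>A\<^esub> (u \<otimes>\<^bsub>A\<^esub> x) = x" by simp
qed (use assms in \<open>simp_all add: mult_assoc\<close>)

section \<open>Rebracketing (X \<otimes> Y) \<otimes> W as X \<otimes> (Y \<otimes> W), and
  splittings of twofold tensors\<close>

definition ap where
  "ap X Y W s w = tsum K (X \<boxtimes> Y \<boxtimes> W) (\<lambda>x y. pure K X (Y \<boxtimes> W) x (pure K Y W y w)) s"

lemma tsum_id:
  assumes [simp]: "vs X" "vs Y" and t: "t \<in> carrier (X \<boxtimes> Y)"
  shows "tsum K (X \<boxtimes> Y) (pure K X Y) t = t"
  using t by (rule tens_ext[where Z = "X \<boxtimes> Y", rotated 4]) (assumption | rule lins | simp add: tsum_pure[OF _ _ _ pure_bil])+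

lemma ap_lin1 [lins]: "vs X \<Longrightarrow> vs Y \<Longrightarrow> vs W \<Longrightarrow> w \<in> carrier W \<Longrightarrow> lin Z (X \<boxtimes> Y) h \<Longrightarrow>
    lin Z (X \<boxtimes> Y \<boxtimes> W) (\<lambda>z. ap X Y W (h z) w)"
  unfolding ap_def by (assumption | rule lins | simp)+

lemma ap_lin2 [lins]: "vs X \<Longrightarrow> vs Y \<Longrightarrow> vs W \<Longrightarrow> vs Z \<Longrightarrow> s \<in> carrier (X \<boxtimes> Y) \<Longrightarrow> lin Z W h \<Longrightarrow>
    lin Z (X \<boxtimes> Y \<boxtimes> W) (\<lambda>z. ap X Y W s (h z))"
  unfolding ap_def by (rule lin_tsum2[where V = X and W = Y]) (assumption | rule lins | simp)+

lemma ap_closed [simp, lins]: "vs X \<Longrightarrow> vs Y \<Longrightarrow> vs W \<Longrightarrow> w \<in> carrier W \<Longrightarrow> s \<in> carrier (X \<boxtimes> Y) \<Longrightarrow>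
    ap X Y W s w \<in> carrier (X \<boxtimes> Y \<boxtimes> W)"
  unfolding ap_def by (rule tsum_closed) auto

lemma ap_pure [simp]: "vs X \<Longrightarrow> vs Y \<Longrightarrow> vs W \<Longrightarrow> w \<in> carrier W \<Longrightarrow> x \<in> carrier X \<Longrightarrow> y \<in> carrier Y \<Longrightarrow>
    ap X Y W (pure K X Y x y) w = pure K X (Y \<boxtimes> W) x (pure K Y W y w)"
  unfolding ap_def by (subst tsum_pure[where V = X and W = Y]) (assumption | rule lins | simp)+

lemma ap_mult:
  assumes [simp]: "nalg X" "nalg Y" "nalg W" and s [simp]: "s \<in> carrier (X \<boxtimes> Y)" and t [simp]: "t \<in> carrier (X \<boxtimes> Y)"
    and [simp]: "w \<in> carrier W" "z \<in> carrier W"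
  shows "ap X Y W s w \<otimes>\<^bsub>X \<boxtimes> Y \<boxtimes> W\<^esub> ap X Y W t z = ap X Y W (s \<otimes>\<^bsub>X \<boxtimes> Y\<^esub> t) (w \<otimes>\<^bsub>W\<^esub> z)"
proof (rule tens_ext[where t = s and V = X and W = Y and Z = "X \<boxtimes> Y \<boxtimes> W"])
  fix a b assume a [simp]: "a \<in> carrier X" "b \<in> carrier Y"
  show "ap X Y W (pure K X Y a b) w \<otimes>\<^bsub>X \<boxtimes> Y \<boxtimes> W\<^esub> ap X Y W t z = ap X Y W (pure K X Y a b \<otimes>\<^bsub>X \<boxtimes> Y\<^esub> t) (w \<otimes>\<^bsub>W\<^esub> z)"
    by (rule tens_ext[where t = t and V = X and W = Y and Z = "X \<boxtimes> Y \<boxtimes> W"]) (assumption | rule lins | simp)+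
qed (assumption | rule lins | simp)+

lemma ap_one [simp]: "vs X \<Longrightarrow> vs Y \<Longrightarrow> vs W \<Longrightarrow> \<one>\<^bsub>X\<^esub> \<in> carrier X \<Longrightarrow> \<one>\<^bsub>Y\<^esub> \<in> carrier Y \<Longrightarrow> \<one>\<^bsub>W\<^esub> \<in> carrier W \<Longrightarrow>
  ap X Y W \<one>\<^bsub>X \<boxtimes> Y\<^esub> \<one>\<^bsub>W\<^esub> = \<one>\<^bsub>X \<boxtimes> Y \<boxtimes> W\<^esub>"
  by (simp add: tens_one)

text \<open>Splitting the first factor breaks the right nesting, and \<open>ap\<close> is the
  repair. In this form multiplicativity of f \<otimes> id follows from that of
  \<open>ap\<close>.\<close>

lemma split_left_ap: "split_left K X Y W f = tsum K (X \<boxtimes> Y \<boxtimes> W) (\<lambda>u w. ap X Y W (f u) w)"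
  by (rule ext) (simp add: split_left_def ap_def pure3_def)

context
  fixes V :: "('k, 'v, 'c) module_scheme" and W :: "('k, 'w, 'd) module_scheme"
    and X :: "('k, 'v1, 'c1) module_scheme" and Y :: "('k, 'w1, 'd1) module_scheme" and f
  assumes vs [simp]: "vs V" "vs W" "vs X" "vs Y" and f: "lin V (X \<boxtimes> Y) f"
begin

lemma lin_split_left: "lin (V \<boxtimes> W) (X \<boxtimes> Y \<boxtimes> W) (split_left K X Y W f)"
  unfolding split_left_ap
  by (assumption | rule lins lin_comp[OF f] lin_closed[OF f] | simp)+

lemma split_left_pure: "v \<in> carrier V \<Longrightarrow> w \<in> carrier W \<Longrightarrow>
    split_left K X Y W f (pure K V W v w) = ap X Y W (f v) w"
  unfolding split_left_ap
  by (subst tsum_pure[where V = V and W = W]) (assumption | rule lins lin_comp[OF f] lin_closed[OF f] | simp)+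

text \<open>Splitting the last factor respects the right nesting, so no rebracketing occurs and the
  map is id \<otimes> f.\<close>

lemma split_right_tmap:
  assumes t [simp]: "t \<in> carrier (W \<boxtimes> V)"
  shows "split_right K W X Y f t = tmap W (X \<boxtimes> Y) (\<lambda>x. x) f t"
  unfolding split_right_def tmap_def pure3_def
proof (rule tsum_cong[where V = W and W = V])
  fix u w assume "u \<in> carrier W" "w \<in> carrier V"
  then show "tsum K (W \<boxtimes> X \<boxtimes> Y) (\<lambda>x y. pure K W (X \<boxtimes> Y) u (pure K X Y x y)) (f w) = pure K W (X \<boxtimes> Y) u (f w)"
    by (subst lin_tsum[where V = X and W = Y and h = "pure K W (X \<boxtimes> Y) u" and Y = "X \<boxtimes> Y", symmetric])
      (assumption | rule lins lin_closed[OF f] | simp add: tsum_id lin_closed[OF f])+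
qed (use t in \<open>auto simp: lin_closed[OF f]\<close>)

end

lemma ahom_split_left:
  assumes [simp]: "nalg V" "nalg W" "nalg X" "nalg Y" and f: "ahom V (X \<boxtimes> Y) f"
  shows "ahom (V \<boxtimes> W) (X \<boxtimes> Y \<boxtimes> W) (split_left K X Y W f)"
  by (rule ahom_tensI)
    (simp_all add: lin_split_left[where V = V] split_left_pure[where V = V and W = W] ahom_lin[OF f]
      ahom_closed[OF f] ahom_mult[OF f] ahom_one[OF f] ap_mult)

end

context base
begin

section \<open>Extensionality of linear maps on pure tensors\<close>

lemma ext2:
  assumes "t \<in> carrier (V \<boxtimes> W)"
    and "\<And>v w. v \<in> carrier V \<Longrightarrow> w \<in> carrier W \<Longrightarrow> f (pure K V W v w) = g (pure K V W v w)"
    and "lin (V \<boxtimes> W) Z f" "lin (V \<boxtimes> W) Z g" and "vs V" "vs W"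
  shows "f t = g t"
  by (rule tens_ext[OF assms(5,6,3,4,1,2)])

lemma ext3:
  assumes t: "t \<in> carrier (U \<boxtimes> V \<boxtimes> W)"
    and e: "\<And>u v w. u \<in> carrier U \<Longrightarrow> v \<in> carrier V \<Longrightarrow> w \<in> carrier W \<Longrightarrow>
      f (pure K U (V \<boxtimes> W) u (pure K V W v w)) = g (pure K U (V \<boxtimes> W) u (pure K V W v w))"
    and f: "lin (U \<boxtimes> V \<boxtimes> W) Z f" and g: "lin (U \<boxtimes> V \<boxtimes> W) Z g" and [simp]: "vs U" "vs V" "vs W"
  shows "f t = g t"
proof (rule ext2[OF t _ f g])
  fix u s assume [simp]: "u \<in> carrier U" "s \<in> carrier (V \<boxtimes> W)"
  show "f (pure K U (V \<boxtimes> W) u s) = g (pure K U (V \<boxtimes> W) u s)"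
    by (rule ext2[where t = s and V = V and W = W and Z = Z])
      (assumption | rule lins lin_comp[OF f] lin_comp[OF g] e | simp)+
qed simp_all

lemma ext4:
  assumes t: "t \<in> carrier (U \<boxtimes> V \<boxtimes> W \<boxtimes> X)"
    and e: "\<And>u v w x. u \<in> carrier U \<Longrightarrow> v \<in> carrier V \<Longrightarrow> w \<in> carrier W \<Longrightarrow> x \<in> carrier X \<Longrightarrow>
      f (pure K U (V \<boxtimes> W \<boxtimes> X) u (pure K V (W \<boxtimes> X) v (pure K W X w x))) =
      g (pure K U (V \<boxtimes> W \<boxtimes> X) u (pure K V (W \<boxtimes> X) v (pure K W X w x)))"
    and f: "lin (U \<boxtimes> V \<boxtimes> W \<boxtimes> X) Z f" and g: "lin (U \<boxtimes> V \<boxtimes> W \<boxtimes> X) Z g"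
    and [simp]: "vs U" "vs V" "vs W" "vs X"
  shows "f t = g t"
proof (rule ext2[OF t _ f g])
  fix u s assume [simp]: "u \<in> carrier U" "s \<in> carrier (V \<boxtimes> W \<boxtimes> X)"
  show "f (pure K U (V \<boxtimes> W \<boxtimes> X) u s) = g (pure K U (V \<boxtimes> W \<boxtimes> X) u s)"
    by (rule ext3[where t = s and U = V and V = W and W = X and Z = Z])
      (assumption | rule lins lin_comp[OF f] lin_comp[OF g] e | simp)+
qed simp_all

lemma lin_tmap' [lins]:
  assumes "lin Y (V \<boxtimes> W) h" "lin V V' f" "lin W W' g" "vs V" "vs W" "vs V'" "vs W'"
  shows "lin Y (V' \<boxtimes> W') (\<lambda>x. tmap V' W' f g (h x))"
  by (rule lin_comp[OF lin_tmap assms(1)]) (use assms in simp_all)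

lemma tmap_closed [lins]:
  assumes "t \<in> carrier (V \<boxtimes> W)" "lin V V' f" "lin W W' g" "vs V" "vs W" "vs V'" "vs W'"
  shows "tmap V' W' f g t \<in> carrier (V' \<boxtimes> W')"
  by (rule lin_closed[OF lin_tmap assms(1)]) (use assms in simp_all)

lemma lin_split_left' [lins]:
  assumes "lin Z (V \<boxtimes> W) h" "lin V (X \<boxtimes> Y) f" "vs V" "vs W" "vs X" "vs Y"
  shows "lin Z (X \<boxtimes> Y \<boxtimes> W) (\<lambda>x. split_left K X Y W f (h x))"
  by (rule lin_comp[OF lin_split_left assms(1)]) (use assms in simp_all)

lemma split_left_closed [lins]:
  assumes "t \<in> carrier (V \<boxtimes> W)" "lin V (X \<boxtimes> Y) f" "vs V" "vs W" "vs X" "vs Y"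
  shows "split_left K X Y W f t \<in> carrier (X \<boxtimes> Y \<boxtimes> W)"
  by (rule lin_closed[OF lin_split_left assms(1)]) (use assms in simp_all)

declare lin_id [simp] lin_tmap [simp] lin_split_left [simp] tmap_pure [simp] split_left_pure [simp]

lemma tsum_closed' [lins]:
  "t \<in> carrier (V \<boxtimes> W) \<Longrightarrow> vs V \<Longrightarrow> vs W \<Longrightarrow> vs Z \<Longrightarrow>
    (\<And>v w. v \<in> carrier V \<Longrightarrow> w \<in> carrier W \<Longrightarrow> f v w \<in> carrier Z) \<Longrightarrow> tsum K Z f t \<in> carrier Z"
  by (rule tsum_closed)

lemma mult_smult [simp]:
  assumes A: "nalg A" and [simp]: "c \<in> carrier K" "x \<in> carrier A" "y \<in> carrier A"
  shows "(c \<odot>\<^bsub>A\<^esub> x) \<otimes>\<^bsub>A\<^esub> y = c \<odot>\<^bsub>A\<^esub> (x \<otimes>\<^bsub>A\<^esub> y)" "x \<otimes>\<^bsub>A\<^esub> (c \<odot>\<^bsub>A\<^esub> y) = c \<odot>\<^bsub>A\<^esub> (x \<otimes>\<^bsub>A\<^esub> y)"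
  using lin_smult[OF bil_lin1[OF nalg_bil[OF A]], of y c x] lin_smult[OF bil_lin2[OF nalg_bil[OF A]], of x c y]
  by simp_all

lemma pure_smult [simp]:
  assumes V: "vs V" and W: "vs W" and [simp]: "c \<in> carrier K" "x \<in> carrier V" "y \<in> carrier W"
  shows "pure K V W (c \<odot>\<^bsub>V\<^esub> x) y = c \<odot>\<^bsub>V \<boxtimes> W\<^esub> pure K V W x y"
    "pure K V W x (c \<odot>\<^bsub>W\<^esub> y) = c \<odot>\<^bsub>V \<boxtimes> W\<^esub> pure K V W x y"
  using lin_smult[OF bil_lin1[OF pure_bil[OF V W]], of y c x] lin_smult[OF bil_lin2[OF pure_bil[OF V W]], of x c y]
  by simp_all

lemma smult_one' [simp]: "vs V \<Longrightarrow> x \<in> carrier V \<Longrightarrow> \<one>\<^bsub>K\<^esub> \<odot>\<^bsub>V\<^esub> x = x"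
  by (rule module.smult_one)

lemma smult_smult: "vs V \<Longrightarrow> x \<in> carrier V \<Longrightarrow> c \<in> carrier K \<Longrightarrow> d \<in> carrier K \<Longrightarrow>
    (c \<otimes>\<^bsub>K\<^esub> d) \<odot>\<^bsub>V\<^esub> x = c \<odot>\<^bsub>V\<^esub> (d \<odot>\<^bsub>V\<^esub> x)"
  by (rule module.smult_assoc1)

section \<open>Multilinear sums\<close>

lemma
  assumes [simp]: "vs U" "vs V" "vs W" "vs Z"
    and 1: "\<And>v w. v \<in> carrier V \<Longrightarrow> w \<in> carrier W \<Longrightarrow> lin U Z (\<lambda>u. f u v w)"
    and 2: "\<And>u w. u \<in> carrier U \<Longrightarrow> w \<in> carrier W \<Longrightarrow> lin V Z (\<lambda>v. f u v w)"
    and 3: "\<And>u v. u \<in> carrier U \<Longrightarrow> v \<in> carrier V \<Longrightarrow> lin W Z (\<lambda>w. f u v w)"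
  shows tsum3_lin: "lin (U \<boxtimes> V \<boxtimes> W) Z (tsum3 K Z f)"
    and tsum3_pure: "u \<in> carrier U \<Longrightarrow> v \<in> carrier V \<Longrightarrow> w \<in> carrier W \<Longrightarrow>
      tsum3 K Z f (pure K U (V \<boxtimes> W) u (pure K V W v w)) = f u v w"
proof -
  have b: "bil U (V \<boxtimes> W) Z (\<lambda>u. tsum K Z (f u))"
    by (assumption | rule lins 1 2 3 | simp)+
  show "lin (U \<boxtimes> V \<boxtimes> W) Z (tsum3 K Z f)"
    unfolding tsum3_def[abs_def] by (assumption | rule lins 1 2 3 b | simp)+
  assume [simp]: "u \<in> carrier U" "v \<in> carrier V" "w \<in> carrier W"
  have "bil V W Z (f u)" by (assumption | rule lins 1 2 3 | simp)+
  then show "tsum3 K Z f (pure K U (V \<boxtimes> W) u (pure K V W v w)) = f u v w"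
    unfolding tsum3_def by (simp add: tsum_pure[OF _ _ _ b] tsum_pure[where V = V and W = W])
qed

lemma
  assumes [simp]: "vs U" "vs V" "vs W" "vs X" "vs Z"
    and 1: "\<And>v w x. v \<in> carrier V \<Longrightarrow> w \<in> carrier W \<Longrightarrow> x \<in> carrier X \<Longrightarrow> lin U Z (\<lambda>u. f u v w x)"
    and 2: "\<And>u w x. u \<in> carrier U \<Longrightarrow> w \<in> carrier W \<Longrightarrow> x \<in> carrier X \<Longrightarrow> lin V Z (\<lambda>v. f u v w x)"
    and 3: "\<And>u v x. u \<in> carrier U \<Longrightarrow> v \<in> carrier V \<Longrightarrow> x \<in> carrier X \<Longrightarrow> lin W Z (\<lambda>w. f u v w x)"
    and 4: "\<And>u v w. u \<in> carrier U \<Longrightarrow> v \<in> carrier V \<Longrightarrow> w \<in> carrier W \<Longrightarrow> lin X Z (\<lambda>x. f u v w x)"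
  shows tsum4_lin: "lin (U \<boxtimes> V \<boxtimes> W \<boxtimes> X) Z (tsum4 K Z f)"
    and tsum4_pure: "u \<in> carrier U \<Longrightarrow> v \<in> carrier V \<Longrightarrow> w \<in> carrier W \<Longrightarrow> x \<in> carrier X \<Longrightarrow>
      tsum4 K Z f (pure K U (V \<boxtimes> W \<boxtimes> X) u (pure K V (W \<boxtimes> X) v (pure K W X w x))) = f u v w x"
proof -
  have l: "lin (V \<boxtimes> W \<boxtimes> X) Z (tsum3 K Z (f u))" if [simp]: "u \<in> carrier U" for u
    by (rule tsum3_lin) (assumption | rule 1 2 3 4 | simp)+
  have b: "bil U (V \<boxtimes> W \<boxtimes> X) Z (\<lambda>u. tsum3 K Z (f u))"
    by (rule bilI, rule l, assumption, unfold tsum3_def) (assumption | rule lins 1 2 3 4 | simp)+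
  show "lin (U \<boxtimes> V \<boxtimes> W \<boxtimes> X) Z (tsum4 K Z f)"
    unfolding tsum4_def[abs_def] by (assumption | rule lins b | simp)+
  assume [simp]: "u \<in> carrier U" "v \<in> carrier V" "w \<in> carrier W" "x \<in> carrier X"
  show "tsum4 K Z f (pure K U (V \<boxtimes> W \<boxtimes> X) u (pure K V (W \<boxtimes> X) v (pure K W X w x))) = f u v w x"
    unfolding tsum4_def by (simp add: tsum_pure[OF _ _ _ b]) (rule tsum3_pure; (assumption | rule 1 2 3 4 | simp)+)
qed

section \<open>Splittings of threefold tensors\<close>

abbreviation rmap where "rmap U V g \<equiv> tmap U V (\<lambda>x. x) g"

text \<open>The tensor t \<otimes> x, renested to the right. Unlike in \<open>append_one\<close> the
  last factor is free, so that products can be formed and arbitrary spectators carried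
  along.\<close>

definition app where
  "app U V W X t x = rmap U (V \<boxtimes> W \<boxtimes> X) (\<lambda>s. ap V W X s x) t"

lemma app_lin1 [lins]: "lin Z (U \<boxtimes> V \<boxtimes> W) h \<Longrightarrow> vs U \<Longrightarrow> vs V \<Longrightarrow> vs W \<Longrightarrow> vs X \<Longrightarrow> x \<in> carrier X \<Longrightarrow>
    lin Z (U \<boxtimes> V \<boxtimes> W \<boxtimes> X) (\<lambda>z. app U V W X (h z) x)"
  unfolding app_def by (assumption | rule lins | simp)+

lemma app_closed [simp, lins]: "vs U \<Longrightarrow> vs V \<Longrightarrow> vs W \<Longrightarrow> vs X \<Longrightarrow> t \<in> carrier (U \<boxtimes> V \<boxtimes> W) \<Longrightarrow> x \<in> carrier X \<Longrightarrow>
    app U V W X t x \<in> carrier (U \<boxtimes> V \<boxtimes> W \<boxtimes> X)"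
  unfolding app_def by (assumption | rule lins | simp)+

lemma app_pure [simp]:
  assumes [simp]: "vs U" "vs V" "vs W" "vs X" "u \<in> carrier U" "s \<in> carrier (V \<boxtimes> W)" "x \<in> carrier X"
  shows "app U V W X (pure K U (V \<boxtimes> W) u s) x = pure K U (V \<boxtimes> W \<boxtimes> X) u (ap V W X s x)"
  unfolding app_def by (rule tmap_pure) (assumption | rule lins | simp)+

lemma app_one [simp]: "nalg U \<Longrightarrow> nalg V \<Longrightarrow> nalg W \<Longrightarrow> nalg X \<Longrightarrow>
    app U V W X \<one>\<^bsub>U \<boxtimes> V \<boxtimes> W\<^esub> \<one>\<^bsub>X\<^esub> = \<one>\<^bsub>U \<boxtimes> V \<boxtimes> W \<boxtimes> X\<^esub>"
  by (simp add: tens_one)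

lemma app_mult:
  assumes [simp]: "nalg U" "nalg V" "nalg W" "nalg X" "s \<in> carrier (U \<boxtimes> V \<boxtimes> W)" "t \<in> carrier (U \<boxtimes> V \<boxtimes> W)"
    "x \<in> carrier X" "y \<in> carrier X"
  shows "app U V W X s x \<otimes>\<^bsub>U \<boxtimes> V \<boxtimes> W \<boxtimes> X\<^esub> app U V W X t y = app U V W X (s \<otimes>\<^bsub>U \<boxtimes> V \<boxtimes> W\<^esub> t) (x \<otimes>\<^bsub>X\<^esub> y)"
proof (rule ext2[where t = s and Z = "U \<boxtimes> V \<boxtimes> W \<boxtimes> X" and V = U and W = "V \<boxtimes> W"])
  fix a b assume [simp]: "a \<in> carrier U" "b \<in> carrier (V \<boxtimes> W)"
  show "app U V W X (pure K U (V \<boxtimes> W) a b) x \<otimes>\<^bsub>U \<boxtimes> V \<boxtimes> W \<boxtimes> X\<^esub> app U V W X t y =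
      app U V W X (pure K U (V \<boxtimes> W) a b \<otimes>\<^bsub>U \<boxtimes> V \<boxtimes> W\<^esub> t) (x \<otimes>\<^bsub>X\<^esub> y)"
    by (rule ext2[where t = t and Z = "U \<boxtimes> V \<boxtimes> W \<boxtimes> X" and V = U and W = "V \<boxtimes> W"])
      (assumption | rule lins | simp add: ap_mult)+
qed (assumption | rule lins | simp)+

lemma append_one_app:
  assumes [simp]: "nalg U" "nalg V" "nalg W" "nalg X" and t: "t \<in> carrier (U \<boxtimes> V \<boxtimes> W)"
  shows "append_one K U V W X t = app U V W X t \<one>\<^bsub>X\<^esub>"
proof -
  have tri: "lin (U \<boxtimes> V \<boxtimes> W) (U \<boxtimes> V \<boxtimes> W \<boxtimes> X) (append_one K U V W X)"
    unfolding append_one_def[abs_def] pure4_def pure3_def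
    by (rule tsum3_lin) (assumption | rule lins | simp)+
  show ?thesis
    by (rule ext3[where t = t and Z = "U \<boxtimes> V \<boxtimes> W \<boxtimes> X", OF t _ tri], unfold append_one_def pure4_def pure3_def,
       subst tsum3_pure[where U = U and V = V and W = W])
      (assumption | rule lins | simp)+
qed

context
  fixes V :: "('k, 'v, 'c) module_scheme" and W :: "('k, 'w, 'd) module_scheme" and U :: "('k, 'u, 'b) module_scheme"
    and X :: "('k, 'v1, 'c1) module_scheme" and Y :: "('k, 'w1, 'd1) module_scheme" and f
  assumes vs [simp]: "vs V" "vs W" "vs X" "vs Y" "vs U" and f [simp]: "lin U (X \<boxtimes> Y) f"
begin

lemma [simp]: "u \<in> carrier U \<Longrightarrow> f u \<in> carrier (X \<boxtimes> Y)"
  by (rule lin_closed[OF f])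

text \<open>Seen from the first factor, the other two form a single factor V \<otimes> W, so this is
  a twofold splitting.\<close>

lemma split1_eq:
  assumes t: "t \<in> carrier (U \<boxtimes> V \<boxtimes> W)"
  shows "split1 K X Y V W f t = split_left K X Y (V \<boxtimes> W) f t"
proof -
  have e: "split1 K X Y V W f = tsum3 K (X \<boxtimes> Y \<boxtimes> V \<boxtimes> W) (\<lambda>u v w. ap X Y (V \<boxtimes> W) (f u) (pure K V W v w))"
    by (rule ext) (simp add: split1_def ap_def pure4_def pure3_def)
  show ?thesis
    unfolding e
    by (rule ext3[where t = t and U = U and V = V and W = W and Z = "X \<boxtimes> Y \<boxtimes> V \<boxtimes> W", OF t], subst tsum3_pure[where U = U and V = V and W = W])
      (assumption | rule lins tsum3_lin lin_comp[OF f] | simp)+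
qed

text \<open>Below the untouched first factor this is a twofold splitting again.\<close>

lemma split2_eq:
  assumes t: "t \<in> carrier (V \<boxtimes> U \<boxtimes> W)"
  shows "split2 K V X Y W f t = rmap V (X \<boxtimes> Y \<boxtimes> W) (split_left K X Y W f) t"
proof -
  have i: "tsum K (V \<boxtimes> X \<boxtimes> Y \<boxtimes> W) (\<lambda>x y. pure K V (X \<boxtimes> Y \<boxtimes> W) v (pure K X (Y \<boxtimes> W) x (pure K Y W y w))) (f u) =
    pure K V (X \<boxtimes> Y \<boxtimes> W) v (ap X Y W (f u) w)"
    if [simp]: "u \<in> carrier U" "v \<in> carrier V" "w \<in> carrier W" for u v w
    unfolding ap_def
    by (rule lin_tsum[symmetric, where h = "pure K V (X \<boxtimes> Y \<boxtimes> W) v" and Y = "X \<boxtimes> Y \<boxtimes> W" and V = X and W = Y]) (assumption | rule lins | simp)+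
  show ?thesis
    unfolding split2_def pure4_def pure3_def
    by (rule ext3[where t = t and U = V and V = U and W = W and Z = "V \<boxtimes> X \<boxtimes> Y \<boxtimes> W", OF t], subst tsum3_pure[where U = V and V = U and W = W])
      (assumption | rule lins tsum3_lin lin_comp[OF f] lin_closed[OF f] | simp add: i)+
qed

lemma split3_eq:
  assumes t: "t \<in> carrier (V \<boxtimes> W \<boxtimes> U)"
  shows "split3 K V W X Y f t = rmap V (W \<boxtimes> X \<boxtimes> Y) (rmap W (X \<boxtimes> Y) f) t"
proof -
  have i: "tsum K (V \<boxtimes> W \<boxtimes> X \<boxtimes> Y) (\<lambda>x y. pure K V (W \<boxtimes> X \<boxtimes> Y) v (pure K W (X \<boxtimes> Y) w (pure K X Y x y))) (f u) =
    pure K V (W \<boxtimes> X \<boxtimes> Y) v (pure K W (X \<boxtimes> Y) w (f u))"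
    if [simp]: "u \<in> carrier U" "v \<in> carrier V" "w \<in> carrier W" for u v w
    by (subst lin_tsum[symmetric, where h = "\<lambda>s. pure K V (W \<boxtimes> X \<boxtimes> Y) v (pure K W (X \<boxtimes> Y) w s)" and Y = "X \<boxtimes> Y" and V = X and W = Y])
      (assumption | rule lins | simp add: tsum_id)+
  show ?thesis
    unfolding split3_def pure4_def pure3_def
    by (rule ext3[where t = t and U = V and V = W and W = U and Z = "V \<boxtimes> W \<boxtimes> X \<boxtimes> Y", OF t], subst tsum3_pure[where U = V and V = W and W = U])
      (assumption | rule lins tsum3_lin lin_comp[OF f] lin_closed[OF f] | simp add: i)+
qed

end

end

locale qhopf = base K for K :: "'k ring" +
  fixes H :: "('k, 'h) quasi_hopf"
  assumes qH: "quasi_hopf_algebra K H"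
begin

section \<open>The quasi-Hopf algebra: counit and reassociator\<close>

abbreviation H2 where "H2 \<equiv> H \<boxtimes> H"
abbreviation H3 where "H3 \<equiv> H \<boxtimes> H2"
abbreviation H4 where "H4 \<equiv> H \<boxtimes> H3"
abbreviation Del where "Del \<equiv> comult H"
abbreviation eps where "eps \<equiv> counit H"
abbreviation Ph where "Ph \<equiv> reassoc H"
abbreviation phi where "phi \<equiv> inv\<^bsub>H3\<^esub> Ph"
abbreviation Sa where "Sa \<equiv> antipode H"
abbreviation al where "al \<equiv> alpha_elem H"
abbreviation be where "be \<equiv> beta_elem H"
abbreviation p2 where "p2 \<equiv> pure K"

lemma qb: "quasi_bialgebra K H"
  using qH by (simp only: quasi_hopf_algebra_def)

lemma H_alg [simp]: "aalg H"
  using qb by (simp only: quasi_bialgebra_def)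

lemma Del_hom [simp]: "ahom H H2 Del"
  using qb by (simp only: quasi_bialgebra_def ahom_iff)

lemma Ph_unit [simp]: "Ph \<in> Units H3"
  using qb by (simp only: quasi_bialgebra_def)

lemma Del_lin [simp]: "lin H H2 Del"
  by (rule ahom_lin) simp

lemma Del_closed [simp, lins]: "h \<in> carrier H \<Longrightarrow> Del h \<in> carrier H2"
  by (rule lin_closed[OF Del_lin])

lemmas [lins] = lin_comp[OF Del_lin]

lemma smult_lcomm: "vs V \<Longrightarrow> x \<in> carrier V \<Longrightarrow> c \<in> carrier K \<Longrightarrow> d \<in> carrier K \<Longrightarrow>
    c \<odot>\<^bsub>V\<^esub> (d \<odot>\<^bsub>V\<^esub> x) = d \<odot>\<^bsub>V\<^esub> (c \<odot>\<^bsub>V\<^esub> x)"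
  by (simp add: smult_smult[symmetric] comm_monoid.m_comm[OF cring.axioms(2)[OF K]])

lemma split_left_Del_closed [simp]: "t \<in> carrier (H \<boxtimes> V) \<Longrightarrow> vs V \<Longrightarrow> split_left K H H V Del t \<in> carrier (H \<boxtimes> H \<boxtimes> V)"
  by (assumption | rule lins | simp)+

lemma rmap_Del_closed [simp]: "t \<in> carrier (V \<boxtimes> H) \<Longrightarrow> vs V \<Longrightarrow> rmap V H2 Del t \<in> carrier (V \<boxtimes> H2)"
  by (assumption | rule lins | simp)+

lemma Ph_closed [simp, lins]: "Ph \<in> carrier H3" "phi \<in> carrier H3"
  by simp_all

lemma eps_hom: "eps \<in> ring_hom H K" "\<And>c h. c \<in> carrier K \<Longrightarrow> h \<in> carrier H \<Longrightarrow> eps (c \<odot>\<^bsub>H\<^esub> h) = c \<otimes>\<^bsub>K\<^esub> eps h"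
  using qb by (simp_all add: quasi_bialgebra_def)

lemma eps_closed [simp]: "h \<in> carrier H \<Longrightarrow> eps h \<in> carrier K"
  and eps_mult [simp]: "g \<in> carrier H \<Longrightarrow> h \<in> carrier H \<Longrightarrow> eps (g \<otimes>\<^bsub>H\<^esub> h) = eps g \<otimes>\<^bsub>K\<^esub> eps h"
  and eps_add: "g \<in> carrier H \<Longrightarrow> h \<in> carrier H \<Longrightarrow> eps (g \<oplus>\<^bsub>H\<^esub> h) = eps g \<oplus>\<^bsub>K\<^esub> eps h"
  and eps_one [simp]: "eps \<one>\<^bsub>H\<^esub> = \<one>\<^bsub>K\<^esub>"
  using eps_hom(1) by (auto simp: ring_hom_def)

text \<open>The target \<open>K\<close> of \<epsilon> is a ring and not a module record, so
  linearity of \<epsilon> is phrased through its action on a fixed vector z.\<close>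

lemma lin_eps [lins]:
  assumes h: "lin Y H h" and Z: "vs Z" and z: "z \<in> carrier Z"
  shows "lin Y Z (\<lambda>x. eps (h x) \<odot>\<^bsub>Z\<^esub> z)"
proof (rule linI)
  interpret Z: module K Z by (rule Z)
  note [simp] = lin_closed[OF h] z
  show "x \<in> carrier Y \<Longrightarrow> eps (h x) \<odot>\<^bsub>Z\<^esub> z \<in> carrier Z" for x by simp
  show "x \<in> carrier Y \<Longrightarrow> y \<in> carrier Y \<Longrightarrow> eps (h (x \<oplus>\<^bsub>Y\<^esub> y)) \<odot>\<^bsub>Z\<^esub> z = eps (h x) \<odot>\<^bsub>Z\<^esub> z \<oplus>\<^bsub>Z\<^esub> eps (h y) \<odot>\<^bsub>Z\<^esub> z" for x y
    by (simp add: lin_add[OF h] eps_add Z.smult_l_distr)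
  show "c \<in> carrier K \<Longrightarrow> x \<in> carrier Y \<Longrightarrow> eps (h (c \<odot>\<^bsub>Y\<^esub> x)) \<odot>\<^bsub>Z\<^esub> z = c \<odot>\<^bsub>Z\<^esub> (eps (h x) \<odot>\<^bsub>Z\<^esub> z)" for c x
    by (simp add: lin_smult[OF h] eps_hom Z.smult_assoc1)
qed

lemma ap_smult [simp]:
  assumes [simp]: "vs X" "vs Y" "vs W" "s \<in> carrier (X \<boxtimes> Y)" "w \<in> carrier W" "c \<in> carrier K"
  shows "ap X Y W (c \<odot>\<^bsub>X \<boxtimes> Y\<^esub> s) w = c \<odot>\<^bsub>X \<boxtimes> Y \<boxtimes> W\<^esub> ap X Y W s w"
    "ap X Y W s (c \<odot>\<^bsub>W\<^esub> w) = c \<odot>\<^bsub>X \<boxtimes> Y \<boxtimes> W\<^esub> ap X Y W s w"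
  by (rule lin_smult, (assumption | rule lins | simp)+)+

text \<open>These are \<epsilon> \<otimes> id and id \<otimes> \<epsilon>, with
  \<open>K \<otimes> V\<close> and \<open>V \<otimes> K\<close> identified with V.\<close>

definition epsl where "epsl V = tsum K V (\<lambda>h v. eps h \<odot>\<^bsub>V\<^esub> v)"
definition epsr where "epsr V = tsum K V (\<lambda>v h. eps h \<odot>\<^bsub>V\<^esub> v)"

lemma epsl_lin [simp]: "vs V \<Longrightarrow> lin (H \<boxtimes> V) V (epsl V)"
  unfolding epsl_def by (assumption | rule lins | simp)+

lemma epsr_lin [simp]: "vs V \<Longrightarrow> lin (V \<boxtimes> H) V (epsr V)"
  unfolding epsr_def by (assumption | rule lins | simp)+

lemma epsl_lin' [lins]: "lin Z (H \<boxtimes> V) h \<Longrightarrow> vs V \<Longrightarrow> lin Z V (\<lambda>z. epsl V (h z))"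
  and epsr_lin' [lins]: "lin Z (V \<boxtimes> H) g \<Longrightarrow> vs V \<Longrightarrow> lin Z V (\<lambda>z. epsr V (g z))"
  using lin_comp[OF epsl_lin] lin_comp[OF epsr_lin] by blast+

lemma epsl_closed [simp, lins]: "t \<in> carrier (H \<boxtimes> V) \<Longrightarrow> vs V \<Longrightarrow> epsl V t \<in> carrier V"
  and epsr_closed [simp, lins]: "s \<in> carrier (V \<boxtimes> H) \<Longrightarrow> vs V \<Longrightarrow> epsr V s \<in> carrier V"
  using lin_closed[OF epsl_lin] lin_closed[OF epsr_lin] by blast+

lemma rmap_epsr_closed [simp]: "t \<in> carrier (U \<boxtimes> V \<boxtimes> H) \<Longrightarrow> vs U \<Longrightarrow> vs V \<Longrightarrow> rmap U V (epsr V) t \<in> carrier (U \<boxtimes> V)"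
  by (assumption | rule lins | simp)+

lemma tmap_smult [simp]:
  assumes [simp]: "vs V" "vs W" "vs V'" "vs W'" and f: "lin V V' f" and g: "lin W W' g"
    and [simp]: "x \<in> carrier V" "y \<in> carrier W" "c \<in> carrier K"
  shows "tmap V' W' f g (c \<odot>\<^bsub>V \<boxtimes> W\<^esub> p2 V W x y) = c \<odot>\<^bsub>V' \<boxtimes> W'\<^esub> p2 V' W' (f x) (g y)"
  using lin_smult[OF lin_tmap[OF _ _ _ _ f g], of c "p2 V W x y"] tmap_pure[OF _ _ _ _ f g] by simp

lemma split_left_one [simp]: "nalg W \<Longrightarrow> split_left K H H W Del \<one>\<^bsub>H \<boxtimes> W\<^esub> = \<one>\<^bsub>H \<boxtimes> H \<boxtimes> W\<^esub>"
  by (rule ahom_one[OF ahom_split_left]) simp_all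

lemma rmap_Del_one [simp]: "nalg W \<Longrightarrow> rmap W H2 Del \<one>\<^bsub>W \<boxtimes> H\<^esub> = \<one>\<^bsub>W \<boxtimes> H2\<^esub>"
  by (rule ahom_one[OF ahom_tmap]) (simp_all add: ahom_id)

lemma epsl_pure [simp]: "vs V \<Longrightarrow> h \<in> carrier H \<Longrightarrow> v \<in> carrier V \<Longrightarrow> epsl V (p2 H V h v) = eps h \<odot>\<^bsub>V\<^esub> v"
  unfolding epsl_def by (rule tsum_pure[where V = H and W = V]) (assumption | rule lins | simp)+

lemma epsr_pure [simp]: "vs V \<Longrightarrow> h \<in> carrier H \<Longrightarrow> v \<in> carrier V \<Longrightarrow> epsr V (p2 V H v h) = eps h \<odot>\<^bsub>V\<^esub> v"
  unfolding epsr_def by (rule tsum_pure[where V = V and W = H]) (assumption | rule lins | simp)+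

lemma epsl_Del [simp]: "h \<in> carrier H \<Longrightarrow> epsl H (Del h) = h"
  and epsr_Del [simp]: "h \<in> carrier H \<Longrightarrow> epsr H (Del h) = h"
  using qb by (simp_all add: quasi_bialgebra_def epsl_def epsr_def)

lemma epsl_hom [simp]: "nalg V \<Longrightarrow> \<one>\<^bsub>V\<^esub> \<otimes>\<^bsub>V\<^esub> \<one>\<^bsub>V\<^esub> = \<one>\<^bsub>V\<^esub> \<Longrightarrow> ahom (H \<boxtimes> V) V (epsl V)"
  by (rule ahom_tensI) (simp_all add: smult_smult smult_lcomm)

lemma epsr_hom [simp]: "nalg V \<Longrightarrow> \<one>\<^bsub>V\<^esub> \<otimes>\<^bsub>V\<^esub> \<one>\<^bsub>V\<^esub> = \<one>\<^bsub>V\<^esub> \<Longrightarrow> ahom (V \<boxtimes> H) V (epsr V)"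
  by (rule ahom_tensI) (simp_all add: smult_smult smult_lcomm)

lemma epsl_split [simp]:
  assumes [simp]: "vs V" and t: "t \<in> carrier (H \<boxtimes> V)"
  shows "epsl (H \<boxtimes> V) (split_left K H H V Del t) = t"
proof -
  have i: "epsl (H \<boxtimes> V) (ap H H V s v) = p2 H V (epsl H s) v" if s: "s \<in> carrier H2" and [simp]: "v \<in> carrier V" for s v
    by (rule ext2[OF s, where Z = "H \<boxtimes> V"]) (assumption | rule lins | simp)+
  show ?thesis
    by (rule ext2[OF t, where Z = "H \<boxtimes> V"]) (assumption | rule lins | simp add: i)+
qed

lemma epsr_ap:
  assumes [simp]: "vs V" "vs X" and s: "s \<in> carrier (X \<boxtimes> H)" and [simp]: "v \<in> carrier V"
  shows "rmap X V (epsl V) (ap X H V s v) = p2 X V (epsr X s) v"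
  by (rule ext2[OF s, where Z = "X \<boxtimes> V"]) (assumption | rule lins | simp)+

text \<open>Translates the normalisation axioms, which are stated as threefold sums, into
  applications of \<epsilon> below a fixed first factor.\<close>

lemma tsum3_mid:
  assumes [simp]: "vs V" "vs U" and t: "t \<in> carrier (U \<boxtimes> H \<boxtimes> V)"
  shows "tsum3 K (U \<boxtimes> V) (\<lambda>x y z. eps y \<odot>\<^bsub>U \<boxtimes> V\<^esub> p2 U V x z) t = rmap U V (epsl V) t"
  by (rule ext3[OF t, where Z = "U \<boxtimes> V"], subst tsum3_pure[where U = U and V = H and W = V])
    (assumption | rule lins tsum3_lin | simp)+

lemma tsum3_last:
  assumes [simp]: "vs V" "vs U" and t: "t \<in> carrier (U \<boxtimes> V \<boxtimes> H)"
  shows "tsum3 K (U \<boxtimes> V) (\<lambda>x y z. eps z \<odot>\<^bsub>U \<boxtimes> V\<^esub> p2 U V x y) t = rmap U V (epsr V) t"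
  by (rule ext3[OF t, where Z = "U \<boxtimes> V"], subst tsum3_pure[where U = U and V = V and W = H])
    (assumption | rule lins tsum3_lin | simp)+

lemma Ph_mid: "rmap H H (epsl H) Ph = \<one>\<^bsub>H2\<^esub>"
proof -
  have "tsum3 K H2 (\<lambda>x y z. eps y \<odot>\<^bsub>H2\<^esub> p2 H H x z) Ph = \<one>\<^bsub>H2\<^esub>"
    using qb by (simp only: quasi_bialgebra_def)
  then show ?thesis by (simp add: tsum3_mid)
qed

text \<open>The first factor is a parameter because the same maps serve the pentagon of H and the
  pentagon of a comodule algebra.\<close>

abbreviation M2 where "M2 U \<equiv> rmap U H3 (split_left K H H H Del)"
abbreviation M3 where "M3 U \<equiv> rmap U H3 (rmap H H2 Del)"

lemma pentagon:
  "p2 H H3 \<one>\<^bsub>H\<^esub> Ph \<otimes>\<^bsub>H4\<^esub> M2 H Ph \<otimes>\<^bsub>H4\<^esub> app H H H H Ph \<one>\<^bsub>H\<^esub> = M3 H Ph \<otimes>\<^bsub>H4\<^esub> split_left K H H H2 Del Ph"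
proof -
  have "p2 H H3 \<one>\<^bsub>H\<^esub> Ph \<otimes>\<^bsub>H4\<^esub> split2 K H H H H Del Ph \<otimes>\<^bsub>H4\<^esub> append_one K H H H H Ph
      = split3 K H H H H Del Ph \<otimes>\<^bsub>H4\<^esub> split1 K H H H H Del Ph"
    using qb by (simp only: quasi_bialgebra_def)
  then show ?thesis
    by (simp add: split1_eq[where U = H] split2_eq[where U = H] split3_eq[where U = H] append_one_app)
qed

text \<open>The other two normalisations of the reassociator come from applying \<open>\<epsilon>\<close> to the second and to
  the third tensor factor of the pentagon identity.\<close>

lemma Ph_left: "epsl H2 Ph = \<one>\<^bsub>H2\<^esub>"
proof -
  let ?e = "rmap H H2 (epsl H2)"
  have h: "ahom H4 H3 ?e" by (rule ahom_tmap) (simp_all add: ahom_id)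
  note m = ahom_mult[OF h] and [lins] = lin_comp[OF ahom_lin[OF h]]
  \<comment> \<open>Under id \<otimes> \<epsilon> \<otimes> id \<otimes> id the four factors treated
    in 2 to 5 become, in this order, \<Phi>, 1, 1 and \<Phi>, the units coming from
    \<open>Ph_mid\<close>. What remains of the pentagon is (1 \<otimes> (\<epsilon> \<otimes> id
    \<otimes> id)(\<Phi>)) \<Phi> = \<Phi>.\<close>
  have 2: "?e (M2 H t) = t" if t: "t \<in> carrier H3" for t
    by (rule ext2[OF t, where Z = H3]) (assumption | rule lins | simp)+
  have 3: "?e (app H H H H t \<one>\<^bsub>H\<^esub>) = ap H H H (rmap H H (epsl H) t) \<one>\<^bsub>H\<^esub>" if t: "t \<in> carrier H3" for t
    by (rule ext3[OF t, where Z = H3]) (assumption | rule lins | simp)+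
  have 4: "?e (M3 H t) = rmap H H2 Del (rmap H H (epsl H) t)" if t: "t \<in> carrier H3" for t
    by (rule ext3[OF t, where Z = H3]) (assumption | rule lins | simp add: lin_smult[OF Del_lin])+
  have 5: "?e (split_left K H H H2 Del t) = t" if t: "t \<in> carrier H3" for t
    by (rule ext2[OF t, where Z = H3]) (assumption | rule lins | simp add: epsr_ap)+
  have c: "M2 H Ph \<in> carrier H4" "M3 H Ph \<in> carrier H4" "split_left K H H H2 Del Ph \<in> carrier H4"
    by (assumption | rule lins | simp)+
  have "?e (p2 H H3 \<one>\<^bsub>H\<^esub> Ph \<otimes>\<^bsub>H4\<^esub> M2 H Ph \<otimes>\<^bsub>H4\<^esub> app H H H H Ph \<one>\<^bsub>H\<^esub>)
      = ?e (M3 H Ph \<otimes>\<^bsub>H4\<^esub> split_left K H H H2 Del Ph)"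
    by (simp only: pentagon)
  then have "p2 H H2 \<one>\<^bsub>H\<^esub> (epsl H2 Ph) \<otimes>\<^bsub>H3\<^esub> Ph = Ph"
    using c by (simp add: m 2 3 4 5 Ph_mid flip: tens_one)
  then have "p2 H H2 \<one>\<^bsub>H\<^esub> (epsl H2 Ph) \<otimes>\<^bsub>H3\<^esub> Ph \<otimes>\<^bsub>H3\<^esub> phi = \<one>\<^bsub>H3\<^esub>"
    by simp
  \<comment> \<open>After cancelling \<Phi>, a second application of \<epsilon> removes the leading
    factor 1.\<close>
  then have "epsl H2 (p2 H H2 \<one>\<^bsub>H\<^esub> (epsl H2 Ph)) = epsl H2 (\<one>\<^bsub>H3\<^esub>)"
    by (simp add: Units_cancel)
  then show ?thesis by (simp add: tens_one[of H H2])
qed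

lemma Ph_right: "rmap H H (epsr H) Ph = \<one>\<^bsub>H2\<^esub>"
proof -
  let ?e = "rmap H H2 (rmap H H (epsl H))"
  have h: "ahom H4 H3 ?e" by (intro ahom_tmap) (simp_all add: ahom_id)
  note m = ahom_mult[OF h] and [lins] = lin_comp[OF ahom_lin[OF h]]
  \<comment> \<open>Under id \<otimes> id \<otimes> \<epsilon> \<otimes> id the factors 1 \<otimes>
    \<Phi> and (\<Delta> \<otimes> id \<otimes> id)(\<Phi>) become trivial by \<open>Ph_mid\<close>,
    two others become \<Phi>, and \<Phi> \<otimes> 1 becomes the unknown element tensored with
    1.\<close>
  have i: "rmap H H (epsl H) (split_left K H H H Del t) = t" if t: "t \<in> carrier H2" for t
    by (rule ext2[OF t, where Z = H2]) (assumption | rule lins | simp add: epsr_ap)+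
  have 2: "?e (M2 H t) = t" if t: "t \<in> carrier H3" for t
    by (rule ext2[OF t, where Z = H3]) (assumption | rule lins | simp add: i)+
  have 3: "?e (app H H H H t \<one>\<^bsub>H\<^esub>) = ap H H H (rmap H H (epsr H) t) \<one>\<^bsub>H\<^esub>" if t: "t \<in> carrier H3" for t
    by (rule ext3[OF t, where Z = H3]) (assumption | rule lins | simp)+
  have 4: "?e (M3 H t) = t" if t: "t \<in> carrier H3" for t
    by (rule ext3[OF t, where Z = H3]) (assumption | rule lins | simp)+
  have j: "?e (ap H H H2 s w) = ap H H H s (epsl H w)" if s: "s \<in> carrier H2" and w [simp]: "w \<in> carrier H2" for s w
    by (rule ext2[OF s, where Z = H3]) (assumption | rule lins | simp)+
  have 5: "?e (split_left K H H H2 Del t) = split_left K H H H Del (rmap H H (epsl H) t)" if t: "t \<in> carrier H3" for t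
    by (rule ext2[OF t, where Z = H3]) (assumption | rule lins | simp add: j)+
  have c: "M2 H Ph \<in> carrier H4" "M3 H Ph \<in> carrier H4" "split_left K H H H2 Del Ph \<in> carrier H4"
    "rmap H H (epsr H) Ph \<in> carrier H2"
    by (assumption | rule lins | simp)+
  have k: "rmap H H (epsr H) (ap H H H s w) = eps w \<odot>\<^bsub>H2\<^esub> s" if s: "s \<in> carrier H2" and w [simp]: "w \<in> carrier H" for s w
    by (rule ext2[OF s, where Z = H2]) (assumption | rule lins | simp)+
  have "?e (p2 H H3 \<one>\<^bsub>H\<^esub> Ph \<otimes>\<^bsub>H4\<^esub> M2 H Ph \<otimes>\<^bsub>H4\<^esub> app H H H H Ph \<one>\<^bsub>H\<^esub>)
      = ?e (M3 H Ph \<otimes>\<^bsub>H4\<^esub> split_left K H H H2 Del Ph)"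
    by (simp only: pentagon)
  then have "Ph \<otimes>\<^bsub>H3\<^esub> ap H H H (rmap H H (epsr H) Ph) \<one>\<^bsub>H\<^esub> = Ph"
    using c by (simp add: m 2 3 4 5 Ph_mid flip: tens_one)
  then have "phi \<otimes>\<^bsub>H3\<^esub> (Ph \<otimes>\<^bsub>H3\<^esub> ap H H H (rmap H H (epsr H) Ph) \<one>\<^bsub>H\<^esub>) = \<one>\<^bsub>H3\<^esub>"
    by simp
  then have "ap H H H (rmap H H (epsr H) Ph) \<one>\<^bsub>H\<^esub> = ap H H H \<one>\<^bsub>H2\<^esub> \<one>\<^bsub>H\<^esub>"
    using c by (simp add: Units_cancel)
  then have "rmap H H (epsr H) (ap H H H (rmap H H (epsr H) Ph) \<one>\<^bsub>H\<^esub>) = rmap H H (epsr H) (ap H H H \<one>\<^bsub>H2\<^esub> \<one>\<^bsub>H\<^esub>)"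
    by simp
  then show ?thesis using c by (simp add: k) (simp add: tens_one)
qed

section \<open>The antipode\<close>

lemma Sa_bij: "bij_betw Sa (carrier H) (carrier H)"
  using qH by (simp only: quasi_hopf_algebra_def)

lemma Sa_closed [simp, lins]: "h \<in> carrier H \<Longrightarrow> Sa h \<in> carrier H"
  by (rule bij_betwE[OF Sa_bij, rule_format])

lemma Sa_lin [simp]: "lin H H Sa"
  by (rule linI) (use qH in \<open>simp_all add: quasi_hopf_algebra_def\<close>)

lemmas [lins] = lin_comp[OF Sa_lin]
lemmas [simp] = lin_smult[OF Sa_lin]

lemma Sa_mult [simp]: "g \<in> carrier H \<Longrightarrow> h \<in> carrier H \<Longrightarrow> Sa (g \<otimes>\<^bsub>H\<^esub> h) = Sa h \<otimes>\<^bsub>H\<^esub> Sa g"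
  and Sa_one [simp]: "Sa \<one>\<^bsub>H\<^esub> = \<one>\<^bsub>H\<^esub>"
  and al_closed [simp, lins]: "al \<in> carrier H"
  and be_closed [simp, lins]: "be \<in> carrier H"
  using qH by (simp_all add: quasi_hopf_algebra_def)

section \<open>Contractions with the antipode\<close>

definition mS where "mS = tsum K H (\<lambda>c d. Sa c \<otimes>\<^bsub>H\<^esub> al \<otimes>\<^bsub>H\<^esub> d)"
definition mb where "mb = tsum K H (\<lambda>c d. c \<otimes>\<^bsub>H\<^esub> be \<otimes>\<^bsub>H\<^esub> Sa d)"

lemma mS_lin [simp]: "lin H2 H mS"
  unfolding mS_def by (assumption | rule lins | simp)+

lemma mb_lin [simp]: "lin H2 H mb"
  unfolding mb_def by (assumption | rule lins | simp)+

lemmas [lins] = lin_comp[OF mS_lin] lin_comp[OF mb_lin]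
lemmas mS_closed [simp, lins] = lin_closed[OF mS_lin]
lemmas mb_closed [simp, lins] = lin_closed[OF mb_lin]
lemmas [simp] = lin_smult[OF mS_lin] lin_smult[OF mb_lin]

lemma mS_pure [simp]: "c \<in> carrier H \<Longrightarrow> d \<in> carrier H \<Longrightarrow> mS (p2 H H c d) = Sa c \<otimes>\<^bsub>H\<^esub> al \<otimes>\<^bsub>H\<^esub> d"
  unfolding mS_def by (rule tsum_pure[where V = H and W = H]) (assumption | rule lins | simp)+

lemma mb_pure [simp]: "c \<in> carrier H \<Longrightarrow> d \<in> carrier H \<Longrightarrow> mb (p2 H H c d) = c \<otimes>\<^bsub>H\<^esub> be \<otimes>\<^bsub>H\<^esub> Sa d"
  unfolding mb_def by (rule tsum_pure[where V = H and W = H]) (assumption | rule lins | simp)+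

lemma mS_Del [simp]: "h \<in> carrier H \<Longrightarrow> mS (Del h) = eps h \<odot>\<^bsub>H\<^esub> al"
  and mb_Del [simp]: "h \<in> carrier H \<Longrightarrow> mb (Del h) = eps h \<odot>\<^bsub>H\<^esub> be"
  using qH by (simp_all add: quasi_hopf_algebra_def mS_def mb_def)

lemma mS_mult:
  assumes t: "t \<in> carrier H2" and [simp]: "c \<in> carrier H" "d \<in> carrier H"
  shows "mS (t \<otimes>\<^bsub>H2\<^esub> p2 H H c d) = Sa c \<otimes>\<^bsub>H\<^esub> mS t \<otimes>\<^bsub>H\<^esub> d"
  by (rule ext2[OF t, where Z = H]) (assumption | rule lins | simp add: mult_assoc)+

lemma mb_mult:
  assumes t: "t \<in> carrier H2" and [simp]: "c \<in> carrier H" "d \<in> carrier H"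
  shows "mb (p2 H H c d \<otimes>\<^bsub>H2\<^esub> t) = c \<otimes>\<^bsub>H\<^esub> mb t \<otimes>\<^bsub>H\<^esub> Sa d"
  by (rule ext2[OF t, where Z = H]) (assumption | rule lins | simp add: mult_assoc)+

text \<open>S reverses products, so S(h1 c) \<alpha> h2 d = S(c) S(h1) \<alpha> h2 d, and the
  antipode axiom applies in the middle. This absorption of a left factor \<Delta>(h) recurs
  throughout.\<close>

lemma mS_Del_mult [simp]:
  assumes t: "t \<in> carrier H2" and [simp]: "h \<in> carrier H"
  shows "mS (Del h \<otimes>\<^bsub>H2\<^esub> t) = eps h \<odot>\<^bsub>H\<^esub> mS t"
  by (rule ext2[OF t, where Z = H]) (assumption | rule lins | simp add: mS_mult)+

text \<open>The mirror image: c h1 \<beta> S(d h2) = c h1 \<beta> S(h2) S(d), so \<beta> absorbs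
  \<Delta>(h) from the right.\<close>

lemma mb_Del_mult [simp]:
  assumes t: "t \<in> carrier H2" and [simp]: "h \<in> carrier H"
  shows "mb (t \<otimes>\<^bsub>H2\<^esub> Del h) = eps h \<odot>\<^bsub>H\<^esub> mb t"
  by (rule ext2[OF t, where Z = H]) (assumption | rule lins | simp add: mb_mult)+

text \<open>The contraction b \<beta> S(c) \<alpha> d, which is 1 on \<Phi> by an antipode axiom; it
  is built from \<open>mS\<close> to inherit absorption on its last two legs.\<close>

definition mm where "mm = tsum K H (\<lambda>b s. b \<otimes>\<^bsub>H\<^esub> be \<otimes>\<^bsub>H\<^esub> mS s)"

lemma mm_lin [simp]: "lin H3 H mm"
  unfolding mm_def by (assumption | rule lins | simp)+

lemmas [lins] = lin_comp[OF mm_lin]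
lemmas mm_closed [simp, lins] = lin_closed[OF mm_lin]

lemma mm_pure [simp]: "b \<in> carrier H \<Longrightarrow> s \<in> carrier H2 \<Longrightarrow> mm (p2 H H2 b s) = b \<otimes>\<^bsub>H\<^esub> be \<otimes>\<^bsub>H\<^esub> mS s"
  unfolding mm_def by (rule tsum_pure[where V = H and W = H2]) (assumption | rule lins | simp)+

lemma mm_Ph [simp]: "mm Ph = \<one>\<^bsub>H\<^esub>"
proof -
  have "tsum3 K H (\<lambda>x y z. x \<otimes>\<^bsub>H\<^esub> be \<otimes>\<^bsub>H\<^esub> Sa y \<otimes>\<^bsub>H\<^esub> al \<otimes>\<^bsub>H\<^esub> z) t = mm t" if t: "t \<in> carrier H3" for t
    by (rule ext3[OF t, where Z = H], subst tsum3_pure[where U = H and V = H and W = H])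
      (assumption | rule lins tsum3_lin | simp add: mult_assoc)+
  then show ?thesis using qH by (simp add: quasi_hopf_algebra_def)
qed

text \<open>The counterpart S(b) \<alpha> c \<beta> S(d), which is 1 on the inverse of
  \<Phi>.\<close>

definition mm' where "mm' = tsum K H (\<lambda>b s. Sa b \<otimes>\<^bsub>H\<^esub> al \<otimes>\<^bsub>H\<^esub> mb s)"

lemma mm'_lin [simp]: "lin H3 H mm'"
  unfolding mm'_def by (assumption | rule lins | simp)+

lemmas [lins] = lin_comp[OF mm'_lin]
lemmas mm'_closed [simp, lins] = lin_closed[OF mm'_lin]

lemma mm'_pure [simp]: "b \<in> carrier H \<Longrightarrow> s \<in> carrier H2 \<Longrightarrow> mm' (p2 H H2 b s) = Sa b \<otimes>\<^bsub>H\<^esub> al \<otimes>\<^bsub>H\<^esub> mb s"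
  unfolding mm'_def by (rule tsum_pure[where V = H and W = H2]) (assumption | rule lins | simp)+

lemma mm'_phi [simp]: "mm' phi = \<one>\<^bsub>H\<^esub>"
proof -
  have "tsum3 K H (\<lambda>x y z. Sa x \<otimes>\<^bsub>H\<^esub> al \<otimes>\<^bsub>H\<^esub> y \<otimes>\<^bsub>H\<^esub> be \<otimes>\<^bsub>H\<^esub> Sa z) t = mm' t" if t: "t \<in> carrier H3" for t
    by (rule ext3[OF t, where Z = H], subst tsum3_pure[where U = H and V = H and W = H])
      (assumption | rule lins tsum3_lin | simp add: mult_assoc)+
  then show ?thesis using qH by (simp add: quasi_hopf_algebra_def)
qed

text \<open>The flip followed by S \<otimes> S, an antihomomorphism; on \<Delta>(h) it is the term
  (S \<otimes> S)(\<Delta>^cop(h)) of the twist.\<close>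

definition F0 where "F0 = tsum K H2 (\<lambda>a b. p2 H H (Sa b) (Sa a))"

lemma F0_lin [simp]: "lin H2 H2 F0"
  unfolding F0_def by (assumption | rule lins | simp)+

lemmas [lins] = lin_comp[OF F0_lin]
lemmas F0_closed [simp, lins] = lin_closed[OF F0_lin]

lemma F0_pure [simp]: "a \<in> carrier H \<Longrightarrow> b \<in> carrier H \<Longrightarrow> F0 (p2 H H a b) = p2 H H (Sa b) (Sa a)"
  unfolding F0_def by (rule tsum_pure[where V = H and W = H]) (assumption | rule lins | simp)+

lemma F0_mult:
  assumes s: "s \<in> carrier H2" and t [simp]: "t \<in> carrier H2"
  shows "F0 (s \<otimes>\<^bsub>H2\<^esub> t) = F0 t \<otimes>\<^bsub>H2\<^esub> F0 s"
proof (rule ext2[OF s, where Z = H2])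
  fix a b assume [simp]: "a \<in> carrier H" "b \<in> carrier H"
  show "F0 (p2 H H a b \<otimes>\<^bsub>H2\<^esub> t) = F0 t \<otimes>\<^bsub>H2\<^esub> F0 (p2 H H a b)"
    by (rule ext2[OF t, where Z = H2]) (assumption | rule lins | simp)+
qed (assumption | rule lins | simp)+

lemma F0_one [simp]: "F0 \<one>\<^bsub>H2\<^esub> = \<one>\<^bsub>H2\<^esub>"
  by (simp add: tens_one)

section \<open>The Drinfeld twist\<close>

text \<open>The formula for \<gamma> with the fourfold tensor A left free, so that multiplying A
  from either side can be studied.\<close>

definition Gam where
  "Gam = tsum4 K H2 (\<lambda>a b c d. p2 H H (Sa b \<otimes>\<^bsub>H\<^esub> al \<otimes>\<^bsub>H\<^esub> c) (Sa a \<otimes>\<^bsub>H\<^esub> al \<otimes>\<^bsub>H\<^esub> d))"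

lemma Gam_lin [simp]: "lin H4 H2 Gam"
  unfolding Gam_def by (rule tsum4_lin) (assumption | rule lins | simp)+

lemmas [lins] = lin_comp[OF Gam_lin]
lemmas Gam_closed [simp, lins] = lin_closed[OF Gam_lin]

lemma Gam_pure [simp]:
  assumes [simp]: "a \<in> carrier H" "b \<in> carrier H" "c \<in> carrier H" "d \<in> carrier H"
  shows "Gam (p2 H H3 a (p2 H H2 b (p2 H H c d))) = p2 H H (Sa b \<otimes>\<^bsub>H\<^esub> al \<otimes>\<^bsub>H\<^esub> c) (Sa a \<otimes>\<^bsub>H\<^esub> al \<otimes>\<^bsub>H\<^esub> d)"
  unfolding Gam_def
  by (rule tsum4_pure[where U = H and V = H and W = H and X = H]) (assumption | rule lins | simp)+

abbreviation L3 where "L3 \<equiv> split_left K H H H Del"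
abbreviation L4 where "L4 \<equiv> split_left K H H H2 Del"
abbreviation R3 where "R3 \<equiv> rmap H H2 Del"
abbreviation ap3 where "ap3 \<equiv> ap H H H"
abbreviation ap4 where "ap4 \<equiv> ap H H H2"
abbreviation app1 where "app1 t \<equiv> app H H H H t \<one>\<^bsub>H\<^esub>"

lemma L3_hom [simp]: "ahom H2 H3 L3" and L4_hom [simp]: "ahom H3 H4 L4"
  by (rule ahom_split_left; simp)+

text \<open>Right factors of A leave the contraction outwards: those of the first two legs under S,
  hence flipped and on the left, those of the last two legs directly on the right.\<close>

lemma Gam_ap4:
  assumes t: "t \<in> carrier H4" and p: "p \<in> carrier H2" and q: "q \<in> carrier H2"
  shows "Gam (t \<otimes>\<^bsub>H4\<^esub> ap4 p q) = F0 p \<otimes>\<^bsub>H2\<^esub> Gam t \<otimes>\<^bsub>H2\<^esub> q"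
proof (rule ext4[OF t, where Z = H2])
  note [simp] = t p q
  fix a b c d assume [simp]: "a \<in> carrier H" "b \<in> carrier H" "c \<in> carrier H" "d \<in> carrier H"
  let ?t = "p2 H H3 a (p2 H H2 b (p2 H H c d))"
  show "Gam (?t \<otimes>\<^bsub>H4\<^esub> ap4 p q) = F0 p \<otimes>\<^bsub>H2\<^esub> Gam ?t \<otimes>\<^bsub>H2\<^esub> q"
  proof (rule ext2[OF p, where Z = H2])
    fix x y assume [simp]: "x \<in> carrier H" "y \<in> carrier H"
    show "Gam (?t \<otimes>\<^bsub>H4\<^esub> ap4 (p2 H H x y) q) = F0 (p2 H H x y) \<otimes>\<^bsub>H2\<^esub> Gam ?t \<otimes>\<^bsub>H2\<^esub> q"
      by (rule ext2[OF q, where Z = H2]) (assumption | rule lins | simp add: mult_assoc)+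
  qed (assumption | rule lins p q | simp)+
qed (assumption | rule lins p q | simp add: p q)+

lemma coassoc: "h \<in> carrier H \<Longrightarrow> R3 (Del h) \<otimes>\<^bsub>H3\<^esub> Ph = Ph \<otimes>\<^bsub>H3\<^esub> L3 (Del h)"
proof -
  assume [simp]: "h \<in> carrier H"
  have "split_right K H H H Del (Del h) = Ph \<otimes>\<^bsub>H3\<^esub> L3 (Del h) \<otimes>\<^bsub>H3\<^esub> phi"
    using qb by (simp add: quasi_bialgebra_def)
  then have "R3 (Del h) = Ph \<otimes>\<^bsub>H3\<^esub> L3 (Del h) \<otimes>\<^bsub>H3\<^esub> phi"
    by (simp add: split_right_tmap[where V = H])
  then show ?thesis by (simp add: Units_cancel)
qed

lemma coassoc': "h \<in> carrier H \<Longrightarrow> phi \<otimes>\<^bsub>H3\<^esub> R3 (Del h) = L3 (Del h) \<otimes>\<^bsub>H3\<^esub> phi"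
proof -
  assume [simp]: "h \<in> carrier H"
  have "phi \<otimes>\<^bsub>H3\<^esub> (R3 (Del h) \<otimes>\<^bsub>H3\<^esub> Ph) \<otimes>\<^bsub>H3\<^esub> phi = phi \<otimes>\<^bsub>H3\<^esub> (Ph \<otimes>\<^bsub>H3\<^esub> L3 (Del h)) \<otimes>\<^bsub>H3\<^esub> phi"
    by (simp add: coassoc)
  moreover have "phi \<otimes>\<^bsub>H3\<^esub> (R3 (Del h) \<otimes>\<^bsub>H3\<^esub> Ph) \<otimes>\<^bsub>H3\<^esub> phi = phi \<otimes>\<^bsub>H3\<^esub> R3 (Del h)"
    by (simp add: mult_assoc)
  ultimately show ?thesis by (simp add: Units_cancel)
qed

definition gam where "gam = Gam (app1 Ph \<otimes>\<^bsub>H4\<^esub> L4 phi)"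

lemma gam_closed [simp, lins]: "gam \<in> carrier H2"
  unfolding gam_def by (assumption | rule lins | simp)+

lemma drinfeld_gamma_eq: "drinfeld_gamma K H = gam"
  by (simp add: drinfeld_gamma_def gam_def Gam_def append_one_app split1_eq[where U = H])

text \<open>The middle legs are multiplied by \<Delta> of the second leg of p. The inner contraction
  S(A2) \<alpha> A3 reduces it to the counit, and only the outer contraction S(A1) \<alpha> A4 still
  sees p and v.\<close>

lemma Gam_M2_ap:
  assumes p: "p \<in> carrier H2" and [simp]: "v \<in> carrier H" "a \<in> carrier H" "b \<in> carrier H" "c \<in> carrier H" "d \<in> carrier H"
  shows "Gam (M2 H (ap3 p v) \<otimes>\<^bsub>H4\<^esub> p2 H H3 a (p2 H H2 b (p2 H H c d))) =
    p2 H H (Sa b \<otimes>\<^bsub>H\<^esub> al \<otimes>\<^bsub>H\<^esub> c) (Sa a \<otimes>\<^bsub>H\<^esub> mS (p2 H H (epsr H p) v) \<otimes>\<^bsub>H\<^esub> d)"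
proof (rule ext2[OF p, where Z = H2])
  fix x y assume [simp]: "x \<in> carrier H" "y \<in> carrier H"
  have i: "Gam (p2 H H3 x (ap3 r v) \<otimes>\<^bsub>H4\<^esub> p2 H H3 a (p2 H H2 b (p2 H H c d))) =
      p2 H H (Sa b \<otimes>\<^bsub>H\<^esub> mS r \<otimes>\<^bsub>H\<^esub> c) (Sa a \<otimes>\<^bsub>H\<^esub> mS (p2 H H x v) \<otimes>\<^bsub>H\<^esub> d)" if r: "r \<in> carrier H2" for r
    by (rule ext2[OF r, where Z = H2]) (assumption | rule lins | simp add: mult_assoc)+
  show "Gam (M2 H (ap3 (p2 H H x y) v) \<otimes>\<^bsub>H4\<^esub> p2 H H3 a (p2 H H2 b (p2 H H c d))) =
    p2 H H (Sa b \<otimes>\<^bsub>H\<^esub> al \<otimes>\<^bsub>H\<^esub> c) (Sa a \<otimes>\<^bsub>H\<^esub> mS (p2 H H (epsr H (p2 H H x y)) v) \<otimes>\<^bsub>H\<^esub> d)"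
    using i[of "Del y"] by simp
qed (assumption | rule lins | simp)+

lemma Gam_M2_L3:
  assumes q: "q \<in> carrier H2" and [simp]: "a \<in> carrier H" "b \<in> carrier H" "c \<in> carrier H" "d \<in> carrier H"
  shows "Gam (M2 H (L3 q) \<otimes>\<^bsub>H4\<^esub> p2 H H3 a (p2 H H2 b (p2 H H c d))) =
    p2 H H (Sa b \<otimes>\<^bsub>H\<^esub> al \<otimes>\<^bsub>H\<^esub> c) (Sa a \<otimes>\<^bsub>H\<^esub> mS q \<otimes>\<^bsub>H\<^esub> d)"
  by (rule ext2[OF q, where Z = H2]) (assumption | rule lins | simp add: Gam_M2_ap)+

lemma M2_closed [simp]: "t \<in> carrier (U \<boxtimes> H2) \<Longrightarrow> vs U \<Longrightarrow> M2 U t \<in> carrier (U \<boxtimes> H3)"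
  by (assumption | rule lins | simp)+

lemma M3_closed [simp]: "t \<in> carrier (U \<boxtimes> H2) \<Longrightarrow> vs U \<Longrightarrow> M3 U t \<in> carrier (U \<boxtimes> H3)"
  by (assumption | rule lins | simp)+

text \<open>In \<open>Gam_M2_L3\<close> at q = \<Delta>(h), the outer contraction meets \<Delta>(h)
  as well and gives the counit.\<close>

lemma Gam_M2_L3_Del:
  assumes t: "t \<in> carrier H4" and [simp]: "h \<in> carrier H"
  shows "Gam (M2 H (L3 (Del h)) \<otimes>\<^bsub>H4\<^esub> t) = eps h \<odot>\<^bsub>H2\<^esub> Gam t"
  by (rule ext4[OF t, where Z = H2]) (assumption | rule lins | simp add: Gam_M2_L3)+

text \<open>Quasi-coassociativity in the first three factors; the second leg of q is a spectator in
  the fourth.\<close>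

lemma app_Ph_L4_L3:
  assumes q: "q \<in> carrier H2"
  shows "app1 Ph \<otimes>\<^bsub>H4\<^esub> L4 (L3 q) = M2 H (L3 q) \<otimes>\<^bsub>H4\<^esub> app1 Ph"
proof (rule ext2[OF q, where Z = H4])
  fix u v assume [simp]: "u \<in> carrier H" "v \<in> carrier H"
  have l: "L4 (ap3 p v) = app H H H H (L3 p) v" if p: "p \<in> carrier H2" for p
  proof (rule ext2[OF p, where Z = H4])
    fix x y assume [simp]: "x \<in> carrier H" "y \<in> carrier H"
    show "L4 (ap3 (p2 H H x y) v) = app H H H H (L3 (p2 H H x y)) v"
    proof -
      have "ap4 s (p2 H H y v) = app H H H H (ap3 s y) v" if s: "s \<in> carrier H2" for s
        by (rule ext2[OF s, where Z = H4]) (assumption | rule lins | simp)+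
      then show ?thesis by simp
    qed
  qed (assumption | rule lins | simp)+
  have r: "M2 H (ap3 p v) = app H H H H (R3 p) v" if p: "p \<in> carrier H2" for p
    by (rule ext2[OF p, where Z = H4]) (assumption | rule lins | simp)+
  show "app1 Ph \<otimes>\<^bsub>H4\<^esub> L4 (L3 (p2 H H u v)) = M2 H (L3 (p2 H H u v)) \<otimes>\<^bsub>H4\<^esub> app1 Ph"
    by (simp add: l r app_mult coassoc)
qed (assumption | rule lins | simp)+

definition J where "J = tsum K H2 (\<lambda>a b. F0 (Del a) \<otimes>\<^bsub>H2\<^esub> gam \<otimes>\<^bsub>H2\<^esub> Del b)"

lemma J_lin [simp]: "lin H2 H2 J"
  unfolding J_def by (assumption | rule lins | simp)+

lemmas [lins] = lin_comp[OF J_lin]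
lemmas J_closed [simp, lins] = lin_closed[OF J_lin]

lemma J_pure [simp]: "a \<in> carrier H \<Longrightarrow> b \<in> carrier H \<Longrightarrow> J (p2 H H a b) = F0 (Del a) \<otimes>\<^bsub>H2\<^esub> gam \<otimes>\<^bsub>H2\<^esub> Del b"
  unfolding J_def by (rule tsum_pure[where V = H and W = H]) (assumption | rule lins | simp)+

text \<open>By \<open>Gam_ap4\<close> the outer factors can be pulled into the tensor that defines
  \<gamma>, where they form (\<Delta> \<otimes> \<Delta>)(\<Delta>(h)) at the right end. Two uses of
  quasi-coassociativity carry this factor to the left end, and there the contractions absorb
  it.\<close>

lemma J_Del [simp]:
  assumes [simp]: "h \<in> carrier H"
  shows "J (Del h) = eps h \<odot>\<^bsub>H2\<^esub> gam"
proof -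
  let ?A = "app1 Ph \<otimes>\<^bsub>H4\<^esub> L4 phi"
  have "J q = Gam (?A \<otimes>\<^bsub>H4\<^esub> L4 (R3 q))" if q: "q \<in> carrier H2" for q
    by (rule ext2[OF q, where Z = H2]) (assumption | rule lins | simp add: Gam_ap4 gam_def)+
  then have "J (Del h) = Gam (?A \<otimes>\<^bsub>H4\<^esub> L4 (R3 (Del h)))" by simp
  also have "?A \<otimes>\<^bsub>H4\<^esub> L4 (R3 (Del h)) = app1 Ph \<otimes>\<^bsub>H4\<^esub> L4 (phi \<otimes>\<^bsub>H3\<^esub> R3 (Del h))"
    by (simp add: ahom_mult[OF L4_hom] mult_assoc)
  also have "\<dots> = app1 Ph \<otimes>\<^bsub>H4\<^esub> L4 (L3 (Del h)) \<otimes>\<^bsub>H4\<^esub> L4 phi"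
    by (simp add: coassoc' ahom_mult[OF L4_hom] mult_assoc)
  also have "\<dots> = M2 H (L3 (Del h)) \<otimes>\<^bsub>H4\<^esub> ?A"
    by (simp add: app_Ph_L4_L3 mult_assoc)
  also have "Gam \<dots> = eps h \<odot>\<^bsub>H2\<^esub> gam"
    by (simp add: Gam_M2_L3_Del gam_def)
  finally show ?thesis .
qed

text \<open>The formula of the Drinfeld twist with the inverse of \<Phi> replaced by an arbitrary
  threefold tensor.\<close>

definition G where "G = tsum K H2 (\<lambda>a s. F0 (Del a) \<otimes>\<^bsub>H2\<^esub> gam \<otimes>\<^bsub>H2\<^esub> Del (mb s))"

lemma G_lin [simp]: "lin H3 H2 G"
  unfolding G_def by (assumption | rule lins | simp)+

lemmas [lins] = lin_comp[OF G_lin]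
lemmas G_closed [simp, lins] = lin_closed[OF G_lin]

lemma G_pure [simp]: "a \<in> carrier H \<Longrightarrow> s \<in> carrier H2 \<Longrightarrow> G (p2 H H2 a s) = F0 (Del a) \<otimes>\<^bsub>H2\<^esub> gam \<otimes>\<^bsub>H2\<^esub> Del (mb s)"
  unfolding G_def by (rule tsum_pure[where V = H and W = H2]) (assumption | rule lins | simp)+

abbreviation tw where "tw \<equiv> drinfeld_twist K H"

lemma twist_eq: "tw = G phi"
proof -
  have "tsum3 K H2 (\<lambda>x1 x2 x3. F0 (Del x1) \<otimes>\<^bsub>H2\<^esub> gam \<otimes>\<^bsub>H2\<^esub> Del (x2 \<otimes>\<^bsub>H\<^esub> be \<otimes>\<^bsub>H\<^esub> Sa x3)) t = G t" if t: "t \<in> carrier H3" for t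
    by (rule ext3[OF t, where Z = H2], subst tsum3_pure[where U = H and V = H and W = H])
      (assumption | rule lins tsum3_lin | simp)+
  then show ?thesis by (simp add: drinfeld_twist_def drinfeld_gamma_eq F0_def[symmetric])
qed

lemma tw_closed [simp, lins]: "tw \<in> carrier H2"
  by (simp add: twist_eq)

lemmas Del_mult [simp] = ahom_mult[OF Del_hom]
lemmas Del_one [simp] = ahom_one[OF Del_hom]
lemmas Del_smult [simp] = lin_smult[OF Del_lin]

text \<open>The first leg of q multiplies inside the antihomomorphism \<open>F0\<close> and so comes
  out on the left, while \<open>mb\<close> absorbs the \<Delta> of the second leg.\<close>

lemma G_R3:
  assumes q: "q \<in> carrier H2" and t: "t \<in> carrier H3"
  shows "G (t \<otimes>\<^bsub>H3\<^esub> R3 q) = F0 (Del (epsr H q)) \<otimes>\<^bsub>H2\<^esub> G t"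
proof (rule ext2[OF q, where Z = H2])
  fix h k assume [simp]: "h \<in> carrier H" "k \<in> carrier H"
  show "G (t \<otimes>\<^bsub>H3\<^esub> R3 (p2 H H h k)) = F0 (Del (epsr H (p2 H H h k))) \<otimes>\<^bsub>H2\<^esub> G t"
    by (rule ext2[OF t, where Z = H2])
      (assumption | rule lins | simp add: F0_mult mult_assoc lin_smult[OF F0_lin])+
qed (assumption | rule lins t | simp add: t)+

text \<open>\<open>J_Del\<close> absorbs the \<Delta> of the first leg of q; the second leg
  multiplies under S and so comes out on the right.\<close>

lemma G_L3:
  assumes q: "q \<in> carrier H2" and t: "t \<in> carrier H3"
  shows "G (L3 q \<otimes>\<^bsub>H3\<^esub> t) = G t \<otimes>\<^bsub>H2\<^esub> Del (Sa (epsl H q))"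
proof (rule ext2[OF q, where Z = H2])
  fix u v assume [simp]: "u \<in> carrier H" "v \<in> carrier H"
  show "G (L3 (p2 H H u v) \<otimes>\<^bsub>H3\<^esub> t) = G t \<otimes>\<^bsub>H2\<^esub> Del (Sa (epsl H (p2 H H u v)))"
  proof (rule ext3[OF t, where Z = H2])
    fix a b c assume [simp]: "a \<in> carrier H" "b \<in> carrier H" "c \<in> carrier H"
    have "G (ap3 p v \<otimes>\<^bsub>H3\<^esub> p2 H H2 a (p2 H H b c)) = F0 (Del a) \<otimes>\<^bsub>H2\<^esub> J p \<otimes>\<^bsub>H2\<^esub> Del (b \<otimes>\<^bsub>H\<^esub> be \<otimes>\<^bsub>H\<^esub> Sa c \<otimes>\<^bsub>H\<^esub> Sa v)"
      if p: "p \<in> carrier H2" for p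
      by (rule ext2[OF p, where Z = H2]) (assumption | rule lins | simp add: F0_mult mult_assoc)+
    then show "G (L3 (p2 H H u v) \<otimes>\<^bsub>H3\<^esub> p2 H H2 a (p2 H H b c)) =
        G (p2 H H2 a (p2 H H b c)) \<otimes>\<^bsub>H2\<^esub> Del (Sa (epsl H (p2 H H u v)))"
      by (simp add: mult_assoc)
  qed (assumption | rule lins t | simp add: t)+
qed (assumption | rule lins t | simp add: t)+

text \<open>\<open>G\<close> is applied to both sides of \<Phi>^-1 (id \<otimes>
  \<Delta>)(\<Delta>(h)) = (\<Delta> \<otimes> id)(\<Delta>(h)) \<Phi>^-1; on each side one leg of
  \<Delta>(h) disappears under \<epsilon> and the other becomes an outer factor of f.\<close>

lemma twist_antipode:
  assumes [simp]: "h \<in> carrier H"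
  shows "F0 (Del h) \<otimes>\<^bsub>H2\<^esub> tw = tw \<otimes>\<^bsub>H2\<^esub> Del (Sa h)"
  using G_R3[of "Del h" phi] G_L3[of "Del h" phi] by (simp add: coassoc' twist_eq)

text \<open>Evaluating \<open>T\<close> on both sides of the pentagon identity gives \<open>f \<Delta>(\<alpha>) = \<gamma>\<close>.\<close>

definition T where "T = tsum K H2 (\<lambda>a s. F0 (Del a) \<otimes>\<^bsub>H2\<^esub> gam \<otimes>\<^bsub>H2\<^esub> Del (mm s))"

lemma T_lin [simp]: "lin H4 H2 T"
  unfolding T_def by (assumption | rule lins | simp)+

lemmas [lins] = lin_comp[OF T_lin]

lemma T_pure [simp]: "a \<in> carrier H \<Longrightarrow> s \<in> carrier H3 \<Longrightarrow> T (p2 H H3 a s) = F0 (Del a) \<otimes>\<^bsub>H2\<^esub> gam \<otimes>\<^bsub>H2\<^esub> Del (mm s)"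
  unfolding T_def by (rule tsum_pure[where V = H and W = H3]) (assumption | rule lins | simp)+

text \<open>As in \<open>G_L3\<close>, the first two legs of the left factor form \<Delta>(u), which
  \<open>J_Del\<close> turns into \<epsilon>(u).\<close>

lemma T_L4:
  assumes s: "s \<in> carrier H3" and t: "t \<in> carrier H4"
  shows "T (L4 s \<otimes>\<^bsub>H4\<^esub> t) = T (p2 H H3 \<one>\<^bsub>H\<^esub> (p2 H H2 \<one>\<^bsub>H\<^esub> (epsl H2 s)) \<otimes>\<^bsub>H4\<^esub> t)"
proof (rule ext2[OF s, where Z = H2])
  fix u w assume [simp]: "u \<in> carrier H" "w \<in> carrier H2"
  show "T (L4 (p2 H H2 u w) \<otimes>\<^bsub>H4\<^esub> t) = T (p2 H H3 \<one>\<^bsub>H\<^esub> (p2 H H2 \<one>\<^bsub>H\<^esub> (epsl H2 (p2 H H2 u w))) \<otimes>\<^bsub>H4\<^esub> t)"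
  proof (rule ext3[OF t, where Z = H2])
    fix a b r assume [simp]: "a \<in> carrier H" "b \<in> carrier H" "r \<in> carrier H2"
    have i: "T (ap4 p w \<otimes>\<^bsub>H4\<^esub> p2 H H3 a (p2 H H2 b r)) =
        F0 (Del a) \<otimes>\<^bsub>H2\<^esub> J p \<otimes>\<^bsub>H2\<^esub> Del (b \<otimes>\<^bsub>H\<^esub> be \<otimes>\<^bsub>H\<^esub> mS (w \<otimes>\<^bsub>H2\<^esub> r))"
      if p: "p \<in> carrier H2" for p
      by (rule ext2[OF p, where Z = H2]) (assumption | rule lins | simp add: F0_mult mult_assoc)+
    show "T (L4 (p2 H H2 u w) \<otimes>\<^bsub>H4\<^esub> p2 H H3 a (p2 H H2 b r)) =
        T (p2 H H3 \<one>\<^bsub>H\<^esub> (p2 H H2 \<one>\<^bsub>H\<^esub> (epsl H2 (p2 H H2 u w))) \<otimes>\<^bsub>H4\<^esub> p2 H H3 a (p2 H H2 b r))"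
      by (simp add: i lin_smult[OF T_lin] mult_assoc)
  qed (assumption | rule lins t | simp add: t)+
qed (assumption | rule lins t | simp add: t)+

text \<open>Here \<Delta> stands on the left of the last two legs, where \<open>mS\<close> inside
  \<open>mm\<close> absorbs it.\<close>

lemma T_M3:
  assumes s: "s \<in> carrier H3" and t: "t \<in> carrier H4"
  shows "T (M3 H s \<otimes>\<^bsub>H4\<^esub> t) = T (rmap H H3 (\<lambda>v. p2 H H2 v \<one>\<^bsub>H2\<^esub>) (rmap H H (epsr H) s) \<otimes>\<^bsub>H4\<^esub> t)"
proof (rule ext3[OF s, where Z = H2])
  fix u v w assume [simp]: "u \<in> carrier H" "v \<in> carrier H" "w \<in> carrier H"
  have [simp]: "lin H H3 (\<lambda>v. p2 H H2 v \<one>\<^bsub>H2\<^esub>)" by (assumption | rule lins | simp)+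
  show "T (M3 H (p2 H H2 u (p2 H H v w)) \<otimes>\<^bsub>H4\<^esub> t) =
      T (rmap H H3 (\<lambda>v. p2 H H2 v \<one>\<^bsub>H2\<^esub>) (rmap H H (epsr H) (p2 H H2 u (p2 H H v w))) \<otimes>\<^bsub>H4\<^esub> t)"
    by (rule ext3[OF t, where Z = H2])
      (assumption | rule lins t | simp add: t lin_smult[OF T_lin])+
qed (assumption | rule lins t | simp add: t)+

text \<open>Regrouping b \<beta> S(c) \<alpha> d exhibits \<open>mb\<close> on the first two legs,
  although \<open>mm\<close> was built from \<open>mS\<close> on the last two; so \<open>mm\<close>
  absorbs \<Delta>(v) from the right there.\<close>

lemma mm_ap_Del [simp]:
  assumes r: "r \<in> carrier H3" and [simp]: "v \<in> carrier H" "w \<in> carrier H"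
  shows "mm (r \<otimes>\<^bsub>H3\<^esub> ap3 (Del v) w) = eps v \<odot>\<^bsub>H\<^esub> (mm r \<otimes>\<^bsub>H\<^esub> w)"
proof (rule ext3[OF r, where Z = H])
  fix b c d assume [simp]: "b \<in> carrier H" "c \<in> carrier H" "d \<in> carrier H"
  have "mm (p2 H H2 b (p2 H H c d) \<otimes>\<^bsub>H3\<^esub> ap3 q w) = b \<otimes>\<^bsub>H\<^esub> mb q \<otimes>\<^bsub>H\<^esub> mS (p2 H H c (d \<otimes>\<^bsub>H\<^esub> w))" if q: "q \<in> carrier H2" for q
    by (rule ext2[OF q, where Z = H]) (assumption | rule lins | simp add: mult_assoc)+
  then show "mm (p2 H H2 b (p2 H H c d) \<otimes>\<^bsub>H3\<^esub> ap3 (Del v) w) = eps v \<odot>\<^bsub>H\<^esub> (mm (p2 H H2 b (p2 H H c d)) \<otimes>\<^bsub>H\<^esub> w)"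
    by (simp add: mult_assoc)
qed (assumption | rule lins | simp)+

text \<open>Here \<Delta> stands on the right of the middle legs, where \<open>mm_ap_Del\<close>
  absorbs it; the outer legs of s survive.\<close>

lemma T_M2:
  assumes s: "s \<in> carrier H3" and r [simp]: "r \<in> carrier H3"
  shows "T (p2 H H3 \<one>\<^bsub>H\<^esub> r \<otimes>\<^bsub>H4\<^esub> M2 H s) =
    tsum K H2 (\<lambda>u w. F0 (Del u) \<otimes>\<^bsub>H2\<^esub> gam \<otimes>\<^bsub>H2\<^esub> Del (mm r \<otimes>\<^bsub>H\<^esub> w)) (rmap H H (epsl H) s)"
proof -
  let ?f = "\<lambda>u w. F0 (Del u) \<otimes>\<^bsub>H2\<^esub> gam \<otimes>\<^bsub>H2\<^esub> Del (mm r \<otimes>\<^bsub>H\<^esub> w)"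
  have b: "bil H H H2 ?f" by (assumption | rule lins | simp)+
  have l: "lin H2 H2 (tsum K H2 ?f)" by (rule tsum_lin[OF _ _ _ b]) simp_all
  have p: "tsum K H2 ?f (p2 H H u w) = ?f u w" if "u \<in> carrier H" "w \<in> carrier H" for u w
    by (rule tsum_pure[OF _ _ _ b that]) simp_all
  show ?thesis
    by (rule ext3[OF s, where Z = H2])
      (assumption | rule lins lin_comp[OF l] | simp add: lin_smult[OF l] p mult_assoc)+
qed

text \<open>The pentagon solved so that each comultiplied reassociator stands on the side where
  \<open>T\<close> can absorb it.\<close>

lemma pentagon': "L4 Ph \<otimes>\<^bsub>H4\<^esub> app1 phi = M3 H phi \<otimes>\<^bsub>H4\<^esub> (p2 H H3 \<one>\<^bsub>H\<^esub> Ph \<otimes>\<^bsub>H4\<^esub> M2 H Ph)"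
proof -
  have M3: "ahom H3 H4 (M3 H)" by (intro ahom_tmap) (simp_all add: ahom_id)
  have a: "app1 Ph \<otimes>\<^bsub>H4\<^esub> app1 phi = \<one>\<^bsub>H4\<^esub>" by (simp add: app_mult)
  have b: "M3 H phi \<otimes>\<^bsub>H4\<^esub> M3 H Ph = \<one>\<^bsub>H4\<^esub>"
    by (simp add: ahom_mult[OF M3, symmetric] ahom_one[OF M3])
  have "p2 H H3 \<one>\<^bsub>H\<^esub> Ph \<otimes>\<^bsub>H4\<^esub> M2 H Ph = p2 H H3 \<one>\<^bsub>H\<^esub> Ph \<otimes>\<^bsub>H4\<^esub> M2 H Ph \<otimes>\<^bsub>H4\<^esub> app1 Ph \<otimes>\<^bsub>H4\<^esub> app1 phi"
    by (simp add: mult_assoc a)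
  also have "\<dots> = M3 H Ph \<otimes>\<^bsub>H4\<^esub> (L4 Ph \<otimes>\<^bsub>H4\<^esub> app1 phi)"
    by (simp only: pentagon) (simp add: mult_assoc)
  finally have "M3 H phi \<otimes>\<^bsub>H4\<^esub> (p2 H H3 \<one>\<^bsub>H\<^esub> Ph \<otimes>\<^bsub>H4\<^esub> M2 H Ph) = (M3 H phi \<otimes>\<^bsub>H4\<^esub> M3 H Ph) \<otimes>\<^bsub>H4\<^esub> (L4 Ph \<otimes>\<^bsub>H4\<^esub> app1 phi)"
    by (simp add: mult_assoc)
  then show ?thesis by (simp add: b)
qed

lemma phi_right: "rmap H H (epsr H) phi = \<one>\<^bsub>H2\<^esub>"
proof -
  have h: "ahom H3 H2 (rmap H H (epsr H))" by (rule ahom_tmap) (simp_all add: ahom_id)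
  have "rmap H H (epsr H) phi = inv\<^bsub>H2\<^esub> (rmap H H (epsr H) Ph)"
    by (rule ahom_Units(2)[OF _ _ h]) simp_all
  then show ?thesis by (simp add: Ph_right monoid.inv_one[OF aalg_monoid])
qed

lemma twist_alpha: "tw \<otimes>\<^bsub>H2\<^esub> Del al = gam"
proof -
  \<comment> \<open>With 1 in the last leg the contraction \<open>mm\<close> ends in \<alpha>, so
    \<open>T\<close> becomes \<open>G\<close> times \<Delta>(\<alpha>).\<close>
  have g: "T (app1 t) = G t \<otimes>\<^bsub>H2\<^esub> Del al" if t: "t \<in> carrier H3" for t
    by (rule ext3[OF t, where Z = H2]) (assumption | rule lins | simp add: mult_assoc)+
  have [simp]: "rmap H H3 (\<lambda>v. p2 H H2 v \<one>\<^bsub>H2\<^esub>) \<one>\<^bsub>H2\<^esub> = \<one>\<^bsub>H4\<^esub>"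
    unfolding tens_one by (subst tmap_pure[where V = H and W = H]) (assumption | rule lins | simp)+
  have "tw \<otimes>\<^bsub>H2\<^esub> Del al = T (L4 Ph \<otimes>\<^bsub>H4\<^esub> app1 phi)"
    by (simp add: g twist_eq T_L4 Ph_left flip: tens_one)
  also have "\<dots> = T (p2 H H3 \<one>\<^bsub>H\<^esub> Ph \<otimes>\<^bsub>H4\<^esub> M2 H Ph)"
    by (simp add: pentagon' T_M3 phi_right)
  also have "\<dots> = tsum K H2 (\<lambda>u w. F0 (Del u) \<otimes>\<^bsub>H2\<^esub> gam \<otimes>\<^bsub>H2\<^esub> Del (mm Ph \<otimes>\<^bsub>H\<^esub> w)) \<one>\<^bsub>H2\<^esub>"
    by (simp only: T_M2 Ph_closed Ph_mid)
  also have "\<dots> = gam"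
    unfolding tens_one by (subst tsum_pure[where V = H and W = H]) (assumption | rule lins | simp)+
  finally show ?thesis .
qed

section \<open>The inverse antipode and contractions with spectators\<close>

abbreviation Si where "Si \<equiv> antipode_inv H"

lemma Si_closed [simp, lins]: "h \<in> carrier H \<Longrightarrow> Si h \<in> carrier H"
  using bij_betw_inv_into[OF Sa_bij] by (simp add: antipode_inv_def bij_betwE)

lemma Sa_Si [simp]: "h \<in> carrier H \<Longrightarrow> Sa (Si h) = h"
  using Sa_bij by (simp add: antipode_inv_def bij_betw_inv_into_right)

lemma Si_Sa [simp]: "h \<in> carrier H \<Longrightarrow> Si (Sa h) = h"
  using Sa_bij by (simp add: antipode_inv_def bij_betw_inv_into_left)

lemma Si_eqI: "g \<in> carrier H \<Longrightarrow> Sa g = h \<Longrightarrow> Si h = g"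
  by auto

lemma Si_lin [simp]: "lin H H Si"
  by (rule linI) (auto intro!: Si_eqI simp: lin_add[OF Sa_lin])

lemmas [lins] = lin_comp[OF Si_lin]
lemmas [simp] = lin_smult[OF Si_lin]

lemma Si_mult [simp]: "g \<in> carrier H \<Longrightarrow> h \<in> carrier H \<Longrightarrow> Si (g \<otimes>\<^bsub>H\<^esub> h) = Si h \<otimes>\<^bsub>H\<^esub> Si g"
  by (rule Si_eqI) simp_all

lemma Si_one [simp]: "Si \<one>\<^bsub>H\<^esub> = \<one>\<^bsub>H\<^esub>"
  by (rule Si_eqI) simp_all

text \<open>Since S^-1(S(c) \<alpha> d) = S^-1(\<alpha> d) c, this is the contraction that forms q.
  Going through \<open>mS\<close> makes it inherit the absorption of \<Delta> from the left.\<close>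

definition m1 where "m1 s = Si (mS s)"

lemma m1_lin [simp]: "lin H2 H m1"
  unfolding m1_def[abs_def] by (assumption | rule lins | simp)+

lemmas [lins] = lin_comp[OF m1_lin]
lemmas m1_closed [simp, lins] = lin_closed[OF m1_lin]
lemmas [simp] = lin_smult[OF m1_lin]

lemma Sa_m1 [simp]: "s \<in> carrier H2 \<Longrightarrow> Sa (m1 s) = mS s"
  by (simp add: m1_def)

lemma m1_pure [simp]: "c \<in> carrier H \<Longrightarrow> d \<in> carrier H \<Longrightarrow> m1 (p2 H H c d) = Si d \<otimes>\<^bsub>H\<^esub> (Si al \<otimes>\<^bsub>H\<^esub> c)"
  by (simp add: m1_def)

lemma m1_Del_mult [simp]: "t \<in> carrier H2 \<Longrightarrow> h \<in> carrier H \<Longrightarrow> m1 (Del h \<otimes>\<^bsub>H2\<^esub> t) = eps h \<odot>\<^bsub>H\<^esub> m1 t"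
  by (simp add: m1_def)

lemma rmap_closed_H2 [simp]: "t \<in> carrier (V \<boxtimes> H2) \<Longrightarrow> vs V \<Longrightarrow> lin H2 H g \<Longrightarrow> rmap V H g t \<in> carrier (V \<boxtimes> H)"
  by (assumption | rule lins | simp)+

text \<open>The reason is S^-1(\<alpha> d h) c y = S^-1(h) S^-1(\<alpha> d) c y: the last leg leaves
  on the left, the others on the right.\<close>

lemma rmap_m1_ap:
  assumes [simp]: "aalg V" and t [simp]: "t \<in> carrier (V \<boxtimes> H2)" and z [simp]: "z \<in> carrier (V \<boxtimes> H)" and [simp]: "h \<in> carrier H"
  shows "rmap V H m1 (t \<otimes>\<^bsub>V \<boxtimes> H2\<^esub> ap V H H z h) = p2 V H \<one>\<^bsub>V\<^esub> (Si h) \<otimes>\<^bsub>V \<boxtimes> H\<^esub> rmap V H m1 t \<otimes>\<^bsub>V \<boxtimes> H\<^esub> z"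
proof (rule ext3[OF t, where Z = "V \<boxtimes> H"])
  fix a b c assume [simp]: "a \<in> carrier V" "b \<in> carrier H" "c \<in> carrier H"
  show "rmap V H m1 (p2 V H2 a (p2 H H b c) \<otimes>\<^bsub>V \<boxtimes> H2\<^esub> ap V H H z h) = p2 V H \<one>\<^bsub>V\<^esub> (Si h) \<otimes>\<^bsub>V \<boxtimes> H\<^esub> rmap V H m1 (p2 V H2 a (p2 H H b c)) \<otimes>\<^bsub>V \<boxtimes> H\<^esub> z"
    by (rule ext2[OF z, where Z = "V \<boxtimes> H"]) (assumption | rule lins | simp add: mult_assoc)+
qed (assumption | rule lins | simp)+

lemma rmap_m1_Del:
  assumes [simp]: "aalg V" and t [simp]: "t \<in> carrier (V \<boxtimes> H2)" and w [simp]: "w \<in> carrier (V \<boxtimes> H)"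
  shows "rmap V H m1 (rmap V H2 Del w \<otimes>\<^bsub>V \<boxtimes> H2\<^esub> t) = p2 V H (epsr V w) \<one>\<^bsub>H\<^esub> \<otimes>\<^bsub>V \<boxtimes> H\<^esub> rmap V H m1 t"
proof (rule ext2[OF t, where Z = "V \<boxtimes> H"])
  fix a b assume [simp]: "a \<in> carrier V" "b \<in> carrier H2"
  show "rmap V H m1 (rmap V H2 Del w \<otimes>\<^bsub>V \<boxtimes> H2\<^esub> p2 V H2 a b) = p2 V H (epsr V w) \<one>\<^bsub>H\<^esub> \<otimes>\<^bsub>V \<boxtimes> H\<^esub> rmap V H m1 (p2 V H2 a b)"
    by (rule ext2[OF w, where Z = "V \<boxtimes> H"]) (assumption | rule lins | simp add: mult_assoc)+
qed (assumption | rule lins w | simp)+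

lemma rmap_mb_ap:
  assumes [simp]: "aalg V" and t [simp]: "t \<in> carrier (V \<boxtimes> H2)" and z [simp]: "z \<in> carrier (V \<boxtimes> H)" and [simp]: "h \<in> carrier H"
  shows "rmap V H mb (ap V H H z h \<otimes>\<^bsub>V \<boxtimes> H2\<^esub> t) = z \<otimes>\<^bsub>V \<boxtimes> H\<^esub> rmap V H mb t \<otimes>\<^bsub>V \<boxtimes> H\<^esub> p2 V H \<one>\<^bsub>V\<^esub> (Sa h)"
proof (rule ext3[OF t, where Z = "V \<boxtimes> H"])
  fix a b c assume [simp]: "a \<in> carrier V" "b \<in> carrier H" "c \<in> carrier H"
  show "rmap V H mb (ap V H H z h \<otimes>\<^bsub>V \<boxtimes> H2\<^esub> p2 V H2 a (p2 H H b c)) = z \<otimes>\<^bsub>V \<boxtimes> H\<^esub> rmap V H mb (p2 V H2 a (p2 H H b c)) \<otimes>\<^bsub>V \<boxtimes> H\<^esub> p2 V H \<one>\<^bsub>V\<^esub> (Sa h)"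
    by (rule ext2[OF z, where Z = "V \<boxtimes> H"]) (assumption | rule lins | simp add: mult_assoc)+
qed (assumption | rule lins | simp)+

lemma rmap_mb_Del:
  assumes [simp]: "aalg V" and t [simp]: "t \<in> carrier (V \<boxtimes> H2)" and w [simp]: "w \<in> carrier (V \<boxtimes> H)"
  shows "rmap V H mb (t \<otimes>\<^bsub>V \<boxtimes> H2\<^esub> rmap V H2 Del w) = rmap V H mb t \<otimes>\<^bsub>V \<boxtimes> H\<^esub> p2 V H (epsr V w) \<one>\<^bsub>H\<^esub>"
proof (rule ext2[OF t, where Z = "V \<boxtimes> H"])
  fix a b assume [simp]: "a \<in> carrier V" "b \<in> carrier H2"
  show "rmap V H mb (p2 V H2 a b \<otimes>\<^bsub>V \<boxtimes> H2\<^esub> rmap V H2 Del w) = rmap V H mb (p2 V H2 a b) \<otimes>\<^bsub>V \<boxtimes> H\<^esub> p2 V H (epsr V w) \<one>\<^bsub>H\<^esub>"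
    by (rule ext2[OF w, where Z = "V \<boxtimes> H"]) (assumption | rule lins | simp add: mult_assoc)+
qed (assumption | rule lins w | simp)+

section \<open>The twist and the inverse antipode\<close>

text \<open>The inverse of \<open>F0\<close>. Its flip puts S^-1(f2 X3) before S^-1(f1 X2), which
  matches \<Omega>: its fifth leg acts on the first factor of a product and its fourth leg on the
  second.\<close>

definition F1 where "F1 = tsum K H2 (\<lambda>a b. p2 H H (Si b) (Si a))"

lemma F1_lin [simp]: "lin H2 H2 F1"
  unfolding F1_def by (assumption | rule lins | simp)+

lemmas [lins] = lin_comp[OF F1_lin]
lemmas F1_closed [simp, lins] = lin_closed[OF F1_lin]

lemma F1_pure [simp]: "a \<in> carrier H \<Longrightarrow> b \<in> carrier H \<Longrightarrow> F1 (p2 H H a b) = p2 H H (Si b) (Si a)"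
  unfolding F1_def by (rule tsum_pure[where V = H and W = H]) (assumption | rule lins | simp)+

lemma F1_mult:
  assumes s: "s \<in> carrier H2" and t [simp]: "t \<in> carrier H2"
  shows "F1 (s \<otimes>\<^bsub>H2\<^esub> t) = F1 t \<otimes>\<^bsub>H2\<^esub> F1 s"
proof (rule ext2[OF s, where Z = H2])
  fix a b assume [simp]: "a \<in> carrier H" "b \<in> carrier H"
  show "F1 (p2 H H a b \<otimes>\<^bsub>H2\<^esub> t) = F1 t \<otimes>\<^bsub>H2\<^esub> F1 (p2 H H a b)"
    by (rule ext2[OF t, where Z = H2]) (assumption | rule lins | simp)+
qed (assumption | rule lins | simp)+

lemma F1_F0:
  assumes s: "s \<in> carrier H2"
  shows "F1 (F0 s) = s"
  by (rule ext2[OF s, where Z = H2]) (assumption | rule lins | simp)+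

text \<open>\<open>twist_antipode\<close> is taken at S^-1(\<alpha> y), f \<Delta>(\<alpha>) is
  replaced by \<gamma>, and \<open>F1\<close> undoes S. This trades f for \<gamma>, an explicit
  contraction of reassociators.\<close>

lemma F1_twist:
  assumes [simp]: "w \<in> carrier H2" "x \<in> carrier H" "y \<in> carrier H"
  shows "F1 (tw \<otimes>\<^bsub>H2\<^esub> w) \<otimes>\<^bsub>H2\<^esub> Del (m1 (p2 H H x y)) = F1 (gam \<otimes>\<^bsub>H2\<^esub> Del y \<otimes>\<^bsub>H2\<^esub> w) \<otimes>\<^bsub>H2\<^esub> Del x"
proof -
  have "F1 (F0 (Del (Si (al \<otimes>\<^bsub>H\<^esub> y))) \<otimes>\<^bsub>H2\<^esub> tw) = F1 (tw \<otimes>\<^bsub>H2\<^esub> Del (al \<otimes>\<^bsub>H\<^esub> y))"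
    by (subst twist_antipode) simp_all
  then have e: "F1 tw \<otimes>\<^bsub>H2\<^esub> Del (Si (al \<otimes>\<^bsub>H\<^esub> y)) = F1 (gam \<otimes>\<^bsub>H2\<^esub> Del y)"
    by (simp add: F1_mult F1_F0 mult_assoc[symmetric] twist_alpha[symmetric] del: Si_mult)
  have "F1 (tw \<otimes>\<^bsub>H2\<^esub> w) \<otimes>\<^bsub>H2\<^esub> Del (m1 (p2 H H x y)) =
      F1 w \<otimes>\<^bsub>H2\<^esub> (F1 tw \<otimes>\<^bsub>H2\<^esub> Del (Si (al \<otimes>\<^bsub>H\<^esub> y))) \<otimes>\<^bsub>H2\<^esub> Del x"
    by (simp add: F1_mult mult_assoc)
  also have "\<dots> = F1 (gam \<otimes>\<^bsub>H2\<^esub> Del y \<otimes>\<^bsub>H2\<^esub> w) \<otimes>\<^bsub>H2\<^esub> Del x"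
    by (simp only: e) (simp add: F1_mult mult_assoc)
  finally show ?thesis .
qed

text \<open>At s = 1 this is the element q of H coacting on itself by \<Delta>.\<close>

definition nn where "nn s = rmap H H m1 (Ph \<otimes>\<^bsub>H3\<^esub> L3 s)"

lemma nn_lin [simp]: "lin H2 H2 nn"
  unfolding nn_def[abs_def] by (assumption | rule lins | simp)+

lemmas [lins] = lin_comp[OF nn_lin]
lemmas nn_closed [simp, lins] = lin_closed[OF nn_lin]

text \<open>Chosen so that \<open>F1\<close> of \<gamma> is a value of \<open>Q0\<close> at
  \<Phi>^-1: undoing S turns the legs of \<gamma> into S^-1(\<alpha> A4) A1 and S^-1(\<alpha> A3)
  A2, the latter being the contraction \<open>m1\<close>.\<close>

definition Q0 where "Q0 = tsum3 K H2 (\<lambda>h k l. p2 H H (Si l \<otimes>\<^bsub>H\<^esub> Si al) \<one>\<^bsub>H\<^esub> \<otimes>\<^bsub>H2\<^esub> nn (p2 H H h k))"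

lemma Q0_lin [simp]: "lin H3 H2 Q0"
  unfolding Q0_def by (rule tsum3_lin) (assumption | rule lins | simp)+

lemmas [lins] = lin_comp[OF Q0_lin]

lemma Q0_pure [simp]:
  assumes [simp]: "h \<in> carrier H" "k \<in> carrier H" "l \<in> carrier H"
  shows "Q0 (p2 H H2 h (p2 H H k l)) = p2 H H (Si l \<otimes>\<^bsub>H\<^esub> Si al) \<one>\<^bsub>H\<^esub> \<otimes>\<^bsub>H2\<^esub> nn (p2 H H h k)"
  unfolding Q0_def by (rule tsum3_pure[where U = H and V = H and W = H]) (assumption | rule lins | simp)+

text \<open>Here t stands for \<Phi>, p for the first two legs of (\<Delta> \<otimes> id \<otimes>
  id)(\<Phi>^-1), and x, y for the other two; leaving them free makes every argument a pure-tensor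
  check.\<close>

lemma F1_Gam:
  assumes t [simp]: "t \<in> carrier H3" and p [simp]: "p \<in> carrier H2" and z [simp]: "z \<in> carrier H2"
    and [simp]: "x \<in> carrier H" "y \<in> carrier H" "k \<in> carrier H" "l \<in> carrier H"
  shows "F1 (Gam (app1 t \<otimes>\<^bsub>H4\<^esub> ap4 p (p2 H H x y)) \<otimes>\<^bsub>H2\<^esub> p2 H H k l) \<otimes>\<^bsub>H2\<^esub> z =
    p2 H H (Si (y \<otimes>\<^bsub>H\<^esub> l) \<otimes>\<^bsub>H\<^esub> Si al) \<one>\<^bsub>H\<^esub> \<otimes>\<^bsub>H2\<^esub> rmap H H m1 (t \<otimes>\<^bsub>H3\<^esub> ap3 (p \<otimes>\<^bsub>H2\<^esub> z) (x \<otimes>\<^bsub>H\<^esub> k))"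
    (is "?l t p z = ?r t p z")
proof (rule ext3[OF t, where Z = H2])
  fix a b c assume [simp]: "a \<in> carrier H" "b \<in> carrier H" "c \<in> carrier H"
  let ?t = "p2 H H2 a (p2 H H b c)"
  show "?l ?t p z = ?r ?t p z"
  proof (rule ext2[OF p, where Z = H2])
    fix u v assume [simp]: "u \<in> carrier H" "v \<in> carrier H"
    show "?l ?t (p2 H H u v) z = ?r ?t (p2 H H u v) z"
      by (rule ext2[OF z, where Z = H2]) (assumption | rule lins | simp add: mult_assoc)+
  qed (assumption | rule lins | simp)+
qed (assumption | rule lins | simp)+

text \<open>Unfolding \<gamma> and relaxing the remaining \<Phi>^-1 to an arbitrary s reduces this
  to \<open>F1_Gam\<close> with p = \<Delta> of the first leg of s.\<close>

lemma Q0_phi: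
  assumes y: "y \<in> carrier H2" and [simp]: "h \<in> carrier H"
  shows "F1 (gam \<otimes>\<^bsub>H2\<^esub> y) \<otimes>\<^bsub>H2\<^esub> Del h = Q0 (phi \<otimes>\<^bsub>H3\<^esub> p2 H H2 h y)"
proof (rule ext2[OF y, where Z = H2])
  fix k l assume [simp]: "k \<in> carrier H" "l \<in> carrier H"
  have "F1 (Gam (app1 Ph \<otimes>\<^bsub>H4\<^esub> L4 s) \<otimes>\<^bsub>H2\<^esub> p2 H H k l) \<otimes>\<^bsub>H2\<^esub> Del h = Q0 (s \<otimes>\<^bsub>H3\<^esub> p2 H H2 h (p2 H H k l))"
    if s: "s \<in> carrier H3" for s
    by (rule ext3[OF s, where Z = H2]) (assumption | rule lins | simp add: F1_Gam nn_def)+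
  then show "F1 (gam \<otimes>\<^bsub>H2\<^esub> p2 H H k l) \<otimes>\<^bsub>H2\<^esub> Del h = Q0 (phi \<otimes>\<^bsub>H3\<^esub> p2 H H2 h (p2 H H k l))"
    by (simp add: gam_def)
qed (assumption | rule lins | simp)+

text \<open>Quasi-coassociativity brings (id \<otimes> \<Delta>)(\<Delta>(h)) to the left of \<Phi>;
  there \<open>m1\<close> drops the comultiplied leg, and the surviving h joins S^-1(\<alpha> k) to
  form \<open>m1\<close> of h \<otimes> k.\<close>

lemma Q0_ap3:
  assumes [simp]: "h \<in> carrier H" "k \<in> carrier H" "b \<in> carrier H" "c \<in> carrier H"
  shows "Q0 (ap3 (Del h) k \<otimes>\<^bsub>H3\<^esub> p2 H H2 b (p2 H H c \<one>\<^bsub>H\<^esub>)) = p2 H H (m1 (p2 H H h k)) \<one>\<^bsub>H\<^esub> \<otimes>\<^bsub>H2\<^esub> nn (p2 H H b c)"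
proof -
  have "Q0 (ap3 p k \<otimes>\<^bsub>H3\<^esub> p2 H H2 b (p2 H H c \<one>\<^bsub>H\<^esub>)) =
      p2 H H (Si k \<otimes>\<^bsub>H\<^esub> Si al) \<one>\<^bsub>H\<^esub> \<otimes>\<^bsub>H2\<^esub> rmap H H m1 (Ph \<otimes>\<^bsub>H3\<^esub> (L3 p \<otimes>\<^bsub>H3\<^esub> L3 (p2 H H b c)))"
    if p: "p \<in> carrier H2" for p
    by (rule ext2[OF p, where Z = H2])
      (assumption | rule lins | simp add: nn_def del: split_left_pure add: ahom_mult[OF L3_hom, symmetric])+
  then have "Q0 (ap3 (Del h) k \<otimes>\<^bsub>H3\<^esub> p2 H H2 b (p2 H H c \<one>\<^bsub>H\<^esub>)) =
      p2 H H (Si k \<otimes>\<^bsub>H\<^esub> Si al) \<one>\<^bsub>H\<^esub> \<otimes>\<^bsub>H2\<^esub> rmap H H m1 (Ph \<otimes>\<^bsub>H3\<^esub> L3 (Del h) \<otimes>\<^bsub>H3\<^esub> L3 (p2 H H b c))"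
    by (simp add: mult_assoc)
  also have "\<dots> = p2 H H (Si k \<otimes>\<^bsub>H\<^esub> Si al) \<one>\<^bsub>H\<^esub> \<otimes>\<^bsub>H2\<^esub> rmap H H m1 (R3 (Del h) \<otimes>\<^bsub>H3\<^esub> (Ph \<otimes>\<^bsub>H3\<^esub> L3 (p2 H H b c)))"
    by (simp only: coassoc[symmetric] assms) (simp add: mult_assoc)
  also have "\<dots> = p2 H H (m1 (p2 H H h k)) \<one>\<^bsub>H\<^esub> \<otimes>\<^bsub>H2\<^esub> nn (p2 H H b c)"
    by (simp add: rmap_m1_Del nn_def del: split_left_pure) (simp add: mult_assoc[symmetric] del: split_left_pure)
  finally show ?thesis .
qed

end

locale rcom = qhopf K H for K :: "'k ring" and H :: "('k, 'h) quasi_hopf" +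
  fixes U :: "('k, 'h, 'c) right_comod"
  assumes rc: "right_comodule_algebra K H U"
begin

section \<open>Right comodule algebras\<close>

abbreviation U2 where "U2 \<equiv> U \<boxtimes> H"
abbreviation U3 where "U3 \<equiv> U \<boxtimes> H2"
abbreviation U4 where "U4 \<equiv> U \<boxtimes> H3"
abbreviation rho where "rho \<equiv> rcoact U"
abbreviation Rr where "Rr \<equiv> rcoact_reassoc U"
abbreviation rr where "rr \<equiv> inv\<^bsub>U3\<^esub> Rr"
abbreviation LU where "LU \<equiv> split_left K U H H rho"
abbreviation LU4 where "LU4 \<equiv> split_left K U H H2 rho"
abbreviation RU where "RU \<equiv> rmap U H2 Del"
abbreviation apU where "apU \<equiv> ap U H H"
abbreviation apU4 where "apU4 \<equiv> ap U H H2"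
abbreviation appU where "appU t \<equiv> app U H H H t \<one>\<^bsub>H\<^esub>"

lemma U_alg [simp]: "aalg U"
  and rho_hom [simp]: "ahom U U2 rho"
  and R_unit [simp]: "Rr \<in> Units U3"
  using rc by (simp_all only: right_comodule_algebra_def Let_def ahom_iff)

lemma rho_lin [simp]: "lin U U2 rho"
  by (rule ahom_lin) simp

lemmas [lins] = lin_comp[OF rho_lin]
lemmas rho_closed [simp, lins] = lin_closed[OF rho_lin]
lemmas [simp] = lin_smult[OF rho_lin] ahom_mult[OF rho_hom] ahom_one[OF rho_hom]

lemma R_closed [simp, lins]: "Rr \<in> carrier U3" "rr \<in> carrier U3"
  by simp_all

lemma LU_hom [simp]: "ahom U2 U3 LU" and LU4_hom [simp]: "ahom U3 U4 LU4"
  by (rule ahom_split_left; simp)+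

lemma LU_closed [simp, lins]: "t \<in> carrier U2 \<Longrightarrow> LU t \<in> carrier U3"
  by (rule ahom_closed[OF LU_hom])

lemma LU4_closed [simp, lins]: "t \<in> carrier U3 \<Longrightarrow> LU4 t \<in> carrier U4"
  by (rule ahom_closed[OF LU4_hom])

lemma RU_hom [simp]: "ahom U2 U3 RU" and M2U_hom [simp]: "ahom U3 U4 (M2 U)" and M3U_hom [simp]: "ahom U3 U4 (M3 U)"
  by (intro ahom_tmap; simp add: ahom_id)+

lemma epsr_rho [simp]: "x \<in> carrier U \<Longrightarrow> epsr U (rho x) = x"
  using rc by (simp add: right_comodule_algebra_def Let_def epsr_def)

lemma R_mid: "rmap U H (epsl H) Rr = \<one>\<^bsub>U2\<^esub>"
proof -
  have "tsum3 K U2 (\<lambda>x y z. eps y \<odot>\<^bsub>U2\<^esub> p2 U H x z) Rr = \<one>\<^bsub>U2\<^esub>"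
    using rc by (simp only: right_comodule_algebra_def Let_def)
  then show ?thesis by (simp add: tsum3_mid)
qed

lemma R_right: "rmap U H (epsr H) Rr = \<one>\<^bsub>U2\<^esub>"
proof -
  have "tsum3 K U2 (\<lambda>x y z. eps z \<odot>\<^bsub>U2\<^esub> p2 U H x y) Rr = \<one>\<^bsub>U2\<^esub>"
    using rc by (simp only: right_comodule_algebra_def Let_def)
  then show ?thesis by (simp add: tsum3_last)
qed

lemma r_mid: "rmap U H (epsl H) rr = \<one>\<^bsub>U2\<^esub>" and r_right: "rmap U H (epsr H) rr = \<one>\<^bsub>U2\<^esub>"
proof -
  have h: "ahom U3 U2 (rmap U H (epsl H))" "ahom U3 U2 (rmap U H (epsr H))"
    by (rule ahom_tmap; simp add: ahom_id)+
  have "rmap U H (epsl H) rr = inv\<^bsub>U2\<^esub> (rmap U H (epsl H) Rr)"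
    by (rule ahom_Units(2)[OF _ _ h(1)]) simp_all
  then show "rmap U H (epsl H) rr = \<one>\<^bsub>U2\<^esub>" by (simp add: R_mid monoid.inv_one[OF aalg_monoid])
  have "rmap U H (epsr H) rr = inv\<^bsub>U2\<^esub> (rmap U H (epsr H) Rr)"
    by (rule ahom_Units(2)[OF _ _ h(2)]) simp_all
  then show "rmap U H (epsr H) rr = \<one>\<^bsub>U2\<^esub>" by (simp add: R_right monoid.inv_one[OF aalg_monoid])
qed

lemma coassocU: "x \<in> carrier U \<Longrightarrow> Rr \<otimes>\<^bsub>U3\<^esub> LU (rho x) = RU (rho x) \<otimes>\<^bsub>U3\<^esub> Rr"
proof -
  assume [simp]: "x \<in> carrier U"
  have "Rr \<otimes>\<^bsub>U3\<^esub> LU (rho x) = split_right K U H H Del (rho x) \<otimes>\<^bsub>U3\<^esub> Rr"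
    using rc by (simp add: right_comodule_algebra_def Let_def)
  then show ?thesis by (simp add: split_right_tmap[where V = H])
qed

lemma coassocU': "x \<in> carrier U \<Longrightarrow> LU (rho x) \<otimes>\<^bsub>U3\<^esub> rr = rr \<otimes>\<^bsub>U3\<^esub> RU (rho x)"
proof -
  assume [simp]: "x \<in> carrier U"
  have "rr \<otimes>\<^bsub>U3\<^esub> (Rr \<otimes>\<^bsub>U3\<^esub> LU (rho x)) \<otimes>\<^bsub>U3\<^esub> rr = rr \<otimes>\<^bsub>U3\<^esub> (RU (rho x) \<otimes>\<^bsub>U3\<^esub> Rr) \<otimes>\<^bsub>U3\<^esub> rr"
    by (simp add: coassocU)
  moreover have "rr \<otimes>\<^bsub>U3\<^esub> (RU (rho x) \<otimes>\<^bsub>U3\<^esub> Rr) \<otimes>\<^bsub>U3\<^esub> rr = rr \<otimes>\<^bsub>U3\<^esub> RU (rho x)"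
    by (simp add: mult_assoc)
  ultimately show ?thesis by (simp add: Units_cancel)
qed

lemma pentagonU:
  "p2 U H3 \<one>\<^bsub>U\<^esub> Ph \<otimes>\<^bsub>U4\<^esub> M2 U Rr \<otimes>\<^bsub>U4\<^esub> appU Rr = M3 U Rr \<otimes>\<^bsub>U4\<^esub> LU4 Rr"
proof -
  have "p2 U H3 \<one>\<^bsub>U\<^esub> Ph \<otimes>\<^bsub>U4\<^esub> split2 K U H H H Del Rr \<otimes>\<^bsub>U4\<^esub> append_one K U H H H Rr
      = split3 K U H H H Del Rr \<otimes>\<^bsub>U4\<^esub> split1 K U H H H rho Rr"
    using rc by (simp only: right_comodule_algebra_def Let_def)
  then show ?thesis
    by (simp add: split1_eq[where U = U] split2_eq[where U = H] split3_eq[where U = H] append_one_app)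
qed

lemma units4:
  "appU Rr \<otimes>\<^bsub>U4\<^esub> appU rr = \<one>\<^bsub>U4\<^esub>"
  "M2 U rr \<otimes>\<^bsub>U4\<^esub> M2 U Rr = \<one>\<^bsub>U4\<^esub>"
  "M3 U rr \<otimes>\<^bsub>U4\<^esub> M3 U Rr = \<one>\<^bsub>U4\<^esub>"
  "LU4 Rr \<otimes>\<^bsub>U4\<^esub> LU4 rr = \<one>\<^bsub>U4\<^esub>"
  "p2 U H3 \<one>\<^bsub>U\<^esub> phi \<otimes>\<^bsub>U4\<^esub> p2 U H3 \<one>\<^bsub>U\<^esub> Ph = \<one>\<^bsub>U4\<^esub>"
      apply (simp add: app_mult)
     apply (simp add: ahom_mult[OF M2U_hom, symmetric] ahom_one[OF M2U_hom])
    apply (simp add: ahom_mult[OF M3U_hom, symmetric] ahom_one[OF M3U_hom])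
   apply (simp add: ahom_mult[OF LU4_hom, symmetric] ahom_one[OF LU4_hom])
  apply (simp flip: tens_one)
  done

text \<open>The pentagon solved for the tensor that arises in \<open>Lam'_qq\<close>. On the new
  side, \<Delta> stands on the left of the last two legs and on the right of the middle ones, where
  \<open>mm\<close> absorbs it.\<close>

lemma pentagonU1: "LU4 Rr \<otimes>\<^bsub>U4\<^esub> appU rr = M3 U rr \<otimes>\<^bsub>U4\<^esub> (p2 U H3 \<one>\<^bsub>U\<^esub> Ph \<otimes>\<^bsub>U4\<^esub> M2 U Rr)"
proof -
  have "M3 U rr \<otimes>\<^bsub>U4\<^esub> (p2 U H3 \<one>\<^bsub>U\<^esub> Ph \<otimes>\<^bsub>U4\<^esub> M2 U Rr) =
      M3 U rr \<otimes>\<^bsub>U4\<^esub> (p2 U H3 \<one>\<^bsub>U\<^esub> Ph \<otimes>\<^bsub>U4\<^esub> M2 U Rr \<otimes>\<^bsub>U4\<^esub> appU Rr) \<otimes>\<^bsub>U4\<^esub> appU rr"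
    by (simp add: mult_assoc units4)
  also have "\<dots> = (M3 U rr \<otimes>\<^bsub>U4\<^esub> M3 U Rr) \<otimes>\<^bsub>U4\<^esub> (LU4 Rr \<otimes>\<^bsub>U4\<^esub> appU rr)"
    by (simp only: pentagonU) (simp add: mult_assoc)
  finally show ?thesis by (simp add: units4)
qed

text \<open>The analogous rearrangement for \<open>Lam_pp\<close>: \<Delta> now stands on the left
  of the middle legs and on the right of the last two, where \<open>mi\<close> absorbs it.\<close>

lemma pentagonU2: "appU Rr \<otimes>\<^bsub>U4\<^esub> LU4 rr = M2 U rr \<otimes>\<^bsub>U4\<^esub> (p2 U H3 \<one>\<^bsub>U\<^esub> phi \<otimes>\<^bsub>U4\<^esub> M3 U Rr)"
proof -
  have "M2 U rr \<otimes>\<^bsub>U4\<^esub> (p2 U H3 \<one>\<^bsub>U\<^esub> phi \<otimes>\<^bsub>U4\<^esub> M3 U Rr) =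
      M2 U rr \<otimes>\<^bsub>U4\<^esub> (p2 U H3 \<one>\<^bsub>U\<^esub> phi \<otimes>\<^bsub>U4\<^esub> (M3 U Rr \<otimes>\<^bsub>U4\<^esub> LU4 Rr) \<otimes>\<^bsub>U4\<^esub> LU4 rr)"
    by (simp add: mult_assoc units4 del: tens_mult_pure)
  also have "\<dots> = M2 U rr \<otimes>\<^bsub>U4\<^esub> ((p2 U H3 \<one>\<^bsub>U\<^esub> phi \<otimes>\<^bsub>U4\<^esub> p2 U H3 \<one>\<^bsub>U\<^esub> Ph) \<otimes>\<^bsub>U4\<^esub> (M2 U Rr \<otimes>\<^bsub>U4\<^esub> appU Rr \<otimes>\<^bsub>U4\<^esub> LU4 rr))"
    by (simp only: pentagonU[symmetric]) (simp add: mult_assoc del: tens_mult_pure)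
  also have "\<dots> = (M2 U rr \<otimes>\<^bsub>U4\<^esub> M2 U Rr) \<otimes>\<^bsub>U4\<^esub> (appU Rr \<otimes>\<^bsub>U4\<^esub> LU4 rr)"
    by (simp only: units4(5)) (simp add: mult_assoc)
  finally show ?thesis by (simp add: units4)
qed

text \<open>The canonical elements of Hausser and Nill:
  \<open>q\<^sub>\<rho> = X\<^sup>1 \<otimes> S\<^sup>-\<^sup>1(\<alpha> X\<^sup>3) X\<^sup>2\<close> and \<open>p\<^sub>\<rho> = x\<^sup>1 \<otimes> x\<^sup>2 \<beta> S(x\<^sup>3)\<close>.\<close>

definition qq where "qq = rmap U H m1 Rr"
definition pp where "pp = rmap U H mb rr"

lemma qq_closed [simp, lins]: "qq \<in> carrier U2" and pp_closed [simp, lins]: "pp \<in> carrier U2"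
  by (simp_all add: qq_def pp_def)

text \<open>These are \<open>mu\<close> and \<open>nu\<close> at the level of coefficients in U
  \<otimes> H, see \<open>mu_act_Si\<close> and \<open>nu_act\<close>. That \<open>mu\<close> and
  \<open>nu\<close> are mutually inverse comes down to \<open>Lam pp\<close> and
  \<open>Lam' qq\<close> being 1.\<close>

definition Lam where "Lam = tsum K U2 (\<lambda>u h. p2 U H \<one>\<^bsub>U\<^esub> (Si h) \<otimes>\<^bsub>U2\<^esub> qq \<otimes>\<^bsub>U2\<^esub> rho u)"
definition Lam' where "Lam' = tsum K U2 (\<lambda>u h. rho u \<otimes>\<^bsub>U2\<^esub> pp \<otimes>\<^bsub>U2\<^esub> p2 U H \<one>\<^bsub>U\<^esub> (Sa h))"

lemma Lam_lin [simp]: "lin U2 U2 Lam" and Lam'_lin [simp]: "lin U2 U2 Lam'"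
  unfolding Lam_def Lam'_def by ((assumption | rule lins | simp)+)[2]

lemmas [lins] = lin_comp[OF Lam_lin] lin_comp[OF Lam'_lin]
lemmas Lam_closed [simp, lins] = lin_closed[OF Lam_lin] lin_closed[OF Lam'_lin]

lemma Lam_pure [simp]: "u \<in> carrier U \<Longrightarrow> h \<in> carrier H \<Longrightarrow> Lam (p2 U H u h) = p2 U H \<one>\<^bsub>U\<^esub> (Si h) \<otimes>\<^bsub>U2\<^esub> qq \<otimes>\<^bsub>U2\<^esub> rho u"
  unfolding Lam_def by (rule tsum_pure[where V = U and W = H]) (assumption | rule lins | simp)+

lemma Lam'_pure [simp]: "u \<in> carrier U \<Longrightarrow> h \<in> carrier H \<Longrightarrow> Lam' (p2 U H u h) = rho u \<otimes>\<^bsub>U2\<^esub> pp \<otimes>\<^bsub>U2\<^esub> p2 U H \<one>\<^bsub>U\<^esub> (Sa h)"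
  unfolding Lam'_def by (rule tsum_pure[where V = U and W = H]) (assumption | rule lins | simp)+

text \<open>\<open>Lam\<close> is the contraction of \<Phi>_\<rho> (\<rho> \<otimes> id)(w). For w =
  \<rho>(x), quasi-coassociativity moves a factor (id \<otimes> \<Delta>)(\<rho>(x)) to the left,
  and \<open>m1\<close> absorbs its \<Delta>.\<close>

lemma Lam_rho:
  assumes [simp]: "x \<in> carrier U"
  shows "Lam (rho x) = p2 U H x \<one>\<^bsub>H\<^esub> \<otimes>\<^bsub>U2\<^esub> qq"
proof -
  have "Lam w = rmap U H m1 (Rr \<otimes>\<^bsub>U3\<^esub> LU w)" if w: "w \<in> carrier U2" for w
    by (rule ext2[OF w, where Z = U2]) (assumption | rule lins | simp add: rmap_m1_ap qq_def)+
  then show ?thesis by (simp add: coassocU rmap_m1_Del qq_def)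
qed

text \<open>The mirror image of \<open>Lam_rho\<close>, with the inverse of \<Phi>_\<rho> and with
  \<open>mb\<close> absorbing from the right.\<close>

lemma Lam'_rho:
  assumes [simp]: "x \<in> carrier U"
  shows "Lam' (rho x) = pp \<otimes>\<^bsub>U2\<^esub> p2 U H x \<one>\<^bsub>H\<^esub>"
proof -
  have "Lam' w = rmap U H mb (LU w \<otimes>\<^bsub>U3\<^esub> rr)" if w: "w \<in> carrier U2" for w
    by (rule ext2[OF w, where Z = U2]) (assumption | rule lins | simp add: rmap_mb_ap pp_def)+
  then show ?thesis by (simp add: coassocU' rmap_mb_Del pp_def)
qed

lemma const_left_lin [simp]: "aalg A \<Longrightarrow> vs V \<Longrightarrow> lin V (A \<boxtimes> V) (p2 A V \<one>\<^bsub>A\<^esub>)"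
  and const_right_lin [simp]: "aalg A \<Longrightarrow> vs V \<Longrightarrow> lin V (V \<boxtimes> A) (\<lambda>v. p2 V A v \<one>\<^bsub>A\<^esub>)"
  by (assumption | rule lins | simp)+

abbreviation P where "P \<equiv> rmap U H mm"

lemma P_ap:
  assumes t [simp]: "t \<in> carrier U3" and z [simp]: "z \<in> carrier U2" and w [simp]: "w \<in> carrier H2"
  shows "P (apU4 z w \<otimes>\<^bsub>U4\<^esub> appU t) = z \<otimes>\<^bsub>U2\<^esub> rmap U H mb t \<otimes>\<^bsub>U2\<^esub> p2 U H \<one>\<^bsub>U\<^esub> (mS w)" (is "?l t z w = ?r t z w")
proof (rule ext3[OF t, where Z = U2])
  fix a b c assume [simp]: "a \<in> carrier U" "b \<in> carrier H" "c \<in> carrier H"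
  let ?t = "p2 U H2 a (p2 H H b c)"
  show "?l ?t z w = ?r ?t z w"
  proof (rule ext2[OF z, where Z = U2])
    fix x y assume [simp]: "x \<in> carrier U" "y \<in> carrier H"
    show "?l ?t (p2 U H x y) w = ?r ?t (p2 U H x y) w"
      by (rule ext2[OF w, where Z = U2]) (assumption | rule lins | simp add: mult_assoc)+
  qed (assumption | rule lins | simp)+
qed (assumption | rule lins | simp)+

lemma P_M3:
  assumes s [simp]: "s \<in> carrier U3" and t [simp]: "t \<in> carrier U4"
  shows "P (M3 U s \<otimes>\<^bsub>U4\<^esub> t) = P (rmap U H3 (\<lambda>v. p2 H H2 v \<one>\<^bsub>H2\<^esub>) (rmap U H (epsr H) s) \<otimes>\<^bsub>U4\<^esub> t)" (is "?l s t = ?r s t")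
proof (rule ext3[OF s, where Z = U2])
  fix u v w assume [simp]: "u \<in> carrier U" "v \<in> carrier H" "w \<in> carrier H"
  let ?s = "p2 U H2 u (p2 H H v w)"
  have [simp]: "lin U4 U2 P" by (assumption | rule lins | simp)+
  note [simp] = lin_smult[of U4 U2 P]
  show "?l ?s t = ?r ?s t"
    by (rule ext3[OF t, where Z = U2]) (assumption | rule lins s t | simp)+
qed (assumption | rule lins s t | simp)+

lemma P_M2:
  assumes s [simp]: "s \<in> carrier U3" and r [simp]: "r \<in> carrier H3"
  shows "P (p2 U H3 \<one>\<^bsub>U\<^esub> r \<otimes>\<^bsub>U4\<^esub> M2 U s) = rmap U H (\<lambda>w. mm r \<otimes>\<^bsub>H\<^esub> w) (rmap U H (epsl H) s)"
proof -
  have [simp]: "lin H H (\<lambda>w. mm r \<otimes>\<^bsub>H\<^esub> w)" by (assumption | rule lins | simp)+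
  show ?thesis
    by (rule ext3[OF s, where Z = U2]) (assumption | rule lins | simp)+
qed

lemma rmap_one: "aalg A \<Longrightarrow> aalg B \<Longrightarrow> aalg C \<Longrightarrow> lin B C g \<Longrightarrow> g \<one>\<^bsub>B\<^esub> = \<one>\<^bsub>C\<^esub> \<Longrightarrow> rmap A C g \<one>\<^bsub>A \<boxtimes> B\<^esub> = \<one>\<^bsub>A \<boxtimes> C\<^esub>"
  by (simp add: tens_one)

text \<open>\<open>Lam'\<close> after the contraction that forms q is the contraction
  \<open>mm\<close> of (\<rho> \<otimes> id \<otimes> id)(\<Phi>_\<rho>) (\<Phi>_\<rho>^-1 \<otimes>
  1), because applying S to S^-1(\<alpha> d) c restores S(c) \<alpha> d. After
  \<open>pentagonU1\<close> the normalisations of \<Phi>_\<rho> and \<open>mm_Ph\<close> leave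
  1.\<close>

lemma Lam'_qq: "Lam' qq = \<one>\<^bsub>U2\<^esub>"
proof -
  have "Lam' (rmap U H m1 s) = P (LU4 s \<otimes>\<^bsub>U4\<^esub> appU rr)" if s: "s \<in> carrier U3" for s
    by (rule ext2[OF s, where Z = U2]) (assumption | rule lins | simp add: P_ap pp_def)+
  then have "Lam' qq = P (M3 U rr \<otimes>\<^bsub>U4\<^esub> (p2 U H3 \<one>\<^bsub>U\<^esub> Ph \<otimes>\<^bsub>U4\<^esub> M2 U Rr))"
    by (simp add: qq_def pentagonU1)
  also have "\<dots> = P (p2 U H3 \<one>\<^bsub>U\<^esub> Ph \<otimes>\<^bsub>U4\<^esub> M2 U Rr)"
  proof -
    have "rmap U H3 (\<lambda>v. p2 H H2 v \<one>\<^bsub>H2\<^esub>) \<one>\<^bsub>U2\<^esub> = \<one>\<^bsub>U4\<^esub>"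
      by (rule rmap_one) (simp_all flip: tens_one)
    then show ?thesis by (simp add: P_M3 r_right)
  qed
  also have "\<dots> = rmap U H (\<lambda>w. mm Ph \<otimes>\<^bsub>H\<^esub> w) \<one>\<^bsub>U2\<^esub>"
    by (simp only: P_M2 R_closed Ph_closed R_mid)
  also have "\<dots> = \<one>\<^bsub>U2\<^esub>"
    by (rule rmap_one) (assumption | rule lins | simp)+
  finally show ?thesis .
qed

text \<open>The outer S^-1 undoes the S on the first leg, so that this leg can multiply freely from
  the right, as \<open>Lam\<close> requires.\<close>

definition mi where "mi s = Si (mm' s)"

lemma mi_lin [simp]: "lin H3 H mi"
  unfolding mi_def[abs_def] by (assumption | rule lins | simp)+

lemmas [lins] = lin_comp[OF mi_lin]
lemmas mi_closed [simp, lins] = lin_closed[OF mi_lin]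

lemma mi_pure [simp]: "b \<in> carrier H \<Longrightarrow> s \<in> carrier H2 \<Longrightarrow> mi (p2 H H2 b s) = Si (mb s) \<otimes>\<^bsub>H\<^esub> (Si al \<otimes>\<^bsub>H\<^esub> b)"
  by (simp add: mi_def)

abbreviation P' where "P' \<equiv> rmap U H mi"

lemma P'_ap:
  assumes t [simp]: "t \<in> carrier U3" and z [simp]: "z \<in> carrier U2" and w [simp]: "w \<in> carrier H2"
  shows "P' (appU t \<otimes>\<^bsub>U4\<^esub> apU4 z w) = p2 U H \<one>\<^bsub>U\<^esub> (Si (mb w)) \<otimes>\<^bsub>U2\<^esub> rmap U H m1 t \<otimes>\<^bsub>U2\<^esub> z" (is "?l t z w = ?r t z w")
proof (rule ext3[OF t, where Z = U2])
  fix a b c assume [simp]: "a \<in> carrier U" "b \<in> carrier H" "c \<in> carrier H"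
  let ?t = "p2 U H2 a (p2 H H b c)"
  show "?l ?t z w = ?r ?t z w"
  proof (rule ext2[OF z, where Z = U2])
    fix x y assume [simp]: "x \<in> carrier U" "y \<in> carrier H"
    show "?l ?t (p2 U H x y) w = ?r ?t (p2 U H x y) w"
      by (rule ext2[OF w, where Z = U2]) (assumption | rule lins | simp add: mult_assoc)+
  qed (assumption | rule lins | simp)+
qed (assumption | rule lins | simp)+

lemma mi_ap_Del:
  assumes [simp]: "b \<in> carrier H" "c \<in> carrier H" "d \<in> carrier H" "k \<in> carrier H" "v \<in> carrier H"
  shows "mi (ap3 (Del v) k \<otimes>\<^bsub>H3\<^esub> p2 H H2 b (p2 H H c d)) = eps v \<odot>\<^bsub>H\<^esub> mi (p2 H H2 b (p2 H H c (k \<otimes>\<^bsub>H\<^esub> d)))"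
proof -
  have "mi (ap3 x k \<otimes>\<^bsub>H3\<^esub> p2 H H2 b (p2 H H c d)) = Si (mS (x \<otimes>\<^bsub>H2\<^esub> p2 H H b c) \<otimes>\<^bsub>H\<^esub> be \<otimes>\<^bsub>H\<^esub> Sa d \<otimes>\<^bsub>H\<^esub> Sa k)"
    if x: "x \<in> carrier H2" for x
    by (rule ext2[OF x, where Z = H]) (assumption | rule lins | simp add: mult_assoc)+
  then show ?thesis by (simp add: mult_assoc)
qed

lemma P'_M2:
  assumes s [simp]: "s \<in> carrier U3" and t [simp]: "t \<in> carrier U4"
  shows "P' (M2 U s \<otimes>\<^bsub>U4\<^esub> t) = P' (rmap U H3 (\<lambda>w. p2 H H2 \<one>\<^bsub>H\<^esub> (p2 H H \<one>\<^bsub>H\<^esub> w)) (rmap U H (epsl H) s) \<otimes>\<^bsub>U4\<^esub> t)" (is "?l s t = ?r s t")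
proof (rule ext3[OF s, where Z = U2])
  have [simp]: "lin H H3 (\<lambda>w. p2 H H2 \<one>\<^bsub>H\<^esub> (p2 H H \<one>\<^bsub>H\<^esub> w))" by (assumption | rule lins | simp)+
  fix u v w assume [simp]: "u \<in> carrier U" "v \<in> carrier H" "w \<in> carrier H"
  let ?s = "p2 U H2 u (p2 H H v w)"
  have [simp]: "lin U4 U2 P'" by (assumption | rule lins | simp)+
  note [simp] = lin_smult[of U4 U2 P']
  show "?l ?s t = ?r ?s t"
    by (rule ext4[OF t, where Z = U2]) (assumption | rule lins s t | simp add: mi_ap_Del del: mi_pure | simp)+
qed (assumption | rule lins s t | simp)+

lemma P'_M3:
  assumes s [simp]: "s \<in> carrier U3" and r [simp]: "r \<in> carrier H3"
  shows "P' (p2 U H3 \<one>\<^bsub>U\<^esub> r \<otimes>\<^bsub>U4\<^esub> M3 U s) = rmap U H (\<lambda>v. Si (Sa v \<otimes>\<^bsub>H\<^esub> mm' r)) (rmap U H (epsr H) s)"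
proof -
  have [simp]: "lin H H (\<lambda>v. Si (mm' r) \<otimes>\<^bsub>H\<^esub> v)" by (assumption | rule lins | simp)+
  have l [simp]: "lin H H (\<lambda>v. Si (Sa v \<otimes>\<^bsub>H\<^esub> mm' r))" by (assumption | rule lins | simp)+
  have m: "mi (r \<otimes>\<^bsub>H3\<^esub> p2 H H2 v (Del w)) = eps w \<odot>\<^bsub>H\<^esub> Si (Sa v \<otimes>\<^bsub>H\<^esub> mm' r)"
    if [simp]: "v \<in> carrier H" "w \<in> carrier H" for v w
    by (rule ext2[OF r, where Z = H]) (assumption | rule lins | simp add: mult_assoc)+
  show ?thesis
    by (rule ext3[OF s, where Z = U2]) (assumption | rule lins | simp add: m del: Si_mult | simp)+
qed

text \<open>The scheme of \<open>Lam'_qq\<close> with all sides exchanged: \<open>mi\<close>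
  contracts (\<Phi>_\<rho> \<otimes> 1)(\<rho> \<otimes> id \<otimes> id)(\<Phi>_\<rho>^-1),
  \<open>pentagonU2\<close> rewrites this tensor, and \<open>mm'_phi\<close> ends the
  computation.\<close>

lemma Lam_pp: "Lam pp = \<one>\<^bsub>U2\<^esub>"
proof -
  have "Lam (rmap U H mb s) = P' (appU Rr \<otimes>\<^bsub>U4\<^esub> LU4 s)" if s: "s \<in> carrier U3" for s
    by (rule ext2[OF s, where Z = U2]) (assumption | rule lins | simp add: P'_ap qq_def)+
  then have "Lam pp = P' (M2 U rr \<otimes>\<^bsub>U4\<^esub> (p2 U H3 \<one>\<^bsub>U\<^esub> phi \<otimes>\<^bsub>U4\<^esub> M3 U Rr))"
    by (simp add: pp_def pentagonU2)
  also have "\<dots> = P' (p2 U H3 \<one>\<^bsub>U\<^esub> phi \<otimes>\<^bsub>U4\<^esub> M3 U Rr)"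
  proof -
    have "lin H H3 (\<lambda>w. p2 H H2 \<one>\<^bsub>H\<^esub> (p2 H H \<one>\<^bsub>H\<^esub> w))" by (assumption | rule lins | simp)+
    then have "rmap U H3 (\<lambda>w. p2 H H2 \<one>\<^bsub>H\<^esub> (p2 H H \<one>\<^bsub>H\<^esub> w)) \<one>\<^bsub>U2\<^esub> = \<one>\<^bsub>U4\<^esub>"
      by (intro rmap_one) (simp_all add: tens_one)
    then show ?thesis by (simp add: P'_M2 r_mid)
  qed
  also have "\<dots> = rmap U H (\<lambda>v. Si (Sa v \<otimes>\<^bsub>H\<^esub> mm' phi)) \<one>\<^bsub>U2\<^esub>"
    by (simp only: P'_M3 R_closed Ph_closed R_right)
  also have "\<dots> = \<one>\<^bsub>U2\<^esub>"
    by (rule rmap_one) (assumption | rule lins | simp)+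
  finally show ?thesis .
qed

section \<open>Comultiplication of the canonical element\<close>

text \<open>The effect of \<open>mu\<close> on the coefficients of a product of two elements of B,
  see \<open>mu_act2\<close>; the \<Delta> is caused by acting on a product.\<close>

definition RR where "RR = tsum K U3 (\<lambda>u e. p2 U H2 \<one>\<^bsub>U\<^esub> e \<otimes>\<^bsub>U3\<^esub> RU (qq \<otimes>\<^bsub>U2\<^esub> rho u))"

lemma RR_lin [simp]: "lin U3 U3 RR"
  unfolding RR_def by (assumption | rule lins | simp)+

lemmas [lins] = lin_comp[OF RR_lin]

lemma RR_pure [simp]: "u \<in> carrier U \<Longrightarrow> e \<in> carrier H2 \<Longrightarrow> RR (p2 U H2 u e) = p2 U H2 \<one>\<^bsub>U\<^esub> e \<otimes>\<^bsub>U3\<^esub> RU (qq \<otimes>\<^bsub>U2\<^esub> rho u)"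
  unfolding RR_def by (rule tsum_pure[where V = U and W = H2]) (assumption | rule lins | simp)+

lemma tw_map_lin [simp]: "lin H2 H2 (\<lambda>w. F1 (tw \<otimes>\<^bsub>H2\<^esub> w))"
  by (assumption | rule lins | simp)+

text \<open>\<open>F1_twist\<close> replaces f by \<gamma> and \<open>Q0_phi\<close> turns \<gamma>
  into \<Phi>^-1. At s = \<Phi>_\<rho> the argument of \<open>Q0\<close> becomes one side of the
  pentagon multiplied by 1 \<otimes> \<Phi>^-1.\<close>

lemma RR_eq:
  assumes s [simp]: "s \<in> carrier U3"
  shows "RR (rmap U H2 (\<lambda>w. F1 (tw \<otimes>\<^bsub>H2\<^esub> w)) s) = rmap U H2 Q0 (p2 U H3 \<one>\<^bsub>U\<^esub> phi \<otimes>\<^bsub>U4\<^esub> M3 U Rr \<otimes>\<^bsub>U4\<^esub> LU4 s)"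
proof -
  \<comment> \<open>The copy of \<Phi>_\<rho> inside q and the coaction \<rho>(u) are relaxed to v
    and z, so that both can be taken pure.\<close>
  have key: "p2 U H2 \<one>\<^bsub>U\<^esub> (F1 (tw \<otimes>\<^bsub>H2\<^esub> w)) \<otimes>\<^bsub>U3\<^esub> RU (rmap U H m1 v \<otimes>\<^bsub>U2\<^esub> z) =
      rmap U H2 Q0 (p2 U H3 \<one>\<^bsub>U\<^esub> phi \<otimes>\<^bsub>U4\<^esub> M3 U v \<otimes>\<^bsub>U4\<^esub> apU4 z w)" (is "?l v z = ?r v z")
    if v [simp]: "v \<in> carrier U3" and z [simp]: "z \<in> carrier U2" and [simp]: "w \<in> carrier H2" for v z w
  proof (rule ext3[OF v, where Z = U3])
    fix a b c assume [simp]: "a \<in> carrier U" "b \<in> carrier H" "c \<in> carrier H"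
    let ?v = "p2 U H2 a (p2 H H b c)"
    show "?l ?v z = ?r ?v z"
    proof (rule ext2[OF z, where Z = U3])
      fix x y assume [simp]: "x \<in> carrier U" "y \<in> carrier H"
      have "F1 (tw \<otimes>\<^bsub>H2\<^esub> w) \<otimes>\<^bsub>H2\<^esub> (Del (m1 (p2 H H b c)) \<otimes>\<^bsub>H2\<^esub> Del y) =
          F1 (gam \<otimes>\<^bsub>H2\<^esub> (Del c \<otimes>\<^bsub>H2\<^esub> w)) \<otimes>\<^bsub>H2\<^esub> Del (b \<otimes>\<^bsub>H\<^esub> y)"
        using F1_twist[of w b c] by (simp add: mult_assoc[symmetric] del: m1_pure)
      also have "\<dots> = Q0 (phi \<otimes>\<^bsub>H3\<^esub> p2 H H2 (b \<otimes>\<^bsub>H\<^esub> y) (Del c \<otimes>\<^bsub>H2\<^esub> w))"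
        by (rule Q0_phi) simp_all
      finally show "?l ?v (p2 U H x y) = ?r ?v (p2 U H x y)"
        by (simp add: mult_assoc del: m1_pure)
    qed (assumption | rule lins v z | simp)+
  qed (assumption | rule lins v z | simp)+
  show ?thesis
    by (rule ext2[OF s, where Z = U3]) (assumption | rule lins | simp add: key[OF R_closed(1), folded qq_def])+
qed

text \<open>The middle legs of the left factor form \<Delta>(v) \<otimes> w, to which
  \<open>Q0_ap3\<close> applies; the contraction falls apart into one of s and one of t.\<close>

lemma Q0_M2:
  assumes s [simp]: "s \<in> carrier U3" and t [simp]: "t \<in> carrier U3"
  shows "rmap U H2 Q0 (M2 U s \<otimes>\<^bsub>U4\<^esub> appU t) = apU (rmap U H m1 s) \<one>\<^bsub>H\<^esub> \<otimes>\<^bsub>U3\<^esub> rmap U H2 nn t" (is "?l s t = ?r s t")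
proof (rule ext3[OF s, where Z = U3])
  fix u v w assume [simp]: "u \<in> carrier U" "v \<in> carrier H" "w \<in> carrier H"
  let ?s = "p2 U H2 u (p2 H H v w)"
  show "?l ?s t = ?r ?s t"
    by (rule ext3[OF t, where Z = U3]) (assumption | rule lins s t | simp add: Q0_ap3)+
qed (assumption | rule lins s t | simp)+

abbreviation Q2 where "Q2 \<equiv> rmap U H2 (rmap H H m1)"

lemma Q2_app:
  assumes t [simp]: "t \<in> carrier U4" and s [simp]: "s \<in> carrier U3"
  shows "Q2 (t \<otimes>\<^bsub>U4\<^esub> appU s) = Q2 t \<otimes>\<^bsub>U3\<^esub> s" (is "?l t s = ?r t s")
proof (rule ext4[OF t, where Z = U3])
  fix a b c d assume [simp]: "a \<in> carrier U" "b \<in> carrier H" "c \<in> carrier H" "d \<in> carrier H"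
  let ?t = "p2 U H3 a (p2 H H2 b (p2 H H c d))"
  show "?l ?t s = ?r ?t s"
    by (rule ext3[OF s, where Z = U3]) (assumption | rule lins s t | simp add: mult_assoc)+
qed (assumption | rule lins s t | simp)+

lemma Q2_M3:
  assumes s [simp]: "s \<in> carrier U3" and t [simp]: "t \<in> carrier U4"
  shows "Q2 (M3 U s \<otimes>\<^bsub>U4\<^esub> t) = rmap U H2 (\<lambda>v. p2 H H v \<one>\<^bsub>H\<^esub>) (rmap U H (epsr H) s) \<otimes>\<^bsub>U3\<^esub> Q2 t" (is "?l s t = ?r s t")
proof (rule ext3[OF s, where Z = U3])
  fix u v w assume [simp]: "u \<in> carrier U" "v \<in> carrier H" "w \<in> carrier H"
  let ?s = "p2 U H2 u (p2 H H v w)"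
  show "?l ?s t = ?r ?s t"
    by (rule ext3[OF t, where Z = U3]) (assumption | rule lins s t | simp)+
qed (assumption | rule lins s t | simp)+

text \<open>After multiplication by \<Phi>_\<rho> on the right, the left-hand side is one side of
  the pentagon contracted in its last two legs. On the other side \<open>m1\<close> absorbs the
  \<Delta>, and (\<rho> \<otimes> id)(q) remains.\<close>

lemma nn_R: "rmap U H2 nn Rr = LU qq \<otimes>\<^bsub>U3\<^esub> rr"
proof -
  have 1: "rmap U H2 nn s = Q2 (p2 U H3 \<one>\<^bsub>U\<^esub> Ph \<otimes>\<^bsub>U4\<^esub> M2 U s)" if s: "s \<in> carrier U3" for s
  proof (rule ext2[OF s, where Z = U3])
    fix u w assume [simp]: "u \<in> carrier U" "w \<in> carrier H2"
    show "rmap U H2 nn (p2 U H2 u w) = Q2 (p2 U H3 \<one>\<^bsub>U\<^esub> Ph \<otimes>\<^bsub>U4\<^esub> M2 U (p2 U H2 u w))"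
      by simp (rule arg_cong[where f = "p2 U H2 u"], rule nn_def)
  qed (assumption | rule lins | simp)+
  have 2: "Q2 (LU4 s) = LU (rmap U H m1 s)" if s: "s \<in> carrier U3" for s
  proof -
    have i: "Q2 (apU4 z w) = apU z (m1 w)" if z: "z \<in> carrier U2" and [simp]: "w \<in> carrier H2" for z w
      by (rule ext2[OF z, where Z = U3]) (assumption | rule lins | simp)+
    show ?thesis
      by (rule ext2[OF s, where Z = U3]) (assumption | rule lins | simp add: i)+
  qed
  have "rmap U H2 nn Rr \<otimes>\<^bsub>U3\<^esub> Rr = Q2 (p2 U H3 \<one>\<^bsub>U\<^esub> Ph \<otimes>\<^bsub>U4\<^esub> M2 U Rr \<otimes>\<^bsub>U4\<^esub> appU Rr)"
    by (subst Q2_app) (simp_all add: 1)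
  also have "\<dots> = rmap U H2 (\<lambda>v. p2 H H v \<one>\<^bsub>H\<^esub>) \<one>\<^bsub>U2\<^esub> \<otimes>\<^bsub>U3\<^esub> LU qq"
    by (simp add: pentagonU Q2_M3 R_right 2 qq_def)
  also have "\<dots> = LU qq"
    by (subst rmap_one) (simp_all add: tens_one[of H H])
  finally have "rmap U H2 nn Rr \<otimes>\<^bsub>U3\<^esub> Rr \<otimes>\<^bsub>U3\<^esub> rr = LU qq \<otimes>\<^bsub>U3\<^esub> rr" by simp
  moreover have "rmap U H2 nn Rr \<in> carrier U3" by (assumption | rule lins | simp)+
  ultimately show ?thesis by (simp add: Units_cancel)
qed

text \<open>The pentagon cancels the \<Phi>^-1 left by \<open>RR_eq\<close>, and
  \<open>Q0_M2\<close> with \<open>nn_R\<close> evaluates the two resulting factors. In legs: (1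
  \<otimes> S^-1(f2 X3) \<otimes> S^-1(f1 X2)) (id \<otimes> \<Delta>)(q \<rho>(X1)) = (q \<otimes>
  1)(\<rho> \<otimes> id)(q) \<Phi>_\<rho>^-1.\<close>

lemma starstar: "RR (rmap U H2 (\<lambda>w. F1 (tw \<otimes>\<^bsub>H2\<^esub> w)) Rr) = apU qq \<one>\<^bsub>H\<^esub> \<otimes>\<^bsub>U3\<^esub> LU qq \<otimes>\<^bsub>U3\<^esub> rr"
proof -
  have "p2 U H3 \<one>\<^bsub>U\<^esub> phi \<otimes>\<^bsub>U4\<^esub> (M3 U Rr \<otimes>\<^bsub>U4\<^esub> LU4 Rr) =
      (p2 U H3 \<one>\<^bsub>U\<^esub> phi \<otimes>\<^bsub>U4\<^esub> p2 U H3 \<one>\<^bsub>U\<^esub> Ph) \<otimes>\<^bsub>U4\<^esub> (M2 U Rr \<otimes>\<^bsub>U4\<^esub> appU Rr)"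
    by (simp only: pentagonU[symmetric]) (simp add: mult_assoc del: tens_mult_pure)
  then have "RR (rmap U H2 (\<lambda>w. F1 (tw \<otimes>\<^bsub>H2\<^esub> w)) Rr) = rmap U H2 Q0 (M2 U Rr \<otimes>\<^bsub>U4\<^esub> appU Rr)"
    by (simp only: RR_eq R_closed units4) (simp add: mult_assoc)
  then show ?thesis by (simp add: Q0_M2 nn_R qq_def mult_assoc)
qed

text \<open>\<open>Wc x x'\<close> collects the legs in \<open>U \<otimes> H \<otimes> H\<close> of the product \<open>(b \<otimes> x)(b' \<otimes> x')\<close> in the
  diagonal crossed product.\<close>

definition Wc where "Wc x x' = tsum K U3 (\<lambda>x0 x1. tsum K U3 (\<lambda>X w.
   p2 U H2 (X \<otimes>\<^bsub>U\<^esub> x0 \<otimes>\<^bsub>U\<^esub> x') (p2 H H \<one>\<^bsub>H\<^esub> (Si x1) \<otimes>\<^bsub>H2\<^esub> F1 (tw \<otimes>\<^bsub>H2\<^esub> w))) Rr) (rho x)"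

lemma ap_commute:
  assumes z: "z \<in> carrier U2" and [simp]: "k \<in> carrier H"
  shows "p2 U H2 \<one>\<^bsub>U\<^esub> (p2 H H \<one>\<^bsub>H\<^esub> k) \<otimes>\<^bsub>U3\<^esub> apU z \<one>\<^bsub>H\<^esub> = apU z \<one>\<^bsub>H\<^esub> \<otimes>\<^bsub>U3\<^esub> p2 U H2 \<one>\<^bsub>U\<^esub> (p2 H H \<one>\<^bsub>H\<^esub> k)"
  by (rule ext2[OF z, where Z = U3]) (assumption | rule lins | simp)+

lemma RR_mult:
  assumes t: "t \<in> carrier U3" and [simp]: "y \<in> carrier U" "e \<in> carrier H2"
  shows "RR (p2 U H2 \<one>\<^bsub>U\<^esub> e \<otimes>\<^bsub>U3\<^esub> t \<otimes>\<^bsub>U3\<^esub> p2 U H2 y \<one>\<^bsub>H2\<^esub>) = p2 U H2 \<one>\<^bsub>U\<^esub> e \<otimes>\<^bsub>U3\<^esub> RR t \<otimes>\<^bsub>U3\<^esub> RU (rho y)"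
proof (rule ext2[OF t, where Z = U3])
  fix a b assume [simp]: "a \<in> carrier U" "b \<in> carrier H2"
  show "RR (p2 U H2 \<one>\<^bsub>U\<^esub> e \<otimes>\<^bsub>U3\<^esub> p2 U H2 a b \<otimes>\<^bsub>U3\<^esub> p2 U H2 y \<one>\<^bsub>H2\<^esub>) =
      p2 U H2 \<one>\<^bsub>U\<^esub> e \<otimes>\<^bsub>U3\<^esub> RR (p2 U H2 a b) \<otimes>\<^bsub>U3\<^esub> RU (rho y)"
    by (simp add: ahom_mult[OF RU_hom]) (simp add: mult_assoc[symmetric])
qed (assumption | rule lins t | simp)+

text \<open>A component x0 \<otimes> x1 of \<rho>(x) adds S^-1(x1) on the left of
  \<open>starstar\<close> and x0 on its right. The first commutes with q \<otimes> 1, the second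
  crosses \<Phi>_\<rho>^-1 by quasi-coassociativity; they meet around (\<rho> \<otimes> id)(q) as a
  value of \<open>Lam\<close>, and \<open>Lam_rho\<close> sums it up.\<close>

lemma RR_Wc:
  assumes [simp]: "x \<in> carrier U" "x' \<in> carrier U"
  shows "RR (Wc x x') = apU (qq \<otimes>\<^bsub>U2\<^esub> rho x) \<one>\<^bsub>H\<^esub> \<otimes>\<^bsub>U3\<^esub> LU (qq \<otimes>\<^bsub>U2\<^esub> rho x') \<otimes>\<^bsub>U3\<^esub> rr"
proof -
  let ?V = "rmap U H2 (\<lambda>w. F1 (tw \<otimes>\<^bsub>H2\<^esub> w))"
  have [simp]: "?V Rr \<in> carrier U3" by (assumption | rule lins | simp)+
  have [simp]: "lin H2 H2 (\<lambda>w. p2 H H \<one>\<^bsub>H\<^esub> (Si h) \<otimes>\<^bsub>H2\<^esub> F1 (tw \<otimes>\<^bsub>H2\<^esub> w))" if [simp]: "h \<in> carrier H" for h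
    by (assumption | rule lins | simp)+
  have inner: "tsum K U3 (\<lambda>X w. p2 U H2 (X \<otimes>\<^bsub>U\<^esub> u \<otimes>\<^bsub>U\<^esub> x') (p2 H H \<one>\<^bsub>H\<^esub> (Si h) \<otimes>\<^bsub>H2\<^esub> F1 (tw \<otimes>\<^bsub>H2\<^esub> w))) s =
      p2 U H2 \<one>\<^bsub>U\<^esub> (p2 H H \<one>\<^bsub>H\<^esub> (Si h)) \<otimes>\<^bsub>U3\<^esub> ?V s \<otimes>\<^bsub>U3\<^esub> p2 U H2 (u \<otimes>\<^bsub>U\<^esub> x') \<one>\<^bsub>H2\<^esub>"
    if [simp]: "u \<in> carrier U" "h \<in> carrier H" and s: "s \<in> carrier U3" for u h s
  proof (rule ext2[OF s, where Z = U3])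
    fix a b assume [simp]: "a \<in> carrier U" "b \<in> carrier H2"
    have "tsum K U3 (\<lambda>X w. p2 U H2 (X \<otimes>\<^bsub>U\<^esub> u \<otimes>\<^bsub>U\<^esub> x') (p2 H H \<one>\<^bsub>H\<^esub> (Si h) \<otimes>\<^bsub>H2\<^esub> F1 (tw \<otimes>\<^bsub>H2\<^esub> w))) (p2 U H2 a b) =
      p2 U H2 (a \<otimes>\<^bsub>U\<^esub> u \<otimes>\<^bsub>U\<^esub> x') (p2 H H \<one>\<^bsub>H\<^esub> (Si h) \<otimes>\<^bsub>H2\<^esub> F1 (tw \<otimes>\<^bsub>H2\<^esub> b))"
      by (rule tsum_pure[where V = U and W = H2]) (assumption | rule lins | simp)+
    then show "tsum K U3 (\<lambda>X w. p2 U H2 (X \<otimes>\<^bsub>U\<^esub> u \<otimes>\<^bsub>U\<^esub> x') (p2 H H \<one>\<^bsub>H\<^esub> (Si h) \<otimes>\<^bsub>H2\<^esub> F1 (tw \<otimes>\<^bsub>H2\<^esub> w))) (p2 U H2 a b) =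
      p2 U H2 \<one>\<^bsub>U\<^esub> (p2 H H \<one>\<^bsub>H\<^esub> (Si h)) \<otimes>\<^bsub>U3\<^esub> ?V (p2 U H2 a b) \<otimes>\<^bsub>U3\<^esub> p2 U H2 (u \<otimes>\<^bsub>U\<^esub> x') \<one>\<^bsub>H2\<^esub>"
      by (simp add: mult_assoc)
  qed (assumption | rule lins | simp)+
  have outer: "RR (tsum K U3 (\<lambda>x0 x1. tsum K U3 (\<lambda>X w.
     p2 U H2 (X \<otimes>\<^bsub>U\<^esub> x0 \<otimes>\<^bsub>U\<^esub> x') (p2 H H \<one>\<^bsub>H\<^esub> (Si x1) \<otimes>\<^bsub>H2\<^esub> F1 (tw \<otimes>\<^bsub>H2\<^esub> w))) Rr) w) =
     apU qq \<one>\<^bsub>H\<^esub> \<otimes>\<^bsub>U3\<^esub> LU (Lam w) \<otimes>\<^bsub>U3\<^esub> LU (rho x') \<otimes>\<^bsub>U3\<^esub> rr" (is "RR (tsum K U3 ?f w) = _") if w: "w \<in> carrier U2" for w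
  proof (rule ext2[OF w, where Z = U3])
    have b: "bil U H U3 ?f" by (assumption | rule lins | simp)+
    show "lin U2 U3 (\<lambda>w. RR (tsum K U3 ?f w))" by (assumption | rule lins b | simp)+
    fix u h assume [simp]: "u \<in> carrier U" "h \<in> carrier H"
    have "RR (tsum K U3 ?f (p2 U H u h)) = RR (?f u h)"
      by (simp add: tsum_pure[OF _ _ _ b])
    also have "\<dots> = p2 U H2 \<one>\<^bsub>U\<^esub> (p2 H H \<one>\<^bsub>H\<^esub> (Si h)) \<otimes>\<^bsub>U3\<^esub> (apU qq \<one>\<^bsub>H\<^esub> \<otimes>\<^bsub>U3\<^esub> LU qq \<otimes>\<^bsub>U3\<^esub> rr) \<otimes>\<^bsub>U3\<^esub> RU (rho (u \<otimes>\<^bsub>U\<^esub> x'))"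
      by (simp only: inner[OF _ _ R_closed(1)] \<open>u \<in> carrier U\<close> \<open>h \<in> carrier H\<close>) (subst RR_mult, simp_all add: starstar del: ahom_mult[OF rho_hom])
    also have "\<dots> = p2 U H2 \<one>\<^bsub>U\<^esub> (p2 H H \<one>\<^bsub>H\<^esub> (Si h)) \<otimes>\<^bsub>U3\<^esub> apU qq \<one>\<^bsub>H\<^esub> \<otimes>\<^bsub>U3\<^esub> LU qq \<otimes>\<^bsub>U3\<^esub> (rr \<otimes>\<^bsub>U3\<^esub> RU (rho (u \<otimes>\<^bsub>U\<^esub> x')))"
      by (simp add: mult_assoc del: ahom_mult[OF rho_hom])
    \<comment> \<open>The element 1 \<otimes> 1 \<otimes> S^-1(h) lives in the third factor only and
      passes q \<otimes> 1; \<open>coassocU'\<close> moves \<Phi>_\<rho>^-1 to the end.\<close>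
    also have "\<dots> = apU qq \<one>\<^bsub>H\<^esub> \<otimes>\<^bsub>U3\<^esub> p2 U H2 \<one>\<^bsub>U\<^esub> (p2 H H \<one>\<^bsub>H\<^esub> (Si h)) \<otimes>\<^bsub>U3\<^esub> LU qq \<otimes>\<^bsub>U3\<^esub> (LU (rho (u \<otimes>\<^bsub>U\<^esub> x')) \<otimes>\<^bsub>U3\<^esub> rr)"
      by (simp only: ap_commute[OF qq_closed Si_closed[OF \<open>h \<in> carrier H\<close>]] coassocU'[symmetric] mult_closed \<open>u \<in> carrier U\<close> aalg_nalg U_alg assms)
    also have "\<dots> = apU qq \<one>\<^bsub>H\<^esub> \<otimes>\<^bsub>U3\<^esub> LU (Lam (p2 U H u h)) \<otimes>\<^bsub>U3\<^esub> LU (rho x') \<otimes>\<^bsub>U3\<^esub> rr"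
      by (simp add: ahom_mult[OF LU_hom] mult_assoc) (simp add: tens_one)
    finally show "RR (tsum K U3 ?f (p2 U H u h)) = apU qq \<one>\<^bsub>H\<^esub> \<otimes>\<^bsub>U3\<^esub> LU (Lam (p2 U H u h)) \<otimes>\<^bsub>U3\<^esub> LU (rho x') \<otimes>\<^bsub>U3\<^esub> rr" .
  qed (assumption | rule lins | simp)+
  show ?thesis
    unfolding Wc_def
    by (subst outer) (simp_all add: Lam_rho ahom_mult[OF LU_hom] mult_assoc ap_mult[symmetric, of U H H _ _ "\<one>\<^bsub>H\<^esub>" "\<one>\<^bsub>H\<^esub>", simplified])
qed

end

text \<open>The product algebras are tensor spaces with overwritten \<open>mult\<close> and
  \<open>one\<close>; being a module does not depend on these two fields.\<close>

lemma module_cong: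
  assumes "carrier A = carrier B" "add A = add B" "zero A = zero B" "smult A = smult B"
  shows "module K A \<longleftrightarrow> module K B"
  using assms
  by (simp add: module_def abelian_group_def abelian_monoid_def abelian_group_axioms_def module_axioms_def
      comm_monoid_def monoid_def comm_monoid_axioms_def comm_group_def group_def group_axioms_def Units_def)

context base
begin

section \<open>Algebras and isomorphisms prescribed on pure tensors\<close>

definition palg where
  "palg V W g e = (V \<boxtimes> W)\<lparr>mult := (\<lambda>s t. tsum K (V \<boxtimes> W) (\<lambda>v w. tsum K (V \<boxtimes> W) (g v w) t) s), one := e\<rparr>"

lemma palg_simps [simp]: "carrier (palg V W g e) = carrier (V \<boxtimes> W)" "add (palg V W g e) = add (V \<boxtimes> W)"
  "smult (palg V W g e) = smult (V \<boxtimes> W)" "zero (palg V W g e) = zero (V \<boxtimes> W)" "one (palg V W g e) = e"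
  by (simp_all add: palg_def)

lemma lin_palg: "lin Z (palg V W g e) f \<longleftrightarrow> lin Z (V \<boxtimes> W) f"
  "lin (palg V W g e) Z' h \<longleftrightarrow> lin (V \<boxtimes> W) Z' h"
  by (simp_all add: lin_def)

lemma palg_vs [simp]: "vs (palg V W g e) \<longleftrightarrow> vs (V \<boxtimes> W)"
  by (rule module_cong) simp_all

context
  fixes V :: "('k, 'v, 'c) module_scheme" and W :: "('k, 'w, 'd) module_scheme" and g e
  assumes V [simp]: "vs V" "vs W"
    and g1: "\<And>b c d. b \<in> carrier W \<Longrightarrow> c \<in> carrier V \<Longrightarrow> d \<in> carrier W \<Longrightarrow> lin V (V \<boxtimes> W) (\<lambda>a. g a b c d)"
    and g2: "\<And>a c d. a \<in> carrier V \<Longrightarrow> c \<in> carrier V \<Longrightarrow> d \<in> carrier W \<Longrightarrow> lin W (V \<boxtimes> W) (\<lambda>b. g a b c d)"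
    and g3: "\<And>a b d. a \<in> carrier V \<Longrightarrow> b \<in> carrier W \<Longrightarrow> d \<in> carrier W \<Longrightarrow> lin V (V \<boxtimes> W) (\<lambda>c. g a b c d)"
    and g4: "\<And>a b c. a \<in> carrier V \<Longrightarrow> b \<in> carrier W \<Longrightarrow> c \<in> carrier V \<Longrightarrow> lin W (V \<boxtimes> W) (\<lambda>d. g a b c d)"
    and e: "e \<in> carrier (V \<boxtimes> W)"
begin

lemma palg_nalg: "nalg (palg V W g e)"
proof -
  have "bil (V \<boxtimes> W) (V \<boxtimes> W) (V \<boxtimes> W) (\<lambda>s t. tsum K (V \<boxtimes> W) (\<lambda>v w. tsum K (V \<boxtimes> W) (g v w) t) s)"
    by (assumption | rule lins g1 g2 g3 g4 | simp)+
  then have "bil (palg V W g e) (palg V W g e) (palg V W g e) (mult (palg V W g e))"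
    by (simp add: bilinear_map_def) (simp add: palg_def)
  then show ?thesis unfolding nalg_def using e by simp
qed

lemma palg_mult:
  assumes v [simp]: "a \<in> carrier V" "b \<in> carrier W" "c \<in> carrier V" "d \<in> carrier W"
  shows "pure K V W a b \<otimes>\<^bsub>palg V W g e\<^esub> pure K V W c d = g a b c d"
proof -
  have "pure K V W a b \<otimes>\<^bsub>palg V W g e\<^esub> pure K V W c d = tsum K (V \<boxtimes> W) (\<lambda>v w. tsum K (V \<boxtimes> W) (g v w) (pure K V W c d)) (pure K V W a b)"
    by (simp add: palg_def)
  also have "\<dots> = tsum K (V \<boxtimes> W) (g a b) (pure K V W c d)"
    by (rule tsum_pure[where V = V and W = W]) (assumption | rule lins g1 g2 g3 g4 | simp)+
  also have "\<dots> = g a b c d"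
    by (rule tsum_pure[where V = V and W = W]) (assumption | rule lins g1 g2 g3 g4 | simp)+
  finally show ?thesis .
qed

end

definition giso where
  "giso A B f \<longleftrightarrow> ahom A B f \<and> bij_betw f (carrier A) (carrier B)"

lemma giso_iff: "f \<in> algebra_iso K A B \<longleftrightarrow> giso A B f"
  by (auto simp: algebra_iso_def giso_def ahom_iff ring_iso_def algebra_hom_def ahom_def ring_hom_def lin_def)

lemma giso_comp: "giso A B f \<Longrightarrow> giso B C g \<Longrightarrow> giso A C (\<lambda>x. g (f x))"
  using bij_betw_trans[of f "carrier A" "carrier B" g "carrier C"]
  by (auto simp: giso_def comp_def intro: ahom_comp)

lemma gisoI:
  assumes "ahom A B f" "\<And>y. y \<in> carrier B \<Longrightarrow> g y \<in> carrier A"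
    "\<And>x. x \<in> carrier A \<Longrightarrow> g (f x) = x" "\<And>y. y \<in> carrier B \<Longrightarrow> f (g y) = y"
  shows "giso A B f"
  unfolding giso_def using assms(1)
  by (auto intro!: bij_betwI[where g = g] assms simp: ahom_closed)

lemma giso_inv:
  assumes f: "giso A B f" and A: "nalg A"
  shows "giso B A (inv_into (carrier A) f)"
proof -
  let ?g = "inv_into (carrier A) f"
  have b: "bij_betw f (carrier A) (carrier B)" and h: "ahom A B f" using f by (simp_all add: giso_def)
  have g: "?g y \<in> carrier A" "f (?g y) = y" if "y \<in> carrier B" for y
    using that b bij_betw_inv_into_right[OF b] bij_betwE[OF bij_betw_inv_into[OF b]] by auto
  have i: "?g y = x" if "x \<in> carrier A" "f x = y" for x y
    using that bij_betw_inv_into_left[OF b] by auto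
  have "ahom B A ?g"
    unfolding ahom_def
  proof (intro conjI ballI linI)
    fix x y assume [simp]: "x \<in> carrier B" "y \<in> carrier B"
    show "?g x \<in> carrier A" by (rule g) simp
    show "?g (x \<oplus>\<^bsub>B\<^esub> y) = ?g x \<oplus>\<^bsub>A\<^esub> ?g y"
      by (rule i) (simp_all add: A g lin_add[OF ahom_lin[OF h]])
    show "?g (x \<otimes>\<^bsub>B\<^esub> y) = ?g x \<otimes>\<^bsub>A\<^esub> ?g y"
      by (rule i) (simp_all add: A g ahom_mult[OF h])
  next
    fix c x assume [simp]: "c \<in> carrier K" "x \<in> carrier B"
    show "?g (c \<odot>\<^bsub>B\<^esub> x) = c \<odot>\<^bsub>A\<^esub> ?g x"
      by (rule i) (simp_all add: A g lin_smult[OF ahom_lin[OF h]])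
  next
    show "?g \<one>\<^bsub>B\<^esub> = \<one>\<^bsub>A\<^esub>"
      by (rule i) (simp_all add: A ahom_one[OF h])
  qed
  then show ?thesis
    using bij_betw_inv_into[OF b] by (simp add: giso_def)
qed

lemma giso_tmap:
  assumes [simp]: "nalg A" "nalg B" "nalg B'" and f: "giso B B' f"
  shows "giso (A \<boxtimes> B) (A \<boxtimes> B') (rmap A B' f)"
proof -
  let ?g = "inv_into (carrier B) f"
  have h: "ahom B B' f" and b: "bij_betw f (carrier B) (carrier B')" and h': "ahom B' B ?g"
    using f giso_inv[OF f] by (simp_all add: giso_def)
  note [simp] = ahom_lin[OF h] ahom_lin[OF h'] ahom_closed[OF h] ahom_closed[OF h']
    bij_betw_inv_into_left[OF b] bij_betw_inv_into_right[OF b]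
  show ?thesis
  proof (rule gisoI[where g = "rmap A B ?g"])
    show "ahom (A \<boxtimes> B) (A \<boxtimes> B') (rmap A B' f)" by (rule ahom_tmap) (simp_all add: ahom_id h)
    fix x assume x: "x \<in> carrier (A \<boxtimes> B)"
    show "rmap A B ?g (rmap A B' f x) = x"
      by (rule ext2[OF x, where Z = "A \<boxtimes> B"]) (assumption | rule lins | simp)+
  next
    fix y assume y: "y \<in> carrier (A \<boxtimes> B')"
    show "rmap A B ?g y \<in> carrier (A \<boxtimes> B)" by (rule tmap_closed[OF y]) simp_all
    show "rmap A B' f (rmap A B ?g y) = y"
      by (rule ext2[OF y, where Z = "A \<boxtimes> B'"]) (assumption | rule lins | simp)+
  qed
qed

end

locale rmodU = rcom K H U for K :: "'k ring" and H :: "('k, 'h) quasi_hopf" and U :: "('k, 'h, 'c) right_comod" +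
  fixes B :: "('k, 'h, 'b) right_mod"
  assumes rm: "right_module_algebra K H B"
begin

section \<open>The right module algebra and coefficient actions on B \<otimes> U\<close>

lemma B_nalg [simp]: "nalg B"
  using rm unfolding right_module_algebra_def nonassoc_algebra_def nalg_def by blast

lemma ract_bil: "bil B H B (ract B)"
  using rm by (simp only: right_module_algebra_def)

lemmas [lins] = lin_comp[OF bil_lin1[OF ract_bil]] lin_comp[OF bil_lin2[OF ract_bil]]
lemmas ract_closed [simp, lins] = bil_closed[OF ract_bil]

lemma ract_mult: "b \<in> carrier B \<Longrightarrow> g \<in> carrier H \<Longrightarrow> h \<in> carrier H \<Longrightarrow> ract B b (g \<otimes>\<^bsub>H\<^esub> h) = ract B (ract B b g) h"
  and ract_one [simp]: "b \<in> carrier B \<Longrightarrow> ract B b \<one>\<^bsub>H\<^esub> = b"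
  and one_ract [simp]: "h \<in> carrier H \<Longrightarrow> ract B \<one>\<^bsub>B\<^esub> h = eps h \<odot>\<^bsub>B\<^esub> \<one>\<^bsub>B\<^esub>"
  and one_B [simp]: "b \<in> carrier B \<Longrightarrow> \<one>\<^bsub>B\<^esub> \<otimes>\<^bsub>B\<^esub> b = b" "b \<in> carrier B \<Longrightarrow> b \<otimes>\<^bsub>B\<^esub> \<one>\<^bsub>B\<^esub> = b"
  using rm by (simp_all add: right_module_algebra_def nonassoc_algebra_def)

definition mB where "mB b b' = tsum K B (\<lambda>h k. ract B b h \<otimes>\<^bsub>B\<^esub> ract B b' k)"

lemma mB_lins [lins]:
  "lin Y H2 f1 \<Longrightarrow> b \<in> carrier B \<Longrightarrow> b' \<in> carrier B \<Longrightarrow> lin Y B (\<lambda>y. mB b b' (f1 y))"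
  "lin Y B f2 \<Longrightarrow> vs Y \<Longrightarrow> t \<in> carrier H2 \<Longrightarrow> b' \<in> carrier B \<Longrightarrow> lin Y B (\<lambda>y. mB (f2 y) b' t)"
  "lin Y B f2 \<Longrightarrow> vs Y \<Longrightarrow> t \<in> carrier H2 \<Longrightarrow> b \<in> carrier B \<Longrightarrow> lin Y B (\<lambda>y. mB b (f2 y) t)"
  unfolding mB_def by (assumption | rule lins | simp)+

lemma mB_lin [simp]: "b \<in> carrier B \<Longrightarrow> b' \<in> carrier B \<Longrightarrow> lin H2 B (mB b b')"
  by (assumption | rule lins | simp)+

lemma mB_closed [simp, lins]: "b \<in> carrier B \<Longrightarrow> b' \<in> carrier B \<Longrightarrow> t \<in> carrier H2 \<Longrightarrow> mB b b' t \<in> carrier B"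
  by (rule lin_closed[OF mB_lin])

lemma mB_pure [simp]: "b \<in> carrier B \<Longrightarrow> b' \<in> carrier B \<Longrightarrow> h \<in> carrier H \<Longrightarrow> k \<in> carrier H \<Longrightarrow>
    mB b b' (p2 H H h k) = ract B b h \<otimes>\<^bsub>B\<^esub> ract B b' k"
  unfolding mB_def by (rule tsum_pure[where V = H and W = H]) (assumption | rule lins | simp)+

lemma mult_ract: "b \<in> carrier B \<Longrightarrow> b' \<in> carrier B \<Longrightarrow> h \<in> carrier H \<Longrightarrow>
    ract B (b \<otimes>\<^bsub>B\<^esub> b') h = mB b b' (Del h)"
  using rm by (simp add: right_module_algebra_def mB_def)

lemma mB_ract:
  assumes [simp]: "b \<in> carrier B" "b' \<in> carrier B" "h \<in> carrier H" "k \<in> carrier H" and t: "t \<in> carrier H2"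
  shows "mB (ract B b h) (ract B b' k) t = mB b b' (p2 H H h k \<otimes>\<^bsub>H2\<^esub> t)"
  by (rule ext2[OF t, where Z = B]) (assumption | rule lins | simp add: ract_mult)+

lemma ract_mB:
  assumes [simp]: "b \<in> carrier B" "b' \<in> carrier B" "h \<in> carrier H" and e: "e \<in> carrier H2"
  shows "ract B (mB b b' e) h = mB b b' (e \<otimes>\<^bsub>H2\<^esub> Del h)"
  by (rule ext2[OF e, where Z = B]) (assumption | rule lins | simp add: mult_ract mB_ract)+

abbreviation BU where "BU \<equiv> B \<boxtimes> U"

text \<open>Elements of B \<otimes> U are written as coefficients in U \<otimes> H acting on a fixed
  b, and products as coefficients in U \<otimes> H \<otimes> H acting on b and b'
  (\<open>act2\<close>). Identities in B \<otimes> U thus become identities of coefficients.\<close>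

definition act where "act b = tsum K BU (\<lambda>u h. p2 B U (ract B b h) u)"
definition act2 where "act2 b b' = tsum K BU (\<lambda>u e. p2 B U (mB b b' e) u)"

lemma act_lins [lins]:
  "lin Y U2 f1 \<Longrightarrow> b \<in> carrier B \<Longrightarrow> lin Y BU (\<lambda>y. act b (f1 y))"
  "lin Y B f2 \<Longrightarrow> vs Y \<Longrightarrow> w \<in> carrier U2 \<Longrightarrow> lin Y BU (\<lambda>y. act (f2 y) w)"
  unfolding act_def by (assumption | rule lins | simp)+

lemma act2_lins [lins]:
  "lin Y U3 f1 \<Longrightarrow> b \<in> carrier B \<Longrightarrow> b' \<in> carrier B \<Longrightarrow> lin Y BU (\<lambda>y. act2 b b' (f1 y))"
  "lin Y B f2 \<Longrightarrow> vs Y \<Longrightarrow> w \<in> carrier U3 \<Longrightarrow> b' \<in> carrier B \<Longrightarrow> lin Y BU (\<lambda>y. act2 (f2 y) b' w)"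
  "lin Y B f2 \<Longrightarrow> vs Y \<Longrightarrow> w \<in> carrier U3 \<Longrightarrow> b \<in> carrier B \<Longrightarrow> lin Y BU (\<lambda>y. act2 b (f2 y) w)"
  unfolding act2_def by (assumption | rule lins | simp)+

lemma act_lin [simp]: "b \<in> carrier B \<Longrightarrow> lin U2 BU (act b)"
  and act2_lin [simp]: "b \<in> carrier B \<Longrightarrow> b' \<in> carrier B \<Longrightarrow> lin U3 BU (act2 b b')"
  by (assumption | rule lins | simp)+

lemma act_closed [simp, lins]: "b \<in> carrier B \<Longrightarrow> w \<in> carrier U2 \<Longrightarrow> act b w \<in> carrier BU"
  by (rule lin_closed[OF act_lin])

lemma act2_closed [simp, lins]: "b \<in> carrier B \<Longrightarrow> b' \<in> carrier B \<Longrightarrow> t \<in> carrier U3 \<Longrightarrow> act2 b b' t \<in> carrier BU"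
  by (rule lin_closed[OF act2_lin])

lemma act_pure [simp]: "b \<in> carrier B \<Longrightarrow> u \<in> carrier U \<Longrightarrow> h \<in> carrier H \<Longrightarrow> act b (p2 U H u h) = p2 B U (ract B b h) u"
  unfolding act_def by (rule tsum_pure[where V = U and W = H]) (assumption | rule lins | simp)+

lemma act2_pure [simp]: "b \<in> carrier B \<Longrightarrow> b' \<in> carrier B \<Longrightarrow> u \<in> carrier U \<Longrightarrow> e \<in> carrier H2 \<Longrightarrow>
    act2 b b' (p2 U H2 u e) = p2 B U (mB b b' e) u"
  unfolding act2_def by (rule tsum_pure[where V = U and W = H2]) (assumption | rule lins | simp)+

lemma act_ract:
  assumes [simp]: "b \<in> carrier B" "h \<in> carrier H" and w: "w \<in> carrier U2"
  shows "act (ract B b h) w = act b (p2 U H \<one>\<^bsub>U\<^esub> h \<otimes>\<^bsub>U2\<^esub> w)"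
  by (rule ext2[OF w, where Z = BU]) (assumption | rule lins | simp add: ract_mult)+

lemma act2_ract:
  assumes [simp]: "b \<in> carrier B" "b' \<in> carrier B" "h \<in> carrier H" "k \<in> carrier H" and t: "t \<in> carrier U3"
  shows "act2 (ract B b h) (ract B b' k) t = act2 b b' (p2 U H2 \<one>\<^bsub>U\<^esub> (p2 H H h k) \<otimes>\<^bsub>U3\<^esub> t)"
  by (rule ext2[OF t, where Z = BU]) (assumption | rule lins | simp add: mB_ract)+

lemma act_mB:
  assumes [simp]: "b \<in> carrier B" "b' \<in> carrier B" "e \<in> carrier H2" and w: "w \<in> carrier U2"
  shows "act (mB b b' e) w = act2 b b' (p2 U H2 \<one>\<^bsub>U\<^esub> e \<otimes>\<^bsub>U3\<^esub> RU w)"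
  by (rule ext2[OF w, where Z = BU]) (assumption | rule lins | simp add: ract_mB)+

definition mu where "mu = tsum K BU (\<lambda>b x. act b (qq \<otimes>\<^bsub>U2\<^esub> rho x))"
definition nu where "nu = tsum K BU (\<lambda>b x. act b (rmap U H Si (rho x \<otimes>\<^bsub>U2\<^esub> pp)))"

lemma rmap_Si_closed [simp]: "t \<in> carrier U2 \<Longrightarrow> rmap U H Si t \<in> carrier U2"
  by (assumption | rule lins | simp)+

lemma mu_lin [simp]: "lin BU BU mu" and nu_lin [simp]: "lin BU BU nu"
  unfolding mu_def nu_def by ((assumption | rule lins | simp)+)[2]

lemmas [lins] = lin_comp[OF mu_lin] lin_comp[OF nu_lin]
lemmas mu_closed [simp, lins] = lin_closed[OF mu_lin]
lemmas nu_closed [simp, lins] = lin_closed[OF nu_lin]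

lemma mu_pure [simp]: "b \<in> carrier B \<Longrightarrow> x \<in> carrier U \<Longrightarrow> mu (p2 B U b x) = act b (qq \<otimes>\<^bsub>U2\<^esub> rho x)"
  unfolding mu_def by (rule tsum_pure[where V = B and W = U]) (assumption | rule lins | simp)+

lemma nu_pure [simp]: "b \<in> carrier B \<Longrightarrow> x \<in> carrier U \<Longrightarrow> nu (p2 B U b x) = act b (rmap U H Si (rho x \<otimes>\<^bsub>U2\<^esub> pp))"
  unfolding nu_def by (rule tsum_pure[where V = B and W = U]) (assumption | rule lins | simp)+

lemma mu_act_Si:
  assumes [simp]: "b \<in> carrier B" and w: "w \<in> carrier U2"
  shows "mu (act b (rmap U H Si w)) = act b (Lam w)"
  by (rule ext2[OF w, where Z = BU]) (assumption | rule lins | simp add: act_ract mult_assoc)+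

lemma nu_act:
  assumes [simp]: "b \<in> carrier B" and w: "w \<in> carrier U2"
  shows "nu (act b w) = act b (rmap U H Si (Lam' w))"
proof -
  have i: "rmap U H Si (z \<otimes>\<^bsub>U2\<^esub> p2 U H \<one>\<^bsub>U\<^esub> (Sa h)) = p2 U H \<one>\<^bsub>U\<^esub> h \<otimes>\<^bsub>U2\<^esub> rmap U H Si z"
    if z: "z \<in> carrier U2" and [simp]: "h \<in> carrier H" for z h
    by (rule ext2[OF z, where Z = U2]) (assumption | rule lins | simp)+
  show ?thesis
    by (rule ext2[OF w, where Z = BU]) (assumption | rule lins | simp add: act_ract i)+
qed

text \<open>\<open>Lam\<close> at z(u \<otimes> h) is \<open>Lam z\<close> placed between 1
  \<otimes> S^-1(h) and \<rho>(u), so the value of \<open>Lam\<close> at z = \<rho>(x) can be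
  inserted.\<close>

lemma Lam_rho_mult:
  assumes [simp]: "x \<in> carrier U" and w: "w \<in> carrier U2"
  shows "Lam (rho x \<otimes>\<^bsub>U2\<^esub> w) = p2 U H x \<one>\<^bsub>H\<^esub> \<otimes>\<^bsub>U2\<^esub> Lam w"
proof (rule ext2[OF w, where Z = U2])
  fix u h assume [simp]: "u \<in> carrier U" "h \<in> carrier H"
  have "Lam (z \<otimes>\<^bsub>U2\<^esub> p2 U H u h) = p2 U H \<one>\<^bsub>U\<^esub> (Si h) \<otimes>\<^bsub>U2\<^esub> Lam z \<otimes>\<^bsub>U2\<^esub> rho u" if z: "z \<in> carrier U2" for z
  proof (rule ext2[OF z, where Z = U2])
    fix a k assume [simp]: "a \<in> carrier U" "k \<in> carrier H"
    show "Lam (p2 U H a k \<otimes>\<^bsub>U2\<^esub> p2 U H u h) = p2 U H \<one>\<^bsub>U\<^esub> (Si h) \<otimes>\<^bsub>U2\<^esub> Lam (p2 U H a k) \<otimes>\<^bsub>U2\<^esub> rho u"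
      by simp (simp add: mult_assoc[symmetric])
  qed (assumption | rule lins | simp)+
  then have "Lam (rho x \<otimes>\<^bsub>U2\<^esub> p2 U H u h) = p2 U H \<one>\<^bsub>U\<^esub> (Si h) \<otimes>\<^bsub>U2\<^esub> Lam (rho x) \<otimes>\<^bsub>U2\<^esub> rho u"
    by simp
  then show "Lam (rho x \<otimes>\<^bsub>U2\<^esub> p2 U H u h) = p2 U H x \<one>\<^bsub>H\<^esub> \<otimes>\<^bsub>U2\<^esub> Lam (p2 U H u h)"
    by (simp add: Lam_rho mult_assoc[symmetric])
qed (assumption | rule lins | simp)+

text \<open>The mirror image: \<open>Lam'\<close> at (u \<otimes> h)z is \<open>Lam' z\<close>
  placed between \<rho>(u) and 1 \<otimes> S(h).\<close>

lemma Lam'_mult_rho: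
  assumes [simp]: "x \<in> carrier U" and w: "w \<in> carrier U2"
  shows "Lam' (w \<otimes>\<^bsub>U2\<^esub> rho x) = Lam' w \<otimes>\<^bsub>U2\<^esub> p2 U H x \<one>\<^bsub>H\<^esub>"
proof (rule ext2[OF w, where Z = U2])
  fix u h assume [simp]: "u \<in> carrier U" "h \<in> carrier H"
  have "Lam' (p2 U H u h \<otimes>\<^bsub>U2\<^esub> z) = rho u \<otimes>\<^bsub>U2\<^esub> Lam' z \<otimes>\<^bsub>U2\<^esub> p2 U H \<one>\<^bsub>U\<^esub> (Sa h)" if z: "z \<in> carrier U2" for z
  proof (rule ext2[OF z, where Z = U2])
    fix a k assume [simp]: "a \<in> carrier U" "k \<in> carrier H"
    show "Lam' (p2 U H u h \<otimes>\<^bsub>U2\<^esub> p2 U H a k) = rho u \<otimes>\<^bsub>U2\<^esub> Lam' (p2 U H a k) \<otimes>\<^bsub>U2\<^esub> p2 U H \<one>\<^bsub>U\<^esub> (Sa h)"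
      by (simp add: mult_assoc)
  qed (assumption | rule lins | simp)+
  then have "Lam' (p2 U H u h \<otimes>\<^bsub>U2\<^esub> rho x) = rho u \<otimes>\<^bsub>U2\<^esub> Lam' (rho x) \<otimes>\<^bsub>U2\<^esub> p2 U H \<one>\<^bsub>U\<^esub> (Sa h)"
    by simp
  then show "Lam' (p2 U H u h \<otimes>\<^bsub>U2\<^esub> rho x) = Lam' (p2 U H u h) \<otimes>\<^bsub>U2\<^esub> p2 U H x \<one>\<^bsub>H\<^esub>"
    by (simp add: Lam'_rho mult_assoc)
qed (assumption | rule lins | simp)+

lemma mu_nu:
  assumes t: "t \<in> carrier BU"
  shows "mu (nu t) = t"
  by (rule ext2[OF t, where Z = BU]) (assumption | rule lins | simp add: mu_act_Si Lam_rho_mult Lam_pp)+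

lemma nu_mu:
  assumes t: "t \<in> carrier BU"
  shows "nu (mu t) = t"
  by (rule ext2[OF t, where Z = BU]) (assumption | rule lins | simp add: nu_act Lam'_mult_rho Lam'_qq)+

text \<open>\<open>Dalg'\<close> is the part of the diagonal crossed product carried by \<open>B \<otimes> U\<close>, and \<open>Dalg\<close> is the part
  carried by \<open>B \<otimes> U\<close> of the other two products.\<close>

definition gD where "gD b x b' x' = act2 b b' (p2 U H2 x \<one>\<^bsub>H2\<^esub> \<otimes>\<^bsub>U3\<^esub> apU (rho x') \<one>\<^bsub>H\<^esub> \<otimes>\<^bsub>U3\<^esub> rr)"
definition gD' where "gD' b x b' x' = act2 b b' (Wc x x')"

lemma Wc_lins [lins]:
  "lin Y U f \<Longrightarrow> vs Y \<Longrightarrow> x' \<in> carrier U \<Longrightarrow> lin Y U3 (\<lambda>y. Wc (f y) x')"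
  "lin Y U f \<Longrightarrow> vs Y \<Longrightarrow> x \<in> carrier U \<Longrightarrow> lin Y U3 (\<lambda>y. Wc x (f y))"
  unfolding Wc_def by (assumption | rule lins | simp)+

lemma Wc_closed [simp, lins]: "x \<in> carrier U \<Longrightarrow> x' \<in> carrier U \<Longrightarrow> Wc x x' \<in> carrier U3"
  by (rule lin_closed[of U U3 "Wc x"]) (assumption | rule lins | simp)+

definition Dalg where "Dalg = palg B U gD (p2 B U \<one>\<^bsub>B\<^esub> \<one>\<^bsub>U\<^esub>)"
definition Dalg' where "Dalg' = palg B U gD' (p2 B U \<one>\<^bsub>B\<^esub> \<one>\<^bsub>U\<^esub>)"

lemma Dalg_simps [simp]: "carrier Dalg = carrier BU" "carrier Dalg' = carrier BU"
  "one Dalg = p2 B U \<one>\<^bsub>B\<^esub> \<one>\<^bsub>U\<^esub>" "one Dalg' = p2 B U \<one>\<^bsub>B\<^esub> \<one>\<^bsub>U\<^esub>"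
  "lin Z Dalg f \<longleftrightarrow> lin Z BU f" "lin Z Dalg' f \<longleftrightarrow> lin Z BU f"
  "lin Dalg Z' h \<longleftrightarrow> lin BU Z' h" "lin Dalg' Z' h \<longleftrightarrow> lin BU Z' h"
  by (simp_all add: Dalg_def Dalg'_def lin_palg)

lemma Dalg_nalg [simp]: "nalg Dalg" and Dalg'_nalg [simp]: "nalg Dalg'"
  unfolding Dalg_def Dalg'_def
  by (rule palg_nalg; (unfold gD_def gD'_def)?, (assumption | rule lins | simp)+)+

lemma Dalg_mult [simp]: "b \<in> carrier B \<Longrightarrow> x \<in> carrier U \<Longrightarrow> b' \<in> carrier B \<Longrightarrow> x' \<in> carrier U \<Longrightarrow>
    p2 B U b x \<otimes>\<^bsub>Dalg\<^esub> p2 B U b' x' = gD b x b' x'"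
  unfolding Dalg_def
  by (rule palg_mult; (unfold gD_def)?, (assumption | rule lins | simp)+)

lemma Dalg'_mult [simp]: "b \<in> carrier B \<Longrightarrow> x \<in> carrier U \<Longrightarrow> b' \<in> carrier B \<Longrightarrow> x' \<in> carrier U \<Longrightarrow>
    p2 B U b x \<otimes>\<^bsub>Dalg'\<^esub> p2 B U b' x' = gD' b x b' x'"
  unfolding Dalg'_def
  by (rule palg_mult; (unfold gD'_def)?, (assumption | rule lins | simp)+)

lemma mu_act2:
  assumes [simp]: "b \<in> carrier B" "b' \<in> carrier B" and t: "t \<in> carrier U3"
  shows "mu (act2 b b' t) = act2 b b' (RR t)"
  by (rule ext2[OF t, where Z = BU]) (assumption | rule lins | simp add: act_mB)+

text \<open>Expresses products in \<open>Dalg\<close> through coefficients, in the form in which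
  \<open>RR_Wc\<close> delivers the image of a product in \<open>Dalg'\<close>.\<close>

lemma Dalg_mult_act:
  assumes [simp]: "b \<in> carrier B" "b' \<in> carrier B" and w: "w \<in> carrier U2" and z: "z \<in> carrier U2"
  shows "act b w \<otimes>\<^bsub>Dalg\<^esub> act b' z = act2 b b' (apU w \<one>\<^bsub>H\<^esub> \<otimes>\<^bsub>U3\<^esub> LU z \<otimes>\<^bsub>U3\<^esub> rr)"
proof -
  have m: "bil BU BU BU (mult Dalg)"
    using nalg_bil[OF Dalg_nalg] by (simp add: bilinear_map_def Dalg_def)
  note [lins] = lin_comp[OF bil_lin1[OF m]] lin_comp[OF bil_lin2[OF m]]
  show ?thesis
  proof (rule ext2[OF w, where Z = BU])
    fix u h assume [simp]: "u \<in> carrier U" "h \<in> carrier H"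
    show "act b (p2 U H u h) \<otimes>\<^bsub>Dalg\<^esub> act b' z = act2 b b' (apU (p2 U H u h) \<one>\<^bsub>H\<^esub> \<otimes>\<^bsub>U3\<^esub> LU z \<otimes>\<^bsub>U3\<^esub> rr)"
    proof (rule ext2[OF z, where Z = BU])
      fix u' h' assume [simp]: "u' \<in> carrier U" "h' \<in> carrier H"
      \<comment> \<open>h and h' act on b and b' and so enter as left factors; h joins u to form w,
        and h' passes \<rho>(u') to complete it to (\<rho> \<otimes> id)(z).\<close>
      have i: "p2 U H2 \<one>\<^bsub>U\<^esub> (p2 H H h h') \<otimes>\<^bsub>U3\<^esub> p2 U H2 u \<one>\<^bsub>H2\<^esub> \<otimes>\<^bsub>U3\<^esub> apU y \<one>\<^bsub>H\<^esub> = apU (p2 U H u h) \<one>\<^bsub>H\<^esub> \<otimes>\<^bsub>U3\<^esub> apU y h'"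
        if y: "y \<in> carrier U2" for y
        by (rule ext2[OF y, where Z = U3]) (assumption | rule lins | simp)+
      have "act b (p2 U H u h) \<otimes>\<^bsub>Dalg\<^esub> act b' (p2 U H u' h') =
          act2 b b' (p2 U H2 \<one>\<^bsub>U\<^esub> (p2 H H h h') \<otimes>\<^bsub>U3\<^esub> p2 U H2 u \<one>\<^bsub>H2\<^esub> \<otimes>\<^bsub>U3\<^esub> apU (rho u') \<one>\<^bsub>H\<^esub> \<otimes>\<^bsub>U3\<^esub> rr)"
        by (simp add: gD_def act2_ract mult_assoc del: tens_mult_pure)
      also have "\<dots> = act2 b b' (apU (p2 U H u h) \<one>\<^bsub>H\<^esub> \<otimes>\<^bsub>U3\<^esub> LU (p2 U H u' h') \<otimes>\<^bsub>U3\<^esub> rr)"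
        by (subst i) simp_all
      finally show "act b (p2 U H u h) \<otimes>\<^bsub>Dalg\<^esub> act b' (p2 U H u' h') =
          act2 b b' (apU (p2 U H u h) \<one>\<^bsub>H\<^esub> \<otimes>\<^bsub>U3\<^esub> LU (p2 U H u' h') \<otimes>\<^bsub>U3\<^esub> rr)" .
    qed (assumption | rule lins w z | simp add: w z)+
  qed (assumption | rule lins w z | simp add: w z)+
qed

lemma eps_Sa [simp]: "h \<in> carrier H \<Longrightarrow> eps (Sa h) = eps h"
  and eps_al [simp]: "eps al = \<one>\<^bsub>K\<^esub>"
  using qH by (simp_all add: quasi_hopf_algebra_def)

lemma eps_Si [simp]: "h \<in> carrier H \<Longrightarrow> eps (Si h) = eps h"
  using eps_Sa[of "Si h"] by simp

text \<open>The normalisations \<epsilon>(\<alpha>) = 1 and \<epsilon> S = \<epsilon> reduce q to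
  the normalisation of \<Phi>_\<rho>. This makes \<open>mu\<close> preserve the unit.\<close>

lemma epsr_qq: "epsr U qq = \<one>\<^bsub>U\<^esub>"
proof -
  have [simp]: "\<one>\<^bsub>K\<^esub> \<otimes>\<^bsub>K\<^esub> c = c" if "c \<in> carrier K" for c
    using that monoid.l_one[OF comm_monoid.axioms(1)[OF cring.axioms(2)[OF K]]] by simp
  have "epsr U (rmap U H m1 s) = epsr U (rmap U H (epsr H) s)" if s: "s \<in> carrier U3" for s
    by (rule ext3[OF s, where Z = U]) (assumption | rule lins | simp add: smult_smult lin_smult[OF epsr_lin])+
  then show ?thesis by (simp add: qq_def R_right) (simp add: tens_one)
qed

text \<open>On coefficients, multiplicativity of \<open>mu\<close> is \<open>RR_Wc\<close> compared
  with \<open>Dalg_mult_act\<close>.\<close>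

lemma mu_giso: "giso Dalg' Dalg mu"
proof (rule gisoI[where g = nu])
  have one: "act \<one>\<^bsub>B\<^esub> w = p2 B U \<one>\<^bsub>B\<^esub> (epsr U w)" if w: "w \<in> carrier U2" for w
    by (rule ext2[OF w, where Z = BU]) (assumption | rule lins | simp)+
  have m: "bil BU BU BU (mult Dalg)" "bil BU BU BU (mult Dalg')"
    using nalg_bil[OF Dalg_nalg] nalg_bil[OF Dalg'_nalg] by (simp_all add: bilinear_map_def Dalg_def Dalg'_def)
  note [lins] = lin_comp[OF bil_lin1[OF m(1)]] lin_comp[OF bil_lin2[OF m(1)]]
    lin_comp[OF bil_lin1[OF m(2)]] lin_comp[OF bil_lin2[OF m(2)]] bil_closed[OF m(1)] bil_closed[OF m(2)]
  have mult: "mu (s \<otimes>\<^bsub>Dalg'\<^esub> t) = mu s \<otimes>\<^bsub>Dalg\<^esub> mu t" if s: "s \<in> carrier BU" and t: "t \<in> carrier BU" for s t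
  proof (rule ext2[OF s, where Z = BU])
    fix b x assume [simp]: "b \<in> carrier B" "x \<in> carrier U"
    show "mu (p2 B U b x \<otimes>\<^bsub>Dalg'\<^esub> t) = mu (p2 B U b x) \<otimes>\<^bsub>Dalg\<^esub> mu t"
      by (rule ext2[OF t, where Z = BU])
        (assumption | rule lins | simp add: gD'_def mu_act2 RR_Wc Dalg_mult_act)+
  qed (assumption | rule lins s t | simp)+
  show "ahom Dalg' Dalg mu"
    unfolding ahom_def using mult by (simp add: one epsr_qq)
qed (simp_all add: mu_nu nu_mu)

end

context base
begin

section \<open>Threefold and fivefold sums\<close>

lemma lin_tsum3_param [lins]:
  assumes "t \<in> carrier (U \<boxtimes> V \<boxtimes> W)" "vs U" "vs V" "vs W" "vs Y" "vs Z"
    and f: "\<And>u v w. u \<in> carrier U \<Longrightarrow> v \<in> carrier V \<Longrightarrow> w \<in> carrier W \<Longrightarrow> lin Y Z (\<lambda>x. f x u v w)"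
  shows "lin Y Z (\<lambda>x. tsum3 K Z (f x) t)"
  unfolding tsum3_def by (assumption | rule lins assms(1) f | simp add: assms)+

lemma lin_tsum3_arg [lins]:
  assumes "lin Y (U \<boxtimes> V \<boxtimes> W) h" "vs U" "vs V" "vs W" "vs Z"
    and "\<And>v w. v \<in> carrier V \<Longrightarrow> w \<in> carrier W \<Longrightarrow> lin U Z (\<lambda>u. f u v w)"
    and "\<And>u w. u \<in> carrier U \<Longrightarrow> w \<in> carrier W \<Longrightarrow> lin V Z (\<lambda>v. f u v w)"
    and "\<And>u v. u \<in> carrier U \<Longrightarrow> v \<in> carrier V \<Longrightarrow> lin W Z (\<lambda>w. f u v w)"
  shows "lin Y Z (\<lambda>x. tsum3 K Z f (h x))"
  by (rule lin_comp[OF tsum3_lin[of U V W Z f] assms(1)]) (use assms in auto)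

lemma tsum3_closed [lins]:
  assumes "t \<in> carrier (U \<boxtimes> V \<boxtimes> W)" "vs U" "vs V" "vs W" "vs Z"
    and f: "\<And>u v w. u \<in> carrier U \<Longrightarrow> v \<in> carrier V \<Longrightarrow> w \<in> carrier W \<Longrightarrow> f u v w \<in> carrier Z"
  shows "tsum3 K Z f t \<in> carrier Z"
  unfolding tsum3_def by (assumption | rule lins assms(1) f | simp add: assms)+

lemma lin_tsum5_param [lins]:
  assumes "t \<in> carrier (U \<boxtimes> V \<boxtimes> W \<boxtimes> X \<boxtimes> X')" "vs U" "vs V" "vs W" "vs X" "vs X'" "vs Y" "vs Z"
    and f: "\<And>u v w x x'. u \<in> carrier U \<Longrightarrow> v \<in> carrier V \<Longrightarrow> w \<in> carrier W \<Longrightarrow> x \<in> carrier X \<Longrightarrow> x' \<in> carrier X' \<Longrightarrow>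
      lin Y Z (\<lambda>y. f y u v w x x')"
  shows "lin Y Z (\<lambda>x. tsum5 K Z (f x) t)"
  unfolding tsum5_def tsum4_def by (assumption | rule lins assms(1) f | simp add: assms)+

lemma
  assumes [simp]: "vs U" "vs V" "vs W" "vs X" "vs X'" "vs Z"
    and 1: "\<And>v w x x'. v \<in> carrier V \<Longrightarrow> w \<in> carrier W \<Longrightarrow> x \<in> carrier X \<Longrightarrow> x' \<in> carrier X' \<Longrightarrow> lin U Z (\<lambda>u. f u v w x x')"
    and 2: "\<And>u w x x'. u \<in> carrier U \<Longrightarrow> w \<in> carrier W \<Longrightarrow> x \<in> carrier X \<Longrightarrow> x' \<in> carrier X' \<Longrightarrow> lin V Z (\<lambda>v. f u v w x x')"
    and 3: "\<And>u v x x'. u \<in> carrier U \<Longrightarrow> v \<in> carrier V \<Longrightarrow> x \<in> carrier X \<Longrightarrow> x' \<in> carrier X' \<Longrightarrow> lin W Z (\<lambda>w. f u v w x x')"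
    and 4: "\<And>u v w x'. u \<in> carrier U \<Longrightarrow> v \<in> carrier V \<Longrightarrow> w \<in> carrier W \<Longrightarrow> x' \<in> carrier X' \<Longrightarrow> lin X Z (\<lambda>x. f u v w x x')"
    and 5: "\<And>u v w x. u \<in> carrier U \<Longrightarrow> v \<in> carrier V \<Longrightarrow> w \<in> carrier W \<Longrightarrow> x \<in> carrier X \<Longrightarrow> lin X' Z (\<lambda>x'. f u v w x x')"
  shows tsum5_lin: "lin (U \<boxtimes> V \<boxtimes> W \<boxtimes> X \<boxtimes> X') Z (tsum5 K Z f)"
    and tsum5_pure: "u \<in> carrier U \<Longrightarrow> v \<in> carrier V \<Longrightarrow> w \<in> carrier W \<Longrightarrow> x \<in> carrier X \<Longrightarrow> x' \<in> carrier X' \<Longrightarrow>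
      tsum5 K Z f (pure5 K U V W X X' u v w x x') = f u v w x x'"
proof -
  have l: "lin (V \<boxtimes> W \<boxtimes> X \<boxtimes> X') Z (tsum4 K Z (f u))" if [simp]: "u \<in> carrier U" for u
    by (rule tsum4_lin) (assumption | rule 1 2 3 4 5 | simp)+
  have b: "bil U (V \<boxtimes> W \<boxtimes> X \<boxtimes> X') Z (\<lambda>u. tsum4 K Z (f u))"
    by (rule bilI, rule l, assumption, unfold tsum4_def) (assumption | rule lins 1 2 3 4 5 | simp)+
  show "lin (U \<boxtimes> V \<boxtimes> W \<boxtimes> X \<boxtimes> X') Z (tsum5 K Z f)"
    unfolding tsum5_def[abs_def] by (assumption | rule lins b | simp)+
  assume [simp]: "u \<in> carrier U" "v \<in> carrier V" "w \<in> carrier W" "x \<in> carrier X" "x' \<in> carrier X'"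
  show "tsum5 K Z f (pure5 K U V W X X' u v w x x') = f u v w x x'"
    unfolding tsum5_def pure5_def pure4_def pure3_def
    by (simp add: tsum_pure[OF _ _ _ b]) (rule tsum4_pure; (assumption | rule 1 2 3 4 5 | simp)+)
qed

lemma lin_tsum5_arg [lins]:
  assumes "lin Y (U \<boxtimes> V \<boxtimes> W \<boxtimes> X \<boxtimes> X') h" "vs U" "vs V" "vs W" "vs X" "vs X'" "vs Z"
    and "\<And>v w x x'. v \<in> carrier V \<Longrightarrow> w \<in> carrier W \<Longrightarrow> x \<in> carrier X \<Longrightarrow> x' \<in> carrier X' \<Longrightarrow> lin U Z (\<lambda>u. f u v w x x')"
    and "\<And>u w x x'. u \<in> carrier U \<Longrightarrow> w \<in> carrier W \<Longrightarrow> x \<in> carrier X \<Longrightarrow> x' \<in> carrier X' \<Longrightarrow> lin V Z (\<lambda>v. f u v w x x')"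
    and "\<And>u v x x'. u \<in> carrier U \<Longrightarrow> v \<in> carrier V \<Longrightarrow> x \<in> carrier X \<Longrightarrow> x' \<in> carrier X' \<Longrightarrow> lin W Z (\<lambda>w. f u v w x x')"
    and "\<And>u v w x'. u \<in> carrier U \<Longrightarrow> v \<in> carrier V \<Longrightarrow> w \<in> carrier W \<Longrightarrow> x' \<in> carrier X' \<Longrightarrow> lin X Z (\<lambda>x. f u v w x x')"
    and "\<And>u v w x. u \<in> carrier U \<Longrightarrow> v \<in> carrier V \<Longrightarrow> w \<in> carrier W \<Longrightarrow> x \<in> carrier X \<Longrightarrow> lin X' Z (\<lambda>x'. f u v w x x')"
  shows "lin Y Z (\<lambda>x. tsum5 K Z f (h x))"
  by (rule lin_comp[OF tsum5_lin[of U V W X X' Z f] assms(1)]) (rule assms; assumption)+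

lemma lin_pure5 [lins]:
  "vs U \<Longrightarrow> vs V \<Longrightarrow> vs W \<Longrightarrow> vs X \<Longrightarrow> vs X' \<Longrightarrow> v \<in> carrier V \<Longrightarrow> w \<in> carrier W \<Longrightarrow> x \<in> carrier X \<Longrightarrow> x' \<in> carrier X' \<Longrightarrow>
    lin Y U f1 \<Longrightarrow> lin Y (U \<boxtimes> V \<boxtimes> W \<boxtimes> X \<boxtimes> X') (\<lambda>y. pure5 K U V W X X' (f1 y) v w x x')"
  "vs U \<Longrightarrow> vs V \<Longrightarrow> vs W \<Longrightarrow> vs X \<Longrightarrow> vs X' \<Longrightarrow> u \<in> carrier U \<Longrightarrow> w \<in> carrier W \<Longrightarrow> x \<in> carrier X \<Longrightarrow> x' \<in> carrier X' \<Longrightarrow>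
    lin Y V f2 \<Longrightarrow> lin Y (U \<boxtimes> V \<boxtimes> W \<boxtimes> X \<boxtimes> X') (\<lambda>y. pure5 K U V W X X' u (f2 y) w x x')"
  "vs U \<Longrightarrow> vs V \<Longrightarrow> vs W \<Longrightarrow> vs X \<Longrightarrow> vs X' \<Longrightarrow> u \<in> carrier U \<Longrightarrow> v \<in> carrier V \<Longrightarrow> x \<in> carrier X \<Longrightarrow> x' \<in> carrier X' \<Longrightarrow>
    lin Y W f3 \<Longrightarrow> lin Y (U \<boxtimes> V \<boxtimes> W \<boxtimes> X \<boxtimes> X') (\<lambda>y. pure5 K U V W X X' u v (f3 y) x x')"
  "vs U \<Longrightarrow> vs V \<Longrightarrow> vs W \<Longrightarrow> vs X \<Longrightarrow> vs X' \<Longrightarrow> u \<in> carrier U \<Longrightarrow> v \<in> carrier V \<Longrightarrow> w \<in> carrier W \<Longrightarrow> x' \<in> carrier X' \<Longrightarrow>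
    lin Y X f4 \<Longrightarrow> lin Y (U \<boxtimes> V \<boxtimes> W \<boxtimes> X \<boxtimes> X') (\<lambda>y. pure5 K U V W X X' u v w (f4 y) x')"
  "vs U \<Longrightarrow> vs V \<Longrightarrow> vs W \<Longrightarrow> vs X \<Longrightarrow> vs X' \<Longrightarrow> u \<in> carrier U \<Longrightarrow> v \<in> carrier V \<Longrightarrow> w \<in> carrier W \<Longrightarrow> x \<in> carrier X \<Longrightarrow>
    lin Y X' f5 \<Longrightarrow> lin Y (U \<boxtimes> V \<boxtimes> W \<boxtimes> X \<boxtimes> X') (\<lambda>y. pure5 K U V W X X' u v w x (f5 y))"
  unfolding pure5_def pure4_def pure3_def by (assumption | rule lins | simp)+

lemma pure5_closed [simp, lins]:
  "vs U \<Longrightarrow> vs V \<Longrightarrow> vs W \<Longrightarrow> vs X \<Longrightarrow> vs X' \<Longrightarrow> u \<in> carrier U \<Longrightarrow> v \<in> carrier V \<Longrightarrow> w \<in> carrier W \<Longrightarrow> x \<in> carrier X \<Longrightarrow>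
    x' \<in> carrier X' \<Longrightarrow> pure5 K U V W X X' u v w x x' \<in> carrier (U \<boxtimes> V \<boxtimes> W \<boxtimes> X \<boxtimes> X')"
  by (simp add: pure5_def pure4_def pure3_def)

section \<open>Dependence of the tensor product on the record fields\<close>

text \<open>\<open>UU\<close> and \<open>MM\<close> are records with extra fields, and
  \<open>Ealg\<close> and \<open>Dalg\<close> carry another product than the tensor products they
  live on. These congruences identify the tensor products built over them with those over the plain
  spaces.\<close>

lemma tens_cong_vs:
  assumes "carrier V = carrier V'" "add V = add V'" "smult V = smult V'"
    "carrier W = carrier W'" "add W = add W'" "smult W = smult W'"
  shows "tensor_space K V W = tensor_space K V' W'" "pure K V W = pure K V' W'"
proof -
  have r: "bilinear_rels K V W = bilinear_rels K V' W'"
    using assms by (simp add: bilinear_rels_def)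
  have k: "tensor_kernel K V W = tensor_kernel K V' W'"
    using assms r by (simp add: tensor_kernel_def)
  show "tensor_space K V W = tensor_space K V' W'" using assms k by (simp add: tensor_space_def)
  show "pure K V W = pure K V' W'"
    using assms k by (intro ext) (simp add: pure_def)
qed

lemma tens_cong_fields:
  assumes "carrier V = carrier V'" "add V = add V'" "smult V = smult V'"
    "carrier W = carrier W'" "add W = add W'" "smult W = smult W'"
  shows "carrier (V \<boxtimes> W) = carrier (V' \<boxtimes> W')" "add (V \<boxtimes> W) = add (V' \<boxtimes> W')" "smult (V \<boxtimes> W) = smult (V' \<boxtimes> W')"
    "zero (V \<boxtimes> W) = zero (V' \<boxtimes> W')"
  using tens_cong_vs(1)[OF assms] by (simp_all add: tensor_def)

lemma tens_cong:
  assumes "carrier V = carrier V'" "add V = add V'" "smult V = smult V'" "mult V = mult V'" "one V = one V'"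
    "carrier W = carrier W'" "add W = add W'" "smult W = smult W'" "mult W = mult W'" "one W = one W'"
  shows "V \<boxtimes> W = V' \<boxtimes> W'"
  using tens_cong_vs[OF assms(1,2,3,6,7,8)] assms by (simp add: tensor_def)

section \<open>Rearranging fourfold tensors\<close>

text \<open>With P, Q, R, S' equal to A, Y, B, U, the source is (A \<otimes> Y) \<otimes> (B
  \<otimes> U), and X, Y, Z mark the shapes of the smash product, the diagonal crossed product and
  the two-sided crossed product. The primed maps go back.\<close>

definition "shX P Q R S' = tsum K (P \<boxtimes> (S' \<boxtimes> Q) \<boxtimes> R) (\<lambda>e d. tsum K (P \<boxtimes> (S' \<boxtimes> Q) \<boxtimes> R) (\<lambda>p q.
  tsum K (P \<boxtimes> (S' \<boxtimes> Q) \<boxtimes> R) (\<lambda>r s. pure K P ((S' \<boxtimes> Q) \<boxtimes> R) p (pure K (S' \<boxtimes> Q) R (pure K S' Q s q) r)) d) e)"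
definition "shY P Q R S' = tsum K ((P \<boxtimes> R) \<boxtimes> (S' \<boxtimes> Q)) (\<lambda>e d. tsum K ((P \<boxtimes> R) \<boxtimes> (S' \<boxtimes> Q)) (\<lambda>p q.
  tsum K ((P \<boxtimes> R) \<boxtimes> (S' \<boxtimes> Q)) (\<lambda>r s. pure K (P \<boxtimes> R) (S' \<boxtimes> Q) (pure K P R p r) (pure K S' Q s q)) d) e)"
definition "shZ P Q R S' = tsum K (S' \<boxtimes> (P \<boxtimes> R) \<boxtimes> Q) (\<lambda>e d. tsum K (S' \<boxtimes> (P \<boxtimes> R) \<boxtimes> Q) (\<lambda>p q.
  tsum K (S' \<boxtimes> (P \<boxtimes> R) \<boxtimes> Q) (\<lambda>r s. pure K S' ((P \<boxtimes> R) \<boxtimes> Q) s (pure K (P \<boxtimes> R) Q (pure K P R p r) q)) d) e)"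
definition "shX' P Q R S' = tsum K ((P \<boxtimes> Q) \<boxtimes> (R \<boxtimes> S')) (\<lambda>p e. tsum K ((P \<boxtimes> Q) \<boxtimes> (R \<boxtimes> S')) (\<lambda>d r.
  tsum K ((P \<boxtimes> Q) \<boxtimes> (R \<boxtimes> S')) (\<lambda>s q. pure K (P \<boxtimes> Q) (R \<boxtimes> S') (pure K P Q p q) (pure K R S' r s)) d) e)"
definition "shY' P Q R S' = tsum K ((P \<boxtimes> Q) \<boxtimes> (R \<boxtimes> S')) (\<lambda>e d. tsum K ((P \<boxtimes> Q) \<boxtimes> (R \<boxtimes> S')) (\<lambda>p r.
  tsum K ((P \<boxtimes> Q) \<boxtimes> (R \<boxtimes> S')) (\<lambda>s q. pure K (P \<boxtimes> Q) (R \<boxtimes> S') (pure K P Q p q) (pure K R S' r s)) d) e)"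
definition "shZ' P Q R S' = tsum K ((P \<boxtimes> Q) \<boxtimes> (R \<boxtimes> S')) (\<lambda>s e. tsum K ((P \<boxtimes> Q) \<boxtimes> (R \<boxtimes> S')) (\<lambda>d q.
  tsum K ((P \<boxtimes> Q) \<boxtimes> (R \<boxtimes> S')) (\<lambda>p r. pure K (P \<boxtimes> Q) (R \<boxtimes> S') (pure K P Q p q) (pure K R S' r s)) d) e)"

context
  fixes P :: "('k, 'v1, 'c1) module_scheme" and Q :: "('k, 'v2, 'c2) module_scheme"
    and R :: "('k, 'v3, 'c3) module_scheme" and S' :: "('k, 'v4, 'c4) module_scheme"
  assumes vs [simp]: "vs P" "vs Q" "vs R" "vs S'"
begin

abbreviation (input) "src \<equiv> (P \<boxtimes> Q) \<boxtimes> (R \<boxtimes> S')"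
abbreviation (input) "tX \<equiv> P \<boxtimes> (S' \<boxtimes> Q) \<boxtimes> R"
abbreviation (input) "tY \<equiv> (P \<boxtimes> R) \<boxtimes> (S' \<boxtimes> Q)"
abbreviation (input) "tZ \<equiv> S' \<boxtimes> (P \<boxtimes> R) \<boxtimes> Q"
abbreviation (input) "ps p q r s \<equiv> pure K (P \<boxtimes> Q) (R \<boxtimes> S') (pure K P Q p q) (pure K R S' r s)"
abbreviation (input) "pX p q r s \<equiv> pure K P ((S' \<boxtimes> Q) \<boxtimes> R) p (pure K (S' \<boxtimes> Q) R (pure K S' Q s q) r)"
abbreviation (input) "pY p q r s \<equiv> pure K (P \<boxtimes> R) (S' \<boxtimes> Q) (pure K P R p r) (pure K S' Q s q)"
abbreviation (input) "pZ p q r s \<equiv> pure K S' ((P \<boxtimes> R) \<boxtimes> Q) s (pure K (P \<boxtimes> R) Q (pure K P R p r) q)"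

lemma sh_lin: "lin src tX (shX P Q R S')" "lin src tY (shY P Q R S')" "lin src tZ (shZ P Q R S')" "lin tX src (shX' P Q R S')" "lin tY src (shY' P Q R S')" "lin tZ src (shZ' P Q R S')"
  unfolding shX_def shY_def shZ_def shX'_def shY'_def shZ'_def by ((assumption | rule lins | simp)+)[6]

lemma shX_pure: "p \<in> carrier P \<Longrightarrow> q \<in> carrier Q \<Longrightarrow> r \<in> carrier R \<Longrightarrow> s \<in> carrier S' \<Longrightarrow> (shX P Q R S') (ps p q r s) = pX p q r s"
  unfolding shX_def
  apply (subst tsum_pure[where V = "P \<boxtimes> Q" and W = "R \<boxtimes> S'"], ((assumption | rule lins | simp)+)[6])
  apply (subst tsum_pure[where V = P and W = Q], ((assumption | rule lins | simp)+)[6])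
  by (rule tsum_pure[where V = R and W = S']) (assumption | rule lins | simp)+

lemma shY_pure: "p \<in> carrier P \<Longrightarrow> q \<in> carrier Q \<Longrightarrow> r \<in> carrier R \<Longrightarrow> s \<in> carrier S' \<Longrightarrow> (shY P Q R S') (ps p q r s) = pY p q r s"
  unfolding shY_def
  apply (subst tsum_pure[where V = "P \<boxtimes> Q" and W = "R \<boxtimes> S'"], ((assumption | rule lins | simp)+)[6])
  apply (subst tsum_pure[where V = P and W = Q], ((assumption | rule lins | simp)+)[6])
  by (rule tsum_pure[where V = R and W = S']) (assumption | rule lins | simp)+

lemma shZ_pure: "p \<in> carrier P \<Longrightarrow> q \<in> carrier Q \<Longrightarrow> r \<in> carrier R \<Longrightarrow> s \<in> carrier S' \<Longrightarrow> (shZ P Q R S') (ps p q r s) = pZ p q r s"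
  unfolding shZ_def
  apply (subst tsum_pure[where V = "P \<boxtimes> Q" and W = "R \<boxtimes> S'"], ((assumption | rule lins | simp)+)[6])
  apply (subst tsum_pure[where V = P and W = Q], ((assumption | rule lins | simp)+)[6])
  by (rule tsum_pure[where V = R and W = S']) (assumption | rule lins | simp)+

lemma shX'_pure: "p \<in> carrier P \<Longrightarrow> q \<in> carrier Q \<Longrightarrow> r \<in> carrier R \<Longrightarrow> s \<in> carrier S' \<Longrightarrow> (shX' P Q R S') (pX p q r s) = ps p q r s"
  unfolding shX'_def
  apply (subst tsum_pure[where V = P and W = "(S' \<boxtimes> Q) \<boxtimes> R"], ((assumption | rule lins | simp)+)[6])
  apply (subst tsum_pure[where V = "S' \<boxtimes> Q" and W = R], ((assumption | rule lins | simp)+)[6])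
  by (rule tsum_pure[where V = S' and W = Q]) (assumption | rule lins | simp)+

lemma shY'_pure: "p \<in> carrier P \<Longrightarrow> q \<in> carrier Q \<Longrightarrow> r \<in> carrier R \<Longrightarrow> s \<in> carrier S' \<Longrightarrow> (shY' P Q R S') (pY p q r s) = ps p q r s"
  unfolding shY'_def
  apply (subst tsum_pure[where V = "P \<boxtimes> R" and W = "S' \<boxtimes> Q"], ((assumption | rule lins | simp)+)[6])
  apply (subst tsum_pure[where V = P and W = R], ((assumption | rule lins | simp)+)[6])
  by (rule tsum_pure[where V = S' and W = Q]) (assumption | rule lins | simp)+

lemma shZ'_pure: "p \<in> carrier P \<Longrightarrow> q \<in> carrier Q \<Longrightarrow> r \<in> carrier R \<Longrightarrow> s \<in> carrier S' \<Longrightarrow> (shZ' P Q R S') (pZ p q r s) = ps p q r s"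
  unfolding shZ'_def
  apply (subst tsum_pure[where V = S' and W = "(P \<boxtimes> R) \<boxtimes> Q"], ((assumption | rule lins | simp)+)[6])
  apply (subst tsum_pure[where V = "P \<boxtimes> R" and W = Q], ((assumption | rule lins | simp)+)[6])
  by (rule tsum_pure[where V = P and W = R]) (assumption | rule lins | simp)+

lemma ext_src:
  assumes t: "t \<in> carrier src" and f: "lin src Z f" and g: "lin src Z g"
    and e: "\<And>p q r s. p \<in> carrier P \<Longrightarrow> q \<in> carrier Q \<Longrightarrow> r \<in> carrier R \<Longrightarrow> s \<in> carrier S' \<Longrightarrow> f (ps p q r s) = g (ps p q r s)"
  shows "f t = g t"
proof (rule ext2[OF t _ f g])
  fix u v assume u [simp]: "u \<in> carrier (P \<boxtimes> Q)" and v [simp]: "v \<in> carrier (R \<boxtimes> S')"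
  show "f (pure K (P \<boxtimes> Q) (R \<boxtimes> S') u v) = g (pure K (P \<boxtimes> Q) (R \<boxtimes> S') u v)"
  proof (rule ext2[OF u, where Z = Z])
    fix p q assume [simp]: "p \<in> carrier P" "q \<in> carrier Q"
    show "f (pure K (P \<boxtimes> Q) (R \<boxtimes> S') (pure K P Q p q) v) = g (pure K (P \<boxtimes> Q) (R \<boxtimes> S') (pure K P Q p q) v)"
      by (rule ext2[OF v, where Z = Z]) (assumption | rule lins lin_comp[OF f] lin_comp[OF g] e | simp)+
  qed (assumption | rule lins lin_comp[OF f] lin_comp[OF g] | simp)+
qed simp_all

lemma ext_tX:
  assumes t: "t \<in> carrier tX" and f: "lin tX Z f" and g: "lin tX Z g"
    and e: "\<And>p q r s. p \<in> carrier P \<Longrightarrow> q \<in> carrier Q \<Longrightarrow> r \<in> carrier R \<Longrightarrow> s \<in> carrier S' \<Longrightarrow> f (pX p q r s) = g (pX p q r s)"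
  shows "f t = g t"
proof (rule ext3[OF t _ f g])
  fix p u r assume [simp]: "p \<in> carrier P" "r \<in> carrier R" and u: "u \<in> carrier (S' \<boxtimes> Q)"
  show "f (pure K P ((S' \<boxtimes> Q) \<boxtimes> R) p (pure K (S' \<boxtimes> Q) R u r)) = g (pure K P ((S' \<boxtimes> Q) \<boxtimes> R) p (pure K (S' \<boxtimes> Q) R u r))"
    by (rule ext2[OF u, where Z = Z]) (assumption | rule lins lin_comp[OF f] lin_comp[OF g] e | simp)+
qed simp_all

lemma ext_tZ:
  assumes t: "t \<in> carrier tZ" and f: "lin tZ Z f" and g: "lin tZ Z g"
    and e: "\<And>p q r s. p \<in> carrier P \<Longrightarrow> q \<in> carrier Q \<Longrightarrow> r \<in> carrier R \<Longrightarrow> s \<in> carrier S' \<Longrightarrow> f (pZ p q r s) = g (pZ p q r s)"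
  shows "f t = g t"
proof (rule ext3[OF t _ f g])
  fix s u q assume [simp]: "s \<in> carrier S'" "q \<in> carrier Q" and u: "u \<in> carrier (P \<boxtimes> R)"
  show "f (pure K S' ((P \<boxtimes> R) \<boxtimes> Q) s (pure K (P \<boxtimes> R) Q u q)) = g (pure K S' ((P \<boxtimes> R) \<boxtimes> Q) s (pure K (P \<boxtimes> R) Q u q))"
    by (rule ext2[OF u, where Z = Z]) (assumption | rule lins lin_comp[OF f] lin_comp[OF g] e | simp)+
qed simp_all

lemma ext_tY:
  assumes t: "t \<in> carrier tY" and f: "lin tY Z f" and g: "lin tY Z g"
    and e: "\<And>p q r s. p \<in> carrier P \<Longrightarrow> q \<in> carrier Q \<Longrightarrow> r \<in> carrier R \<Longrightarrow> s \<in> carrier S' \<Longrightarrow> f (pY p q r s) = g (pY p q r s)"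
  shows "f t = g t"
proof (rule ext2[OF t _ f g])
  fix u v assume u [simp]: "u \<in> carrier (P \<boxtimes> R)" and v [simp]: "v \<in> carrier (S' \<boxtimes> Q)"
  show "f (pure K (P \<boxtimes> R) (S' \<boxtimes> Q) u v) = g (pure K (P \<boxtimes> R) (S' \<boxtimes> Q) u v)"
  proof (rule ext2[OF u, where Z = Z])
    fix p q assume [simp]: "p \<in> carrier P" "q \<in> carrier R"
    show "f (pure K (P \<boxtimes> R) (S' \<boxtimes> Q) (pure K P R p q) v) = g (pure K (P \<boxtimes> R) (S' \<boxtimes> Q) (pure K P R p q) v)"
      by (rule ext2[OF v, where Z = Z]) (assumption | rule lins lin_comp[OF f] lin_comp[OF g] e | simp)+
  qed (assumption | rule lins lin_comp[OF f] lin_comp[OF g] | simp)+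
qed simp_all

lemma sh_bij: "bij_betw (shX P Q R S') (carrier src) (carrier tX)" "bij_betw (shY P Q R S') (carrier src) (carrier tY)" "bij_betw (shZ P Q R S') (carrier src) (carrier tZ)"
proof -
  note [lins] = lin_comp[OF sh_lin(1)] lin_comp[OF sh_lin(2)] lin_comp[OF sh_lin(3)]
    lin_comp[OF sh_lin(4)] lin_comp[OF sh_lin(5)] lin_comp[OF sh_lin(6)]
  note [simp] = shX_pure shY_pure shZ_pure shX'_pure shY'_pure shZ'_pure
  have 1: "(shX' P Q R S') ((shX P Q R S') t) = t" "(shY' P Q R S') ((shY P Q R S') t) = t" "(shZ' P Q R S') ((shZ P Q R S') t) = t" if t: "t \<in> carrier src" for t
    by (rule ext_src[OF t, where Z = src]; (assumption | rule lins | simp)+)+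
  have 2: "(shX P Q R S') ((shX' P Q R S') t) = t" if t: "t \<in> carrier tX" for t
    by (rule ext_tX[OF t, where Z = tX]) (assumption | rule lins | simp)+
  have 3: "(shY P Q R S') ((shY' P Q R S') t) = t" if t: "t \<in> carrier tY" for t
    by (rule ext_tY[OF t, where Z = tY]) (assumption | rule lins | simp)+
  have 4: "(shZ P Q R S') ((shZ' P Q R S') t) = t" if t: "t \<in> carrier tZ" for t
    by (rule ext_tZ[OF t, where Z = tZ]) (assumption | rule lins | simp)+
  show "bij_betw (shX P Q R S') (carrier src) (carrier tX)"
    by (rule bij_betwI[OF funcsetI[OF lin_closed[OF sh_lin(1)]] funcsetI[OF lin_closed[OF sh_lin(4)]] 1(1) 2])
  show "bij_betw (shY P Q R S') (carrier src) (carrier tY)"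
    by (rule bij_betwI[OF funcsetI[OF lin_closed[OF sh_lin(2)]] funcsetI[OF lin_closed[OF sh_lin(5)]] 1(2) 3])
  show "bij_betw (shZ P Q R S') (carrier src) (carrier tZ)"
    by (rule bij_betwI[OF funcsetI[OF lin_closed[OF sh_lin(3)]] funcsetI[OF lin_closed[OF sh_lin(6)]] 1(3) 4])
qed

text \<open>A linear map out of a tensor product of two algebras given on pure tensors is an algebra map
  as soon as it is multiplicative there.\<close>

lemma ahom_src:
  assumes E: "nalg E" and D: "nalg D" and Z: "bil Z Z Z (mult Z)" "vs Z"
    and f: "lin src Z f"
    and fE: "carrier E = carrier (P \<boxtimes> Q)" "add E = add (P \<boxtimes> Q)" "smult E = smult (P \<boxtimes> Q)"
    and fD: "carrier D = carrier (R \<boxtimes> S')" "add D = add (R \<boxtimes> S')" "smult D = smult (R \<boxtimes> S')"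
    and m: "\<And>p q r s p' q' r' s'. p \<in> carrier P \<Longrightarrow> q \<in> carrier Q \<Longrightarrow> r \<in> carrier R \<Longrightarrow> s \<in> carrier S' \<Longrightarrow>
      p' \<in> carrier P \<Longrightarrow> q' \<in> carrier Q \<Longrightarrow> r' \<in> carrier R \<Longrightarrow> s' \<in> carrier S' \<Longrightarrow>
      f (pure K (P \<boxtimes> Q) (R \<boxtimes> S') (pure K P Q p q \<otimes>\<^bsub>E\<^esub> pure K P Q p' q') (pure K R S' r s \<otimes>\<^bsub>D\<^esub> pure K R S' r' s'))
      = f (ps p q r s) \<otimes>\<^bsub>Z\<^esub> f (ps p' q' r' s')"
    and one: "f (pure K (P \<boxtimes> Q) (R \<boxtimes> S') \<one>\<^bsub>E\<^esub> \<one>\<^bsub>D\<^esub>) = \<one>\<^bsub>Z\<^esub>"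
  shows "ahom (E \<boxtimes> D) Z f"
proof -
  have ED: "carrier (E \<boxtimes> D) = carrier src" "add (E \<boxtimes> D) = add src" "smult (E \<boxtimes> D) = smult src"
    "pure K E D = pure K (P \<boxtimes> Q) (R \<boxtimes> S')"
    using tens_cong_fields[OF fE fD] tens_cong_vs[OF fE fD] by simp_all
  have mb: "bil src src src (mult (E \<boxtimes> D))"
    using tens_mult_bil[OF E D] by (simp add: bilinear_map_def ED)
  note [lins] = lin_comp[OF bil_lin1[OF mb]] lin_comp[OF bil_lin2[OF mb]] lin_comp[OF f]
     lin_comp[OF bil_lin1[OF Z(1)]] lin_comp[OF bil_lin2[OF Z(1)]] lin_closed[OF f]
  have mp: "ps p q r s \<otimes>\<^bsub>E \<boxtimes> D\<^esub> ps p' q' r' s' =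
      pure K (P \<boxtimes> Q) (R \<boxtimes> S') (pure K P Q p q \<otimes>\<^bsub>E\<^esub> pure K P Q p' q') (pure K R S' r s \<otimes>\<^bsub>D\<^esub> pure K R S' r' s')"
    if "p \<in> carrier P" "q \<in> carrier Q" "r \<in> carrier R" "s \<in> carrier S'" "p' \<in> carrier P" "q' \<in> carrier Q" "r' \<in> carrier R" "s' \<in> carrier S'"
    for p q r s p' q' r' s'
    using that tens_mult_pure[OF E D, of "pure K P Q p q" "pure K R S' r s" "pure K P Q p' q'" "pure K R S' r' s'"]
    by (simp add: ED fE fD)
  have "f (x \<otimes>\<^bsub>E \<boxtimes> D\<^esub> y) = f x \<otimes>\<^bsub>Z\<^esub> f y" if x: "x \<in> carrier src" and y: "y \<in> carrier src" for x y
  proof (rule ext_src[OF x, where Z = Z])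
    fix p q r s assume [simp]: "p \<in> carrier P" "q \<in> carrier Q" "r \<in> carrier R" "s \<in> carrier S'"
    show "f (ps p q r s \<otimes>\<^bsub>E \<boxtimes> D\<^esub> y) = f (ps p q r s) \<otimes>\<^bsub>Z\<^esub> f y"
      by (rule ext_src[OF y, where Z = Z]) (assumption | rule lins | simp add: mp m)+
  qed (assumption | rule lins x y | simp)+
  moreover have "lin (E \<boxtimes> D) Z f" using f by (simp add: lin_def ED)
  moreover have "f \<one>\<^bsub>E \<boxtimes> D\<^esub> = \<one>\<^bsub>Z\<^esub>" using one by (simp add: tens_one ED)
  ultimately show ?thesis by (simp add: ahom_def ED)
qed

end

end

context base
begin

text \<open>Substitution in a sum; with \<open>lco_pure\<close> it turns a sum over \<lambda>(x
  \<otimes> y) into one over \<lambda>(y).\<close>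

lemma tsum_rmap:
  assumes t: "t \<in> carrier (V \<boxtimes> W)" and [simp]: "vs V" "vs W" "vs W'" "vs Z" and g: "lin W W' g" and F: "bil V W' Z F"
  shows "tsum K Z F (rmap V W' g t) = tsum K Z (\<lambda>v w. F v (g w)) t"
proof (rule ext2[OF t, where Z = Z])
  have b: "bil V W Z (\<lambda>v w. F v (g w))"
    by (assumption | rule lins lin_comp[OF bil_lin1[OF F]] lin_comp[OF bil_lin2[OF F]] lin_comp[OF g] lin_closed[OF g] | simp)+
  fix v w assume vw: "v \<in> carrier V" "w \<in> carrier W"
  have "tsum K Z F (pure K V W' v (g w)) = F v (g w)"
    by (rule tsum_pure[OF _ _ _ F]) (simp_all add: vw lin_closed[OF g])
  then show "tsum K Z F (rmap V W' g (pure K V W v w)) = tsum K Z (\<lambda>v w. F v (g w)) (pure K V W v w)"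
    by (simp add: vw g tsum_pure[OF _ _ _ b])
next
  show "lin (V \<boxtimes> W) Z (\<lambda>t. tsum K Z F (rmap V W' g t))"
    by (assumption | rule lins F g | simp)+
  show "lin (V \<boxtimes> W) Z (tsum K Z (\<lambda>v w. F v (g w)))"
    by (assumption | rule lins lin_comp[OF bil_lin1[OF F]] lin_comp[OF bil_lin2[OF F]] lin_comp[OF g] lin_closed[OF g] | simp)+
qed simp_all

end

locale full = rmodU K H U B
  for K :: "'k ring" and H :: "('k, 'h) quasi_hopf" and U :: "('k, 'h, 'c) right_comod" and B :: "('k, 'h, 'b) right_mod" +
  fixes A :: "('k, 'h, 'a) left_mod" and Y :: "('k, 'h, 'd) left_comod"
  assumes lm: "left_module_algebra K H A" and lc: "left_comodule_algebra K H Y"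
begin

section \<open>The left module algebra and the left comodule algebra\<close>

lemma A_nalg [simp]: "nalg A"
  using lm unfolding left_module_algebra_def nonassoc_algebra_def nalg_def by blast

lemma lact_bil: "bil H A A (lact A)"
  using lm by (simp only: left_module_algebra_def)

lemmas [lins] = lin_comp[OF bil_lin1[OF lact_bil]] lin_comp[OF bil_lin2[OF lact_bil]]
lemmas lact_closed [simp, lins] = bil_closed[OF lact_bil]
lemmas [simp] = bil_lin2[OF lact_bil]

abbreviation HY where "HY \<equiv> H \<boxtimes> Y"
abbreviation HHY where "HHY \<equiv> H \<boxtimes> HY"
abbreviation AY where "AY \<equiv> A \<boxtimes> Y"
abbreviation AB where "AB \<equiv> A \<boxtimes> B"
abbreviation UY where "UY \<equiv> U \<boxtimes> Y"
abbreviation lam where "lam \<equiv> lcoact Y"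
abbreviation Rl where "Rl \<equiv> lcoact_reassoc Y"
abbreviation ll where "ll \<equiv> inv\<^bsub>HHY\<^esub> Rl"
abbreviation UU where "UU \<equiv> tensor_bicomod K H U Y"
abbreviation MM where "MM \<equiv> tensor_bimod K A B"

lemma Y_alg [simp]: "aalg Y"
  and lam_hom [simp]: "ahom Y HY lam"
  and Rl_unit [simp]: "Rl \<in> Units HHY"
  using lc by (simp_all only: left_comodule_algebra_def Let_def ahom_iff)

lemma lam_lin [simp]: "lin Y HY lam"
  by (rule ahom_lin) simp

lemmas [lins] = lin_comp[OF lam_lin]
lemmas lam_closed [simp, lins] = lin_closed[OF lam_lin]

lemma Rl_closed [simp, lins]: "Rl \<in> carrier HHY" "ll \<in> carrier HHY"
  by simp_all

section \<open>The product on the tensor product of the left tensor factors\<close>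

text \<open>The product of a \<otimes> y and a' \<otimes> y', with \<Phi>_\<lambda>^-1 and
  \<lambda>(y) relaxed to tL and tm. Linearity in both allows the three large products to be
  compared with it on pure tensors.\<close>

definition GE where
  "GE a a' y' tL tm = tsum3 K AY (\<lambda>l1 l2 l3. tsum K AY (\<lambda>m z.
     p2 A Y (lact A l1 a \<otimes>\<^bsub>A\<^esub> lact A (l2 \<otimes>\<^bsub>H\<^esub> m) a') (l3 \<otimes>\<^bsub>Y\<^esub> z \<otimes>\<^bsub>Y\<^esub> y')) tm) tL"

lemma GE_lins [lins]:
  "lin Z A f1 \<Longrightarrow> vs Z \<Longrightarrow> a' \<in> carrier A \<Longrightarrow> y' \<in> carrier Y \<Longrightarrow> tL \<in> carrier HHY \<Longrightarrow> tm \<in> carrier HY \<Longrightarrow>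
    lin Z AY (\<lambda>z. GE (f1 z) a' y' tL tm)"
  "lin Z A f1 \<Longrightarrow> vs Z \<Longrightarrow> a \<in> carrier A \<Longrightarrow> y' \<in> carrier Y \<Longrightarrow> tL \<in> carrier HHY \<Longrightarrow> tm \<in> carrier HY \<Longrightarrow>
    lin Z AY (\<lambda>z. GE a (f1 z) y' tL tm)"
  "lin Z Y f2 \<Longrightarrow> vs Z \<Longrightarrow> a \<in> carrier A \<Longrightarrow> a' \<in> carrier A \<Longrightarrow> tL \<in> carrier HHY \<Longrightarrow> tm \<in> carrier HY \<Longrightarrow>
    lin Z AY (\<lambda>z. GE a a' (f2 z) tL tm)"
  "lin Z HHY f3 \<Longrightarrow> vs Z \<Longrightarrow> a \<in> carrier A \<Longrightarrow> a' \<in> carrier A \<Longrightarrow> y' \<in> carrier Y \<Longrightarrow> tm \<in> carrier HY \<Longrightarrow>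
    lin Z AY (\<lambda>z. GE a a' y' (f3 z) tm)"
  "lin Z HY f4 \<Longrightarrow> vs Z \<Longrightarrow> a \<in> carrier A \<Longrightarrow> a' \<in> carrier A \<Longrightarrow> y' \<in> carrier Y \<Longrightarrow> tL \<in> carrier HHY \<Longrightarrow>
    lin Z AY (\<lambda>z. GE a a' y' tL (f4 z))"
  unfolding GE_def by (assumption | rule lins | simp)+

lemma GE_closed [simp, lins]:
  "a \<in> carrier A \<Longrightarrow> a' \<in> carrier A \<Longrightarrow> y' \<in> carrier Y \<Longrightarrow> tL \<in> carrier HHY \<Longrightarrow> tm \<in> carrier HY \<Longrightarrow> GE a a' y' tL tm \<in> carrier AY"
  unfolding GE_def by (assumption | rule lins | simp)+

lemma GE_pure [simp]:
  "a \<in> carrier A \<Longrightarrow> a' \<in> carrier A \<Longrightarrow> y' \<in> carrier Y \<Longrightarrow> l1 \<in> carrier H \<Longrightarrow> l2 \<in> carrier H \<Longrightarrow> l3 \<in> carrier Y \<Longrightarrow>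
    m \<in> carrier H \<Longrightarrow> z \<in> carrier Y \<Longrightarrow>
    GE a a' y' (p2 H HY l1 (p2 H Y l2 l3)) (p2 H Y m z) =
      p2 A Y (lact A l1 a \<otimes>\<^bsub>A\<^esub> lact A (l2 \<otimes>\<^bsub>H\<^esub> m) a') (l3 \<otimes>\<^bsub>Y\<^esub> z \<otimes>\<^bsub>Y\<^esub> y')"
  unfolding GE_def
  apply (subst tsum3_pure[where U = H and V = H and W = Y], ((assumption | rule lins | simp)+)[10])
  by (rule tsum_pure[where V = H and W = Y]) (assumption | rule lins | simp)+

definition Ealg where "Ealg = palg A Y (\<lambda>a y a' y'. GE a a' y' ll (lam y)) (p2 A Y \<one>\<^bsub>A\<^esub> \<one>\<^bsub>Y\<^esub>)"

lemma Ealg_simps [simp]: "carrier Ealg = carrier AY" "add Ealg = add AY" "smult Ealg = smult AY"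
  "one Ealg = p2 A Y \<one>\<^bsub>A\<^esub> \<one>\<^bsub>Y\<^esub>"
  by (simp_all add: Ealg_def)

lemma Dalg_fields [simp]: "add Dalg = add BU" "add Dalg' = add BU" "smult Dalg = smult BU" "smult Dalg' = smult BU"
  by (simp_all add: Dalg_def Dalg'_def)

lemma Ealg_nalg [simp]: "nalg Ealg"
  unfolding Ealg_def by (rule palg_nalg) (assumption | rule lins | simp)+

lemma Ealg_mult [simp]: "a \<in> carrier A \<Longrightarrow> y \<in> carrier Y \<Longrightarrow> a' \<in> carrier A \<Longrightarrow> y' \<in> carrier Y \<Longrightarrow>
    p2 A Y a y \<otimes>\<^bsub>Ealg\<^esub> p2 A Y a' y' = GE a a' y' ll (lam y)"
  unfolding Ealg_def by (rule palg_mult) (assumption | rule lins | simp)+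

section \<open>The bicomodule algebra\<close>

lemma UU_fields [simp]: "carrier UU = carrier UY" "add UU = add UY" "smult UU = smult UY" "mult UU = mult UY"
  "one UU = one UY" "zero UU = zero UY"
  by (simp_all add: tensor_bicomod_def Let_def)

lemma MM_fields [simp]: "carrier MM = carrier AB" "add MM = add AB" "smult MM = smult AB" "mult MM = mult AB"
  "one MM = one AB" "zero MM = zero AB"
  by (simp_all add: tensor_bimod_def Let_def)

lemma UU_tens [simp]: "UU \<boxtimes> W = UY \<boxtimes> W" "W' \<boxtimes> UU = W' \<boxtimes> UY"
  by (rule tens_cong; simp)+

lemma MM_tens [simp]: "MM \<boxtimes> W = AB \<boxtimes> W" "W' \<boxtimes> MM = W' \<boxtimes> AB"
  by (rule tens_cong; simp)+

lemma UU_pure [simp]: "p2 UU W = p2 UY W" "p2 W' UU = p2 W' UY"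
  by (rule tens_cong_vs; simp)+

lemma MM_pure [simp]: "p2 MM W = p2 AB W" "p2 W' MM = p2 W' AB"
  by (rule tens_cong_vs; simp)+

abbreviation HUY where "HUY \<equiv> H \<boxtimes> UY"
abbreviation UYH where "UYH \<equiv> UY \<boxtimes> H"
abbreviation lco where "lco \<equiv> bi_lcoact UU"
abbreviation rco where "rco \<equiv> bi_rcoact UU"
abbreviation lU where "lU \<equiv> inv\<^bsub>H \<boxtimes> H \<boxtimes> UU\<^esub> (bi_lreassoc UU)"
abbreviation rU where "rU \<equiv> inv\<^bsub>UU \<boxtimes> H \<boxtimes> H\<^esub> (bi_rreassoc UU)"
abbreviation thU where "thU \<equiv> inv\<^bsub>H \<boxtimes> UU \<boxtimes> H\<^esub> (bi_lrreassoc UU)"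

lemma lco_eq: "lco = tsum K HUY (\<lambda>a b. tsum K HUY (\<lambda>b1 b0. p2 H UY b1 (p2 U Y a b0)) (lam b))"
  by (simp add: tensor_bicomod_def Let_def)

lemma rco_eq: "rco = tsum K UYH (\<lambda>a b. tsum K UYH (\<lambda>a0 a1. p2 UY H (p2 U Y a0 b) a1) (rho a))"
  by (simp add: tensor_bicomod_def Let_def)

lemma lco_lin [simp]: "lin UY HUY lco"
  unfolding lco_eq by (assumption | rule lins | simp)+

lemma rco_lin [simp]: "lin UY UYH rco"
  unfolding rco_eq by (assumption | rule lins | simp)+

lemmas [lins] = lin_comp[OF lco_lin] lin_comp[OF rco_lin]
lemmas lco_closed [simp, lins] = lin_closed[OF lco_lin]
lemmas rco_closed [simp, lins] = lin_closed[OF rco_lin]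

lemma pure_left_lin [simp]: "x \<in> carrier U \<Longrightarrow> lin Y UY (p2 U Y x)"
  and pure_right_lin [simp]: "y \<in> carrier Y \<Longrightarrow> lin U UY (\<lambda>x. p2 U Y x y)"
  by (assumption | rule lins | simp)+

abbreviation ltw where "ltw x \<equiv> rmap H UY (p2 U Y x)"
abbreviation rtw where "rtw y \<equiv> tmap UY H (\<lambda>x. p2 U Y x y) (\<lambda>h. h)"

lemma lco_pure: "x \<in> carrier U \<Longrightarrow> y \<in> carrier Y \<Longrightarrow> lco (p2 U Y x y) = ltw x (lam y)"
  unfolding lco_eq tmap_def by (rule tsum_pure[where V = U and W = Y]) (assumption | rule lins | simp)+

lemma rco_pure: "x \<in> carrier U \<Longrightarrow> y \<in> carrier Y \<Longrightarrow> rco (p2 U Y x y) = rtw y (rho x)"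
  unfolding rco_eq tmap_def by (rule tsum_pure[where V = U and W = Y]) (assumption | rule lins | simp)+

abbreviation embl where "embl \<equiv> rmap H HUY (rmap H UY (p2 U Y \<one>\<^bsub>U\<^esub>))"
abbreviation embr where "embr \<equiv> tmap UY H2 (\<lambda>x. p2 U Y x \<one>\<^bsub>Y\<^esub>) (\<lambda>h. h)"

text \<open>Inserting the unit of U into the last leg is an algebra map, so it carries the inverse
  of \<Phi>_\<lambda> of Y to the inverse for U \<otimes> Y.\<close>

lemma lU_eq: "lU = embl ll"
proof -
  have e: "tsum3 K (H \<boxtimes> HUY) (\<lambda>x y z. pure3 K H H UY x y (p2 U Y \<one>\<^bsub>U\<^esub> z)) t = embl t" if t: "t \<in> carrier HHY" for t
    unfolding pure3_def
    by (rule ext3[OF t, where Z = "H \<boxtimes> HUY"], subst tsum3_pure[where U = H and V = H and W = Y])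
      (assumption | rule lins | simp)+
  have "ahom Y UY (p2 U Y \<one>\<^bsub>U\<^esub>)" by (simp add: ahom_def tens_one)
  then have h: "ahom HHY (H \<boxtimes> HUY) embl" by (intro ahom_tmap) (simp_all add: ahom_id)
  have "bi_lreassoc UU = embl Rl"
    using e[of Rl] by (simp add: tensor_bicomod_def Let_def)
  then show ?thesis
    using ahom_Units(2)[OF _ _ h Rl_unit] by simp
qed

lemma rreassoc_eq: "bi_rreassoc UU = embr Rr"
proof -
  have e: "tsum3 K (UY \<boxtimes> H2) (\<lambda>x y z. pure3 K UY H H (p2 U Y x \<one>\<^bsub>Y\<^esub>) y z) t = embr t" if t: "t \<in> carrier U3" for t
    unfolding pure3_def
    by (rule ext3[OF t, where Z = "UY \<boxtimes> H2"], subst tsum3_pure[where U = U and V = H and W = H])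
      (assumption | rule lins | simp)+
  show ?thesis using e[of Rr] by (simp add: tensor_bicomod_def Let_def)
qed

lemma rU_eq: "rU = embr rr"
proof -
  have "ahom U UY (\<lambda>x. p2 U Y x \<one>\<^bsub>Y\<^esub>)" by (simp add: ahom_def tens_one)
  then have h: "ahom U3 (UY \<boxtimes> H2) embr" by (intro ahom_tmap) (simp_all add: ahom_id)
  show ?thesis
    using ahom_Units(2)[OF _ _ h R_unit] by (simp add: rreassoc_eq)
qed

abbreviation th1 where "th1 \<equiv> p2 H UYH \<one>\<^bsub>H\<^esub> (p2 UY H (p2 U Y \<one>\<^bsub>U\<^esub> \<one>\<^bsub>Y\<^esub>) \<one>\<^bsub>H\<^esub>)"

lemma thU_eq: "thU = th1"
proof -
  have "bi_lrreassoc UU = \<one>\<^bsub>H \<boxtimes> UYH\<^esub>"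
    by (simp add: tensor_bicomod_def Let_def pure3_def tens_one)
  then have "thU = \<one>\<^bsub>H \<boxtimes> UYH\<^esub>" by (simp add: monoid.inv_one[OF aalg_monoid])
  then show ?thesis by (simp add: tens_one)
qed

section \<open>The two-sided smash product\<close>

abbreviation TX where "TX \<equiv> A \<boxtimes> UY \<boxtimes> B"

text \<open>The product formula with all structural tensors as parameters: tL, th, tr for the three
  inverse reassociators, tm for \<lambda>(u), tp for \<rho>(u').\<close>

definition prodX where
  "prodX a b a' b' tL th tr tm tp = tsum3 K TX (\<lambda>l1 l2 l3. tsum3 K TX (\<lambda>\<theta>1 \<theta>2 \<theta>3. tsum3 K TX (\<lambda>r1 r2 r3.
     tsum K TX (\<lambda>m z. tsum K TX (\<lambda>p q.
       p2 A (UY \<boxtimes> B) (lact A l1 a \<otimes>\<^bsub>A\<^esub> lact A (l2 \<otimes>\<^bsub>H\<^esub> m \<otimes>\<^bsub>H\<^esub> \<theta>1) a') (p2 UY B (l3 \<otimes>\<^bsub>UY\<^esub> z \<otimes>\<^bsub>UY\<^esub> \<theta>2 \<otimes>\<^bsub>UY\<^esub> p \<otimes>\<^bsub>UY\<^esub> r1)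
         (ract B b (\<theta>3 \<otimes>\<^bsub>H\<^esub> q \<otimes>\<^bsub>H\<^esub> r2) \<otimes>\<^bsub>B\<^esub> ract B b' r3))) tp) tm) tr) th) tL"

lemma prodX_lins [lins]:
  "lin Z A f1 \<Longrightarrow> vs Z \<Longrightarrow> b \<in> carrier B \<Longrightarrow> a' \<in> carrier A \<Longrightarrow> b' \<in> carrier B \<Longrightarrow> tL \<in> carrier (H \<boxtimes> HUY) \<Longrightarrow> th \<in> carrier (H \<boxtimes> UYH) \<Longrightarrow>
    tr \<in> carrier (UY \<boxtimes> H2) \<Longrightarrow> tm \<in> carrier HUY \<Longrightarrow> tp \<in> carrier UYH \<Longrightarrow> lin Z TX (\<lambda>z. prodX (f1 z) b a' b' tL th tr tm tp)"
  "lin Z B f2 \<Longrightarrow> vs Z \<Longrightarrow> a \<in> carrier A \<Longrightarrow> a' \<in> carrier A \<Longrightarrow> b' \<in> carrier B \<Longrightarrow> tL \<in> carrier (H \<boxtimes> HUY) \<Longrightarrow> th \<in> carrier (H \<boxtimes> UYH) \<Longrightarrow>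
    tr \<in> carrier (UY \<boxtimes> H2) \<Longrightarrow> tm \<in> carrier HUY \<Longrightarrow> tp \<in> carrier UYH \<Longrightarrow> lin Z TX (\<lambda>z. prodX a (f2 z) a' b' tL th tr tm tp)"
  "lin Z A f1 \<Longrightarrow> vs Z \<Longrightarrow> a \<in> carrier A \<Longrightarrow> b \<in> carrier B \<Longrightarrow> b' \<in> carrier B \<Longrightarrow> tL \<in> carrier (H \<boxtimes> HUY) \<Longrightarrow> th \<in> carrier (H \<boxtimes> UYH) \<Longrightarrow>
    tr \<in> carrier (UY \<boxtimes> H2) \<Longrightarrow> tm \<in> carrier HUY \<Longrightarrow> tp \<in> carrier UYH \<Longrightarrow> lin Z TX (\<lambda>z. prodX a b (f1 z) b' tL th tr tm tp)"
  "lin Z B f2 \<Longrightarrow> vs Z \<Longrightarrow> a \<in> carrier A \<Longrightarrow> b \<in> carrier B \<Longrightarrow> a' \<in> carrier A \<Longrightarrow> tL \<in> carrier (H \<boxtimes> HUY) \<Longrightarrow> th \<in> carrier (H \<boxtimes> UYH) \<Longrightarrow>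
    tr \<in> carrier (UY \<boxtimes> H2) \<Longrightarrow> tm \<in> carrier HUY \<Longrightarrow> tp \<in> carrier UYH \<Longrightarrow> lin Z TX (\<lambda>z. prodX a b a' (f2 z) tL th tr tm tp)"
  "lin Z (H \<boxtimes> HUY) f3 \<Longrightarrow> vs Z \<Longrightarrow> a \<in> carrier A \<Longrightarrow> b \<in> carrier B \<Longrightarrow> a' \<in> carrier A \<Longrightarrow> b' \<in> carrier B \<Longrightarrow> th \<in> carrier (H \<boxtimes> UYH) \<Longrightarrow>
    tr \<in> carrier (UY \<boxtimes> H2) \<Longrightarrow> tm \<in> carrier HUY \<Longrightarrow> tp \<in> carrier UYH \<Longrightarrow> lin Z TX (\<lambda>z. prodX a b a' b' (f3 z) th tr tm tp)"
  "lin Z (UY \<boxtimes> H2) f4 \<Longrightarrow> vs Z \<Longrightarrow> a \<in> carrier A \<Longrightarrow> b \<in> carrier B \<Longrightarrow> a' \<in> carrier A \<Longrightarrow> b' \<in> carrier B \<Longrightarrow> tL \<in> carrier (H \<boxtimes> HUY) \<Longrightarrow>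
    th \<in> carrier (H \<boxtimes> UYH) \<Longrightarrow> tm \<in> carrier HUY \<Longrightarrow> tp \<in> carrier UYH \<Longrightarrow> lin Z TX (\<lambda>z. prodX a b a' b' tL th (f4 z) tm tp)"
  "lin Z HUY f5 \<Longrightarrow> vs Z \<Longrightarrow> a \<in> carrier A \<Longrightarrow> b \<in> carrier B \<Longrightarrow> a' \<in> carrier A \<Longrightarrow> b' \<in> carrier B \<Longrightarrow> tL \<in> carrier (H \<boxtimes> HUY) \<Longrightarrow>
    th \<in> carrier (H \<boxtimes> UYH) \<Longrightarrow> tr \<in> carrier (UY \<boxtimes> H2) \<Longrightarrow> tp \<in> carrier UYH \<Longrightarrow> lin Z TX (\<lambda>z. prodX a b a' b' tL th tr (f5 z) tp)"
  "lin Z UYH f6 \<Longrightarrow> vs Z \<Longrightarrow> a \<in> carrier A \<Longrightarrow> b \<in> carrier B \<Longrightarrow> a' \<in> carrier A \<Longrightarrow> b' \<in> carrier B \<Longrightarrow> tL \<in> carrier (H \<boxtimes> HUY) \<Longrightarrow>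
    th \<in> carrier (H \<boxtimes> UYH) \<Longrightarrow> tr \<in> carrier (UY \<boxtimes> H2) \<Longrightarrow> tm \<in> carrier HUY \<Longrightarrow> lin Z TX (\<lambda>z. prodX a b a' b' tL th tr tm (f6 z))"
  unfolding prodX_def by (assumption | rule lins | simp)+

lemma prodX_pure:
  "a \<in> carrier A \<Longrightarrow> b \<in> carrier B \<Longrightarrow> a' \<in> carrier A \<Longrightarrow> b' \<in> carrier B \<Longrightarrow>
   l1 \<in> carrier H \<Longrightarrow> l2 \<in> carrier H \<Longrightarrow> l3 \<in> carrier UY \<Longrightarrow> \<theta>1 \<in> carrier H \<Longrightarrow> \<theta>2 \<in> carrier UY \<Longrightarrow> \<theta>3 \<in> carrier H \<Longrightarrow>
   r1 \<in> carrier UY \<Longrightarrow> r2 \<in> carrier H \<Longrightarrow> r3 \<in> carrier H \<Longrightarrow> m \<in> carrier H \<Longrightarrow> z \<in> carrier UY \<Longrightarrow> p \<in> carrier UY \<Longrightarrow> q \<in> carrier H \<Longrightarrow>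
   prodX a b a' b' (p2 H HUY l1 (p2 H UY l2 l3)) (p2 H UYH \<theta>1 (p2 UY H \<theta>2 \<theta>3)) (p2 UY H2 r1 (p2 H H r2 r3)) (p2 H UY m z) (p2 UY H p q)
   = p2 A (UY \<boxtimes> B) (lact A l1 a \<otimes>\<^bsub>A\<^esub> lact A (l2 \<otimes>\<^bsub>H\<^esub> m \<otimes>\<^bsub>H\<^esub> \<theta>1) a') (p2 UY B (l3 \<otimes>\<^bsub>UY\<^esub> z \<otimes>\<^bsub>UY\<^esub> \<theta>2 \<otimes>\<^bsub>UY\<^esub> p \<otimes>\<^bsub>UY\<^esub> r1)
         (ract B b (\<theta>3 \<otimes>\<^bsub>H\<^esub> q \<otimes>\<^bsub>H\<^esub> r2) \<otimes>\<^bsub>B\<^esub> ract B b' r3))"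
  unfolding prodX_def
  apply (subst tsum3_pure[where U = H and V = H and W = UY], ((assumption | rule lins | simp)+)[10])
  apply (subst tsum3_pure[where U = H and V = UY and W = H], ((assumption | rule lins | simp)+)[10])
  apply (subst tsum3_pure[where U = UY and V = H and W = H], ((assumption | rule lins | simp)+)[10])
  apply (subst tsum_pure[where V = H and W = UY], ((assumption | rule lins | simp)+)[6])
  by (rule tsum_pure[where V = UY and W = H]) (assumption | rule lins | simp)+

end

context full
begin

abbreviation ED where "ED \<equiv> AY \<boxtimes> BU"
abbreviation sX where "sX \<equiv> shX A Y B U"
abbreviation sY where "sY \<equiv> shY A Y B U"
abbreviation sZ where "sZ \<equiv> shZ A Y B U"
abbreviation TY where "TY \<equiv> AB \<boxtimes> UY"
abbreviation TZ where "TZ \<equiv> U \<boxtimes> AB \<boxtimes> Y"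

lemma sh_lins [simp]: "lin ED TX sX" "lin ED TY sY" "lin ED TZ sZ"
  by (rule sh_lin; simp)+

lemmas [lins] = lin_comp[OF sh_lins(1)] lin_comp[OF sh_lins(2)] lin_comp[OF sh_lins(3)]

lemma sh_pure [simp]:
  assumes "a \<in> carrier A" "y \<in> carrier Y" "b \<in> carrier B" "x \<in> carrier U"
  shows "sX (p2 AY BU (p2 A Y a y) (p2 B U b x)) = p2 A (UY \<boxtimes> B) a (p2 UY B (p2 U Y x y) b)"
    "sY (p2 AY BU (p2 A Y a y) (p2 B U b x)) = p2 AB UY (p2 A B a b) (p2 U Y x y)"
    "sZ (p2 AY BU (p2 A Y a y) (p2 B U b x)) = p2 U (AB \<boxtimes> Y) x (p2 AB Y (p2 A B a b) y)"
  using assms by (simp_all add: shX_pure shY_pure shZ_pure)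

text \<open>In U \<otimes> Y the middle legs multiply to (1 \<otimes> l3)(x \<otimes> z)(1 \<otimes>
  1)(p \<otimes> y')(r1 \<otimes> 1) = x p r1 \<otimes> l3 z y'. All data of U end up with B and all
  data of Y with A, so the formula separates.\<close>

lemma prodX_emb:
  assumes [simp]: "a \<in> carrier A" "b \<in> carrier B" "a' \<in> carrier A" "b' \<in> carrier B" "x \<in> carrier U" "y' \<in> carrier Y"
    and tL [simp]: "tL \<in> carrier HHY" and tr [simp]: "tr \<in> carrier U3" and tm [simp]: "tm \<in> carrier HY" and tp [simp]: "tp \<in> carrier U2"
  shows "prodX a b a' b' (embl tL) th1 (embr tr) (ltw x tm) (rtw y' tp) =
    sX (p2 AY BU (GE a a' y' tL tm) (act2 b b' (p2 U H2 x \<one>\<^bsub>H2\<^esub> \<otimes>\<^bsub>U3\<^esub> apU tp \<one>\<^bsub>H\<^esub> \<otimes>\<^bsub>U3\<^esub> tr)))"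
    (is "?l tL tr tm tp = ?r tL tr tm tp")
proof (rule ext3[OF tL, where Z = TX])
  fix l1 l2 l3 assume [simp]: "l1 \<in> carrier H" "l2 \<in> carrier H" "l3 \<in> carrier Y"
  let ?L = "p2 H HY l1 (p2 H Y l2 l3)"
  show "?l ?L tr tm tp = ?r ?L tr tm tp"
  proof (rule ext3[OF tr, where Z = TX])
    fix r1 r2 r3 assume [simp]: "r1 \<in> carrier U" "r2 \<in> carrier H" "r3 \<in> carrier H"
    let ?R = "p2 U H2 r1 (p2 H H r2 r3)"
    show "?l ?L ?R tm tp = ?r ?L ?R tm tp"
    proof (rule ext2[OF tm, where Z = TX])
      fix m z assume [simp]: "m \<in> carrier H" "z \<in> carrier Y"
      show "?l ?L ?R (p2 H Y m z) tp = ?r ?L ?R (p2 H Y m z) tp"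
        by (rule ext2[OF tp, where Z = TX]) (assumption | rule lins | simp add: prodX_pure tens_one[of H H])+
    qed (assumption | rule lins tp tm | simp)+
  qed (assumption | rule lins tp tm tr | simp)+
qed (assumption | rule lins tp tm tr tL | simp)+

abbreviation Xalg where "Xalg \<equiv> two_sided_smash_product K H A UU B"

lemma Xalg_fields [simp]: "carrier Xalg = carrier TX" "add Xalg = add TX" "smult Xalg = smult TX" "zero Xalg = zero TX"
  "one Xalg = p2 A (UY \<boxtimes> B) \<one>\<^bsub>A\<^esub> (p2 UY B (p2 U Y \<one>\<^bsub>U\<^esub> \<one>\<^bsub>Y\<^esub>) \<one>\<^bsub>B\<^esub>)"
  by (simp_all add: two_sided_smash_product_def Let_def pure3_def) (simp add: tens_one)

lemma Xalg_mult: "mult Xalg = (\<lambda>s t. tsum3 K TX (\<lambda>a u b. tsum3 K TX (\<lambda>a' u' b'.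
    prodX a b a' b' (embl ll) th1 (embr rr) (lco u) (rco u')) t) s)"
  unfolding two_sided_smash_product_def Let_def lU_eq rU_eq thU_eq prodX_def pure3_def by simp

lemma Xalg_vs [simp]: "vs Xalg"
  by (rule module_cong[THEN iffD2, of _ TX]) simp_all

lemma Xalg_bil: "bil Xalg Xalg Xalg (mult Xalg)"
proof -
  have "bil TX TX TX (mult Xalg)"
    unfolding Xalg_mult by (assumption | rule lins | simp)+
  then show ?thesis by (simp add: bilinear_map_def)
qed

lemma Xalg_mult_pure:
  assumes [simp]: "a \<in> carrier A" "u \<in> carrier UY" "b \<in> carrier B" "a' \<in> carrier A" "u' \<in> carrier UY" "b' \<in> carrier B"
  shows "p2 A (UY \<boxtimes> B) a (p2 UY B u b) \<otimes>\<^bsub>Xalg\<^esub> p2 A (UY \<boxtimes> B) a' (p2 UY B u' b') =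
    prodX a b a' b' (embl ll) th1 (embr rr) (lco u) (rco u')"
  unfolding Xalg_mult
  apply (subst tsum3_pure[where U = A and V = UY and W = B and u = a and v = u and w = b], ((assumption | rule lins | simp)+)[10])
  by (rule tsum3_pure[where U = A and V = UY and W = B]) (assumption | rule lins | simp)+

lemma ED_carrier: "carrier (Ealg \<boxtimes> Dalg) = carrier ED" "carrier (Ealg \<boxtimes> Dalg') = carrier ED"
  by (rule tens_cong_fields; simp)+

lemma X_giso: "giso (Ealg \<boxtimes> Dalg) Xalg sX"
  unfolding giso_def
proof
  show "bij_betw sX (carrier (Ealg \<boxtimes> Dalg)) (carrier Xalg)"
    using sh_bij(1)[of A Y B U] by (simp add: ED_carrier)
  show "ahom (Ealg \<boxtimes> Dalg) Xalg sX"
    by (rule ahom_src[where P = A and Q = Y and R = B and S' = U])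
      (simp_all add: Xalg_bil lin_def[of _ Xalg] sh_lins[unfolded lin_def] Xalg_mult_pure lco_pure rco_pure prodX_emb gD_def)
qed

section \<open>The two-sided crossed product\<close>

abbreviation lM where "lM \<equiv> bi_lact MM"
abbreviation rM where "rM \<equiv> bi_ract MM"

lemma lM_eq: "lM h = tsum K AB (\<lambda>a b. p2 A B (lact A h a) b)"
  and rM_eq: "rM t h = tsum K AB (\<lambda>a b. p2 A B a (ract B b h)) t"
  by (simp_all add: tensor_bimod_def Let_def)

lemma lM_lins [lins]:
  "lin Z H f1 \<Longrightarrow> vs Z \<Longrightarrow> t \<in> carrier AB \<Longrightarrow> lin Z AB (\<lambda>z. lM (f1 z) t)"
  "lin Z AB f2 \<Longrightarrow> h \<in> carrier H \<Longrightarrow> lin Z AB (\<lambda>z. lM h (f2 z))"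
  "lin Z H f1 \<Longrightarrow> vs Z \<Longrightarrow> t \<in> carrier AB \<Longrightarrow> lin Z AB (\<lambda>z. rM t (f1 z))"
  "lin Z AB f2 \<Longrightarrow> h \<in> carrier H \<Longrightarrow> lin Z AB (\<lambda>z. rM (f2 z) h)"
  unfolding lM_eq rM_eq by (assumption | rule lins | simp)+

lemma lM_closed [simp, lins]: "h \<in> carrier H \<Longrightarrow> t \<in> carrier AB \<Longrightarrow> lM h t \<in> carrier AB"
  "h \<in> carrier H \<Longrightarrow> t \<in> carrier AB \<Longrightarrow> rM t h \<in> carrier AB"
  unfolding lM_eq rM_eq by (assumption | rule lins | simp)+

lemma lM_pure [simp]: "h \<in> carrier H \<Longrightarrow> a \<in> carrier A \<Longrightarrow> b \<in> carrier B \<Longrightarrow> lM h (p2 A B a b) = p2 A B (lact A h a) b"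
  "h \<in> carrier H \<Longrightarrow> a \<in> carrier A \<Longrightarrow> b \<in> carrier B \<Longrightarrow> rM (p2 A B a b) h = p2 A B a (ract B b h)"
  unfolding lM_eq rM_eq by (rule tsum_pure[where V = A and W = B]; (assumption | rule lins | simp)+)+

text \<open>As \<open>prodX\<close>, but the inverse reassociators are those of U and Y themselves,
  so no units have to be inserted.\<close>

definition prodZ where
  "prodZ x \<phi> \<phi>' y' tr tL tp tm = tsum3 K TZ (\<lambda>r1 r2 r3. tsum3 K TZ (\<lambda>l1 l2 l3.
     tsum K TZ (\<lambda>p q. tsum K TZ (\<lambda>m z. p2 U (AB \<boxtimes> Y) (x \<otimes>\<^bsub>U\<^esub> p \<otimes>\<^bsub>U\<^esub> r1)
       (p2 AB Y (rM (lM l1 \<phi>) (q \<otimes>\<^bsub>H\<^esub> r2) \<otimes>\<^bsub>AB\<^esub> rM (lM (l2 \<otimes>\<^bsub>H\<^esub> m) \<phi>') r3) (l3 \<otimes>\<^bsub>Y\<^esub> z \<otimes>\<^bsub>Y\<^esub> y'))) tm) tp) tL) tr"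

lemma prodZ_lins [lins]:
  "lin Z U f1 \<Longrightarrow> vs Z \<Longrightarrow> \<phi> \<in> carrier AB \<Longrightarrow> \<phi>' \<in> carrier AB \<Longrightarrow> y' \<in> carrier Y \<Longrightarrow> tr \<in> carrier U3 \<Longrightarrow> tL \<in> carrier HHY \<Longrightarrow>
    tp \<in> carrier U2 \<Longrightarrow> tm \<in> carrier HY \<Longrightarrow> lin Z TZ (\<lambda>z. prodZ (f1 z) \<phi> \<phi>' y' tr tL tp tm)"
  "lin Z AB f2 \<Longrightarrow> vs Z \<Longrightarrow> x \<in> carrier U \<Longrightarrow> \<phi>' \<in> carrier AB \<Longrightarrow> y' \<in> carrier Y \<Longrightarrow> tr \<in> carrier U3 \<Longrightarrow> tL \<in> carrier HHY \<Longrightarrow>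
    tp \<in> carrier U2 \<Longrightarrow> tm \<in> carrier HY \<Longrightarrow> lin Z TZ (\<lambda>z. prodZ x (f2 z) \<phi>' y' tr tL tp tm)"
  "lin Z AB f2 \<Longrightarrow> vs Z \<Longrightarrow> x \<in> carrier U \<Longrightarrow> \<phi> \<in> carrier AB \<Longrightarrow> y' \<in> carrier Y \<Longrightarrow> tr \<in> carrier U3 \<Longrightarrow> tL \<in> carrier HHY \<Longrightarrow>
    tp \<in> carrier U2 \<Longrightarrow> tm \<in> carrier HY \<Longrightarrow> lin Z TZ (\<lambda>z. prodZ x \<phi> (f2 z) y' tr tL tp tm)"
  "lin Z Y f3 \<Longrightarrow> vs Z \<Longrightarrow> x \<in> carrier U \<Longrightarrow> \<phi> \<in> carrier AB \<Longrightarrow> \<phi>' \<in> carrier AB \<Longrightarrow> tr \<in> carrier U3 \<Longrightarrow> tL \<in> carrier HHY \<Longrightarrow>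
    tp \<in> carrier U2 \<Longrightarrow> tm \<in> carrier HY \<Longrightarrow> lin Z TZ (\<lambda>z. prodZ x \<phi> \<phi>' (f3 z) tr tL tp tm)"
  "lin Z U3 f4 \<Longrightarrow> vs Z \<Longrightarrow> x \<in> carrier U \<Longrightarrow> \<phi> \<in> carrier AB \<Longrightarrow> \<phi>' \<in> carrier AB \<Longrightarrow> y' \<in> carrier Y \<Longrightarrow> tL \<in> carrier HHY \<Longrightarrow>
    tp \<in> carrier U2 \<Longrightarrow> tm \<in> carrier HY \<Longrightarrow> lin Z TZ (\<lambda>z. prodZ x \<phi> \<phi>' y' (f4 z) tL tp tm)"
  "lin Z HHY f5 \<Longrightarrow> vs Z \<Longrightarrow> x \<in> carrier U \<Longrightarrow> \<phi> \<in> carrier AB \<Longrightarrow> \<phi>' \<in> carrier AB \<Longrightarrow> y' \<in> carrier Y \<Longrightarrow> tr \<in> carrier U3 \<Longrightarrow>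
    tp \<in> carrier U2 \<Longrightarrow> tm \<in> carrier HY \<Longrightarrow> lin Z TZ (\<lambda>z. prodZ x \<phi> \<phi>' y' tr (f5 z) tp tm)"
  "lin Z U2 f6 \<Longrightarrow> vs Z \<Longrightarrow> x \<in> carrier U \<Longrightarrow> \<phi> \<in> carrier AB \<Longrightarrow> \<phi>' \<in> carrier AB \<Longrightarrow> y' \<in> carrier Y \<Longrightarrow> tr \<in> carrier U3 \<Longrightarrow>
    tL \<in> carrier HHY \<Longrightarrow> tm \<in> carrier HY \<Longrightarrow> lin Z TZ (\<lambda>z. prodZ x \<phi> \<phi>' y' tr tL (f6 z) tm)"
  "lin Z HY f7 \<Longrightarrow> vs Z \<Longrightarrow> x \<in> carrier U \<Longrightarrow> \<phi> \<in> carrier AB \<Longrightarrow> \<phi>' \<in> carrier AB \<Longrightarrow> y' \<in> carrier Y \<Longrightarrow> tr \<in> carrier U3 \<Longrightarrow>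
    tL \<in> carrier HHY \<Longrightarrow> tp \<in> carrier U2 \<Longrightarrow> lin Z TZ (\<lambda>z. prodZ x \<phi> \<phi>' y' tr tL tp (f7 z))"
  unfolding prodZ_def by (assumption | rule lins | simp)+

lemma prodZ_pure:
  "x \<in> carrier U \<Longrightarrow> \<phi> \<in> carrier AB \<Longrightarrow> \<phi>' \<in> carrier AB \<Longrightarrow> y' \<in> carrier Y \<Longrightarrow>
   r1 \<in> carrier U \<Longrightarrow> r2 \<in> carrier H \<Longrightarrow> r3 \<in> carrier H \<Longrightarrow> l1 \<in> carrier H \<Longrightarrow> l2 \<in> carrier H \<Longrightarrow> l3 \<in> carrier Y \<Longrightarrow>
   p \<in> carrier U \<Longrightarrow> q \<in> carrier H \<Longrightarrow> m \<in> carrier H \<Longrightarrow> z \<in> carrier Y \<Longrightarrow>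
   prodZ x \<phi> \<phi>' y' (p2 U H2 r1 (p2 H H r2 r3)) (p2 H HY l1 (p2 H Y l2 l3)) (p2 U H p q) (p2 H Y m z) =
   p2 U (AB \<boxtimes> Y) (x \<otimes>\<^bsub>U\<^esub> p \<otimes>\<^bsub>U\<^esub> r1)
       (p2 AB Y (rM (lM l1 \<phi>) (q \<otimes>\<^bsub>H\<^esub> r2) \<otimes>\<^bsub>AB\<^esub> rM (lM (l2 \<otimes>\<^bsub>H\<^esub> m) \<phi>') r3) (l3 \<otimes>\<^bsub>Y\<^esub> z \<otimes>\<^bsub>Y\<^esub> y'))"
  unfolding prodZ_def
  apply (subst tsum3_pure[where U = U and V = H and W = H], ((assumption | rule lins | simp)+)[10])
  apply (subst tsum3_pure[where U = H and V = H and W = Y], ((assumption | rule lins | simp)+)[10])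
  apply (subst tsum_pure[where V = U and W = H], ((assumption | rule lins | simp)+)[6])
  by (rule tsum_pure[where V = H and W = Y]) (assumption | rule lins | simp)+

text \<open>The left action on A \<otimes> B sees only A and carries the data of Y; the right action
  sees only B and carries the data of U.\<close>

lemma prodZ_emb:
  assumes [simp]: "a \<in> carrier A" "b \<in> carrier B" "a' \<in> carrier A" "b' \<in> carrier B" "x \<in> carrier U" "y' \<in> carrier Y"
    and tL [simp]: "tL \<in> carrier HHY" and tr [simp]: "tr \<in> carrier U3" and tm [simp]: "tm \<in> carrier HY" and tp [simp]: "tp \<in> carrier U2"
  shows "prodZ x (p2 A B a b) (p2 A B a' b') y' tr tL tp tm =
    sZ (p2 AY BU (GE a a' y' tL tm) (act2 b b' (p2 U H2 x \<one>\<^bsub>H2\<^esub> \<otimes>\<^bsub>U3\<^esub> apU tp \<one>\<^bsub>H\<^esub> \<otimes>\<^bsub>U3\<^esub> tr)))"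
    (is "?l tL tr tm tp = ?r tL tr tm tp")
proof (rule ext3[OF tL, where Z = TZ])
  fix l1 l2 l3 assume [simp]: "l1 \<in> carrier H" "l2 \<in> carrier H" "l3 \<in> carrier Y"
  let ?L = "p2 H HY l1 (p2 H Y l2 l3)"
  show "?l ?L tr tm tp = ?r ?L tr tm tp"
  proof (rule ext3[OF tr, where Z = TZ])
    fix r1 r2 r3 assume [simp]: "r1 \<in> carrier U" "r2 \<in> carrier H" "r3 \<in> carrier H"
    let ?R = "p2 U H2 r1 (p2 H H r2 r3)"
    show "?l ?L ?R tm tp = ?r ?L ?R tm tp"
    proof (rule ext2[OF tm, where Z = TZ])
      fix m z assume [simp]: "m \<in> carrier H" "z \<in> carrier Y"
      show "?l ?L ?R (p2 H Y m z) tp = ?r ?L ?R (p2 H Y m z) tp"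
        by (rule ext2[OF tp, where Z = TZ]) (assumption | rule lins | simp add: prodZ_pure tens_one[of H H])+
    qed (assumption | rule lins tp tm | simp)+
  qed (assumption | rule lins tp tm tr | simp)+
qed (assumption | rule lins tp tm tr tL | simp)+

abbreviation Zalg where "Zalg \<equiv> two_sided_crossed_product K H U MM Y"

lemma Zalg_fields [simp]: "carrier Zalg = carrier TZ" "add Zalg = add TZ" "smult Zalg = smult TZ" "zero Zalg = zero TZ"
  "one Zalg = p2 U (AB \<boxtimes> Y) \<one>\<^bsub>U\<^esub> (p2 AB Y (p2 A B \<one>\<^bsub>A\<^esub> \<one>\<^bsub>B\<^esub>) \<one>\<^bsub>Y\<^esub>)"
  by (simp_all add: two_sided_crossed_product_def Let_def pure3_def) (simp add: tens_one)

lemma Zalg_mult: "mult Zalg = (\<lambda>s t. tsum3 K TZ (\<lambda>x \<phi> y. tsum3 K TZ (\<lambda>x' \<phi>' y'.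
    prodZ x \<phi> \<phi>' y' rr ll (rho x') (lam y)) t) s)"
  unfolding two_sided_crossed_product_def Let_def prodZ_def pure3_def by simp

lemma Zalg_vs [simp]: "vs Zalg"
  by (rule module_cong[THEN iffD2, of _ TZ]) simp_all

lemma Zalg_bil: "bil Zalg Zalg Zalg (mult Zalg)"
proof -
  have "bil TZ TZ TZ (mult Zalg)"
    unfolding Zalg_mult by (assumption | rule lins | simp)+
  then show ?thesis by (simp add: bilinear_map_def)
qed

lemma Zalg_mult_pure:
  assumes [simp]: "x \<in> carrier U" "\<phi> \<in> carrier AB" "y \<in> carrier Y" "x' \<in> carrier U" "\<phi>' \<in> carrier AB" "y' \<in> carrier Y"
  shows "p2 U (AB \<boxtimes> Y) x (p2 AB Y \<phi> y) \<otimes>\<^bsub>Zalg\<^esub> p2 U (AB \<boxtimes> Y) x' (p2 AB Y \<phi>' y') =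
    prodZ x \<phi> \<phi>' y' rr ll (rho x') (lam y)"
  unfolding Zalg_mult
  apply (subst tsum3_pure[where U = U and V = AB and W = Y and u = x and v = \<phi> and w = y], ((assumption | rule lins | simp)+)[10])
  by (rule tsum3_pure[where U = U and V = AB and W = Y]) (assumption | rule lins | simp)+

lemma Z_giso: "giso (Ealg \<boxtimes> Dalg) Zalg sZ"
  unfolding giso_def
proof
  show "bij_betw sZ (carrier (Ealg \<boxtimes> Dalg)) (carrier Zalg)"
    using sh_bij(3)[of A Y B U] by (simp add: ED_carrier)
  show "ahom (Ealg \<boxtimes> Dalg) Zalg sZ"
    by (rule ahom_src[where P = A and Q = Y and R = B and S' = U])
      (simp_all add: Zalg_bil lin_def[of _ Zalg] sh_lins[unfolded lin_def] Zalg_mult_pure prodZ_emb gD_def)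
qed

end

context base
begin

lemma ext5:
  assumes t: "t \<in> carrier (U \<boxtimes> V \<boxtimes> W \<boxtimes> X \<boxtimes> Y)"
    and e: "\<And>u v w x y. u \<in> carrier U \<Longrightarrow> v \<in> carrier V \<Longrightarrow> w \<in> carrier W \<Longrightarrow> x \<in> carrier X \<Longrightarrow> y \<in> carrier Y \<Longrightarrow>
      f (pure5 K U V W X Y u v w x y) = g (pure5 K U V W X Y u v w x y)"
    and f: "lin (U \<boxtimes> V \<boxtimes> W \<boxtimes> X \<boxtimes> Y) Z f" and g: "lin (U \<boxtimes> V \<boxtimes> W \<boxtimes> X \<boxtimes> Y) Z g"
    and [simp]: "vs U" "vs V" "vs W" "vs X" "vs Y"
  shows "f t = g t"
proof (rule ext2[OF t _ f g])
  fix u s assume [simp]: "u \<in> carrier U" "s \<in> carrier (V \<boxtimes> W \<boxtimes> X \<boxtimes> Y)"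
  show "f (pure K U (V \<boxtimes> W \<boxtimes> X \<boxtimes> Y) u s) = g (pure K U (V \<boxtimes> W \<boxtimes> X \<boxtimes> Y) u s)"
    by (rule ext4[where t = s and U = V and V = W and W = X and X = Y and Z = Z])
      (assumption | rule lins lin_comp[OF f] lin_comp[OF g] e[unfolded pure5_def pure4_def pure3_def] | simp)+
qed simp_all

end

context full
begin

section \<open>The diagonal crossed product\<close>

abbreviation T5 where "T5 \<equiv> H \<boxtimes> H \<boxtimes> UY \<boxtimes> H \<boxtimes> H"

text \<open>\<Omega> for U \<otimes> Y with the trivial \<theta> already inserted, and with
  \<Phi>_\<rho>, \<Phi>_\<lambda>^-1 and f as the parameters tR, tL and tf.\<close>

definition Omg where
  "Omg tR tL tf = tsum3 K T5 (\<lambda>X1 X2 X3. tsum3 K T5 (\<lambda>l1 l2 l3. tsum3 K T5 (\<lambda>\<theta>1 \<theta>2 \<theta>3. tsum K T5 (\<lambda>f1 f2.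
     tsum K T5 (\<lambda>X1m X1z. tsum K T5 (\<lambda>X1m1 X1m2. tsum K T5 (\<lambda>\<theta>2m \<theta>2z.
       pure5 K H H UY H H (X1m1 \<otimes>\<^bsub>H\<^esub> l1 \<otimes>\<^bsub>H\<^esub> \<theta>1) (X1m2 \<otimes>\<^bsub>H\<^esub> l2 \<otimes>\<^bsub>H\<^esub> \<theta>2m) (X1z \<otimes>\<^bsub>UY\<^esub> l3 \<otimes>\<^bsub>UY\<^esub> \<theta>2z)
         (Si (f1 \<otimes>\<^bsub>H\<^esub> X2 \<otimes>\<^bsub>H\<^esub> \<theta>3)) (Si (f2 \<otimes>\<^bsub>H\<^esub> X3)))
     (lco \<theta>2)) (Del X1m)) (lco X1)) tf) th1) tL) tR"

lemma Omega_eq: "Omega K H UU = Omg (embr Rr) (embl ll) tw"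
  unfolding Omega_def Let_def lU_eq thU_eq rreassoc_eq Omg_def pure5_def pure4_def pure3_def by simp

text \<open>The left coaction sees only the factor in Y. The first leg of \<Phi>_\<rho> and the
  middle leg of \<theta> have 1 there, so every leg that \<lambda> contributes to \<Omega> is
  trivial.\<close>

lemma lco_one: "x \<in> carrier U \<Longrightarrow> lco (p2 U Y x \<one>\<^bsub>Y\<^esub>) = p2 H UY \<one>\<^bsub>H\<^esub> (p2 U Y x \<one>\<^bsub>Y\<^esub>)"
  by (simp add: lco_pure ahom_one[OF lam_hom]) (simp add: tens_one)

lemma Omg_lins [lins]:
  "lin Z (UY \<boxtimes> H2) f1 \<Longrightarrow> vs Z \<Longrightarrow> tL \<in> carrier (H \<boxtimes> HUY) \<Longrightarrow> tf \<in> carrier H2 \<Longrightarrow> lin Z T5 (\<lambda>z. Omg (f1 z) tL tf)"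
  "lin Z (H \<boxtimes> HUY) f2 \<Longrightarrow> vs Z \<Longrightarrow> tR \<in> carrier (UY \<boxtimes> H2) \<Longrightarrow> tf \<in> carrier H2 \<Longrightarrow> lin Z T5 (\<lambda>z. Omg tR (f2 z) tf)"
  "lin Z H2 f3 \<Longrightarrow> vs Z \<Longrightarrow> tR \<in> carrier (UY \<boxtimes> H2) \<Longrightarrow> tL \<in> carrier (H \<boxtimes> HUY) \<Longrightarrow> lin Z T5 (\<lambda>z. Omg tR tL (f3 z))"
  unfolding Omg_def by (assumption | rule lins | simp)+

lemma Omg_closed [simp, lins]:
  "tR \<in> carrier (UY \<boxtimes> H2) \<Longrightarrow> tL \<in> carrier (H \<boxtimes> HUY) \<Longrightarrow> tf \<in> carrier H2 \<Longrightarrow> Omg tR tL tf \<in> carrier T5"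
  unfolding Omg_def by (assumption | rule lins | simp)+

lemma Omg_pure:
  assumes [simp]: "X \<in> carrier U" "X2 \<in> carrier H" "X3 \<in> carrier H" "l1 \<in> carrier H" "l2 \<in> carrier H" "l3 \<in> carrier UY"
    "f1 \<in> carrier H" "f2 \<in> carrier H"
  shows "Omg (p2 UY H2 (p2 U Y X \<one>\<^bsub>Y\<^esub>) (p2 H H X2 X3)) (p2 H HUY l1 (p2 H UY l2 l3)) (p2 H H f1 f2) =
    pure5 K H H UY H H l1 l2 (p2 U Y X \<one>\<^bsub>Y\<^esub> \<otimes>\<^bsub>UY\<^esub> l3) (Si (f1 \<otimes>\<^bsub>H\<^esub> X2)) (Si (f2 \<otimes>\<^bsub>H\<^esub> X3))"
  unfolding Omg_def
  apply (rule trans, rule tsum3_pure[where U = UY and V = H and W = H], ((assumption | rule lins | simp)+)[10])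
  apply (rule trans, rule tsum3_pure[where U = H and V = H and W = UY], ((assumption | rule lins | simp)+)[10])
  apply (rule trans, rule tsum3_pure[where U = H and V = UY and W = H], ((assumption | rule lins | simp)+)[10])
  apply (rule trans, rule tsum_pure[where V = H and W = H and v = f1 and w = f2], ((assumption | rule lins | simp)+)[6])
  unfolding lco_one[OF assms(1)] lco_one[OF nalg_one[OF aalg_nalg[OF U_alg]]]
  apply (rule trans, rule tsum_pure[where V = H and W = UY and v = "\<one>\<^bsub>H\<^esub>" and w = "p2 U Y X \<one>\<^bsub>Y\<^esub>"], ((assumption | rule lins | simp)+)[6])
  unfolding Del_one tens_one[of H H]
  apply (rule trans, rule tsum_pure[where V = H and W = H and v = "\<one>\<^bsub>H\<^esub>" and w = "\<one>\<^bsub>H\<^esub>"], ((assumption | rule lins | simp)+)[6])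
  apply (rule trans, rule tsum_pure[where V = H and W = UY], ((assumption | rule lins | simp)+)[6])
  by (simp del: tens_mult_pure Si_mult flip: tens_one)

definition coreY where
  "coreY \<phi> \<phi>' u' O1 O2 O3 O4 O5 u1 m z = p2 AB UY
     (rM (lM O1 \<phi>) O5 \<otimes>\<^bsub>AB\<^esub> rM (lM (O2 \<otimes>\<^bsub>H\<^esub> m) \<phi>') (Si u1 \<otimes>\<^bsub>H\<^esub> O4)) (O3 \<otimes>\<^bsub>UY\<^esub> z \<otimes>\<^bsub>UY\<^esub> u')"

definition prodY where
  "prodY \<phi> \<phi>' u' Om tu = tsum5 K TY (\<lambda>O1 O2 O3 O4 O5. tsum K TY (\<lambda>u0 u1.
     tsum K TY (\<lambda>m z. coreY \<phi> \<phi>' u' O1 O2 O3 O4 O5 u1 m z) (lco u0)) tu) Om"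

text \<open>In \<open>prodY\<close> the left coaction is applied to a leg of \<rho>(u), so the two
  coactions are nested. For u = x \<otimes> y, \<rho> touches only x and \<lambda> only y; hence
  \<rho>(x) and \<lambda>(y) can be the independent parameters tp and tm here.\<close>

definition prodY2 where
  "prodY2 \<phi> \<phi>' u' Om tp tm = tsum5 K TY (\<lambda>O1 O2 O3 O4 O5. tsum K TY (\<lambda>x0 x1.
     tsum K TY (\<lambda>m z. coreY \<phi> \<phi>' u' O1 O2 O3 O4 O5 x1 m (p2 U Y x0 z)) tm) tp) Om"

lemma prodY_lins [lins]:
  "lin Z AB f1 \<Longrightarrow> vs Z \<Longrightarrow> \<phi>' \<in> carrier AB \<Longrightarrow> u' \<in> carrier UY \<Longrightarrow> Om \<in> carrier T5 \<Longrightarrow> tu \<in> carrier UYH \<Longrightarrow>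
    lin Z TY (\<lambda>z. prodY (f1 z) \<phi>' u' Om tu)"
  "lin Z AB f1 \<Longrightarrow> vs Z \<Longrightarrow> \<phi> \<in> carrier AB \<Longrightarrow> u' \<in> carrier UY \<Longrightarrow> Om \<in> carrier T5 \<Longrightarrow> tu \<in> carrier UYH \<Longrightarrow>
    lin Z TY (\<lambda>z. prodY \<phi> (f1 z) u' Om tu)"
  "lin Z UY f2 \<Longrightarrow> vs Z \<Longrightarrow> \<phi> \<in> carrier AB \<Longrightarrow> \<phi>' \<in> carrier AB \<Longrightarrow> Om \<in> carrier T5 \<Longrightarrow> tu \<in> carrier UYH \<Longrightarrow>
    lin Z TY (\<lambda>z. prodY \<phi> \<phi>' (f2 z) Om tu)"
  "lin Z T5 f3 \<Longrightarrow> vs Z \<Longrightarrow> \<phi> \<in> carrier AB \<Longrightarrow> \<phi>' \<in> carrier AB \<Longrightarrow> u' \<in> carrier UY \<Longrightarrow> tu \<in> carrier UYH \<Longrightarrow>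
    lin Z TY (\<lambda>z. prodY \<phi> \<phi>' u' (f3 z) tu)"
  "lin Z UYH f4 \<Longrightarrow> vs Z \<Longrightarrow> \<phi> \<in> carrier AB \<Longrightarrow> \<phi>' \<in> carrier AB \<Longrightarrow> u' \<in> carrier UY \<Longrightarrow> Om \<in> carrier T5 \<Longrightarrow>
    lin Z TY (\<lambda>z. prodY \<phi> \<phi>' u' Om (f4 z))"
  unfolding prodY_def coreY_def by (assumption | rule lins | simp)+

lemma prodY2_lins [lins]:
  "lin Z T5 f3 \<Longrightarrow> vs Z \<Longrightarrow> \<phi> \<in> carrier AB \<Longrightarrow> \<phi>' \<in> carrier AB \<Longrightarrow> u' \<in> carrier UY \<Longrightarrow> tp \<in> carrier U2 \<Longrightarrow> tm \<in> carrier HY \<Longrightarrow>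
    lin Z TY (\<lambda>z. prodY2 \<phi> \<phi>' u' (f3 z) tp tm)"
  "lin Z U2 f4 \<Longrightarrow> vs Z \<Longrightarrow> \<phi> \<in> carrier AB \<Longrightarrow> \<phi>' \<in> carrier AB \<Longrightarrow> u' \<in> carrier UY \<Longrightarrow> Om \<in> carrier T5 \<Longrightarrow> tm \<in> carrier HY \<Longrightarrow>
    lin Z TY (\<lambda>z. prodY2 \<phi> \<phi>' u' Om (f4 z) tm)"
  "lin Z HY f5 \<Longrightarrow> vs Z \<Longrightarrow> \<phi> \<in> carrier AB \<Longrightarrow> \<phi>' \<in> carrier AB \<Longrightarrow> u' \<in> carrier UY \<Longrightarrow> Om \<in> carrier T5 \<Longrightarrow> tp \<in> carrier U2 \<Longrightarrow>
    lin Z TY (\<lambda>z. prodY2 \<phi> \<phi>' u' Om tp (f5 z))"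
  unfolding prodY2_def coreY_def by (assumption | rule lins | simp)+

lemma coreY_bil:
  "\<phi> \<in> carrier AB \<Longrightarrow> \<phi>' \<in> carrier AB \<Longrightarrow> u' \<in> carrier UY \<Longrightarrow> O1 \<in> carrier H \<Longrightarrow> O2 \<in> carrier H \<Longrightarrow> O3 \<in> carrier UY \<Longrightarrow>
   O4 \<in> carrier H \<Longrightarrow> O5 \<in> carrier H \<Longrightarrow> u1 \<in> carrier H \<Longrightarrow> bil H UY TY (coreY \<phi> \<phi>' u' O1 O2 O3 O4 O5 u1)"
  unfolding coreY_def by (assumption | rule lins | simp)+

lemma prodY_pure5:
  "\<phi> \<in> carrier AB \<Longrightarrow> \<phi>' \<in> carrier AB \<Longrightarrow> u' \<in> carrier UY \<Longrightarrow> O1 \<in> carrier H \<Longrightarrow> O2 \<in> carrier H \<Longrightarrow> O3 \<in> carrier UY \<Longrightarrow>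
   O4 \<in> carrier H \<Longrightarrow> O5 \<in> carrier H \<Longrightarrow> u0 \<in> carrier UY \<Longrightarrow> u1 \<in> carrier H \<Longrightarrow>
   prodY \<phi> \<phi>' u' (pure5 K H H UY H H O1 O2 O3 O4 O5) (p2 UY H u0 u1) =
     tsum K TY (\<lambda>m z. coreY \<phi> \<phi>' u' O1 O2 O3 O4 O5 u1 m z) (lco u0)"
  unfolding prodY_def coreY_def
  apply (rule trans, rule tsum5_pure[where U = H and V = H and W = UY and X = H and X' = H], ((assumption | rule lins | simp)+)[16])
  by (rule tsum_pure[where V = UY and W = H]) (assumption | rule lins | simp)+

lemma prodY2_pure5:
  "\<phi> \<in> carrier AB \<Longrightarrow> \<phi>' \<in> carrier AB \<Longrightarrow> u' \<in> carrier UY \<Longrightarrow> O1 \<in> carrier H \<Longrightarrow> O2 \<in> carrier H \<Longrightarrow> O3 \<in> carrier UY \<Longrightarrow>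
   O4 \<in> carrier H \<Longrightarrow> O5 \<in> carrier H \<Longrightarrow> x0 \<in> carrier U \<Longrightarrow> x1 \<in> carrier H \<Longrightarrow> tm \<in> carrier HY \<Longrightarrow>
   prodY2 \<phi> \<phi>' u' (pure5 K H H UY H H O1 O2 O3 O4 O5) (p2 U H x0 x1) tm =
     tsum K TY (\<lambda>m z. coreY \<phi> \<phi>' u' O1 O2 O3 O4 O5 x1 m (p2 U Y x0 z)) tm"
  unfolding prodY2_def coreY_def
  apply (rule trans, rule tsum5_pure[where U = H and V = H and W = UY and X = H and X' = H], ((assumption | rule lins | simp)+)[16])
  by (rule tsum_pure[where V = U and W = H]) (assumption | rule lins | simp)+

lemma prodY2_pure:
  "\<phi> \<in> carrier AB \<Longrightarrow> \<phi>' \<in> carrier AB \<Longrightarrow> u' \<in> carrier UY \<Longrightarrow> O1 \<in> carrier H \<Longrightarrow> O2 \<in> carrier H \<Longrightarrow> O3 \<in> carrier UY \<Longrightarrow>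
   O4 \<in> carrier H \<Longrightarrow> O5 \<in> carrier H \<Longrightarrow> x0 \<in> carrier U \<Longrightarrow> x1 \<in> carrier H \<Longrightarrow> m \<in> carrier H \<Longrightarrow> z \<in> carrier Y \<Longrightarrow>
   prodY2 \<phi> \<phi>' u' (pure5 K H H UY H H O1 O2 O3 O4 O5) (p2 U H x0 x1) (p2 H Y m z) =
     coreY \<phi> \<phi>' u' O1 O2 O3 O4 O5 x1 m (p2 U Y x0 z)"
  apply (subst prodY2_pure5, simp_all)
  unfolding coreY_def
  by (rule tsum_pure[where V = H and W = Y]) (assumption | rule lins | simp)+

lemma prodY_eq:
  assumes [simp]: "\<phi> \<in> carrier AB" "\<phi>' \<in> carrier AB" "u' \<in> carrier UY" "y \<in> carrier Y"
    and Om [simp]: "Om \<in> carrier T5" and tp [simp]: "tp \<in> carrier U2"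
  shows "prodY \<phi> \<phi>' u' Om (rtw y tp) = prodY2 \<phi> \<phi>' u' Om tp (lam y)"
proof (rule ext5[OF Om, where Z = TY])
  fix O1 O2 O3 O4 O5 assume [simp]: "O1 \<in> carrier H" "O2 \<in> carrier H" "O3 \<in> carrier UY" "O4 \<in> carrier H" "O5 \<in> carrier H"
  let ?O = "pure5 K H H UY H H O1 O2 O3 O4 O5"
  show "prodY \<phi> \<phi>' u' ?O (rtw y tp) = prodY2 \<phi> \<phi>' u' ?O tp (lam y)"
  proof (rule ext2[OF tp, where Z = TY])
    fix x0 x1 assume [simp]: "x0 \<in> carrier U" "x1 \<in> carrier H"
    show "prodY \<phi> \<phi>' u' ?O (rtw y (p2 U H x0 x1)) = prodY2 \<phi> \<phi>' u' ?O (p2 U H x0 x1) (lam y)"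
      by (simp add: prodY_pure5 prodY2_pure5 lco_pure tsum_rmap[OF _ _ _ _ _ _ coreY_bil, where W = Y])
  qed (assumption | rule lins tp | simp)+
qed (assumption | rule lins tp Om | simp)+

text \<open>\<open>Wc\<close> with \<Phi>_\<rho>, f and \<rho>(x) relaxed to free tensors, for
  comparison on pure ones.\<close>

definition WcG where "WcG x' tR tf tp = tsum K U3 (\<lambda>x0 x1. tsum K U3 (\<lambda>X w.
   p2 U H2 (X \<otimes>\<^bsub>U\<^esub> x0 \<otimes>\<^bsub>U\<^esub> x') (p2 H H \<one>\<^bsub>H\<^esub> (Si x1) \<otimes>\<^bsub>H2\<^esub> F1 (tf \<otimes>\<^bsub>H2\<^esub> w))) tR) tp"

lemma WcG_lins [lins]:
  "lin Z U3 f1 \<Longrightarrow> vs Z \<Longrightarrow> x' \<in> carrier U \<Longrightarrow> tf \<in> carrier H2 \<Longrightarrow> tp \<in> carrier U2 \<Longrightarrow> lin Z U3 (\<lambda>z. WcG x' (f1 z) tf tp)"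
  "lin Z H2 f2 \<Longrightarrow> vs Z \<Longrightarrow> x' \<in> carrier U \<Longrightarrow> tR \<in> carrier U3 \<Longrightarrow> tp \<in> carrier U2 \<Longrightarrow> lin Z U3 (\<lambda>z. WcG x' tR (f2 z) tp)"
  "lin Z U2 f3 \<Longrightarrow> vs Z \<Longrightarrow> x' \<in> carrier U \<Longrightarrow> tR \<in> carrier U3 \<Longrightarrow> tf \<in> carrier H2 \<Longrightarrow> lin Z U3 (\<lambda>z. WcG x' tR tf (f3 z))"
  unfolding WcG_def by (assumption | rule lins | simp)+

lemma WcG_closed [simp, lins]:
  "x' \<in> carrier U \<Longrightarrow> tR \<in> carrier U3 \<Longrightarrow> tf \<in> carrier H2 \<Longrightarrow> tp \<in> carrier U2 \<Longrightarrow> WcG x' tR tf tp \<in> carrier U3"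
  unfolding WcG_def by (assumption | rule lins | simp)+

lemma WcG_pure:
  "x' \<in> carrier U \<Longrightarrow> X \<in> carrier U \<Longrightarrow> w \<in> carrier H2 \<Longrightarrow> tf \<in> carrier H2 \<Longrightarrow> x0 \<in> carrier U \<Longrightarrow> x1 \<in> carrier H \<Longrightarrow>
   WcG x' (p2 U H2 X w) tf (p2 U H x0 x1) = p2 U H2 (X \<otimes>\<^bsub>U\<^esub> x0 \<otimes>\<^bsub>U\<^esub> x') (p2 H H \<one>\<^bsub>H\<^esub> (Si x1) \<otimes>\<^bsub>H2\<^esub> F1 (tf \<otimes>\<^bsub>H2\<^esub> w))"
  unfolding WcG_def
  apply (subst tsum_pure[where V = U and W = H], ((assumption | rule lins | simp)+)[6])
  by (rule tsum_pure[where V = U and W = H2]) (assumption | rule lins | simp)+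

text \<open>The first two legs of \<Omega> act on A, the last two on B, and the third splits into X1
  in U and l3 in Y. The flip in \<open>F1\<close> reflects that the fifth leg acts on b and the
  fourth on b'.\<close>

lemma prodY_emb:
  assumes [simp]: "a \<in> carrier A" "b \<in> carrier B" "a' \<in> carrier A" "b' \<in> carrier B" "x' \<in> carrier U" "y' \<in> carrier Y"
    and tR [simp]: "tR \<in> carrier U3" and tL [simp]: "tL \<in> carrier HHY" and tf [simp]: "tf \<in> carrier H2"
    and tp [simp]: "tp \<in> carrier U2" and tm [simp]: "tm \<in> carrier HY"
  shows "prodY2 (p2 A B a b) (p2 A B a' b') (p2 U Y x' y') (Omg (embr tR) (embl tL) tf) tp tm =
    sY (p2 AY BU (GE a a' y' tL tm) (act2 b b' (WcG x' tR tf tp)))"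
    (is "?l tL tR tf tm tp = ?r tL tR tf tm tp")
proof (rule ext3[OF tL, where Z = TY])
  fix l1 l2 l3 assume [simp]: "l1 \<in> carrier H" "l2 \<in> carrier H" "l3 \<in> carrier Y"
  let ?L = "p2 H HY l1 (p2 H Y l2 l3)"
  show "?l ?L tR tf tm tp = ?r ?L tR tf tm tp"
  proof (rule ext3[OF tR, where Z = TY])
    fix r1 r2 r3 assume [simp]: "r1 \<in> carrier U" "r2 \<in> carrier H" "r3 \<in> carrier H"
    let ?R = "p2 U H2 r1 (p2 H H r2 r3)"
    show "?l ?L ?R tf tm tp = ?r ?L ?R tf tm tp"
    proof (rule ext2[OF tm, where Z = TY])
      fix m z assume [simp]: "m \<in> carrier H" "z \<in> carrier Y"
      let ?M = "p2 H Y m z"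
      show "?l ?L ?R tf ?M tp = ?r ?L ?R tf ?M tp"
      proof (rule ext2[OF tp, where Z = TY])
        fix p q assume [simp]: "p \<in> carrier U" "q \<in> carrier H"
        let ?P = "p2 U H p q"
        show "?l ?L ?R tf ?M ?P = ?r ?L ?R tf ?M ?P"
          by (rule ext2[OF tf, where Z = TY])
            (assumption | rule lins | simp add: Omg_pure prodY2_pure coreY_def WcG_pure mult_assoc)+
      qed (assumption | rule lins tp tm tR tL tf | simp)+
    qed (assumption | rule lins tp tm tR tL tf | simp)+
  qed (assumption | rule lins tp tm tR tL tf | simp)+
qed (assumption | rule lins tp tm tR tL tf | simp)+

abbreviation Yalg where "Yalg \<equiv> diagonal_crossed_product K H MM UU"

lemma Yalg_fields [simp]: "carrier Yalg = carrier TY" "add Yalg = add TY" "smult Yalg = smult TY" "zero Yalg = zero TY"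
  "one Yalg = p2 AB UY (p2 A B \<one>\<^bsub>A\<^esub> \<one>\<^bsub>B\<^esub>) (p2 U Y \<one>\<^bsub>U\<^esub> \<one>\<^bsub>Y\<^esub>)"
  by (simp_all add: diagonal_crossed_product_def Let_def) (simp add: tens_one)

abbreviation Om where "Om \<equiv> Omg (embr Rr) (embl ll) tw"

lemma Yalg_mult: "mult Yalg = (\<lambda>s t. tsum K TY (\<lambda>\<phi> u. tsum K TY (\<lambda>\<phi>' u'.
    prodY \<phi> \<phi>' u' Om (rco u)) t) s)"
  unfolding diagonal_crossed_product_def Let_def Omega_eq prodY_def coreY_def by simp

lemma Om_closed [simp, lins]: "Om \<in> carrier T5"
  by (assumption | rule lins | simp)+

lemma Yalg_vs [simp]: "vs Yalg"
  by (rule module_cong[THEN iffD2, of _ TY]) simp_all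

lemma Yalg_bil: "bil Yalg Yalg Yalg (mult Yalg)"
proof -
  have "bil TY TY TY (mult Yalg)"
    unfolding Yalg_mult by (assumption | rule lins | simp)+
  then show ?thesis by (simp add: bilinear_map_def)
qed

lemma Yalg_mult_pure:
  assumes [simp]: "\<phi> \<in> carrier AB" "u \<in> carrier UY" "\<phi>' \<in> carrier AB" "u' \<in> carrier UY"
  shows "p2 AB UY \<phi> u \<otimes>\<^bsub>Yalg\<^esub> p2 AB UY \<phi>' u' = prodY \<phi> \<phi>' u' Om (rco u)"
  unfolding Yalg_mult
  apply (subst tsum_pure[where V = AB and W = UY and v = \<phi> and w = u], ((assumption | rule lins | simp)+)[6])
  by (rule tsum_pure[where V = AB and W = UY]) (assumption | rule lins | simp)+

lemma Y_giso: "giso (Ealg \<boxtimes> Dalg') Yalg sY"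
  unfolding giso_def
proof
  show "bij_betw sY (carrier (Ealg \<boxtimes> Dalg')) (carrier Yalg)"
    using sh_bij(2)[of A Y B U] by (simp add: ED_carrier)
  show "ahom (Ealg \<boxtimes> Dalg') Yalg sY"
    by (rule ahom_src[where P = A and Q = Y and R = B and S' = U])
      (simp_all add: Yalg_bil lin_def[of _ Yalg] sh_lins[unfolded lin_def] Yalg_mult_pure rco_pure prodY_eq prodY_emb
        gD'_def Wc_def WcG_def[symmetric])
qed

section \<open>Assembling the isomorphisms\<close>

lemma ED_nalg [simp]: "nalg (Ealg \<boxtimes> Dalg)" "nalg (Ealg \<boxtimes> Dalg')"
  by simp_all

text \<open>Both chains cross between \<open>Dalg'\<close> and \<open>Dalg\<close> once, by
  \<open>mu\<close> on the second tensor factor with \<open>Ealg\<close> fixed, and otherwise only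
  permute tensor factors.\<close>

lemma isos: "\<exists>f. f \<in> algebra_iso K Xalg Yalg" "\<exists>g. g \<in> algebra_iso K Yalg Zalg"
proof -
  have m: "giso (Ealg \<boxtimes> Dalg') (Ealg \<boxtimes> Dalg) (rmap Ealg Dalg mu)"
    by (rule giso_tmap) (simp_all add: mu_giso)
  show "\<exists>f. f \<in> algebra_iso K Xalg Yalg"
    using giso_comp[OF giso_comp[OF giso_inv[OF X_giso ED_nalg(1)] giso_inv[OF m ED_nalg(2)]] Y_giso]
    unfolding giso_iff by blast
  show "\<exists>g. g \<in> algebra_iso K Yalg Zalg"
    using giso_comp[OF giso_comp[OF giso_inv[OF Y_giso ED_nalg(2)] m] Z_giso]
    unfolding giso_iff by blast
qed

end

theorem corollary6p4:
  fixes K :: "'k ring"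
    and H :: "('k, 'h) quasi_hopf"
    and A :: "('k, 'h, 'a) left_mod"
    and B :: "('k, 'h, 'b) right_mod"
    and AA :: "('k, 'h, 'c) right_comod"
    and BB :: "('k, 'h, 'd) left_comod"
  assumes "field K"
    and "quasi_hopf_algebra K H"
    and "left_module_algebra K H A"
    and "right_module_algebra K H B"
    and "right_comodule_algebra K H AA"
    and "left_comodule_algebra K H BB"
  shows "(\<exists>f. f \<in> algebra_iso K
             (two_sided_smash_product K H A (tensor_bicomod K H AA BB) B)
             (diagonal_crossed_product K H (tensor_bimod K A B) (tensor_bicomod K H AA BB))) \<and>
         (\<exists>g. g \<in> algebra_iso K
             (diagonal_crossed_product K H (tensor_bimod K A B) (tensor_bicomod K H AA BB))
             (two_sided_crossed_product K H AA (tensor_bimod K A B) BB))"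
proof -
  interpret K: field K by fact
  interpret full K H AA B A BB
    by unfold_locales (use assms in simp_all)
  show ?thesis using isos by blast
qed

end
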